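(* Let $R$ be a commutative noetherian ring with non-zero identity and $\mathfrak{a}$ an ideal of $R$ with $\dim R/\mathfrak{a}\leq 1$. Then the category $\mathcal{C}(R,\mathfrak{a})_{coa}$ of semi-discrete linearly compact $\mathfrak{a}$-coartinian $R$-modules is an Abelian subcategory of the category of all $R$-modules.
   Context: Morphisms in $\mathcal{C}(R,\mathfrak{a})_{coa}$ are $R$-homomorphisms. A topological $R$-module $M$ is linearly topologized if $M$ has a base of neighborhoods of zero consisting of submodules; it is Hausdorff if the intersection of all the neighborhoods of zero is $0$. A Hausdorff linearly topologized $R$-module $M$ is linearly compact if every family of closed cosets (i.e. cosets of closed submodules) in $M$ with the finite intersection property has non-empty intersection; it is semi-discrete if every submodule of $M$ is closed. $\mathrm{V}(\mathfrak{a})$ is the set of prime ideals of $R$ containing $\mathfrak{a}$. An $R$-module $L$ is cocyclic if it is (isomorphic to) a submodule of the injective hull $E(R/\mathfrak{m})$ for some maximal ideal $\mathfrak{m}$ of $R$. $\mathrm{Cosupp}_{R}M$ is the set of prime ideals $\mathfrak{p}$ such that there is a cocyclic homomorphic image $L$ of $M$ with $\mathfrak{p}\supseteq \mathrm{Ann}_{R}L$. An $R$-module $M$ is $\mathfrak{a}$-coartinian if $\mathrm{Cosupp}_{R}M\subseteq \mathrm{V}(\mathfrak{a})$ and $\mathrm{Tor}_{i}^{R}(R/\mathfrak{a},M)$ is artinian for all $i\geq 0$. *)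

theory Defs
  imports
    "HOL-Analysis.Product_Topology"
    "HOL-Library.Extended_Real"
    "HOL-Algebra.Module"
    "HOL-Algebra.QuotRing"
    "HOL-Algebra.Ring_Divisibility"
begin

section \<open>Categories\<close>

text \<open>
  In \<open>Comp C X Y Z g f\<close>, \<open>f : X \<rightarrow> Y\<close> and \<open>g : Y \<rightarrow> Z\<close>. The hom-sets of distinct pairs of objects
  need not be disjoint, so composition takes the objects as arguments.
\<close>

record ('o, 'f) cat =
  Obj :: "'o set"
  Hom :: "'o \<Rightarrow> 'o \<Rightarrow> 'f set"
  Comp :: "'o \<Rightarrow> 'o \<Rightarrow> 'o \<Rightarrow> 'f \<Rightarrow> 'f \<Rightarrow> 'f"
  Ident :: "'o \<Rightarrow> 'f"

definition is_category :: "('o, 'f) cat \<Rightarrow> bool" where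
  "is_category C \<longleftrightarrow>
     (\<forall>X\<in>Obj C. Ident C X \<in> Hom C X X) \<and>
     (\<forall>X\<in>Obj C. \<forall>Y\<in>Obj C. \<forall>Z\<in>Obj C. \<forall>f\<in>Hom C X Y. \<forall>g\<in>Hom C Y Z.
        Comp C X Y Z g f \<in> Hom C X Z) \<and>
     (\<forall>X\<in>Obj C. \<forall>Y\<in>Obj C. \<forall>f\<in>Hom C X Y.
        Comp C X X Y f (Ident C X) = f \<and> Comp C X Y Y (Ident C Y) f = f) \<and>
     (\<forall>W\<in>Obj C. \<forall>X\<in>Obj C. \<forall>Y\<in>Obj C. \<forall>Z\<in>Obj C. \<forall>f\<in>Hom C W X. \<forall>g\<in>Hom C X Y. \<forall>h\<in>Hom C Y Z.
        Comp C W Y Z h (Comp C W X Y g f) = Comp C W X Z (Comp C X Y Z h g) f)"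

definition zero_object :: "('o, 'f) cat \<Rightarrow> 'o \<Rightarrow> bool" where
  "zero_object C Z \<longleftrightarrow> Z \<in> Obj C \<and>
     (\<forall>X\<in>Obj C. (\<exists>!f. f \<in> Hom C X Z) \<and> (\<exists>!f. f \<in> Hom C Z X))"

definition zero_morphism :: "('o, 'f) cat \<Rightarrow> 'o \<Rightarrow> 'o \<Rightarrow> 'f \<Rightarrow> bool" where
  "zero_morphism C X Y f \<longleftrightarrow>
     (\<exists>Z. zero_object C Z \<and> (\<exists>u\<in>Hom C X Z. \<exists>v\<in>Hom C Z Y. f = Comp C X Z Y v u))"

definition is_mono :: "('o, 'f) cat \<Rightarrow> 'o \<Rightarrow> 'o \<Rightarrow> 'f \<Rightarrow> bool" where
  "is_mono C X Y f \<longleftrightarrow> f \<in> Hom C X Y \<and>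
     (\<forall>W\<in>Obj C. \<forall>u\<in>Hom C W X. \<forall>v\<in>Hom C W X. Comp C W X Y f u = Comp C W X Y f v \<longrightarrow> u = v)"

definition is_epi :: "('o, 'f) cat \<Rightarrow> 'o \<Rightarrow> 'o \<Rightarrow> 'f \<Rightarrow> bool" where
  "is_epi C X Y f \<longleftrightarrow> f \<in> Hom C X Y \<and>
     (\<forall>W\<in>Obj C. \<forall>u\<in>Hom C Y W. \<forall>v\<in>Hom C Y W. Comp C X Y W u f = Comp C X Y W v f \<longrightarrow> u = v)"

definition is_kernel :: "('o, 'f) cat \<Rightarrow> 'o \<Rightarrow> 'o \<Rightarrow> 'f \<Rightarrow> 'o \<Rightarrow> 'f \<Rightarrow> bool" where
  "is_kernel C X Y f K k \<longleftrightarrow> K \<in> Obj C \<and> k \<in> Hom C K X \<and> zero_morphism C K Y (Comp C K X Y f k) \<and>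
     (\<forall>W\<in>Obj C. \<forall>g\<in>Hom C W X. zero_morphism C W Y (Comp C W X Y f g) \<longrightarrow>
        (\<exists>!u. u \<in> Hom C W K \<and> Comp C W K X k u = g))"

definition is_cokernel :: "('o, 'f) cat \<Rightarrow> 'o \<Rightarrow> 'o \<Rightarrow> 'f \<Rightarrow> 'o \<Rightarrow> 'f \<Rightarrow> bool" where
  "is_cokernel C X Y f Q q \<longleftrightarrow> Q \<in> Obj C \<and> q \<in> Hom C Y Q \<and> zero_morphism C X Q (Comp C X Y Q q f) \<and>
     (\<forall>W\<in>Obj C. \<forall>g\<in>Hom C Y W. zero_morphism C X W (Comp C X Y W g f) \<longrightarrow>
        (\<exists>!u. u \<in> Hom C Q W \<and> Comp C Y Q W u q = g))"

definition is_product :: "('o, 'f) cat \<Rightarrow> 'o \<Rightarrow> 'o \<Rightarrow> 'o \<Rightarrow> 'f \<Rightarrow> 'f \<Rightarrow> bool" where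
  "is_product C X Y P p q \<longleftrightarrow> P \<in> Obj C \<and> p \<in> Hom C P X \<and> q \<in> Hom C P Y \<and>
     (\<forall>W\<in>Obj C. \<forall>f\<in>Hom C W X. \<forall>g\<in>Hom C W Y.
        \<exists>!u. u \<in> Hom C W P \<and> Comp C W P X p u = f \<and> Comp C W P Y q u = g)"

definition is_coproduct :: "('o, 'f) cat \<Rightarrow> 'o \<Rightarrow> 'o \<Rightarrow> 'o \<Rightarrow> 'f \<Rightarrow> 'f \<Rightarrow> bool" where
  "is_coproduct C X Y S i j \<longleftrightarrow> S \<in> Obj C \<and> i \<in> Hom C X S \<and> j \<in> Hom C Y S \<and>
     (\<forall>W\<in>Obj C. \<forall>f\<in>Hom C X W. \<forall>g\<in>Hom C Y W.
        \<exists>!u. u \<in> Hom C S W \<and> Comp C X S W u i = f \<and> Comp C Y S W u j = g)"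

text \<open>Freyd's axioms; the additive structure on the hom-sets is determined by them.\<close>

definition abelian_category :: "('o, 'f) cat \<Rightarrow> bool" where
  "abelian_category C \<longleftrightarrow> is_category C \<and>
     (\<exists>Z. zero_object C Z) \<and>
     (\<forall>X\<in>Obj C. \<forall>Y\<in>Obj C. \<exists>P p q. is_product C X Y P p q) \<and>
     (\<forall>X\<in>Obj C. \<forall>Y\<in>Obj C. \<exists>S i j. is_coproduct C X Y S i j) \<and>
     (\<forall>X\<in>Obj C. \<forall>Y\<in>Obj C. \<forall>f\<in>Hom C X Y.
        (\<exists>K k. is_kernel C X Y f K k) \<and> (\<exists>Q q. is_cokernel C X Y f Q q)) \<and>
     (\<forall>X\<in>Obj C. \<forall>Y\<in>Obj C. \<forall>f. is_mono C X Y f \<longrightarrow>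
        (\<exists>Z\<in>Obj C. \<exists>g\<in>Hom C Y Z. is_kernel C Y Z g X f)) \<and>
     (\<forall>X\<in>Obj C. \<forall>Y\<in>Obj C. \<forall>f. is_epi C X Y f \<longrightarrow>
        (\<exists>W\<in>Obj C. \<exists>g\<in>Hom C W X. is_cokernel C W X g Y f))"

definition subcategory :: "('o, 'f) cat \<Rightarrow> ('o, 'f) cat \<Rightarrow> bool" where
  "subcategory D C \<longleftrightarrow> is_category D \<and> is_category C \<and> Obj D \<subseteq> Obj C \<and>
     (\<forall>X\<in>Obj D. Ident D X = Ident C X) \<and>
     (\<forall>X\<in>Obj D. \<forall>Y\<in>Obj D. Hom D X Y \<subseteq> Hom C X Y) \<and>
     (\<forall>X\<in>Obj D. \<forall>Y\<in>Obj D. \<forall>Z\<in>Obj D. \<forall>f\<in>Hom D X Y. \<forall>g\<in>Hom D Y Z.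
        Comp D X Y Z g f = Comp C X Y Z g f)"

text \<open>
  An Abelian subcategory is a subcategory that is Abelian and whose inclusion functor is exact,
  that is, preserves kernels and cokernels.
\<close>

definition abelian_subcategory :: "('o, 'f) cat \<Rightarrow> ('o, 'f) cat \<Rightarrow> bool" where
  "abelian_subcategory D C \<longleftrightarrow> subcategory D C \<and> abelian_category D \<and>
     (\<forall>X\<in>Obj D. \<forall>Y\<in>Obj D. \<forall>f\<in>Hom D X Y.
        (\<forall>K k. is_kernel D X Y f K k \<longrightarrow> is_kernel C X Y f K k) \<and>
        (\<forall>Q q. is_cokernel D X Y f Q q \<longrightarrow> is_cokernel C X Y f Q q))"

definition full_subcat :: "('o, 'f) cat \<Rightarrow> 'o set \<Rightarrow> ('o, 'f) cat" where
  "full_subcat C A = C\<lparr>Obj := A\<rparr>"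


section \<open>Modules\<close>

text \<open>
  A module record inherits the fields \<open>mult\<close> and \<open>one\<close> from rings. They play no role for modules
  and are left \<open>undefined\<close> in the constructions below.
\<close>

definition mod_hom ::
  "('r, 'x) ring_scheme \<Rightarrow> ('r, 'm) module \<Rightarrow> ('r, 'n) module \<Rightarrow> ('m \<Rightarrow> 'n) set" where
  "mod_hom R M N = {h. h \<in> carrier M \<rightarrow> carrier N \<and>
     (\<forall>x\<in>carrier M. \<forall>y\<in>carrier M. h (x \<oplus>\<^bsub>M\<^esub> y) = h x \<oplus>\<^bsub>N\<^esub> h y) \<and>
     (\<forall>r\<in>carrier R. \<forall>x\<in>carrier M. h (r \<odot>\<^bsub>M\<^esub> x) = r \<odot>\<^bsub>N\<^esub> h x)}"

text \<open>
  The category of all \<open>R\<close>-modules with elements in a given type, which plays the role of the universe. For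
  an infinite type it contains finite direct sums up to isomorphism. Linear maps are made
  extensional so that equal morphisms are equal functions.
\<close>

definition module_cat :: "('r, 'x) ring_scheme \<Rightarrow> (('r, 'm) module, 'm \<Rightarrow> 'm) cat" where
  "module_cat R =
     \<lparr>Obj = {M. Module.module R M},
      Hom = (\<lambda>M N. mod_hom R M N \<inter> extensional (carrier M)),
      Comp = (\<lambda>M N L g f. compose (carrier M) g f),
      Ident = (\<lambda>M. \<lambda>x\<in>carrier M. x)\<rparr>"

definition regular_module :: "('r, 'x) ring_scheme \<Rightarrow> ('r, 'r) module" where
  "regular_module R =
     \<lparr>carrier = carrier R, mult = mult R, one = one R, zero = zero R, add = add R, smult = mult R\<rparr>"

definition quot_module :: "('r, 'm) module \<Rightarrow> 'm set \<Rightarrow> ('r, 'm set) module" where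
  "quot_module M N =
     \<lparr>carrier = a_rcosets\<^bsub>M\<^esub> N, mult = undefined, one = undefined, zero = N, add = set_add M,
      smult = (\<lambda>r X. \<Union>x\<in>X. N +>\<^bsub>M\<^esub> (r \<odot>\<^bsub>M\<^esub> x))\<rparr>"

definition mod_ker :: "('r, 'm) module \<Rightarrow> ('r, 'n) module \<Rightarrow> ('m \<Rightarrow> 'n) \<Rightarrow> 'm set" where
  "mod_ker M N h = {x \<in> carrier M. h x = \<zero>\<^bsub>N\<^esub>}"

definition submodule_gen :: "('r, 'x) ring_scheme \<Rightarrow> ('r, 'm) module \<Rightarrow> 'm set \<Rightarrow> 'm set" where
  "submodule_gen R M A = \<Inter>{H. submodule H R M \<and> A \<subseteq> H}"

definition annihilator :: "('r, 'x) ring_scheme \<Rightarrow> ('r, 'm) module \<Rightarrow> 'r set" where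
  "annihilator R M = {r \<in> carrier R. \<forall>x\<in>carrier M. r \<odot>\<^bsub>M\<^esub> x = \<zero>\<^bsub>M\<^esub>}"

definition artinian_module :: "('r, 'x) ring_scheme \<Rightarrow> ('r, 'm) module \<Rightarrow> bool" where
  "artinian_module R M \<longleftrightarrow> Module.module R M \<and>
     (\<forall>N :: nat \<Rightarrow> 'm set. (\<forall>n. submodule (N n) R M) \<and> (\<forall>n. N (Suc n) \<subseteq> N n) \<longrightarrow>
        (\<exists>k. \<forall>n\<ge>k. N n = N k))"


section \<open>Tensor products and Tor\<close>

definition free_mod :: "('r, 'x) ring_scheme \<Rightarrow> 'b set \<Rightarrow> ('r, 'b \<Rightarrow> 'r) module" where
  "free_mod R S =
     \<lparr>carrier = {f. (\<forall>s. f s \<in> carrier R) \<and> finite {s. f s \<noteq> \<zero>\<^bsub>R\<^esub>} \<and> (\<forall>s. s \<notin> S \<longrightarrow> f s = \<zero>\<^bsub>R\<^esub>)},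
      mult = undefined, one = undefined,
      zero = (\<lambda>s. \<zero>\<^bsub>R\<^esub>), add = (\<lambda>f g s. f s \<oplus>\<^bsub>R\<^esub> g s), smult = (\<lambda>r f s. r \<otimes>\<^bsub>R\<^esub> f s)\<rparr>"

definition free_gen :: "('r, 'x) ring_scheme \<Rightarrow> 'b \<Rightarrow> 'b \<Rightarrow> 'r" where
  "free_gen R s = (\<lambda>t. if t = s then \<one>\<^bsub>R\<^esub> else \<zero>\<^bsub>R\<^esub>)"

definition tensor_relations ::
  "('r, 'x) ring_scheme \<Rightarrow> ('r, 'm) module \<Rightarrow> ('r, 'n) module \<Rightarrow> ('m \<times> 'n \<Rightarrow> 'r) set" where
  "tensor_relations R M N = (let F = free_mod R (carrier M \<times> carrier N); e = free_gen R in
     {e (x \<oplus>\<^bsub>M\<^esub> x', y) \<ominus>\<^bsub>F\<^esub> (e (x, y) \<oplus>\<^bsub>F\<^esub> e (x', y)) | x x' y.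
        x \<in> carrier M \<and> x' \<in> carrier M \<and> y \<in> carrier N} \<union>
     {e (x, y \<oplus>\<^bsub>N\<^esub> y') \<ominus>\<^bsub>F\<^esub> (e (x, y) \<oplus>\<^bsub>F\<^esub> e (x, y')) | x y y'.
        x \<in> carrier M \<and> y \<in> carrier N \<and> y' \<in> carrier N} \<union>
     {e (r \<odot>\<^bsub>M\<^esub> x, y) \<ominus>\<^bsub>F\<^esub> (r \<odot>\<^bsub>F\<^esub> e (x, y)) | r x y.
        r \<in> carrier R \<and> x \<in> carrier M \<and> y \<in> carrier N} \<union>
     {e (x, r \<odot>\<^bsub>N\<^esub> y) \<ominus>\<^bsub>F\<^esub> (r \<odot>\<^bsub>F\<^esub> e (x, y)) | r x y.
        r \<in> carrier R \<and> x \<in> carrier M \<and> y \<in> carrier N})"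

definition tensor_ker ::
  "('r, 'x) ring_scheme \<Rightarrow> ('r, 'm) module \<Rightarrow> ('r, 'n) module \<Rightarrow> ('m \<times> 'n \<Rightarrow> 'r) set" where
  "tensor_ker R M N =
     submodule_gen R (free_mod R (carrier M \<times> carrier N)) (tensor_relations R M N)"

definition tensor ::
  "('r, 'x) ring_scheme \<Rightarrow> ('r, 'm) module \<Rightarrow> ('r, 'n) module \<Rightarrow> ('r, ('m \<times> 'n \<Rightarrow> 'r) set) module" where
  "tensor R M N = quot_module (free_mod R (carrier M \<times> carrier N)) (tensor_ker R M N)"

definition elem_tensor ::
  "('r, 'x) ring_scheme \<Rightarrow> ('r, 'm) module \<Rightarrow> ('r, 'n) module \<Rightarrow> 'm \<Rightarrow> 'n \<Rightarrow> ('m \<times> 'n \<Rightarrow> 'r) set" where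
  "elem_tensor R M N x y =
     tensor_ker R M N +>\<^bsub>free_mod R (carrier M \<times> carrier N)\<^esub> free_gen R (x, y)"

text \<open>
  \<open>f \<otimes> id : P \<otimes> M \<rightarrow> Q \<otimes> M\<close>. By the universal property the linear map chosen here exists and is
  unique on the carrier of \<open>P \<otimes> M\<close>.
\<close>

definition tensor_map ::
  "('r, 'x) ring_scheme \<Rightarrow> ('r, 'p) module \<Rightarrow> ('r, 'q) module \<Rightarrow> ('r, 'm) module \<Rightarrow> ('p \<Rightarrow> 'q) \<Rightarrow>
    ('p \<times> 'm \<Rightarrow> 'r) set \<Rightarrow> ('q \<times> 'm \<Rightarrow> 'r) set" where
  "tensor_map R P Q M f = (SOME h. h \<in> mod_hom R (tensor R P M) (tensor R Q M) \<and>
     (\<forall>x\<in>carrier P. \<forall>y\<in>carrier M. h (elem_tensor R P M x y) = elem_tensor R Q M (f x) y))"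

text \<open>
  A resolution \<open>\<dots> \<rightarrow> F\<^sub>1 \<rightarrow> F\<^sub>0 \<rightarrow> A \<rightarrow> 0\<close> in which \<open>F\<^sub>n\<close> is free on the set \<open>S n\<close> and
  \<open>d n : F\<^sub>n\<^sub>+\<^sub>1 \<rightarrow> F\<^sub>n\<close>.
\<close>

definition free_resolution ::
  "('r, 'x) ring_scheme \<Rightarrow> ('r, 'a) module \<Rightarrow> (nat \<Rightarrow> 'b set) \<Rightarrow>
    (nat \<Rightarrow> ('b \<Rightarrow> 'r) \<Rightarrow> 'b \<Rightarrow> 'r) \<Rightarrow> (('b \<Rightarrow> 'r) \<Rightarrow> 'a) \<Rightarrow> bool" where
  "free_resolution R A S d \<epsilon> \<longleftrightarrow>
     \<epsilon> \<in> mod_hom R (free_mod R (S 0)) A \<and>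
     (\<forall>n. d n \<in> mod_hom R (free_mod R (S (Suc n))) (free_mod R (S n))) \<and>
     \<epsilon> ` carrier (free_mod R (S 0)) = carrier A \<and>
     mod_ker (free_mod R (S 0)) A \<epsilon> = d 0 ` carrier (free_mod R (S 1)) \<and>
     (\<forall>n. mod_ker (free_mod R (S (Suc n))) (free_mod R (S n)) (d n) =
        d (Suc n) ` carrier (free_mod R (S (Suc (Suc n)))))"

text \<open>
  \<open>Tor\<^sub>i(A, M)\<close> is the homology at degree \<open>i\<close> of \<open>F\<^sub>\<bullet> \<otimes> M\<close>, where \<open>F\<^sub>\<bullet>\<close> is a chosen free resolution of \<open>A\<close>;
  up to isomorphism it does not depend on the choice. Every module \<open>A\<close> has a free resolution on
  bases contained in the type \<^typ>\<open>('a \<times> 'r) list\<close>: this type is infinite and at least as large as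
  both \<^typ>\<open>'a\<close> and \<^typ>\<open>'r\<close>, hence as large as the set of finitely supported functions from it
  to \<^typ>\<open>'r\<close>, so that each kernel can be covered by a free module on such a basis.
\<close>

definition chosen_resolution ::
  "('r, 'x) ring_scheme \<Rightarrow> ('r, 'a) module \<Rightarrow>
    (nat \<Rightarrow> ('a \<times> 'r) list set) \<times> (nat \<Rightarrow> (('a \<times> 'r) list \<Rightarrow> 'r) \<Rightarrow> ('a \<times> 'r) list \<Rightarrow> 'r)" where
  "chosen_resolution R A = (SOME (S, d). \<exists>\<epsilon>. free_resolution R A S d \<epsilon>)"

definition Tor ::
  "('r, 'x) ring_scheme \<Rightarrow> nat \<Rightarrow> ('r, 'a) module \<Rightarrow> ('r, 'm) module \<Rightarrow>
    ('r, ((('a \<times> 'r) list \<Rightarrow> 'r) \<times> 'm \<Rightarrow> 'r) set set) module" where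
  "Tor R i A M = (let (S, d) = chosen_resolution R A;
       F = (\<lambda>n. free_mod R (S n));
       T = (\<lambda>n. tensor R (F n) M);
       D = (\<lambda>n. tensor_map R (F (Suc n)) (F n) M (d n));
       Z = (case i of 0 \<Rightarrow> carrier (T 0) | Suc n \<Rightarrow> mod_ker (T (Suc n)) (T n) (D n));
       B = D i ` carrier (T (Suc i))
     in quot_module ((T i)\<lparr>carrier := Z\<rparr>) B)"


section \<open>Primes and Krull dimension\<close>

text \<open>The supremum is taken in the extended reals, so the zero ring has dimension \<open>-\<infinity>\<close>.\<close>

definition krull_dim :: "('r, 'x) ring_scheme \<Rightarrow> ereal" where
  "krull_dim R = (SUP n \<in> {n :: nat. \<exists>p :: nat \<Rightarrow> 'r set.
     (\<forall>i\<le>n. primeideal (p i) R) \<and> (\<forall>i<n. p i \<subset> p (Suc i))}. ereal (real n))"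

definition prime_variety :: "('r, 'x) ring_scheme \<Rightarrow> 'r set \<Rightarrow> 'r set set" where
  "prime_variety R \<aa> = {p. primeideal p R \<and> \<aa> \<subseteq> p}"


section \<open>Injective hulls and cocyclic modules\<close>

text \<open>
  Extension of linear maps is tested on all modules with elements in \<^typ>\<open>'r + 'e\<close>. This type contains
  copies of the ring and of its ideals, so by Baer's criterion the extension property then holds for
  modules with elements in any type.
\<close>

definition injective_module :: "('r, 'x) ring_scheme \<Rightarrow> ('r, 'e) module \<Rightarrow> bool" where
  "injective_module R E \<longleftrightarrow> Module.module R E \<and>
     (\<forall>(X :: ('r, 'r + 'e) module) (Y :: ('r, 'r + 'e) module). \<forall>i\<in>mod_hom R X Y. \<forall>f\<in>mod_hom R X E.
        Module.module R X \<and> Module.module R Y \<and> inj_on i (carrier X) \<longrightarrow>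
        (\<exists>g\<in>mod_hom R Y E. \<forall>x\<in>carrier X. g (i x) = f x))"

definition injective_hull ::
  "('r, 'x) ring_scheme \<Rightarrow> ('r, 'a) module \<Rightarrow> ('r, 'e) module \<Rightarrow> ('a \<Rightarrow> 'e) \<Rightarrow> bool" where
  "injective_hull R A E i \<longleftrightarrow> injective_module R E \<and> i \<in> mod_hom R A E \<and> inj_on i (carrier A) \<and>
     (\<forall>H. submodule H R E \<and> H \<inter> i ` carrier A = {\<zero>\<^bsub>E\<^esub>} \<longrightarrow> H = {\<zero>\<^bsub>E\<^esub>})"

text \<open>
  The hull \<open>E(R/\<mm>)\<close> is sought in the type \<^typ>\<open>'r \<Rightarrow> nat\<close>, which is large enough: \<open>E(R/\<mm>)\<close> embeds into
  \<open>Hom\<^sub>\<int>(R, D)\<close> with \<open>D\<close> the divisible hull of \<open>R/\<mm>\<close>, and it is finite when \<open>R\<close> is finite.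
\<close>

definition cocyclic :: "('r, 'x) ring_scheme \<Rightarrow> ('r, 'l) module \<Rightarrow> bool" where
  "cocyclic R L \<longleftrightarrow> Module.module R L \<and>
     (\<exists>\<mm> (E :: ('r, 'r \<Rightarrow> nat) module) i j. maximalideal \<mm> R \<and>
        injective_hull R (quot_module (regular_module R) \<mm>) E i \<and>
        j \<in> mod_hom R L E \<and> inj_on j (carrier L))"

text \<open>Up to isomorphism the homomorphic images of \<open>M\<close> are its quotients.\<close>

definition cosupp :: "('r, 'x) ring_scheme \<Rightarrow> ('r, 'm) module \<Rightarrow> 'r set set" where
  "cosupp R M = {p. primeideal p R \<and>
     (\<exists>N. submodule N R M \<and> cocyclic R (quot_module M N) \<and> annihilator R (quot_module M N) \<subseteq> p)}"

definition coartinian :: "('r, 'x) ring_scheme \<Rightarrow> 'r set \<Rightarrow> ('r, 'm) module \<Rightarrow> bool" where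
  "coartinian R \<aa> M \<longleftrightarrow> Module.module R M \<and> cosupp R M \<subseteq> prime_variety R \<aa> \<and>
     (\<forall>i. artinian_module R (Tor R i (quot_module (regular_module R) \<aa>) M))"


section \<open>Linearly compact modules\<close>

text \<open>The ring carries the discrete topology; no other topology on it is given.\<close>

definition topological_module ::
  "('r, 'x) ring_scheme \<Rightarrow> ('r, 'm) module \<Rightarrow> 'm topology \<Rightarrow> bool" where
  "topological_module R M T \<longleftrightarrow> Module.module R M \<and> topspace T = carrier M \<and>
     continuous_map (prod_topology T T) T (\<lambda>(x, y). x \<oplus>\<^bsub>M\<^esub> y) \<and>
     continuous_map T T (\<lambda>x. \<ominus>\<^bsub>M\<^esub> x) \<and>
     continuous_map (prod_topology (discrete_topology (carrier R)) T) T (\<lambda>(r, x). r \<odot>\<^bsub>M\<^esub> x)"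

definition zero_nbhd :: "('r, 'm) module \<Rightarrow> 'm topology \<Rightarrow> 'm set \<Rightarrow> bool" where
  "zero_nbhd M T U \<longleftrightarrow> U \<subseteq> carrier M \<and> (\<exists>V. openin T V \<and> \<zero>\<^bsub>M\<^esub> \<in> V \<and> V \<subseteq> U)"

definition linearly_topologized ::
  "('r, 'x) ring_scheme \<Rightarrow> ('r, 'm) module \<Rightarrow> 'm topology \<Rightarrow> bool" where
  "linearly_topologized R M T \<longleftrightarrow> topological_module R M T \<and>
     (\<forall>U. zero_nbhd M T U \<longrightarrow> (\<exists>N. submodule N R M \<and> zero_nbhd M T N \<and> N \<subseteq> U))"

definition hausdorff_module :: "('r, 'm) module \<Rightarrow> 'm topology \<Rightarrow> bool" where
  "hausdorff_module M T \<longleftrightarrow> \<Inter>{U. zero_nbhd M T U} = {\<zero>\<^bsub>M\<^esub>}"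

definition closed_coset ::
  "('r, 'x) ring_scheme \<Rightarrow> ('r, 'm) module \<Rightarrow> 'm topology \<Rightarrow> 'm set \<Rightarrow> bool" where
  "closed_coset R M T C \<longleftrightarrow>
     (\<exists>N x. submodule N R M \<and> closedin T N \<and> x \<in> carrier M \<and> C = N +>\<^bsub>M\<^esub> x)"

definition linearly_compact ::
  "('r, 'x) ring_scheme \<Rightarrow> ('r, 'm) module \<Rightarrow> 'm topology \<Rightarrow> bool" where
  "linearly_compact R M T \<longleftrightarrow> linearly_topologized R M T \<and> hausdorff_module M T \<and>
     (\<forall>\<F>. (\<forall>C\<in>\<F>. closed_coset R M T C) \<and> (\<forall>\<G>\<subseteq>\<F>. finite \<G> \<longrightarrow> \<Inter>\<G> \<noteq> {}) \<longrightarrow> \<Inter>\<F> \<noteq> {})"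

definition semi_discrete ::
  "('r, 'x) ring_scheme \<Rightarrow> ('r, 'm) module \<Rightarrow> 'm topology \<Rightarrow> bool" where
  "semi_discrete R M T \<longleftrightarrow> (\<forall>N. submodule N R M \<longrightarrow> closedin T N)"

text \<open>
  Morphisms are all linear maps, continuous or not, so an object is a module that admits a
  suitable topology.
\<close>

definition sdlc_coartinian_modules ::
  "('r, 'x) ring_scheme \<Rightarrow> 'r set \<Rightarrow> ('r, 'm) module set" where
  "sdlc_coartinian_modules R \<aa> =
     {M. Module.module R M \<and> (\<exists>T. linearly_compact R M T \<and> semi_discrete R M T) \<and> coartinian R \<aa> M}"

definition coa_cat :: "('r, 'x) ring_scheme \<Rightarrow> 'r set \<Rightarrow> (('r, 'm) module, 'm \<Rightarrow> 'm) cat" where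
  "coa_cat R \<aa> = full_subcat (module_cat R) (sdlc_coartinian_modules R \<aa>)"

end

theory Submission
  imports Defs
begin

text \<open>
  A semi-discrete linearly compact module \<open>M\<close> is linearly compact in the discrete topology, so none of
  its quotients contains an infinite direct sum. Over a noetherian ring this forces \<open>M\<close> to be minimax:
  it has a finitely generated submodule \<open>N\<close> such that \<open>M/N\<close> is supported at maximal ideals. If \<open>M/\<aa>M\<close> is
  supported at maximal ideals as well, then Nakayama's lemma shows that so is \<open>R/(\<aa> + Ann N)\<close>. Since
  \<open>\<aa>\<close> kills \<open>Tor\<^sub>i(R/\<aa>, M)\<close>, every \<open>Tor\<^sub>i(R/\<aa>, M)\<close> is then supported at maximal ideals; it is also linearly
  compact, hence artinian. The existence of such an \<open>N\<close> passes to submodules, quotients and direct sums,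
  and so does the condition on the cosupport, by injectivity of \<open>E(R/\<mm>)\<close>. Therefore kernels and
  cokernels of maps between \<open>\<aa>\<close>-coartinian modules of this kind are again of this kind.
\<close>

section \<open>Submodules and colon ideals\<close>

text \<open>The finiteness conditions form an infinite family, one for each degree of
  \<open>Tor\<close>, and long exact sequences are avoided altogether. Instead a circle is closed:
  artinian \<open>Tor\<close> in degree 0 makes M/\<aa>M torsion, this produces a witness N, and the
  witness returns artinian \<open>Tor\<close> in every degree. Only the witness is then carried to
  submodules and sums. Two obstacles shape the text. \<open>Tor\<close> is built on a resolution
  picked by choice, whose bases may be infinite, so linear compactness of its homology has to come
  from comparison with a resolution by finite bases. And the objects of the category have their
  elements in a fixed universe type, so quotients and direct sums must be carried back there by
  injections. No localisation is formed: vanishing at a prime p is expressed by multipliers outside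
  p. Likewise most arguments about M/N stay inside M, the annihilator of the class of x being the
  ideal \<open>colon R M N x\<close>.\<close>

definition colon :: "('r, 'x) ring_scheme \<Rightarrow> ('r, 'm) module \<Rightarrow> 'm set \<Rightarrow> 'm \<Rightarrow> 'r set" where
  "colon R M N x = {r \<in> carrier R. r \<odot>\<^bsub>M\<^esub> x \<in> N}"

locale rmodule = module R M for R :: "('r, 'x) ring_scheme" (structure) and M :: "('r, 'm) module" (structure)

lemma rmoduleI: "Module.module R M \<Longrightarrow> rmodule R M"
  by (simp add: rmodule_def)

context rmodule
begin

lemma module_M: "Module.module R M"
  by (rule module_axioms)

text \<open>One condition replaces three: x = 0 gives multiples, r = 1 gives sums, and
  multiplication by -1 gives negatives.\<close>

lemma submoduleI':
  assumes "H \<subseteq> carrier M" "\<zero>\<^bsub>M\<^esub> \<in> H"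
    and lin: "\<And>x y r. \<lbrakk>x \<in> H; y \<in> H; r \<in> carrier R\<rbrakk> \<Longrightarrow> x \<oplus>\<^bsub>M\<^esub> r \<odot>\<^bsub>M\<^esub> y \<in> H"
  shows "submodule H R M"
proof (rule submoduleI)
  show smult: "r \<odot>\<^bsub>M\<^esub> x \<in> H" if "r \<in> carrier R" "x \<in> H" for r x
    using lin[OF assms(2) that(2,1)] assms(1) that by (simp add: subset_iff)
  show "x \<oplus>\<^bsub>M\<^esub> y \<in> H" if "x \<in> H" "y \<in> H" for x y
    using lin[OF that R.one_closed] assms(1) that by (simp add: subset_iff)
  show "\<ominus>\<^bsub>M\<^esub> x \<in> H" if "x \<in> H" for x
    using smult[of "\<ominus> \<one>" x] assms(1) that by (simp add: smult_l_minus subset_iff)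
qed (use assms in auto)

lemma submodule_zero: "submodule H R M \<Longrightarrow> \<zero>\<^bsub>M\<^esub> \<in> H"
  by (metis additive_subgroup.intro additive_subgroup.zero_closed submodule.axioms(1))

lemma submodule_diff: "submodule H R M \<Longrightarrow> x \<in> H \<Longrightarrow> y \<in> H \<Longrightarrow> x \<ominus>\<^bsub>M\<^esub> y \<in> H"
  by (simp add: minus_eq submoduleE)

lemma submodule_lin:
  "\<lbrakk>submodule H R M; x \<in> H; y \<in> H; r \<in> carrier R\<rbrakk> \<Longrightarrow> x \<oplus>\<^bsub>M\<^esub> r \<odot>\<^bsub>M\<^esub> y \<in> H"
  by (simp add: submoduleE)

lemma submodule_mem: "\<lbrakk>submodule H R M; x \<in> H\<rbrakk> \<Longrightarrow> x \<in> carrier M"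
  using submoduleE(1) by blast

lemma submodule_add_cancel:
  assumes "submodule H R M" "x \<in> H" "y \<in> carrier M" "x \<oplus>\<^bsub>M\<^esub> y \<in> H"
  shows "y \<in> H"
proof -
  have "y = (x \<oplus>\<^bsub>M\<^esub> y) \<oplus>\<^bsub>M\<^esub> \<ominus>\<^bsub>M\<^esub> x"
    using assms(3) submodule_mem[OF assms(1,2)] by (metis M.a_comm M.add.inv_closed M.add.m_closed M.r_neg1)
  then show ?thesis
    by (metis assms(1,2,4) submoduleE(3,5))
qed

lemma submodule_Inter:
  assumes "\<H> \<noteq> {}" "\<And>H. H \<in> \<H> \<Longrightarrow> submodule H R M"
  shows "submodule (\<Inter>\<H>) R M"
  by (rule submoduleI') (use assms submodule_zero submodule_lin submodule_mem in blast)+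

lemma submodule_Int: "submodule H R M \<Longrightarrow> submodule K R M \<Longrightarrow> submodule (H \<inter> K) R M"
  using submodule_Inter[of "{H, K}"] by auto

lemma submodule_chain_Union:
  assumes ne: "\<C> \<noteq> {}" and sub: "\<And>H. H \<in> \<C> \<Longrightarrow> submodule H R M"
    and ch: "\<And>H K. \<lbrakk>H \<in> \<C>; K \<in> \<C>\<rbrakk> \<Longrightarrow> H \<subseteq> K \<or> K \<subseteq> H"
  shows "submodule (\<Union>\<C>) R M"
proof (rule submoduleI')
  show "\<Union>\<C> \<subseteq> carrier M" using sub submodule_mem by blast
  show "\<zero>\<^bsub>M\<^esub> \<in> \<Union>\<C>" using ne sub submodule_zero by blast
  fix x y r assume "x \<in> \<Union>\<C>" "y \<in> \<Union>\<C>" and r: "r \<in> carrier R"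
  then obtain H K where "H \<in> \<C>" "K \<in> \<C>" "x \<in> H" "y \<in> K" by auto
  then obtain L where "L \<in> \<C>" "x \<in> L" "y \<in> L" using ch[of H K] by blast
  then show "x \<oplus>\<^bsub>M\<^esub> r \<odot>\<^bsub>M\<^esub> y \<in> \<Union>\<C>" using sub r submodule_lin by blast
qed

lemma submodule_gen_submodule: "A \<subseteq> carrier M \<Longrightarrow> submodule (submodule_gen R M A) R M"
  unfolding submodule_gen_def using carrier_is_submodule by (intro submodule_Inter) auto

lemma submodule_gen_incl: "A \<subseteq> submodule_gen R M A"
  unfolding submodule_gen_def by blast

lemma submodule_gen_least: "submodule H R M \<Longrightarrow> A \<subseteq> H \<Longrightarrow> submodule_gen R M A \<subseteq> H"
  unfolding submodule_gen_def by blast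

lemma submodule_gen_mono: "A \<subseteq> B \<Longrightarrow> submodule_gen R M A \<subseteq> submodule_gen R M B"
  unfolding submodule_gen_def by blast

lemma submodule_zero_set: "submodule {\<zero>\<^bsub>M\<^esub>} R M"
  by (rule submoduleI') auto

lemma submodule_gen_empty: "submodule_gen R M {} = {\<zero>\<^bsub>M\<^esub>}"
  using submodule_gen_least[OF submodule_zero_set, of "{}"]
    submodule_zero[OF submodule_gen_submodule, of "{}"] by auto

lemma submodule_adjoin:
  assumes N: "submodule N R M" and x: "x \<in> carrier M"
  shows "submodule {n \<oplus>\<^bsub>M\<^esub> c \<odot>\<^bsub>M\<^esub> x | n c. n \<in> N \<and> c \<in> carrier R} R M"
proof (rule submoduleI')
  show "{n \<oplus>\<^bsub>M\<^esub> c \<odot>\<^bsub>M\<^esub> x | n c. n \<in> N \<and> c \<in> carrier R} \<subseteq> carrier M"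
    using submodule_mem[OF N] x by auto
  have "\<zero>\<^bsub>M\<^esub> = \<zero>\<^bsub>M\<^esub> \<oplus>\<^bsub>M\<^esub> \<zero> \<odot>\<^bsub>M\<^esub> x" using x by simp
  then show "\<zero>\<^bsub>M\<^esub> \<in> {n \<oplus>\<^bsub>M\<^esub> c \<odot>\<^bsub>M\<^esub> x | n c. n \<in> N \<and> c \<in> carrier R}"
    using submodule_zero[OF N] by blast
  fix u v r assume "u \<in> {n \<oplus>\<^bsub>M\<^esub> c \<odot>\<^bsub>M\<^esub> x | n c. n \<in> N \<and> c \<in> carrier R}"
    "v \<in> {n \<oplus>\<^bsub>M\<^esub> c \<odot>\<^bsub>M\<^esub> x | n c. n \<in> N \<and> c \<in> carrier R}" and r: "r \<in> carrier R"
  then obtain n c n' c' where u: "u = n \<oplus>\<^bsub>M\<^esub> c \<odot>\<^bsub>M\<^esub> x" "n \<in> N" "c \<in> carrier R"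
    and v: "v = n' \<oplus>\<^bsub>M\<^esub> c' \<odot>\<^bsub>M\<^esub> x" "n' \<in> N" "c' \<in> carrier R" by blast
  have "u \<oplus>\<^bsub>M\<^esub> r \<odot>\<^bsub>M\<^esub> v = (n \<oplus>\<^bsub>M\<^esub> r \<odot>\<^bsub>M\<^esub> n') \<oplus>\<^bsub>M\<^esub> (c \<oplus> r \<otimes> c') \<odot>\<^bsub>M\<^esub> x"
    using u v r x submodule_mem[OF N]
    by (simp add: smult_l_distr smult_r_distr smult_assoc1 M.a_ac)
  moreover have "n \<oplus>\<^bsub>M\<^esub> r \<odot>\<^bsub>M\<^esub> n' \<in> N" using N u v r submodule_lin by blast
  ultimately show "u \<oplus>\<^bsub>M\<^esub> r \<odot>\<^bsub>M\<^esub> v \<in> {n \<oplus>\<^bsub>M\<^esub> c \<odot>\<^bsub>M\<^esub> x | n c. n \<in> N \<and> c \<in> carrier R}"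
    using u v r by blast
qed

lemma adjoin_mem:
  assumes "submodule N R M" "x \<in> carrier M"
  shows "x \<in> {n \<oplus>\<^bsub>M\<^esub> c \<odot>\<^bsub>M\<^esub> x | n c. n \<in> N \<and> c \<in> carrier R}"
    and "N \<subseteq> {n \<oplus>\<^bsub>M\<^esub> c \<odot>\<^bsub>M\<^esub> x | n c. n \<in> N \<and> c \<in> carrier R}"
proof -
  have "x = \<zero>\<^bsub>M\<^esub> \<oplus>\<^bsub>M\<^esub> \<one> \<odot>\<^bsub>M\<^esub> x" using assms by simp
  then show "x \<in> {n \<oplus>\<^bsub>M\<^esub> c \<odot>\<^bsub>M\<^esub> x | n c. n \<in> N \<and> c \<in> carrier R}"
    using submodule_zero[OF assms(1)] by blast
  show "N \<subseteq> {n \<oplus>\<^bsub>M\<^esub> c \<odot>\<^bsub>M\<^esub> x | n c. n \<in> N \<and> c \<in> carrier R}"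
  proof
    fix n assume "n \<in> N"
    then have "n = n \<oplus>\<^bsub>M\<^esub> \<zero> \<odot>\<^bsub>M\<^esub> x" using assms submodule_mem[OF assms(1)] by simp
    with \<open>n \<in> N\<close> show "n \<in> {n \<oplus>\<^bsub>M\<^esub> c \<odot>\<^bsub>M\<^esub> x | n c. n \<in> N \<and> c \<in> carrier R}" by blast
  qed
qed

lemma submodule_gen_insert:
  assumes A: "A \<subseteq> carrier M" and x: "x \<in> carrier M"
  shows "submodule_gen R M (insert x A) =
    {n \<oplus>\<^bsub>M\<^esub> c \<odot>\<^bsub>M\<^esub> x | n c. n \<in> submodule_gen R M A \<and> c \<in> carrier R}" (is "_ = ?S")
proof
  have sA: "submodule (submodule_gen R M A) R M" using A by (rule submodule_gen_submodule)
  show "submodule_gen R M (insert x A) \<subseteq> ?S"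
    using adjoin_mem[OF sA x] submodule_gen_incl[of A]
    by (intro submodule_gen_least submodule_adjoin sA x) blast
  show "?S \<subseteq> submodule_gen R M (insert x A)"
  proof safe
    fix n c assume "n \<in> submodule_gen R M A" "c \<in> carrier R"
    moreover have "submodule_gen R M A \<subseteq> submodule_gen R M (insert x A)"
      by (rule submodule_gen_mono) blast
    moreover have "x \<in> submodule_gen R M (insert x A)"
      using submodule_gen_incl by blast
    ultimately show "n \<oplus>\<^bsub>M\<^esub> c \<odot>\<^bsub>M\<^esub> x \<in> submodule_gen R M (insert x A)"
      using submodule_lin[OF submodule_gen_submodule] A x by blast
  qed
qed

lemma colon_ideal:
  assumes N: "submodule N R M" and x: "x \<in> carrier M"
  shows "ideal (colon R M N x) R"
proof (rule idealI)
  show "ring R" by (rule R.ring_axioms)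
  show "subgroup (colon R M N x) (add_monoid R)"
  proof (rule R.add.subgroupI)
    show "colon R M N x \<noteq> {}"
      using x submodule_zero[OF N] unfolding colon_def by (auto intro!: exI[of _ \<zero>])
  next
    fix a assume "a \<in> colon R M N x"
    then show "\<ominus> a \<in> colon R M N x"
      using x N unfolding colon_def by (simp add: smult_l_minus submoduleE(3))
  qed (use x N in \<open>auto simp: colon_def smult_l_distr submoduleE(5)\<close>)
  fix a b assume "a \<in> colon R M N x" "b \<in> carrier R"
  then show "b \<otimes> a \<in> colon R M N x" "a \<otimes> b \<in> colon R M N x"
    using x N by (auto simp: colon_def smult_assoc1 submoduleE(4) R.m_comm[of a b])
qed

lemma colon_smult:
  assumes "submodule N R M" "x \<in> carrier M" "r \<in> carrier R"
  shows "colon R M N (r \<odot>\<^bsub>M\<^esub> x) = {s \<in> carrier R. s \<otimes> r \<in> colon R M N x}"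
  using assms by (auto simp: colon_def smult_assoc1)

end


section \<open>Ideals of noetherian rings\<close>

text \<open>In a noetherian ring a nonempty chain of ideals contains its own union, so Zorn's
  condition holds for every family, whether or not it is closed under unions.\<close>

lemma (in noetherian_ring) ex_maximal_ideal_in:
  assumes "\<S> \<noteq> {}" "\<And>I. I \<in> \<S> \<Longrightarrow> ideal I R"
  shows "\<exists>I\<in>\<S>. \<forall>J\<in>\<S>. I \<subseteq> J \<longrightarrow> J = I"
proof (rule subset_Zorn_nonempty[OF assms(1)])
  fix C assume C: "C \<noteq> {}" "subset.chain \<S> C"
  then have "subset.chain {I. ideal I R} C"
    using assms(2) by (auto simp: subset_chain_def subset_iff)
  from ideal_chain_is_trivial[OF C(1) this] show "\<Union>C \<in> \<S>"
    using C(2) by (auto simp: subset_chain_def)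
qed

lemma (in primeideal) one_notin: "\<one> \<notin> I"
  using I_notcarr one_imp_carrier by blast

lemma (in noetherian_ring) ex_maximalideal_ge:
  assumes "ideal I R" "\<one> \<notin> I"
  shows "\<exists>m. maximalideal m R \<and> I \<subseteq> m"
proof -
  have "\<exists>m\<in>{J. ideal J R \<and> I \<subseteq> J \<and> \<one> \<notin> J}. \<forall>J\<in>{J. ideal J R \<and> I \<subseteq> J \<and> \<one> \<notin> J}. m \<subseteq> J \<longrightarrow> J = m"
    using assms by (intro ex_maximal_ideal_in) auto
  then obtain m where m: "ideal m R" "I \<subseteq> m" "\<one> \<notin> m"
    and max: "\<And>J. \<lbrakk>ideal J R; I \<subseteq> J; \<one> \<notin> J; m \<subseteq> J\<rbrakk> \<Longrightarrow> J = m" by auto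
  have "maximalideal m R"
  proof (rule maximalidealI)
    fix J assume "ideal J R" "m \<subseteq> J" "J \<subseteq> carrier R"
    then show "J = m \<or> J = carrier R"
      using max[of J] m(2) ideal.one_imp_carrier[of J R] by blast
  qed (use m in auto)
  then show ?thesis using m by blast
qed

text \<open>The sum of \<open>m\<close> and the principal ideal of \<open>a\<close> exceeds
  \<open>m\<close>, hence is everything; so \<open>a\<close> is invertible modulo
  \<open>m\<close>.\<close>

lemma (in cring) maximalideal_unit_mod:
  assumes m: "maximalideal m R" and a: "a \<in> carrier R" "a \<notin> m"
  shows "\<exists>b\<in>carrier R. \<exists>c\<in>m. \<one> = b \<otimes> a \<oplus> c"
proof -
  interpret m: maximalideal m R by fact
  have J: "ideal (m <+> PIdl a) R" using add_ideals[OF m.is_ideal cgenideal_ideal[OF a(1)]] .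
  interpret P: ideal "PIdl a" R using a(1) by (rule cgenideal_ideal)
  have aP: "a \<in> PIdl a" using a(1) by (rule cgenideal_self)
  have sub: "m \<subseteq> m <+> PIdl a"
  proof
    fix x assume "x \<in> m"
    moreover have "x = x \<oplus> \<zero>" using \<open>x \<in> m\<close> by (simp add: m.Icarr)
    ultimately show "x \<in> m <+> PIdl a" unfolding set_add_def' using P.zero_closed by blast
  qed
  have "a = \<zero> \<oplus> a" using a(1) by simp
  then have mem: "a \<in> m <+> PIdl a" unfolding set_add_def' using m.zero_closed aP by blast
  have "m <+> PIdl a = carrier R"
    using m.I_maximal[OF J sub] mem a ideal.axioms(1)[OF J] additive_subgroup.a_subset by blast
  then have "\<one> \<in> m <+> PIdl a" by simp
  then obtain c d where cd: "c \<in> m" "d \<in> PIdl a" "\<one> = c \<oplus> d"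
    unfolding set_add_def' by auto
  then obtain b where "b \<in> carrier R" "d = b \<otimes> a" unfolding cgenideal_def by blast
  then show ?thesis using cd a m.a_subset by (metis a_comm m.Icarr m_closed)
qed

lemma (in cring) ideal_colon:
  assumes I: "ideal I R" and r: "r \<in> carrier R"
  shows "ideal {s \<in> carrier R. s \<otimes> r \<in> I} R"
proof (rule idealI)
  interpret I: ideal I R by fact
  show "ring R" by (rule ring_axioms)
  show "subgroup {s \<in> carrier R. s \<otimes> r \<in> I} (add_monoid R)"
  proof (rule add.subgroupI)
    have "\<zero> \<in> {s \<in> carrier R. s \<otimes> r \<in> I}" using r I.zero_closed by simp
    then show "{s \<in> carrier R. s \<otimes> r \<in> I} \<noteq> {}" by blast
    show "\<ominus> a \<in> {s \<in> carrier R. s \<otimes> r \<in> I}" if "a \<in> {s \<in> carrier R. s \<otimes> r \<in> I}" for a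
      using that r I.a_inv_closed by (simp add: l_minus)
    show "a \<oplus> b \<in> {s \<in> carrier R. s \<otimes> r \<in> I}"
      if "a \<in> {s \<in> carrier R. s \<otimes> r \<in> I}" "b \<in> {s \<in> carrier R. s \<otimes> r \<in> I}" for a b
      using that r I.a_closed by (simp add: l_distr)
  qed auto
  fix a x assume "a \<in> {s \<in> carrier R. s \<otimes> r \<in> I}" "x \<in> carrier R"
  then show "x \<otimes> a \<in> {s \<in> carrier R. s \<otimes> r \<in> I}" "a \<otimes> x \<in> {s \<in> carrier R. s \<otimes> r \<in> I}"
    using r I.I_l_closed[of "a \<otimes> r" x] by (auto simp: m_assoc m_comm[of a x])
qed

text \<open>
  Localising at \<open>p\<close> and taking an associated prime of the ideal \<open>I\<^sub>p\<close>: the sets \<open>A r\<close> below are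
  the contractions of the annihilators in \<open>R\<^sub>p / I\<^sub>p\<close>.
\<close>

lemma (in cring) ex_prime_colon_below:
  assumes noeth: "noetherian_ring R" and I: "ideal I R" and p: "primeideal p R" and Ip: "I \<subseteq> p"
  shows "\<exists>r\<in>carrier R. primeideal {s \<in> carrier R. s \<otimes> r \<in> I} R \<and> {s \<in> carrier R. s \<otimes> r \<in> I} \<subseteq> p"
proof -
  interpret I: ideal I R by fact
  interpret p: primeideal p R by fact
  define A where "A r = {b \<in> carrier R. \<exists>u\<in>carrier R - p. (u \<otimes> b) \<otimes> r \<in> I}" for r
  have mult: "u \<otimes> v \<in> carrier R - p" if "u \<in> carrier R - p" "v \<in> carrier R - p" for u v
    using that p.I_prime by blast
  have idl: "ideal (A r) R" if r: "r \<in> carrier R" for r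
  proof (rule idealI)
    show "ring R" by (rule ring_axioms)
    have sm: "x \<otimes> a \<in> A r" if a: "a \<in> A r" and x: "x \<in> carrier R" for a x
    proof -
      obtain u where u: "u \<in> carrier R - p" "(u \<otimes> a) \<otimes> r \<in> I" "a \<in> carrier R"
        using a unfolding A_def by blast
      have "(u \<otimes> (x \<otimes> a)) \<otimes> r = x \<otimes> ((u \<otimes> a) \<otimes> r)"
        using u x r by (simp add: m_ac)
      also have "\<dots> \<in> I" using u(2) x by (rule I.I_l_closed)
      finally show ?thesis unfolding A_def using u x by blast
    qed
    then show "x \<otimes> a \<in> A r" "a \<otimes> x \<in> A r" if "a \<in> A r" "x \<in> carrier R" for a x
      using that by (auto simp: m_comm[of a x] A_def)
    show "subgroup (A r) (add_monoid R)"
    proof (rule add.subgroupI)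
      have "(\<one> \<otimes> \<zero>) \<otimes> r \<in> I" using r by simp
      then show "A r \<noteq> {}" unfolding A_def using p.one_notin by blast
      show "\<ominus> a \<in> A r" if "a \<in> A r" for a
      proof -
        have "\<ominus> a = \<ominus> \<one> \<otimes> a" using that by (simp add: l_minus A_def)
        then show ?thesis using sm[OF that, of "\<ominus> \<one>"] by simp
      qed
      fix a b assume "a \<in> A r" "b \<in> A r"
      then obtain u v where u: "u \<in> carrier R - p" "(u \<otimes> a) \<otimes> r \<in> I" "a \<in> carrier R"
        and v: "v \<in> carrier R - p" "(v \<otimes> b) \<otimes> r \<in> I" "b \<in> carrier R" unfolding A_def by auto
      have "((u \<otimes> v) \<otimes> (a \<oplus> b)) \<otimes> r = v \<otimes> ((u \<otimes> a) \<otimes> r) \<oplus> u \<otimes> ((v \<otimes> b) \<otimes> r)"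
        using u v r by (simp add: l_distr r_distr m_ac)
      also have "\<dots> \<in> I" using u v by (simp add: I.I_l_closed)
      finally show "a \<oplus> b \<in> A r" unfolding A_def using u v mult by blast
    qed (auto simp: A_def)
  qed
  \<comment> \<open>Since I is contained in p, the family of proper \<open>A r\<close> is nonempty.
    A maximal member is prime, by the usual argument for associated primes.\<close>
  have "\<one> \<notin> A \<one>" using Ip unfolding A_def by auto
  then have "\<exists>J\<in>{A r | r. r \<in> carrier R \<and> \<one> \<notin> A r}. \<forall>K\<in>{A r | r. r \<in> carrier R \<and> \<one> \<notin> A r}. J \<subseteq> K \<longrightarrow> K = J"
    by (intro noetherian_ring.ex_maximal_ideal_in[OF noeth]) (use idl in auto)
  then obtain r where r: "r \<in> carrier R" "\<one> \<notin> A r"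
    and max: "\<And>s. \<lbrakk>s \<in> carrier R; \<one> \<notin> A s; A r \<subseteq> A s\<rbrakk> \<Longrightarrow> A s = A r" by blast
  have prime: "primeideal (A r) R"
  proof (rule primeidealI)
    show "carrier R \<noteq> A r" using r by blast
    fix b c assume bc: "b \<in> carrier R" "c \<in> carrier R" "b \<otimes> c \<in> A r"
    have "b \<in> A r" if c: "c \<notin> A r"
    proof -
      have "\<one> \<notin> A (c \<otimes> r)"
      proof
        assume "\<one> \<in> A (c \<otimes> r)"
        then obtain u where "u \<in> carrier R - p" "u \<otimes> (c \<otimes> r) \<in> I" unfolding A_def by auto
        then have "c \<in> A r" unfolding A_def using bc r by (auto simp: m_assoc)
        with c show False by simp
      qed
      moreover have "A r \<subseteq> A (c \<otimes> r)"
      proof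
        fix b assume "b \<in> A r"
        then obtain u where u: "u \<in> carrier R - p" "(u \<otimes> b) \<otimes> r \<in> I" "b \<in> carrier R"
          unfolding A_def by auto
        have "(u \<otimes> b) \<otimes> (c \<otimes> r) = c \<otimes> ((u \<otimes> b) \<otimes> r)" using u bc r by (simp add: m_ac)
        also have "\<dots> \<in> I" using u(2) bc(2) by (rule I.I_l_closed)
        finally show "b \<in> A (c \<otimes> r)" using u unfolding A_def by blast
      qed
      ultimately have "A (c \<otimes> r) = A r" using max bc r by blast
      moreover obtain u where "u \<in> carrier R - p" "(u \<otimes> (b \<otimes> c)) \<otimes> r \<in> I"
        using bc unfolding A_def by auto
      then have "b \<in> A (c \<otimes> r)" unfolding A_def using bc r by (auto simp: m_assoc)
      ultimately show ?thesis by simp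
    qed
    then show "b \<in> A r \<or> c \<in> A r" by blast
  qed (use idl r is_cring in auto)
  \<comment> \<open>Each element of \<open>A r\<close> has its own multiplier u. A finite generating
    set has a common one, and replacing r by u r turns \<open>A r\<close> into an honest colon
    ideal.\<close>
  obtain X where X: "X \<subseteq> carrier R" "finite X" "A r = Idl X"
    using noetherian_ring.finetely_gen[OF noeth idl[OF r(1)]] by blast
  have "\<exists>u\<in>carrier R - p. \<forall>x\<in>X. (u \<otimes> x) \<otimes> r \<in> I"
    using X(2) subset_trans[OF genideal_self[OF X(1)] equalityD2[OF X(3)]]
  proof (induction X rule: finite_induct)
    case empty
    show ?case using p.one_notin by (intro bexI[of _ \<one>]) auto
  next
    case (insert y Y)
    then obtain u where u: "u \<in> carrier R - p" "\<And>x. x \<in> Y \<Longrightarrow> (u \<otimes> x) \<otimes> r \<in> I" by auto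
    obtain v where v: "v \<in> carrier R - p" "(v \<otimes> y) \<otimes> r \<in> I" "y \<in> carrier R"
      using insert.prems unfolding A_def by auto
    have Y: "Y \<subseteq> carrier R" using insert.prems unfolding A_def by auto
    show ?case
    proof (intro bexI ballI)
      show "u \<otimes> v \<in> carrier R - p" using u v mult by blast
      fix x assume x: "x \<in> insert y Y"
      show "((u \<otimes> v) \<otimes> x) \<otimes> r \<in> I"
      proof (cases "x = y")
        case True
        have "((u \<otimes> v) \<otimes> x) \<otimes> r = u \<otimes> ((v \<otimes> y) \<otimes> r)" using True u v r by (simp add: m_ac)
        then show ?thesis using I.I_l_closed[OF v(2)] u by simp
      next
        case False
        then have xY: "x \<in> Y" using x by simp
        have "((u \<otimes> v) \<otimes> x) \<otimes> r = v \<otimes> ((u \<otimes> x) \<otimes> r)" using xY Y u v r by (simp add: m_ac subset_iff)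
        then show ?thesis using I.I_l_closed[OF u(2)[OF xY]] v by simp
      qed
    qed
  qed
  then obtain u where u: "u \<in> carrier R - p" "\<And>x. x \<in> X \<Longrightarrow> (u \<otimes> x) \<otimes> r \<in> I" by blast
  have "ideal {s \<in> carrier R. s \<otimes> (u \<otimes> r) \<in> I} R"
    using I u r by (intro ideal_colon) auto
  then have "Idl X \<subseteq> {s \<in> carrier R. s \<otimes> (u \<otimes> r) \<in> I}"
  proof (rule genideal_minimal)
    show "X \<subseteq> {s \<in> carrier R. s \<otimes> (u \<otimes> r) \<in> I}"
    proof
      fix x assume x: "x \<in> X"
      then have "x \<otimes> (u \<otimes> r) = (u \<otimes> x) \<otimes> r" using u(1) r X(1) by (simp add: m_ac subset_iff)
      then show "x \<in> {s \<in> carrier R. s \<otimes> (u \<otimes> r) \<in> I}" using u(2)[OF x] x X(1) by auto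
    qed
  qed
  moreover have "{s \<in> carrier R. s \<otimes> (u \<otimes> r) \<in> I} \<subseteq> A r"
  proof
    fix s assume s: "s \<in> {s \<in> carrier R. s \<otimes> (u \<otimes> r) \<in> I}"
    then have "(u \<otimes> s) \<otimes> r = s \<otimes> (u \<otimes> r)" using u(1) r by (simp add: m_ac)
    then show "s \<in> A r" unfolding A_def using u(1) s by (auto intro: bexI[of _ u])
  qed
  ultimately have eq: "{s \<in> carrier R. s \<otimes> (u \<otimes> r) \<in> I} = A r" using X(3) by blast
  have "A r \<subseteq> p"
  proof
    fix b assume "b \<in> A r"
    then obtain v where v: "v \<in> carrier R - p" "(v \<otimes> b) \<otimes> r \<in> I" "b \<in> carrier R" unfolding A_def by auto
    show "b \<in> p"
    proof (rule ccontr)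
      assume "b \<notin> p"
      then have "v \<otimes> b \<in> carrier R - p" using v mult by blast
      then have "\<one> \<in> A r" unfolding A_def using v by auto
      with r show False by simp
    qed
  qed
  then have "primeideal {s \<in> carrier R. s \<otimes> (u \<otimes> r) \<in> I} R \<and> {s \<in> carrier R. s \<otimes> (u \<otimes> r) \<in> I} \<subseteq> p"
    using prime unfolding eq by blast
  moreover have "u \<otimes> r \<in> carrier R" using u(1) r(1) by simp
  ultimately show ?thesis by blast
qed

section \<open>Linear compactness of discrete modules\<close>

text \<open>Closure under x + r(y - z) mentions no base point and admits the empty set, so
  intersections and projections of affine sets are affine without case distinctions.\<close>

definition affine_subset :: "('r, 'x) ring_scheme \<Rightarrow> ('r, 'm) module \<Rightarrow> 'm set \<Rightarrow> bool" where
  "affine_subset R M C \<longleftrightarrow> C \<subseteq> carrier M \<and>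
     (\<forall>x\<in>C. \<forall>y\<in>C. \<forall>z\<in>C. \<forall>r\<in>carrier R. x \<oplus>\<^bsub>M\<^esub> r \<odot>\<^bsub>M\<^esub> (y \<ominus>\<^bsub>M\<^esub> z) \<in> C)"

text \<open>The nonempty affine subsets are the cosets of submodules.\<close>

definition lin_compact :: "('r, 'x) ring_scheme \<Rightarrow> ('r, 'm) module \<Rightarrow> 'm set \<Rightarrow> bool" where
  "lin_compact R M H \<longleftrightarrow> (\<forall>\<F>. (\<forall>C\<in>\<F>. affine_subset R M C \<and> C \<subseteq> H) \<and>
     (\<forall>\<G>\<subseteq>\<F>. finite \<G> \<longrightarrow> \<Inter>\<G> \<noteq> {}) \<longrightarrow> \<Inter>\<F> \<noteq> {})"

lemma lin_compactD:
  assumes "lin_compact R M H" "\<And>C. C \<in> \<F> \<Longrightarrow> affine_subset R M C" "\<And>C. C \<in> \<F> \<Longrightarrow> C \<subseteq> H"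
    "\<And>\<G>. \<lbrakk>\<G> \<subseteq> \<F>; finite \<G>\<rbrakk> \<Longrightarrow> \<Inter>\<G> \<noteq> {}"
  shows "\<Inter>\<F> \<noteq> {}"
  using assms unfolding lin_compact_def by blast

lemma lin_compact_mono: "lin_compact R M H \<Longrightarrow> K \<subseteq> H \<Longrightarrow> lin_compact R M K"
  unfolding lin_compact_def by (meson order_trans)

lemma affine_subset_Int: "affine_subset R M C \<Longrightarrow> affine_subset R M D \<Longrightarrow> affine_subset R M (C \<inter> D)"
  unfolding affine_subset_def by blast

context rmodule
begin

lemma affine_submodule: "submodule H R M \<Longrightarrow> affine_subset R M H"
  unfolding affine_subset_def by (simp add: submodule_diff submodule_lin submodule_mem subsetI)

lemma affine_coset:
  assumes N: "submodule N R M" and a: "a \<in> carrier M"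
  shows "affine_subset R M {x \<in> carrier M. x \<ominus>\<^bsub>M\<^esub> a \<in> N}"
  unfolding affine_subset_def
proof (intro conjI ballI)
  fix x y z r assume h: "x \<in> {x \<in> carrier M. x \<ominus>\<^bsub>M\<^esub> a \<in> N}" "y \<in> {x \<in> carrier M. x \<ominus>\<^bsub>M\<^esub> a \<in> N}"
    "z \<in> {x \<in> carrier M. x \<ominus>\<^bsub>M\<^esub> a \<in> N}" "r \<in> carrier R"
  have "(y \<ominus>\<^bsub>M\<^esub> a) \<ominus>\<^bsub>M\<^esub> (z \<ominus>\<^bsub>M\<^esub> a) = y \<ominus>\<^bsub>M\<^esub> z"
    using h a by (simp add: M.minus_eq M.minus_add M.a_ac M.r_neg1 M.r_neg2)
  then have "y \<ominus>\<^bsub>M\<^esub> z \<in> N" using h submodule_diff[OF N, of "y \<ominus>\<^bsub>M\<^esub> a" "z \<ominus>\<^bsub>M\<^esub> a"] by simp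
  then have "(x \<ominus>\<^bsub>M\<^esub> a) \<oplus>\<^bsub>M\<^esub> r \<odot>\<^bsub>M\<^esub> (y \<ominus>\<^bsub>M\<^esub> z) \<in> N" using h submodule_lin[OF N] by blast
  moreover have "(x \<ominus>\<^bsub>M\<^esub> a) \<oplus>\<^bsub>M\<^esub> r \<odot>\<^bsub>M\<^esub> (y \<ominus>\<^bsub>M\<^esub> z) = (x \<oplus>\<^bsub>M\<^esub> r \<odot>\<^bsub>M\<^esub> (y \<ominus>\<^bsub>M\<^esub> z)) \<ominus>\<^bsub>M\<^esub> a"
    using h a by (simp add: M.minus_eq M.a_ac)
  ultimately show "x \<oplus>\<^bsub>M\<^esub> r \<odot>\<^bsub>M\<^esub> (y \<ominus>\<^bsub>M\<^esub> z) \<in> {x \<in> carrier M. x \<ominus>\<^bsub>M\<^esub> a \<in> N}"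
    using h by simp
qed auto

lemma mem_rcoset_iff:
  assumes N: "submodule N R M" and a: "a \<in> carrier M"
  shows "x \<in> N +>\<^bsub>M\<^esub> a \<longleftrightarrow> x \<in> carrier M \<and> x \<ominus>\<^bsub>M\<^esub> a \<in> N"
proof
  assume "x \<in> N +>\<^bsub>M\<^esub> a"
  then obtain n where n: "n \<in> N" "x = n \<oplus>\<^bsub>M\<^esub> a" unfolding a_r_coset_def' by auto
  then have "x \<ominus>\<^bsub>M\<^esub> a = n" using submodule_mem[OF N] a by (simp add: M.minus_eq M.a_assoc M.r_neg)
  then show "x \<in> carrier M \<and> x \<ominus>\<^bsub>M\<^esub> a \<in> N" using n submodule_mem[OF N] a by simp
next
  assume x: "x \<in> carrier M \<and> x \<ominus>\<^bsub>M\<^esub> a \<in> N"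
  then have "x = (x \<ominus>\<^bsub>M\<^esub> a) \<oplus>\<^bsub>M\<^esub> a" using a by (simp add: M.minus_eq M.a_assoc M.l_neg)
  then show "x \<in> N +>\<^bsub>M\<^esub> a" unfolding a_r_coset_def' using x by auto
qed

lemma rcoset_eq_Collect:
  "\<lbrakk>submodule N R M; a \<in> carrier M\<rbrakk> \<Longrightarrow> N +>\<^bsub>M\<^esub> a = {x \<in> carrier M. x \<ominus>\<^bsub>M\<^esub> a \<in> N}"
  using mem_rcoset_iff by blast

text \<open>The submodule is the translate of \<open>C\<close> that moves its point \<open>a\<close>
  to 0; closure is the affine condition with z = a.\<close>

lemma affine_imp_coset:
  assumes C: "affine_subset R M C" and a: "a \<in> C"
  shows "\<exists>N. submodule N R M \<and> C = N +>\<^bsub>M\<^esub> a"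
proof -
  have sub: "C \<subseteq> carrier M" and lin: "\<And>x y z r. \<lbrakk>x \<in> C; y \<in> C; z \<in> C; r \<in> carrier R\<rbrakk> \<Longrightarrow> x \<oplus>\<^bsub>M\<^esub> r \<odot>\<^bsub>M\<^esub> (y \<ominus>\<^bsub>M\<^esub> z) \<in> C"
    using C unfolding affine_subset_def by auto
  have aM: "a \<in> carrier M" using a sub by blast
  let ?N = "{x \<in> carrier M. x \<oplus>\<^bsub>M\<^esub> a \<in> C}"
  have N: "submodule ?N R M"
  proof (rule submoduleI')
    fix x y r assume h: "x \<in> ?N" "y \<in> ?N" "r \<in> carrier R"
    have "(x \<oplus>\<^bsub>M\<^esub> a) \<oplus>\<^bsub>M\<^esub> r \<odot>\<^bsub>M\<^esub> ((y \<oplus>\<^bsub>M\<^esub> a) \<ominus>\<^bsub>M\<^esub> a) \<in> C" using h a by (intro lin) auto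
    moreover have "(x \<oplus>\<^bsub>M\<^esub> a) \<oplus>\<^bsub>M\<^esub> r \<odot>\<^bsub>M\<^esub> ((y \<oplus>\<^bsub>M\<^esub> a) \<ominus>\<^bsub>M\<^esub> a) = (x \<oplus>\<^bsub>M\<^esub> r \<odot>\<^bsub>M\<^esub> y) \<oplus>\<^bsub>M\<^esub> a"
      using h aM by (simp add: M.minus_eq M.a_assoc M.r_neg) (simp add: M.a_ac)
    ultimately show "x \<oplus>\<^bsub>M\<^esub> r \<odot>\<^bsub>M\<^esub> y \<in> ?N" using h by simp
  qed (use a aM in auto)
  have "C = ?N +>\<^bsub>M\<^esub> a"
  proof (rule Set.set_eqI)
    fix x
    have "(x \<ominus>\<^bsub>M\<^esub> a) \<oplus>\<^bsub>M\<^esub> a = x" if "x \<in> carrier M"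
      using that aM by (simp add: M.minus_eq M.a_assoc M.l_neg)
    then show "x \<in> C \<longleftrightarrow> x \<in> ?N +>\<^bsub>M\<^esub> a"
      using sub aM by (auto simp: mem_rcoset_iff[OF N aM])
  qed
  then show ?thesis using N by blast
qed

end

section \<open>Linear maps, and linear compactness of sums and images\<close>

lemma mod_homD:
  assumes "h \<in> mod_hom R M N"
  shows "x \<in> carrier M \<Longrightarrow> h x \<in> carrier N"
    and "\<lbrakk>x \<in> carrier M; y \<in> carrier M\<rbrakk> \<Longrightarrow> h (x \<oplus>\<^bsub>M\<^esub> y) = h x \<oplus>\<^bsub>N\<^esub> h y"
    and "\<lbrakk>r \<in> carrier R; x \<in> carrier M\<rbrakk> \<Longrightarrow> h (r \<odot>\<^bsub>M\<^esub> x) = r \<odot>\<^bsub>N\<^esub> h x"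
  using assms unfolding mod_hom_def by auto

lemma mod_homI:
  assumes "\<And>x. x \<in> carrier M \<Longrightarrow> h x \<in> carrier N"
    and "\<And>x y. \<lbrakk>x \<in> carrier M; y \<in> carrier M\<rbrakk> \<Longrightarrow> h (x \<oplus>\<^bsub>M\<^esub> y) = h x \<oplus>\<^bsub>N\<^esub> h y"
    and "\<And>r x. \<lbrakk>r \<in> carrier R; x \<in> carrier M\<rbrakk> \<Longrightarrow> h (r \<odot>\<^bsub>M\<^esub> x) = r \<odot>\<^bsub>N\<^esub> h x"
  shows "h \<in> mod_hom R M N"
  using assms unfolding mod_hom_def by auto

lemma mod_hom_comp: "f \<in> mod_hom R M N \<Longrightarrow> g \<in> mod_hom R N P \<Longrightarrow> (\<lambda>x. g (f x)) \<in> mod_hom R M P"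
  by (rule mod_homI) (simp_all add: mod_homD)

locale mod_map = M: rmodule R M + N: rmodule R N
  for R :: "('r, 'x) ring_scheme" (structure) and M :: "('r, 'm) module" and N :: "('r, 'n) module" +
  fixes h assumes h: "h \<in> mod_hom R M N"
begin

lemmas closed = mod_homD(1)[OF h] and add = mod_homD(2)[OF h] and smult = mod_homD(3)[OF h]

lemma zero: "h \<zero>\<^bsub>M\<^esub> = \<zero>\<^bsub>N\<^esub>"
  using smult[of \<zero> "\<zero>\<^bsub>M\<^esub>"] closed[of "\<zero>\<^bsub>M\<^esub>"] by simp

lemma neg: "x \<in> carrier M \<Longrightarrow> h (\<ominus>\<^bsub>M\<^esub> x) = \<ominus>\<^bsub>N\<^esub> h x"
  using smult[of "\<ominus> \<one>" x] closed[of x] by (simp add: M.smult_l_minus N.smult_l_minus)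

lemma diff: "\<lbrakk>x \<in> carrier M; y \<in> carrier M\<rbrakk> \<Longrightarrow> h (x \<ominus>\<^bsub>M\<^esub> y) = h x \<ominus>\<^bsub>N\<^esub> h y"
  by (simp add: M.minus_eq N.minus_eq add neg)

lemma vimage_submodule:
  assumes H: "submodule H R N" shows "submodule {x \<in> carrier M. h x \<in> H} R M"
  by (rule M.submoduleI')
    (use H in \<open>auto simp: zero add smult closed N.submodule_zero N.submodule_lin\<close>)

lemma image_submodule:
  assumes H: "submodule H R M" shows "submodule (h ` H) R N"
proof (rule N.submoduleI')
  show "h ` H \<subseteq> carrier N" using M.submodule_mem[OF H] closed by blast
  show "\<zero>\<^bsub>N\<^esub> \<in> h ` H" using M.submodule_zero[OF H] zero by force
  fix x y r assume "x \<in> h ` H" "y \<in> h ` H" "r \<in> carrier R"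
  then obtain u v where "u \<in> H" "v \<in> H" "x = h u" "y = h v" by auto
  moreover have "h (u \<oplus>\<^bsub>M\<^esub> r \<odot>\<^bsub>M\<^esub> v) = h u \<oplus>\<^bsub>N\<^esub> r \<odot>\<^bsub>N\<^esub> h v"
    using calculation M.submodule_mem[OF H] \<open>r \<in> carrier R\<close> by (simp add: add smult)
  ultimately show "x \<oplus>\<^bsub>N\<^esub> r \<odot>\<^bsub>N\<^esub> y \<in> h ` H"
    using M.submodule_lin[OF H] \<open>r \<in> carrier R\<close> by (metis imageI)
qed

lemma ker_submodule: "submodule (mod_ker M N h) R M"
  using vimage_submodule[OF N.submodule_zero_set] unfolding mod_ker_def by simp

end

lemma mod_mapI: "\<lbrakk>Module.module R M; Module.module R N; h \<in> mod_hom R M N\<rbrakk> \<Longrightarrow> mod_map R M N h"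
  by (simp add: mod_map_def mod_map_axioms_def rmoduleI)

text \<open>
  Over the finite intersections of the given family, first a compatible first component is chosen
  and then a compatible second one.
\<close>

lemma lin_compact_sum:
  assumes X: "Module.module R X" and Y: "Module.module R Y" and P: "Module.module R P"
    and i: "i \<in> mod_hom R X P" and j: "j \<in> mod_hom R Y P"
    and H: "submodule H R X" "lin_compact R X H" and K: "submodule K R Y" "lin_compact R Y K"
  shows "lin_compact R P {i x \<oplus>\<^bsub>P\<^esub> j y | x y. x \<in> H \<and> y \<in> K}"
  unfolding lin_compact_def
proof (intro allI impI)
  interpret i: mod_map R X P i by (rule mod_mapI[OF X P i])
  interpret j: mod_map R Y P j by (rule mod_mapI[OF Y P j])
  fix \<F> assume "(\<forall>C\<in>\<F>. affine_subset R P C \<and> C \<subseteq> {i x \<oplus>\<^bsub>P\<^esub> j y | x y. x \<in> H \<and> y \<in> K}) \<and>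
     (\<forall>\<G>\<subseteq>\<F>. finite \<G> \<longrightarrow> \<Inter>\<G> \<noteq> {})"
  then have aff: "\<And>C. C \<in> \<F> \<Longrightarrow> affine_subset R P C"
    and sub: "\<And>C. C \<in> \<F> \<Longrightarrow> C \<subseteq> {i x \<oplus>\<^bsub>P\<^esub> j y | x y. x \<in> H \<and> y \<in> K}"
    and fip: "\<And>\<G>. \<lbrakk>\<G> \<subseteq> \<F>; finite \<G>\<rbrakk> \<Longrightarrow> \<Inter>\<G> \<noteq> {}" by auto
  note mem = i.M.submodule_mem[OF H(1)] j.M.submodule_mem[OF K(1)]
  \<comment> \<open>The map sending (x, y) to i x + j y respects the ternary operation of affine
    sets. This makes the sets \<open>D\<close> and \<open>E\<close> below affine.\<close>
  have lin: "i (x1 \<oplus>\<^bsub>X\<^esub> r \<odot>\<^bsub>X\<^esub> (x2 \<ominus>\<^bsub>X\<^esub> x3)) \<oplus>\<^bsub>P\<^esub> j (y1 \<oplus>\<^bsub>Y\<^esub> r \<odot>\<^bsub>Y\<^esub> (y2 \<ominus>\<^bsub>Y\<^esub> y3)) =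
      (i x1 \<oplus>\<^bsub>P\<^esub> j y1) \<oplus>\<^bsub>P\<^esub> r \<odot>\<^bsub>P\<^esub> ((i x2 \<oplus>\<^bsub>P\<^esub> j y2) \<ominus>\<^bsub>P\<^esub> (i x3 \<oplus>\<^bsub>P\<^esub> j y3))"
    if "x1 \<in> H" "x2 \<in> H" "x3 \<in> H" "y1 \<in> K" "y2 \<in> K" "y3 \<in> K" "r \<in> carrier R" for x1 x2 x3 y1 y2 y3 r
    using that mem
    by (simp add: i.add i.smult i.diff j.add j.smult j.diff i.closed j.closed i.N.minus_eq
        i.N.smult_r_distr i.N.minus_add i.N.M.a_ac)
  \<comment> \<open>The first components that admit one completion common to all members of \<G>;
    separate completions for the members could not be combined later.\<close>
  define D where "D \<G> = {x \<in> H. \<exists>y\<in>K. \<forall>C\<in>\<G>. i x \<oplus>\<^bsub>P\<^esub> j y \<in> C}" for \<G>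
  have D_aff: "affine_subset R X (D \<G>)" if "\<G> \<subseteq> \<F>" for \<G>
    unfolding affine_subset_def
  proof (intro conjI ballI)
    show "D \<G> \<subseteq> carrier X" using mem(1) unfolding D_def by blast
    fix x1 x2 x3 r assume h: "x1 \<in> D \<G>" "x2 \<in> D \<G>" "x3 \<in> D \<G>" "r \<in> carrier R"
    then obtain y1 y2 y3 where y: "y1 \<in> K" "y2 \<in> K" "y3 \<in> K" and
      C: "\<And>C. C \<in> \<G> \<Longrightarrow> i x1 \<oplus>\<^bsub>P\<^esub> j y1 \<in> C" "\<And>C. C \<in> \<G> \<Longrightarrow> i x2 \<oplus>\<^bsub>P\<^esub> j y2 \<in> C"
        "\<And>C. C \<in> \<G> \<Longrightarrow> i x3 \<oplus>\<^bsub>P\<^esub> j y3 \<in> C"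
      unfolding D_def by auto
    have x: "x1 \<in> H" "x2 \<in> H" "x3 \<in> H" using h unfolding D_def by auto
    have "i (x1 \<oplus>\<^bsub>X\<^esub> r \<odot>\<^bsub>X\<^esub> (x2 \<ominus>\<^bsub>X\<^esub> x3)) \<oplus>\<^bsub>P\<^esub> j (y1 \<oplus>\<^bsub>Y\<^esub> r \<odot>\<^bsub>Y\<^esub> (y2 \<ominus>\<^bsub>Y\<^esub> y3)) \<in> C" if "C \<in> \<G>" for C
      unfolding lin[OF x y h(4)] using aff C[OF that] that \<open>\<G> \<subseteq> \<F>\<close> h(4)
      unfolding affine_subset_def by blast
    moreover have "y1 \<oplus>\<^bsub>Y\<^esub> r \<odot>\<^bsub>Y\<^esub> (y2 \<ominus>\<^bsub>Y\<^esub> y3) \<in> K"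
      using K(1) y h by (simp add: j.M.submodule_lin j.M.submodule_diff)
    moreover have "x1 \<oplus>\<^bsub>X\<^esub> r \<odot>\<^bsub>X\<^esub> (x2 \<ominus>\<^bsub>X\<^esub> x3) \<in> H"
      using H(1) x h by (simp add: i.M.submodule_lin i.M.submodule_diff)
    ultimately show "x1 \<oplus>\<^bsub>X\<^esub> r \<odot>\<^bsub>X\<^esub> (x2 \<ominus>\<^bsub>X\<^esub> x3) \<in> D \<G>" unfolding D_def by blast
  qed
  have D_ne: "D \<G> \<noteq> {}" if GF: "\<G> \<subseteq> \<F>" "finite \<G>" for \<G>
  proof (cases "\<G> = {}")
    case True
    then show ?thesis using i.M.submodule_zero[OF H(1)] j.M.submodule_zero[OF K(1)] unfolding D_def by blast
  next
    case False
    obtain c where c: "c \<in> \<Inter>\<G>" using fip[OF GF] by blast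
    then have "c \<in> {i x \<oplus>\<^bsub>P\<^esub> j y | x y. x \<in> H \<and> y \<in> K}" using False sub GF(1) by blast
    then obtain x y where "x \<in> H" "y \<in> K" "c = i x \<oplus>\<^bsub>P\<^esub> j y" by blast
    then have "x \<in> D \<G>" using c unfolding D_def by blast
    then show ?thesis by blast
  qed
  have "\<Inter>(insert H (D ` {\<G>. \<G> \<subseteq> \<F> \<and> finite \<G>})) \<noteq> {}"
  proof (rule lin_compactD[OF H(2)])
    fix \<G> assume "\<G> \<subseteq> insert H (D ` {\<G>. \<G> \<subseteq> \<F> \<and> finite \<G>})" "finite \<G>"
    then have "finite (\<G> - {H})" "\<G> - {H} \<subseteq> D ` {\<G>. \<G> \<subseteq> \<F> \<and> finite \<G>}" by auto
    then obtain S where S: "S \<subseteq> {\<G>. \<G> \<subseteq> \<F> \<and> finite \<G>}" "finite S" "\<G> - {H} = D ` S"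
      by (meson finite_subset_image)
    \<comment> \<open>Finitely many finite subfamilies have a finite union, and \<open>D\<close> of
      the union is contained in \<open>D\<close> of each of them.\<close>
    then have "\<Union>S \<subseteq> \<F>" "finite (\<Union>S)" by auto
    then have "D (\<Union>S) \<noteq> {}" by (rule D_ne)
    then obtain d where d: "d \<in> D (\<Union>S)" by blast
    have "d \<in> C" if C: "C \<in> \<G>" for C
    proof (cases "C = H")
      case True
      then show ?thesis using d unfolding D_def by simp
    next
      case False
      then have "C \<in> D ` S" using C S(3) by auto
      then obtain T where "T \<in> S" "C = D T" by auto
      then show ?thesis using d unfolding D_def by auto
    qed
    then show "\<Inter>\<G> \<noteq> {}" by blast
  qed (use D_aff i.M.affine_submodule[OF H(1)] in \<open>auto simp: D_def\<close>)
  then obtain x where x: "x \<in> H" "\<And>\<G>. \<lbrakk>\<G> \<subseteq> \<F>; finite \<G>\<rbrakk> \<Longrightarrow> x \<in> D \<G>" by auto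
  define E where "E C = {y \<in> K. i x \<oplus>\<^bsub>P\<^esub> j y \<in> C}" for C
  \<comment> \<open>\<open>K\<close> is added so that the common point lies in \<open>K\<close> even
    when \<F> is empty.\<close>
  have "\<Inter>(insert K (E ` \<F>)) \<noteq> {}"
  proof (rule lin_compactD[OF K(2)])
    have E_aff: "affine_subset R Y (E C)" if C: "C \<in> \<F>" for C
      unfolding affine_subset_def
    proof (intro conjI ballI)
      show "E C \<subseteq> carrier Y" using mem(2) unfolding E_def by blast
      fix y1 y2 y3 r assume h: "y1 \<in> E C" "y2 \<in> E C" "y3 \<in> E C" "r \<in> carrier R"
      then have y: "y1 \<in> K" "y2 \<in> K" "y3 \<in> K" unfolding E_def by auto
      \<comment> \<open>A disguised form of x, so that \<open>lin\<close> applies with the first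
        component held fixed.\<close>
      have "x = x \<oplus>\<^bsub>X\<^esub> r \<odot>\<^bsub>X\<^esub> (x \<ominus>\<^bsub>X\<^esub> x)" using x(1) mem(1) h by (simp add: i.M.minus_eq i.M.M.r_neg)
      then have "i x \<oplus>\<^bsub>P\<^esub> j (y1 \<oplus>\<^bsub>Y\<^esub> r \<odot>\<^bsub>Y\<^esub> (y2 \<ominus>\<^bsub>Y\<^esub> y3)) =
        (i x \<oplus>\<^bsub>P\<^esub> j y1) \<oplus>\<^bsub>P\<^esub> r \<odot>\<^bsub>P\<^esub> ((i x \<oplus>\<^bsub>P\<^esub> j y2) \<ominus>\<^bsub>P\<^esub> (i x \<oplus>\<^bsub>P\<^esub> j y3))"
        using lin[OF x(1) x(1) x(1) y h(4)] by simp
      also have "\<dots> \<in> C" using aff[OF C] h unfolding affine_subset_def E_def by blast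
      finally show "y1 \<oplus>\<^bsub>Y\<^esub> r \<odot>\<^bsub>Y\<^esub> (y2 \<ominus>\<^bsub>Y\<^esub> y3) \<in> E C"
        using K(1) y h by (simp add: E_def j.M.submodule_lin j.M.submodule_diff)
    qed
    show "affine_subset R Y C" if "C \<in> insert K (E ` \<F>)" for C
      using that E_aff j.M.affine_submodule[OF K(1)] by auto
    fix \<G> assume "\<G> \<subseteq> insert K (E ` \<F>)" "finite \<G>"
    then have "finite (\<G> - {K})" "\<G> - {K} \<subseteq> E ` \<F>" by auto
    then obtain S where S: "S \<subseteq> \<F>" "finite S" "\<G> - {K} = E ` S"
      by (meson finite_subset_image)
    then have "x \<in> D S" using x(2) by blast
    then obtain y where "y \<in> K" "\<forall>C\<in>S. i x \<oplus>\<^bsub>P\<^esub> j y \<in> C" unfolding D_def by blast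
    have "y \<in> C" if C: "C \<in> \<G>" for C
    proof (cases "C = K")
      case True
      then show ?thesis using \<open>y \<in> K\<close> by simp
    next
      case False
      then have "C \<in> E ` S" using C S(3) by auto
      then show ?thesis using \<open>y \<in> K\<close> \<open>\<forall>C\<in>S. i x \<oplus>\<^bsub>P\<^esub> j y \<in> C\<close> unfolding E_def by auto
    qed
    then show "\<Inter>\<G> \<noteq> {}" by blast
  qed (auto simp: E_def)
  then obtain y where "y \<in> K" "\<forall>C\<in>\<F>. y \<in> E C" by auto
  then have "i x \<oplus>\<^bsub>P\<^esub> j y \<in> \<Inter>\<F>" unfolding E_def by blast
  then show "\<Inter>\<F> \<noteq> {}" by blast
qed

text \<open>Obtained from the lemma on sums with the same map twice: i(H) lies in i(H) + i(H), since
  i(0) = 0.\<close>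

lemma lin_compact_image:
  assumes X: "Module.module R X" and P: "Module.module R P" and i: "i \<in> mod_hom R X P"
    and H: "submodule H R X" "lin_compact R X H"
  shows "lin_compact R P (i ` H)"
proof -
  interpret i: mod_map R X P i by (rule mod_mapI[OF X P i])
  have "lin_compact R P {i x \<oplus>\<^bsub>P\<^esub> i y | x y. x \<in> H \<and> y \<in> H}"
    by (rule lin_compact_sum[OF X X P i i H H])
  moreover have "i x \<in> {i x \<oplus>\<^bsub>P\<^esub> i y | x y. x \<in> H \<and> y \<in> H}" if "x \<in> H" for x
  proof -
    have "i x = i x \<oplus>\<^bsub>P\<^esub> i \<zero>\<^bsub>X\<^esub>" using that i.M.submodule_mem[OF H(1)] by (simp add: i.zero i.closed)
    then show ?thesis using that i.M.submodule_zero[OF H(1)] by blast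
  qed
  ultimately show ?thesis using lin_compact_mono by blast
qed

section \<open>Torsion with respect to the maximal ideals\<close>

text \<open>
  The class of \<open>x\<close> in \<open>M / N\<close> generates a module supported at maximal ideals; over a noetherian ring
  this means that it has finite length.
\<close>

definition torsion_mod :: "('r, 'x) ring_scheme \<Rightarrow> ('r, 'm) module \<Rightarrow> 'm set \<Rightarrow> 'm \<Rightarrow> bool" where
  "torsion_mod R M N x \<longleftrightarrow> (\<forall>p. primeideal p R \<and> colon R M N x \<subseteq> p \<longrightarrow> maximalideal p R)"

lemma torsion_modD: "\<lbrakk>torsion_mod R M N x; primeideal p R; colon R M N x \<subseteq> p\<rbrakk> \<Longrightarrow> maximalideal p R"
  unfolding torsion_mod_def by blast

lemma torsion_mod_mono: "torsion_mod R M N x \<Longrightarrow> N \<subseteq> N' \<Longrightarrow> torsion_mod R M N' x"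
  unfolding torsion_mod_def colon_def by blast

text \<open>The form in which torsion is used: a nonmaximal prime p cannot contain the colon ideal,
  so the class of x dies after multiplication by an element outside p.\<close>

lemma torsion_mod_witness:
  assumes "torsion_mod R M N x" "primeideal p R" "\<not> maximalideal p R"
  shows "\<exists>r\<in>carrier R - p. r \<odot>\<^bsub>M\<^esub> x \<in> N"
  using assms unfolding torsion_mod_def colon_def by blast

context rmodule
begin

lemma torsion_mod_zero: "submodule N R M \<Longrightarrow> x \<in> N \<Longrightarrow> torsion_mod R M N x"
  unfolding torsion_mod_def colon_def
  by (metis (mono_tags, lifting) R.one_closed mem_Collect_eq primeideal.one_notin submoduleE(4) subsetD)

text \<open>Extensions of torsion by torsion are torsion: at a nonmaximal prime one multiplier moves
  x into N, a second one moves it on into U, and their product still avoids the prime.\<close>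

lemma torsion_mod_trans:
  assumes N: "submodule N R M" and x: "x \<in> carrier M" "torsion_mod R M N x"
    and U: "submodule U R M" "\<And>y. y \<in> N \<Longrightarrow> torsion_mod R M U y"
  shows "torsion_mod R M U x"
  unfolding torsion_mod_def
proof (intro allI impI, rule ccontr)
  fix p assume p: "primeideal p R \<and> colon R M U x \<subseteq> p" and nm: "\<not> maximalideal p R"
  interpret p: primeideal p R using p by simp
  obtain r where r: "r \<in> carrier R" "r \<notin> p" "r \<odot>\<^bsub>M\<^esub> x \<in> N"
    using torsion_mod_witness[OF x(2) conjunct1[OF p] nm] by auto
  obtain s where s: "s \<in> carrier R" "s \<notin> p" "s \<odot>\<^bsub>M\<^esub> (r \<odot>\<^bsub>M\<^esub> x) \<in> U"
    using torsion_mod_witness[OF U(2)[OF r(3)] conjunct1[OF p] nm] by auto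
  have "s \<otimes> r \<in> colon R M U x" using r s x by (simp add: colon_def smult_assoc1)
  then show False using p r s p.I_prime by blast
qed

lemma submodule_sum:
  assumes H: "submodule H R M" and K: "submodule K R M"
  shows "submodule {h \<oplus>\<^bsub>M\<^esub> k | h k. h \<in> H \<and> k \<in> K} R M"
proof (rule submoduleI')
  show "{h \<oplus>\<^bsub>M\<^esub> k | h k. h \<in> H \<and> k \<in> K} \<subseteq> carrier M" using submodule_mem H K by auto
  have "\<zero>\<^bsub>M\<^esub> = \<zero>\<^bsub>M\<^esub> \<oplus>\<^bsub>M\<^esub> \<zero>\<^bsub>M\<^esub>" by simp
  then show "\<zero>\<^bsub>M\<^esub> \<in> {h \<oplus>\<^bsub>M\<^esub> k | h k. h \<in> H \<and> k \<in> K}" using submodule_zero H K by blast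
  fix x y r assume "x \<in> {h \<oplus>\<^bsub>M\<^esub> k | h k. h \<in> H \<and> k \<in> K}" "y \<in> {h \<oplus>\<^bsub>M\<^esub> k | h k. h \<in> H \<and> k \<in> K}"
    and r: "r \<in> carrier R"
  then obtain h k h' k' where hk: "h \<in> H" "k \<in> K" "h' \<in> H" "k' \<in> K"
    and xy: "x = h \<oplus>\<^bsub>M\<^esub> k" "y = h' \<oplus>\<^bsub>M\<^esub> k'" by blast
  have "x \<oplus>\<^bsub>M\<^esub> r \<odot>\<^bsub>M\<^esub> y = (h \<oplus>\<^bsub>M\<^esub> r \<odot>\<^bsub>M\<^esub> h') \<oplus>\<^bsub>M\<^esub> (k \<oplus>\<^bsub>M\<^esub> r \<odot>\<^bsub>M\<^esub> k')"
    using xy hk r submodule_mem[OF H] submodule_mem[OF K] by (simp add: smult_r_distr M.a_ac)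
  then show "x \<oplus>\<^bsub>M\<^esub> r \<odot>\<^bsub>M\<^esub> y \<in> {h \<oplus>\<^bsub>M\<^esub> k | h k. h \<in> H \<and> k \<in> K}"
    using submodule_lin[OF H hk(1,3) r] submodule_lin[OF K hk(2,4) r] by blast
qed

text \<open>
  A linearly compact module has no quotient containing an infinite direct sum: the partial sums
  of the \<open>s n\<close> are Cauchy for the tails \<open>T n\<close>, and a limit inside their span would be a finite sum.
\<close>

lemma lin_compact_no_infinite_sum:
  assumes lc: "lin_compact R M (carrier M)"
    and U: "submodule U R M"
    and T: "\<And>n. submodule (T n) R M" "\<And>n. T (Suc n) \<subseteq> T n" "\<And>n. s n \<in> T n"
    and s: "\<And>n. s n \<notin> U"
    and ind: "\<And>n. submodule_gen R M (U \<union> s ` {..<n}) \<inter> T n \<subseteq> U"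
  shows False
proof -
  define Sp where "Sp n = submodule_gen R M (U \<union> s ` {..<n})" for n
  have sM: "s n \<in> carrier M" for n using T submodule_mem by blast
  have sub: "U \<union> s ` {..<n} \<subseteq> carrier M" for n using sM U submodule_mem by auto
  have Sp: "submodule (Sp n) R M" for n unfolding Sp_def by (rule submodule_gen_submodule[OF sub])
  have Sp_mono: "Sp n \<subseteq> Sp m" if "n \<le> m" for n m
    unfolding Sp_def by (rule submodule_gen_mono) (use that in auto)
  have T_mono: "T m \<subseteq> T n" if "n \<le> m" for n m
    using lift_Suc_antimono_le[of T, OF T(2) that] .
  define D where "D = \<Union>(range Sp)"
  have D: "submodule D R M" unfolding D_def
  proof (rule submodule_chain_Union)
    fix H K assume "H \<in> range Sp" "K \<in> range Sp"
    then show "H \<subseteq> K \<or> K \<subseteq> H" using Sp_mono by (metis nat_le_linear rangeE)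
  qed (use Sp in auto)
  define \<sigma> where "\<sigma> = rec_nat \<zero>\<^bsub>M\<^esub> (\<lambda>n a. a \<oplus>\<^bsub>M\<^esub> s n)"
  have \<sigma>_0: "\<sigma> 0 = \<zero>\<^bsub>M\<^esub>" and \<sigma>_Suc: "\<sigma> (Suc n) = \<sigma> n \<oplus>\<^bsub>M\<^esub> s n" for n unfolding \<sigma>_def by simp_all
  have \<sigma>: "\<sigma> n \<in> Sp n" for n
  proof (induction n)
    case 0
    show ?case using submodule_zero[OF Sp] \<sigma>_0 by simp
  next
    case (Suc n)
    have "s n \<in> Sp (Suc n)" unfolding Sp_def by (rule subsetD[OF submodule_gen_incl]) auto
    then show ?case unfolding \<sigma>_Suc using Suc Sp_mono[of n "Suc n"] submoduleE(5)[OF Sp[of "Suc n"]] by auto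
  qed
  have \<sigma>M: "\<sigma> n \<in> carrier M" for n using \<sigma> Sp submodule_mem by blast
  have diff: "\<sigma> m \<ominus>\<^bsub>M\<^esub> \<sigma> n \<in> T n" if "n \<le> m" for n m
    using that
  proof (induction m rule: dec_induct)
    case base
    show ?case using submodule_zero[OF T(1)] \<sigma>M by (simp add: M.minus_eq M.r_neg)
  next
    case (step m)
    have "\<sigma> (Suc m) \<ominus>\<^bsub>M\<^esub> \<sigma> n = (\<sigma> m \<ominus>\<^bsub>M\<^esub> \<sigma> n) \<oplus>\<^bsub>M\<^esub> s m"
      unfolding \<sigma>_Suc using \<sigma>M sM by (simp add: M.minus_eq M.a_ac)
    moreover have "s m \<in> T n" using T(3) T_mono[of n m] step by auto
    ultimately show ?case using step submoduleE(5)[OF T(1)] by simp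
  qed
  \<comment> \<open>Intersecting the coset \<sigma> n + T n with \<open>D\<close> forces the limit
    into the span of the s n and U.\<close>
  define C where "C n = {x \<in> carrier M. x \<ominus>\<^bsub>M\<^esub> \<sigma> n \<in> T n} \<inter> D" for n
  have "\<Inter>(range C) \<noteq> {}"
  proof (rule lin_compactD[OF lc])
    show "affine_subset R M B" if "B \<in> range C" for B
      using that affine_subset_Int[OF affine_coset[OF T(1) \<sigma>M] affine_submodule[OF D]] unfolding C_def by auto
    show "B \<subseteq> carrier M" if "B \<in> range C" for B using that unfolding C_def by auto
    fix \<G> assume "\<G> \<subseteq> range C" "finite \<G>"
    then obtain I where I: "finite I" "\<G> = C ` I" by (metis finite_subset_image)
    then obtain m where "\<And>n. n \<in> I \<Longrightarrow> n \<le> m" by (metis finite_nat_set_iff_bounded_le)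
    moreover have "\<sigma> m \<in> D" unfolding D_def using \<sigma> by blast
    ultimately have "\<sigma> m \<in> \<Inter>\<G>" using I(2) diff \<sigma>M unfolding C_def by auto
    then show "\<Inter>\<G> \<noteq> {}" by blast
  qed
  then obtain x where "\<And>n. x \<in> C n" by auto
  then have x: "x \<in> carrier M" "x \<in> D" "\<And>n. x \<ominus>\<^bsub>M\<^esub> \<sigma> n \<in> T n" unfolding C_def by auto
  then obtain n where "x \<in> Sp n" unfolding D_def by auto
  then have "x \<in> Sp k" if "n \<le> k" for k using Sp_mono that by blast
  \<comment> \<open>x and \<sigma> k both lie in the k-th partial span, so \<open>ind\<close>
    applies to their difference. Two consecutive indices then approximate x modulo U, and s n, the
    difference of the partial sums, falls into U.\<close>
  then have *: "x \<ominus>\<^bsub>M\<^esub> \<sigma> k \<in> U" if "n \<le> k" for k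
    using ind[of k] x(3)[of k] submodule_diff[OF Sp _ \<sigma>] that unfolding Sp_def[symmetric] by blast
  have "(x \<ominus>\<^bsub>M\<^esub> \<sigma> (Suc n)) \<oplus>\<^bsub>M\<^esub> s n = x \<ominus>\<^bsub>M\<^esub> \<sigma> n"
    unfolding \<sigma>_Suc using x(1) \<sigma>M sM by (simp add: M.minus_eq M.minus_add M.a_assoc M.l_neg)
  then have "s n \<in> U"
    using submodule_add_cancel[OF U *[of "Suc n"] sM] *[of n] by simp
  then show False using s by blast
qed

text \<open>
  If a descending chain with intersection \<open>U\<close> does not stabilise, its members contain socle
  elements of \<open>M / U\<close> which span an infinite direct sum.
\<close>

lemma lin_compact_torsion_dcc:
  assumes noeth: "noetherian_ring R" and lc: "lin_compact R M (carrier M)"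
    and tors: "\<And>x. x \<in> carrier M \<Longrightarrow> torsion_mod R M {\<zero>\<^bsub>M\<^esub>} x"
    and N: "\<And>n. submodule (N n) R M" "\<And>n. N (Suc n) \<subseteq> N n"
  shows "\<exists>k. \<forall>n\<ge>k. N n = N k"
proof (rule ccontr)
  assume neg: "\<nexists>k. \<forall>n\<ge>k. N n = N k"
  have N_mono: "N m \<subseteq> N n" if "n \<le> m" for n m
    using lift_Suc_antimono_le[of N, OF N(2) that] .
  define U where "U = \<Inter>(range N)"
  have U: "submodule U R M" unfolding U_def by (rule submodule_Inter) (use N in auto)
  have UN: "U \<subseteq> N n" for n unfolding U_def by auto
  \<comment> \<open>For y outside U some multiple r y has a prime annihilator modulo U. Torsion
    makes this prime maximal, so r y is a socle element of M/U.\<close>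
  have ex: "\<exists>s\<in>N i. maximalideal (colon R M U s) R" for i
  proof -
    have "\<not> N i \<subseteq> U"
    proof
      assume "N i \<subseteq> U"
      then have "\<forall>n\<ge>i. N n = N i" using UN N_mono by blast
      with neg show False by blast
    qed
    then obtain y where y: "y \<in> N i" "y \<notin> U" by auto
    have yM: "y \<in> carrier M" using y N submodule_mem by blast
    have "\<one> \<notin> colon R M U y" using y yM unfolding colon_def by auto
    then obtain p where p: "maximalideal p R" "colon R M U y \<subseteq> p"
      using noetherian_ring.ex_maximalideal_ge[OF noeth colon_ideal[OF U yM]] by blast
    then obtain r where r: "r \<in> carrier R" "primeideal {s \<in> carrier R. s \<otimes> r \<in> colon R M U y} R"
      using R.ex_prime_colon_below[OF noeth colon_ideal[OF U yM] R.maximalideal_prime] by blast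
    have eq: "{s \<in> carrier R. s \<otimes> r \<in> colon R M U y} = colon R M U (r \<odot>\<^bsub>M\<^esub> y)"
      using colon_smult[OF U yM r(1)] by simp
    have "torsion_mod R M U (r \<odot>\<^bsub>M\<^esub> y)"
      using r(1) yM submodule_zero[OF U] by (intro torsion_mod_mono[OF tors]) auto
    then have "maximalideal (colon R M U (r \<odot>\<^bsub>M\<^esub> y)) R"
      using r(2) unfolding eq by (rule torsion_modD) simp
    moreover have "r \<odot>\<^bsub>M\<^esub> y \<in> N i" using y r N submoduleE(4) by blast
    ultimately show ?thesis by blast
  qed
  define P where "P z \<longleftrightarrow> snd z \<in> N (fst z) \<and> maximalideal (colon R M U (snd z)) R" for z :: "nat \<times> 'm"
  \<comment> \<open>An element outside U leaves the chain at some later index, and the next element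
    is chosen there. The indices increase strictly, so \<open>T\<close> below is a subchain.\<close>
  have "\<exists>f. \<forall>n. P (f n) \<and> (fst (f n) < fst (f (Suc n)) \<and> snd (f n) \<notin> N (fst (f (Suc n))))"
  proof (rule dependent_nat_choice)
    show "\<exists>z. P z" using ex[of 0] unfolding P_def by auto
    fix z :: "nat \<times> 'm" and n :: nat assume z: "P z"
    have zM: "snd z \<in> carrier M" using z N submodule_mem unfolding P_def by blast
    have "\<one> \<notin> colon R M U (snd z)"
      using z maximalideal.I_notcarr maximalideal.axioms(1) ideal.one_imp_carrier unfolding P_def by metis
    then have "snd z \<notin> U" using zM unfolding colon_def by auto
    then obtain j where "snd z \<notin> N j" unfolding U_def by auto
    then have j: "snd z \<notin> N (max j (Suc (fst z)))" using N_mono[of j "max j (Suc (fst z))"] by auto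
    obtain t where "t \<in> N (max j (Suc (fst z)))" "maximalideal (colon R M U t) R" using ex by blast
    then show "\<exists>w. P w \<and> (fst z < fst w \<and> snd z \<notin> N (fst w))"
      using j unfolding P_def by (intro exI[of _ "(max j (Suc (fst z)), t)"]) auto
  qed
  then obtain f where f: "\<And>n. P (f n)" "\<And>n. fst (f n) < fst (f (Suc n))"
    "\<And>n. snd (f n) \<notin> N (fst (f (Suc n)))" by blast
  define s where "s n = snd (f n)" for n
  define T where "T n = N (fst (f n))" for n
  have T: "submodule (T n) R M" "T (Suc n) \<subseteq> T n" "s n \<in> T n" "U \<subseteq> T n" for n
    using N(1) N_mono[OF less_imp_le[OF f(2)]] f(1) UN unfolding T_def s_def P_def by auto
  have max: "maximalideal (colon R M U (s n)) R" and sT: "s n \<notin> T (Suc n)" for n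
    using f unfolding s_def P_def T_def by auto
  have sM: "s n \<in> carrier M" for n using T submodule_mem by blast
  \<comment> \<open>Modulo U the element s n spans a simple module, so a nonzero multiple inside T
    (Suc n) would bring s n itself there.\<close>
  have key: "r \<odot>\<^bsub>M\<^esub> s n \<in> U" if r: "r \<in> carrier R" and rs: "r \<odot>\<^bsub>M\<^esub> s n \<in> T (Suc n)" for r n
  proof (rule ccontr)
    assume "r \<odot>\<^bsub>M\<^esub> s n \<notin> U"
    then have "r \<notin> colon R M U (s n)" unfolding colon_def by simp
    then obtain b c where bc: "b \<in> carrier R" "c \<in> colon R M U (s n)" "\<one> = b \<otimes> r \<oplus> c"
      using R.maximalideal_unit_mod[OF max r] by blast
    have c: "c \<in> carrier R" "c \<odot>\<^bsub>M\<^esub> s n \<in> U" using bc unfolding colon_def by auto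
    have "s n = b \<odot>\<^bsub>M\<^esub> (r \<odot>\<^bsub>M\<^esub> s n) \<oplus>\<^bsub>M\<^esub> c \<odot>\<^bsub>M\<^esub> s n"
      using smult_one[OF sM[of n]] bc c r sM[of n] by (simp add: smult_l_distr smult_assoc1)
    moreover have "c \<odot>\<^bsub>M\<^esub> s n \<in> T (Suc n)" using c T(4) by blast
    ultimately have "s n \<in> T (Suc n)"
      using submoduleE(4)[OF T(1) bc(1) rs] submoduleE(5)[OF T(1)] by metis
    with sT show False by blast
  qed
  \<comment> \<open>The summand w lies in T n because z and c s n do, so the induction hypothesis
    puts it into U. What remains of z is a multiple of s n inside T (Suc n), to which
    \<open>key\<close> applies.\<close>
  have "submodule_gen R M (U \<union> s ` {..<n}) \<inter> T n \<subseteq> U" for n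
  proof (induction n)
    case 0
    show ?case using submodule_gen_least[OF U, of U] by auto
  next
    case (Suc n)
    show ?case
    proof
      fix z assume z: "z \<in> submodule_gen R M (U \<union> s ` {..<Suc n}) \<inter> T (Suc n)"
      have "U \<union> s ` {..<Suc n} = insert (s n) (U \<union> s ` {..<n})" by (simp add: lessThan_Suc)
      moreover have sub: "U \<union> s ` {..<n} \<subseteq> carrier M" using sM U submodule_mem by auto
      ultimately obtain w c where w: "w \<in> submodule_gen R M (U \<union> s ` {..<n})" "c \<in> carrier R"
        "z = w \<oplus>\<^bsub>M\<^esub> c \<odot>\<^bsub>M\<^esub> s n"
        using z submodule_gen_insert[OF sub sM[of n]] by auto
      have wM: "w \<in> carrier M" using w(1) submodule_mem[OF submodule_gen_submodule[OF sub]] by blast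
      have cs: "c \<odot>\<^bsub>M\<^esub> s n \<in> T n" using submoduleE(4)[OF T(1)] w T(3) by blast
      have "w \<in> T n"
        using submodule_add_cancel[OF T(1) cs wM] z T(2) w wM sM[of n] by (auto simp: M.a_comm)
      then have wU: "w \<in> U" using w Suc by blast
      then have "c \<odot>\<^bsub>M\<^esub> s n \<in> T (Suc n)"
        using submodule_add_cancel[OF T(1)[of "Suc n"], of w] T(4) z w sM[of n] by auto
      then have "c \<odot>\<^bsub>M\<^esub> s n \<in> U" using key w by blast
      then show "z \<in> U" using wU w submoduleE(5)[OF U] by blast
    qed
  qed
  moreover have "s n \<notin> U" for n using sT T(4) by blast
  ultimately show False
    by (intro lin_compact_no_infinite_sum[where T = T and s = s, OF lc U T(1-3)])
qed


section \<open>Torsion of quotients by maximal submodules\<close>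

lemma chain_maximal_submodule:
  assumes ne: "H \<in> \<A>" and sub: "\<And>H. H \<in> \<A> \<Longrightarrow> submodule H R M"
    and un: "\<And>\<C>. \<lbrakk>\<C> \<noteq> {}; \<C> \<subseteq> \<A>; submodule (\<Union>\<C>) R M\<rbrakk> \<Longrightarrow> \<Union>\<C> \<in> \<A>"
  shows "\<exists>H\<in>\<A>. \<forall>K\<in>\<A>. H \<subseteq> K \<longrightarrow> K = H"
proof (rule subset_Zorn_nonempty)
  show "\<A> \<noteq> {}" using ne by blast
  fix \<C> assume C: "\<C> \<noteq> {}" "subset.chain \<A> \<C>"
  then have CA: "\<C> \<subseteq> \<A>" and ch: "\<And>H K. \<lbrakk>H \<in> \<C>; K \<in> \<C>\<rbrakk> \<Longrightarrow> H \<subseteq> K \<or> K \<subseteq> H"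
    by (auto simp: subset_chain_def)
  have "submodule (\<Union>\<C>) R M"
    using C(1) CA sub ch by (intro submodule_chain_Union) (auto simp: subset_iff)
  then show "\<Union>\<C> \<in> \<A>" using un[OF C(1) CA] by blast
qed

text \<open>By maximality of W every nonzero submodule of N'/W meets the image of N. So a prime
  annihilator q in N'/W contains the annihilator of a nonzero class of N/U, and torsion of N/U makes
  q maximal.\<close>

lemma torsion_mod_complement:
  assumes noeth: "noetherian_ring R"
    and N: "submodule N R M" and N': "submodule N' R M"
    and U: "submodule U R M" "\<And>y. y \<in> N \<Longrightarrow> torsion_mod R M U y"
    and W: "submodule W R M" "W \<inter> N = U" "W \<subseteq> N'"
    and max: "\<And>V. \<lbrakk>submodule V R M; V \<inter> N = U; V \<subseteq> N'; W \<subseteq> V\<rbrakk> \<Longrightarrow> V = W"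
    and y: "y \<in> N'"
  shows "torsion_mod R M W y"
  unfolding torsion_mod_def
proof (intro allI impI)
  fix p assume p: "primeideal p R \<and> colon R M W y \<subseteq> p"
  have yM: "y \<in> carrier M" using y submodule_mem[OF N'] by blast
  obtain r where r: "r \<in> carrier R" and "primeideal {s \<in> carrier R. s \<otimes> r \<in> colon R M W y} R"
     "{s \<in> carrier R. s \<otimes> r \<in> colon R M W y} \<subseteq> p"
    using R.ex_prime_colon_below[OF noeth colon_ideal[OF W(1) yM]] p by blast
  then have q: "primeideal (colon R M W (r \<odot>\<^bsub>M\<^esub> y)) R" "colon R M W (r \<odot>\<^bsub>M\<^esub> y) \<subseteq> p"
    unfolding colon_smult[OF W(1) yM r] by simp_all
  let ?z = "r \<odot>\<^bsub>M\<^esub> y" let ?q = "colon R M W ?z"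
  interpret q: primeideal ?q R by (rule q(1))
  have zM: "?z \<in> carrier M" and zN': "?z \<in> N'" using r yM y submoduleE(4)[OF N'] by auto
  have "?z \<notin> W" using q.one_notin zM unfolding colon_def by auto
  let ?V = "{w \<oplus>\<^bsub>M\<^esub> c \<odot>\<^bsub>M\<^esub> ?z | w c. w \<in> W \<and> c \<in> carrier R}"
  have "?V \<noteq> W" using \<open>?z \<notin> W\<close> adjoin_mem(1)[OF W(1) zM] by metis
  moreover have "?V \<subseteq> N'"
  proof
    fix v assume "v \<in> ?V"
    then obtain w c where "w \<in> W" "c \<in> carrier R" "v = w \<oplus>\<^bsub>M\<^esub> c \<odot>\<^bsub>M\<^esub> ?z" by blast
    then show "v \<in> N'" using submodule_lin[OF N' _ zN'] W(3) by auto
  qed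
  \<comment> \<open>W + Rz is strictly larger than W and lies in N', so it can only violate
    maximality by gaining an element n of N outside U.\<close>
  ultimately have "?V \<inter> N \<noteq> U"
    using max[OF submodule_adjoin[OF W(1) zM]] adjoin_mem(2)[OF W(1) zM] by metis
  moreover have "U \<subseteq> ?V \<inter> N" using W(2) adjoin_mem(2)[OF W(1) zM] by auto
  ultimately obtain n where n: "n \<in> ?V" "n \<in> N" "n \<notin> U" by auto
  then obtain w c where w: "w \<in> W" "c \<in> carrier R" "n = w \<oplus>\<^bsub>M\<^esub> c \<odot>\<^bsub>M\<^esub> ?z" by blast
  have nM: "n \<in> carrier M" using n submodule_mem[OF N] by blast
  have c: "c \<notin> ?q"
  proof
    assume "c \<in> ?q"
    then have "n \<in> W" using w submoduleE(5)[OF W(1)] unfolding colon_def by simp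
    then show False using n W(2) by blast
  qed
  \<comment> \<open>If t n is in U, then t c z is in W, so t c lies in the prime q, and c does
    not.\<close>
  have sub: "colon R M U n \<subseteq> ?q"
  proof
    fix t assume t: "t \<in> colon R M U n"
    then have tR: "t \<in> carrier R" and "t \<odot>\<^bsub>M\<^esub> n \<in> W" using W(2) unfolding colon_def by auto
    moreover have "t \<odot>\<^bsub>M\<^esub> n = t \<odot>\<^bsub>M\<^esub> w \<oplus>\<^bsub>M\<^esub> (t \<otimes> c) \<odot>\<^bsub>M\<^esub> ?z"
      using tR w zM submodule_mem[OF W(1)] by (simp add: smult_r_distr smult_assoc1)
    ultimately have "(t \<otimes> c) \<odot>\<^bsub>M\<^esub> ?z \<in> W"
      using submodule_add_cancel[OF W(1), of "t \<odot>\<^bsub>M\<^esub> w"] submoduleE(4)[OF W(1) tR w(1)] w(2) zM by simp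
    then have "t \<otimes> c \<in> ?q" using tR w(2) unfolding colon_def by simp
    then show "t \<in> ?q" using q.I_prime tR w(2) c by blast
  qed
  have qmax: "maximalideal ?q R" using torsion_modD[OF U(2)[OF n(2)] q(1) sub] .
  interpret p: primeideal p R using p by simp
  have "p = ?q"
    using maximalideal.I_maximal[OF qmax p.is_ideal q(2)] p.a_subset p.I_notcarr by blast
  then show "maximalideal p R" using qmax by simp
qed

text \<open>V is maximal without s, so every nonzero submodule of W/V contains the class of s. For a
  prime annihilator q this means that one fixed c, nonzero modulo q, is a multiple of every b that
  is nonzero modulo q, which makes R/q a field.\<close>

lemma torsion_mod_avoiding:
  assumes noeth: "noetherian_ring R"
    and W: "submodule W R M" and V: "submodule V R M" and s: "s \<notin> V"
    and max: "\<And>V'. \<lbrakk>submodule V' R M; V' \<subseteq> W; s \<notin> V'; V \<subseteq> V'\<rbrakk> \<Longrightarrow> V' = V" and VW: "V \<subseteq> W"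
    and y: "y \<in> W"
  shows "torsion_mod R M V y"
  unfolding torsion_mod_def
proof (intro allI impI)
  fix p assume p: "primeideal p R \<and> colon R M V y \<subseteq> p"
  have yM: "y \<in> carrier M" using y submodule_mem[OF W] by blast
  obtain r where r: "r \<in> carrier R" and "primeideal {s \<in> carrier R. s \<otimes> r \<in> colon R M V y} R"
     "{s \<in> carrier R. s \<otimes> r \<in> colon R M V y} \<subseteq> p"
    using R.ex_prime_colon_below[OF noeth colon_ideal[OF V yM]] p by blast
  then have q: "primeideal (colon R M V (r \<odot>\<^bsub>M\<^esub> y)) R" "colon R M V (r \<odot>\<^bsub>M\<^esub> y) \<subseteq> p"
    unfolding colon_smult[OF V yM r] by simp_all
  let ?z = "r \<odot>\<^bsub>M\<^esub> y" let ?q = "colon R M V ?z"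
  interpret q: primeideal ?q R by (rule q(1))
  have zM: "?z \<in> carrier M" and zW: "?z \<in> W" using r yM y submoduleE(4)[OF W] by auto
  have multiples: "\<exists>v\<in>V. \<exists>c\<in>carrier R. s = v \<oplus>\<^bsub>M\<^esub> c \<odot>\<^bsub>M\<^esub> (b \<odot>\<^bsub>M\<^esub> ?z)" if b: "b \<in> carrier R" "b \<notin> ?q" for b
  proof -
    let ?x = "b \<odot>\<^bsub>M\<^esub> ?z"
    have xM: "?x \<in> carrier M" and xW: "?x \<in> W" and xV: "?x \<notin> V"
      using b zM zW submoduleE(4)[OF W] unfolding colon_def by auto
    let ?V = "{w \<oplus>\<^bsub>M\<^esub> c \<odot>\<^bsub>M\<^esub> ?x | w c. w \<in> V \<and> c \<in> carrier R}"
    have "?V \<subseteq> W"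
    proof
      fix v assume "v \<in> ?V"
      then obtain w c where "w \<in> V" "c \<in> carrier R" "v = w \<oplus>\<^bsub>M\<^esub> c \<odot>\<^bsub>M\<^esub> ?x" by blast
      then show "v \<in> W" using submodule_lin[OF W _ xW] VW by auto
    qed
    moreover have "?V \<noteq> V" using xV adjoin_mem(1)[OF V xM] by metis
    ultimately have "s \<in> ?V"
      using max[OF submodule_adjoin[OF V xM]] adjoin_mem(2)[OF V xM] by metis
    then show ?thesis by blast
  qed
  obtain v c where c: "v \<in> V" "c \<in> carrier R" "s = v \<oplus>\<^bsub>M\<^esub> c \<odot>\<^bsub>M\<^esub> ?z"
    using multiples[OF R.one_closed q.one_notin] zM by auto
  have cq: "c \<notin> ?q"
  proof
    assume "c \<in> ?q"
    then have "s \<in> V" using c submoduleE(5)[OF V] unfolding colon_def by simp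
    with s show False by simp
  qed
  \<comment> \<open>s is expressed once through z and once through b z; the two expressions differ
    by an element of V.\<close>
  have unit: "\<exists>d\<in>carrier R. c \<ominus> d \<otimes> b \<in> ?q" if b: "b \<in> carrier R" "b \<notin> ?q" for b
  proof -
    obtain w d where d: "w \<in> V" "d \<in> carrier R" "s = w \<oplus>\<^bsub>M\<^esub> d \<odot>\<^bsub>M\<^esub> (b \<odot>\<^bsub>M\<^esub> ?z)"
      using multiples[OF b] by blast
    have vw: "v \<in> carrier M" "w \<in> carrier M" using c d submodule_mem[OF V] by auto
    have "(c \<ominus> d \<otimes> b) \<odot>\<^bsub>M\<^esub> ?z = c \<odot>\<^bsub>M\<^esub> ?z \<oplus>\<^bsub>M\<^esub> \<ominus>\<^bsub>M\<^esub> (d \<odot>\<^bsub>M\<^esub> (b \<odot>\<^bsub>M\<^esub> ?z))"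
      using c(2) d(2) b zM
      by (simp add: R.minus_eq smult_l_distr smult_l_minus smult_assoc1)
    also have "\<dots> = w \<ominus>\<^bsub>M\<^esub> v"
    proof -
      have "c \<odot>\<^bsub>M\<^esub> ?z = s \<ominus>\<^bsub>M\<^esub> v" "d \<odot>\<^bsub>M\<^esub> (b \<odot>\<^bsub>M\<^esub> ?z) = s \<ominus>\<^bsub>M\<^esub> w"
        using c d vw b zM
        by (metis M.add.inv_solve_right' M.a_comm M.minus_eq M.add.m_closed smult_closed)+
      moreover have "s \<in> carrier M" using c vw zM by simp
      ultimately show ?thesis using vw
        by (simp add: M.minus_eq M.minus_add M.a_ac M.r_neg1 M.r_neg2)
    qed
    finally have "(c \<ominus> d \<otimes> b) \<odot>\<^bsub>M\<^esub> ?z \<in> V" using submodule_diff[OF V d(1) c(1)] by simp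
    then show ?thesis using c(2) d(2) b unfolding colon_def by auto
  qed
  have qmax: "maximalideal ?q R"
  proof (rule maximalidealI)
    show "ideal ?q R" by (rule q.is_ideal)
    show "carrier R \<noteq> ?q" by (rule q.I_notcarr)
    fix J assume J: "ideal J R" "?q \<subseteq> J" "J \<subseteq> carrier R"
    interpret J: ideal J R by (rule J(1))
    show "J = ?q \<or> J = carrier R"
    proof (rule disjCI)
      assume "J \<noteq> carrier R"
      show "J = ?q"
      proof (rule ccontr)
        assume "J \<noteq> ?q"
        then obtain b where b: "b \<in> J" "b \<notin> ?q" using J(2) by blast
        then have bR: "b \<in> carrier R" using J(3) by blast
        obtain d where d: "d \<in> carrier R" "c \<ominus> d \<otimes> b \<in> ?q" using unit[OF bR b(2)] by blast
        have "c = (c \<ominus> d \<otimes> b) \<oplus> d \<otimes> b" using c(2) d bR by (simp add: R.minus_eq R.a_assoc R.l_neg)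
        moreover have "d \<otimes> b \<in> J" "c \<ominus> d \<otimes> b \<in> J" using d b J(2) J.I_l_closed by auto
        ultimately have cJ: "c \<in> J" using J.a_closed by metis
        \<comment> \<open>With b the square of c, cancelling c from c(1 - e c) in q shows that c is
          invertible modulo q. As J contains both c and q, it contains 1.\<close>
        have "c \<otimes> c \<notin> ?q" using cq c(2) q.I_prime by blast
        then obtain e where e: "e \<in> carrier R" "c \<ominus> e \<otimes> (c \<otimes> c) \<in> ?q"
          using unit[of "c \<otimes> c"] c(2) by auto
        have "c \<ominus> e \<otimes> (c \<otimes> c) = c \<otimes> (\<one> \<ominus> e \<otimes> c)"
          using c(2) e(1) by (simp add: R.minus_eq R.r_distr R.r_minus R.m_ac)
        then have "\<one> \<ominus> e \<otimes> c \<in> ?q" using e cq q.I_prime[of c "\<one> \<ominus> e \<otimes> c"] c(2) by auto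
        then have "\<one> \<ominus> e \<otimes> c \<in> J" "e \<otimes> c \<in> J" using J(2) J.I_l_closed[OF cJ e(1)] by auto
        moreover have "\<one> = (\<one> \<ominus> e \<otimes> c) \<oplus> e \<otimes> c" using c(2) e(1) by (simp add: R.minus_eq R.a_assoc R.l_neg)
        ultimately have "\<one> \<in> J" using J.a_closed by metis
        with \<open>J \<noteq> carrier R\<close> show False using J.one_imp_carrier by blast
      qed
    qed
  qed
  interpret p: primeideal p R using p by simp
  have "p = ?q"
    using maximalideal.I_maximal[OF qmax p.is_ideal q(2)] p.a_subset p.I_notcarr by blast
  then show "maximalideal p R" using qmax by simp
qed

end

context rmodule
begin

text \<open>One step of building an infinite direct sum. A maximal W in N' with trace U on N is
  larger than U, since otherwise x would be torsion modulo N. It is shrunk to V, maximal without a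
  chosen s in W outside U. Then N'/V is still torsion and V still has trace U on N, while s has
  become a direction independent of N modulo V.\<close>

lemma torsion_extension_step:
  assumes noeth: "noetherian_ring R"
    and N: "submodule N R M" and N': "submodule N' R M" "N \<subseteq> N'"
    and U: "submodule U R M" "U \<subseteq> N" "\<And>y. y \<in> N \<Longrightarrow> torsion_mod R M U y"
    and x: "x \<in> N'" "\<not> torsion_mod R M N x"
  shows "\<exists>U' s. submodule U' R M \<and> U' \<subseteq> N' \<and> (\<forall>y\<in>N'. torsion_mod R M U' y) \<and> U' \<inter> N = U \<and>
    s \<in> N' \<and> s \<notin> U' \<and> (\<forall>r\<in>carrier R. \<forall>u\<in>U'. \<forall>n\<in>N. r \<odot>\<^bsub>M\<^esub> s = u \<oplus>\<^bsub>M\<^esub> n \<longrightarrow> r \<odot>\<^bsub>M\<^esub> s \<in> U')"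
proof -
  have "\<exists>W\<in>{W. submodule W R M \<and> W \<inter> N = U \<and> W \<subseteq> N'}.
      \<forall>K\<in>{W. submodule W R M \<and> W \<inter> N = U \<and> W \<subseteq> N'}. W \<subseteq> K \<longrightarrow> K = W"
  proof (rule chain_maximal_submodule)
    show "U \<in> {W. submodule W R M \<and> W \<inter> N = U \<and> W \<subseteq> N'}" using U N' by auto
    fix \<C> assume "\<C> \<noteq> {}" "\<C> \<subseteq> {W. submodule W R M \<and> W \<inter> N = U \<and> W \<subseteq> N'}" "submodule (\<Union>\<C>) R M"
    then show "\<Union>\<C> \<in> {W. submodule W R M \<and> W \<inter> N = U \<and> W \<subseteq> N'}" by fast
  qed simp
  then obtain W where W: "submodule W R M" "W \<inter> N = U" "W \<subseteq> N'"
    and Wmax: "\<And>V. \<lbrakk>submodule V R M; V \<inter> N = U; V \<subseteq> N'; W \<subseteq> V\<rbrakk> \<Longrightarrow> V = W" by auto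
  have torsW: "torsion_mod R M W y" if "y \<in> N'" for y
    by (rule torsion_mod_complement[OF noeth N N'(1) U(1,3) W Wmax that])
  have "W \<noteq> U" using torsW[OF x(1)] torsion_mod_mono[OF _ U(2)] x(2) by blast
  then obtain s where s: "s \<in> W" "s \<notin> U" using W(2) by blast
  have "\<exists>V\<in>{V. submodule V R M \<and> U \<subseteq> V \<and> V \<subseteq> W \<and> s \<notin> V}.
      \<forall>K\<in>{V. submodule V R M \<and> U \<subseteq> V \<and> V \<subseteq> W \<and> s \<notin> V}. V \<subseteq> K \<longrightarrow> K = V"
  proof (rule chain_maximal_submodule)
    show "U \<in> {V. submodule V R M \<and> U \<subseteq> V \<and> V \<subseteq> W \<and> s \<notin> V}" using U W s by auto
    fix \<C> assume "\<C> \<noteq> {}" "\<C> \<subseteq> {V. submodule V R M \<and> U \<subseteq> V \<and> V \<subseteq> W \<and> s \<notin> V}" "submodule (\<Union>\<C>) R M"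
    then show "\<Union>\<C> \<in> {V. submodule V R M \<and> U \<subseteq> V \<and> V \<subseteq> W \<and> s \<notin> V}" by fast
  qed simp
  then obtain V where V: "submodule V R M" "U \<subseteq> V" "V \<subseteq> W" "s \<notin> V"
    and Vmax: "\<And>V'. \<lbrakk>submodule V' R M; U \<subseteq> V'; V' \<subseteq> W; s \<notin> V'; V \<subseteq> V'\<rbrakk> \<Longrightarrow> V' = V" by auto
  have torsV: "torsion_mod R M V y" if "y \<in> W" for y
    using Vmax V by (intro torsion_mod_avoiding[OF noeth W(1) V(1,4) _ V(3) that]) blast
  have "torsion_mod R M V y" if "y \<in> N'" for y
    using torsion_mod_trans[OF W(1) submodule_mem[OF N'(1) that] torsW[OF that] V(1) torsV] .
  moreover have "V \<inter> N = U" using V W U by blast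
  moreover have "r \<odot>\<^bsub>M\<^esub> s \<in> V"
    if r: "r \<in> carrier R" and u: "u \<in> V" and n: "n \<in> N" and eq: "r \<odot>\<^bsub>M\<^esub> s = u \<oplus>\<^bsub>M\<^esub> n" for r u n
  proof -
    have "u \<oplus>\<^bsub>M\<^esub> n \<in> W" using submoduleE(4)[OF W(1) r s(1)] eq by simp
    then have "n \<in> W"
      using submodule_add_cancel[OF W(1), of u n] u V(3) submodule_mem[OF N n] by blast
    then have "n \<in> V" using n W(2) V(2) by blast
    then show ?thesis unfolding eq using submoduleE(5)[OF V(1) u] by blast
  qed
  moreover have "V \<subseteq> N'" "s \<in> N'" using V(3) W(3) s(1) by auto
  ultimately show ?thesis using V(1,4)
    by (intro exI[of _ V] exI[of _ s] conjI ballI impI) assumption+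
qed

text \<open>
  Otherwise one builds finitely generated \<open>N\<^sub>0 \<subseteq> N\<^sub>1 \<subseteq> \<dots>\<close> and \<open>U\<^sub>k \<subseteq> N\<^sub>k\<close> with \<open>U\<^sub>k\<^sub>+\<^sub>1 \<inter> N\<^sub>k = U\<^sub>k\<close>
  such that every step contributes a new direct summand to \<open>M / \<Union>\<^sub>k U\<^sub>k\<close>.
\<close>

theorem lin_compact_minimax:
  assumes noeth: "noetherian_ring R" and lc: "lin_compact R M (carrier M)"
  shows "\<exists>X. finite X \<and> X \<subseteq> carrier M \<and> (\<forall>x\<in>carrier M. torsion_mod R M (submodule_gen R M X) x)"
proof (rule ccontr)
  assume neg: "\<nexists>X. finite X \<and> X \<subseteq> carrier M \<and> (\<forall>x\<in>carrier M. torsion_mod R M (submodule_gen R M X) x)"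
  let ?g = "submodule_gen R M"
  \<comment> \<open>A state holds generators of the current N, the submodule U, and the element
    gained in the step leading to it; in the initial state this last entry is a dummy.\<close>
  define P where "P z \<longleftrightarrow> (case z of (X, U, s) \<Rightarrow> finite X \<and> X \<subseteq> carrier M \<and> submodule U R M \<and> U \<subseteq> ?g X \<and>
      (\<forall>y\<in>?g X. torsion_mod R M U y))" for z :: "'m set \<times> 'm set \<times> 'm"
  define Q where "Q z z' \<longleftrightarrow> (case z of (X, U, s) \<Rightarrow> case z' of (X', U', s') \<Rightarrow> X \<subseteq> X' \<and> U' \<inter> ?g X = U \<and>
      s' \<in> ?g X' \<and> s' \<notin> U' \<and>
      (\<forall>r\<in>carrier R. \<forall>u\<in>U'. \<forall>n\<in>?g X. r \<odot>\<^bsub>M\<^esub> s' = u \<oplus>\<^bsub>M\<^esub> n \<longrightarrow> r \<odot>\<^bsub>M\<^esub> s' \<in> U'))"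
    for z z' :: "'m set \<times> 'm set \<times> 'm"
  have "\<exists>f. \<forall>n. P (f n) \<and> Q (f n) (f (Suc n))"
  proof (rule dependent_nat_choice)
    show "\<exists>z. P z"
      by (rule exI[of _ "({}, {\<zero>\<^bsub>M\<^esub>}, \<zero>\<^bsub>M\<^esub>)"])
        (simp add: P_def submodule_gen_empty submodule_zero_set torsion_mod_zero)
    fix z :: "'m set \<times> 'm set \<times> 'm" and n :: nat assume "P z"
    then obtain X U s where z: "z = (X, U, s)" and X: "finite X" "X \<subseteq> carrier M"
      and U: "submodule U R M" "U \<subseteq> ?g X" "\<And>y. y \<in> ?g X \<Longrightarrow> torsion_mod R M U y"
      unfolding P_def by (cases z) auto
    obtain x where x: "x \<in> carrier M" "\<not> torsion_mod R M (?g X) x" using neg X by blast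
    have sub: "insert x X \<subseteq> carrier M" using x X by simp
    have xg: "x \<in> ?g (insert x X)" by (rule subsetD[OF submodule_gen_incl]) simp
    have mono: "?g X \<subseteq> ?g (insert x X)" by (rule submodule_gen_mono) blast
    obtain U' s' where U': "submodule U' R M \<and> U' \<subseteq> ?g (insert x X) \<and> (\<forall>y\<in>?g (insert x X). torsion_mod R M U' y) \<and> U' \<inter> ?g X = U \<and>
        s' \<in> ?g (insert x X) \<and> s' \<notin> U' \<and> (\<forall>r\<in>carrier R. \<forall>u\<in>U'. \<forall>n\<in>?g X. r \<odot>\<^bsub>M\<^esub> s' = u \<oplus>\<^bsub>M\<^esub> n \<longrightarrow> r \<odot>\<^bsub>M\<^esub> s' \<in> U')"
      using torsion_extension_step[OF noeth submodule_gen_submodule[OF X(2)] submodule_gen_submodule[OF sub] mono U xg x(2)]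
      by blast
    have "P (insert x X, U', s')" unfolding P_def prod.case using U' X(1) sub by simp
    moreover have "Q z (insert x X, U', s')" unfolding Q_def z prod.case using U' by auto
    ultimately show "\<exists>w. P w \<and> Q z w" by blast
  qed
  then obtain f where f: "\<And>n. P (f n)" "\<And>n. Q (f n) (f (Suc n))" by blast
  define N where "N n = ?g (fst (f n))" for n
  define V where "V n = fst (snd (f n))" for n
  \<comment> \<open>Shifted by one: s n is the element gained in passing from N n to N (Suc
    n).\<close>
  define s where "s n = snd (snd (f (Suc n)))" for n
  have N: "submodule (N n) R M" and V: "submodule (V n) R M" and VN: "V n \<subseteq> N n" for n
    using f(1)[of n] unfolding P_def N_def V_def by (auto simp: split_beta submodule_gen_submodule)
  have N_Suc: "N n \<subseteq> N (Suc n)" and V_Suc: "V (Suc n) \<inter> N n = V n" and s: "s n \<in> N (Suc n)" "s n \<notin> V (Suc n)" for n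
    using f(2)[of n] unfolding Q_def N_def V_def s_def by (auto simp: split_beta submodule_gen_mono)
  have ind: "r \<odot>\<^bsub>M\<^esub> s n \<in> V (Suc n)"
    if "r \<in> carrier R" "u \<in> V (Suc n)" "k \<in> N n" "r \<odot>\<^bsub>M\<^esub> s n = u \<oplus>\<^bsub>M\<^esub> k" for r n u k
    using f(2)[of n] that unfolding Q_def N_def V_def s_def by (simp add: split_beta)
  have N_mono: "N n \<subseteq> N m" if "n \<le> m" for n m using lift_Suc_mono_le[of N, OF N_Suc that] .
  have V_Int: "V m \<inter> N n = V n" if "n \<le> m" for n m
    using that
  proof (induction m rule: dec_induct)
    case base
    show ?case using VN by blast
  next
    case (step m)
    have "V (Suc m) \<inter> N n = (V (Suc m) \<inter> N m) \<inter> N n" using N_mono[OF step(1)] by blast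
    then show ?case using V_Suc step by simp
  qed
  have V_mono: "V n \<subseteq> V m" if "n \<le> m" for n m using V_Int[OF that] by blast
  define U where "U = \<Union>(range V)"
  have U: "submodule U R M" unfolding U_def
  proof (rule submodule_chain_Union)
    fix H K assume "H \<in> range V" "K \<in> range V"
    then show "H \<subseteq> K \<or> K \<subseteq> H" using V_mono by (metis nat_le_linear rangeE)
  qed (use V in auto)
  \<comment> \<open>Later steps do not change the trace on N n, so neither does the union.\<close>
  have UN: "U \<inter> N n = V n" for n
  proof
    show "V n \<subseteq> U \<inter> N n" using VN unfolding U_def by blast
    show "U \<inter> N n \<subseteq> V n"
    proof
      fix x assume "x \<in> U \<inter> N n"
      then obtain m where "x \<in> V m" "x \<in> N n" unfolding U_def by blast
      then have "x \<in> V (max m n)" using V_mono[of m "max m n"] by auto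
      then show "x \<in> V n" using V_Int[of n "max m n"] \<open>x \<in> N n\<close> by auto
    qed
  qed
  have sM: "s n \<in> carrier M" for n using s(1) N submodule_mem by blast
  have sU: "s n \<notin> U" for n using s UN[of "Suc n"] by blast
  have key: "r \<odot>\<^bsub>M\<^esub> s n \<in> U" if r: "r \<in> carrier R" and mem: "r \<odot>\<^bsub>M\<^esub> s n \<in> ?g (U \<union> s ` {..<n})" for r n
  proof -
    have "?g (U \<union> s ` {..<n}) \<subseteq> {h \<oplus>\<^bsub>M\<^esub> k | h k. h \<in> U \<and> k \<in> N n}"
    proof (rule submodule_gen_least[OF submodule_sum[OF U N]], rule Un_least)
      show "U \<subseteq> {h \<oplus>\<^bsub>M\<^esub> k | h k. h \<in> U \<and> k \<in> N n}"
      proof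
        fix u assume "u \<in> U"
        moreover have "u = u \<oplus>\<^bsub>M\<^esub> \<zero>\<^bsub>M\<^esub>" using \<open>u \<in> U\<close> submodule_mem[OF U] by simp
        ultimately show "u \<in> {h \<oplus>\<^bsub>M\<^esub> k | h k. h \<in> U \<and> k \<in> N n}" using submodule_zero[OF N] by blast
      qed
      show "s ` {..<n} \<subseteq> {h \<oplus>\<^bsub>M\<^esub> k | h k. h \<in> U \<and> k \<in> N n}"
      proof
        fix x assume "x \<in> s ` {..<n}"
        then obtain i where i: "i < n" "x = s i" by auto
        then have "x \<in> N n" using s(1)[of i] N_mono[of "Suc i" n] by auto
        moreover have "x = \<zero>\<^bsub>M\<^esub> \<oplus>\<^bsub>M\<^esub> x" using i sM by simp
        ultimately show "x \<in> {h \<oplus>\<^bsub>M\<^esub> k | h k. h \<in> U \<and> k \<in> N n}" using submodule_zero[OF U] by blast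
      qed
    qed
    \<comment> \<open>In r s n = u + k the element u of U lies in N (Suc n), hence in V (Suc n),
      where the independence of s n is known.\<close>
    then obtain u k where uk: "u \<in> U" "k \<in> N n" "r \<odot>\<^bsub>M\<^esub> s n = u \<oplus>\<^bsub>M\<^esub> k" using mem by blast
    have uM: "u \<in> carrier M" using uk submodule_mem[OF U] by blast
    have kN: "k \<in> N (Suc n)" using uk(2) N_Suc by blast
    have "k \<oplus>\<^bsub>M\<^esub> u \<in> N (Suc n)"
      using submoduleE(4)[OF N r s(1)[of n]] unfolding uk(3) M.a_comm[OF uM submodule_mem[OF N kN]] .
    then have "u \<in> N (Suc n)" using submodule_add_cancel[OF N kN uM] by blast
    then have "u \<in> V (Suc n)" using uk(1) UN by blast
    then have "r \<odot>\<^bsub>M\<^esub> s n \<in> V (Suc n)" using ind[OF r _ uk(2,3)] by blast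
    then show ?thesis unfolding U_def by blast
  qed
  \<comment> \<open>No descending chain is given here; the tails are spanned by the s n themselves
    together with U.\<close>
  define T where "T n = ?g (U \<union> s ` {n..})" for n
  have sub: "U \<union> s ` A \<subseteq> carrier M" for A using sM submodule_mem[OF U] by blast
  have T: "submodule (T n) R M" "T (Suc n) \<subseteq> T n" "s n \<in> T n" for n
  proof -
    show "submodule (T n) R M" unfolding T_def by (rule submodule_gen_submodule[OF sub])
    show "T (Suc n) \<subseteq> T n" unfolding T_def by (rule submodule_gen_mono) auto
    show "s n \<in> T n" unfolding T_def by (rule subsetD[OF submodule_gen_incl]) auto
  qed
  have fin: "T n \<subseteq> (\<Union>m. ?g (U \<union> s ` {n..<m}))" for n
    unfolding T_def
  proof (rule submodule_gen_least)
    show "submodule (\<Union>m. ?g (U \<union> s ` {n..<m})) R M"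
    proof (rule submodule_chain_Union)
      fix H K assume "H \<in> range (\<lambda>m. ?g (U \<union> s ` {n..<m}))" "K \<in> range (\<lambda>m. ?g (U \<union> s ` {n..<m}))"
      then obtain i j where "H = ?g (U \<union> s ` {n..<i})" "K = ?g (U \<union> s ` {n..<j})" by auto
      moreover have "?g (U \<union> s ` {n..<i}) \<subseteq> ?g (U \<union> s ` {n..<j})" if "i \<le> j" for i j
        by (rule submodule_gen_mono) (use that in auto)
      ultimately show "H \<subseteq> K \<or> K \<subseteq> H" by (metis nat_le_linear)
    qed (use submodule_gen_submodule[OF sub] in auto)
    show "U \<union> s ` {n..} \<subseteq> (\<Union>m. ?g (U \<union> s ` {n..<m}))"
    proof
      fix x assume "x \<in> U \<union> s ` {n..}"
      then obtain m where "x \<in> U \<union> s ` {n..<m}"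
      proof
        assume "x \<in> s ` {n..}"
        then obtain i where "n \<le> i" "x = s i" by auto
        then show thesis using that[of "Suc i"] by auto
      qed auto
      then have "x \<in> ?g (U \<union> s ` {n..<m})" by (rule subsetD[OF submodule_gen_incl])
      then show "x \<in> (\<Union>m. ?g (U \<union> s ` {n..<m}))" by (rule UN_I[OF UNIV_I])
    qed
  qed
  \<comment> \<open>The last generator of the finite tail is peeled off: by \<open>key\<close> its
    contribution already lies in U, which leaves a shorter tail.\<close>
  have finite_tail: "?g (U \<union> s ` {..<n}) \<inter> ?g (U \<union> s ` {n..<m}) \<subseteq> U" for n m
  proof (cases "n \<le> m")
    case False
    then show ?thesis using submodule_gen_least[OF U, of U] by auto
  next
    case True
    then show ?thesis
    proof (induction m rule: dec_induct)
      case base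
      show ?case using submodule_gen_least[OF U, of U] by auto
    next
      case (step m)
      show ?case
      proof
        fix z assume z: "z \<in> ?g (U \<union> s ` {..<n}) \<inter> ?g (U \<union> s ` {n..<Suc m})"
        have "U \<union> s ` {n..<Suc m} = insert (s m) (U \<union> s ` {n..<m})"
          using step(1) by (simp add: atLeastLessThanSuc)
        then obtain w c where w: "w \<in> ?g (U \<union> s ` {n..<m})" "c \<in> carrier R" "z = w \<oplus>\<^bsub>M\<^esub> c \<odot>\<^bsub>M\<^esub> s m"
          using z submodule_gen_insert[OF sub sM[of m]] by auto
        have sp: "submodule (?g (U \<union> s ` {..<m})) R M" by (rule submodule_gen_submodule[OF sub])
        have "?g (U \<union> s ` {n..<m}) \<subseteq> ?g (U \<union> s ` {..<m})" by (rule submodule_gen_mono) auto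
        moreover have "?g (U \<union> s ` {..<n}) \<subseteq> ?g (U \<union> s ` {..<m})"
          by (rule submodule_gen_mono) (use step(1) in auto)
        ultimately have "w \<in> ?g (U \<union> s ` {..<m})" "z \<in> ?g (U \<union> s ` {..<m})" using w z by auto
        then have "c \<odot>\<^bsub>M\<^esub> s m \<in> ?g (U \<union> s ` {..<m})"
          using submodule_add_cancel[OF sp, of w] w sM[of m] by simp
        then have cU: "c \<odot>\<^bsub>M\<^esub> s m \<in> U" using key w by blast
        have spn: "submodule (?g (U \<union> s ` {..<n})) R M" by (rule submodule_gen_submodule[OF sub])
        have "U \<subseteq> ?g (U \<union> s ` {..<n})" using submodule_gen_incl[of "U \<union> s ` {..<n}"] by simp
        then have "w \<in> ?g (U \<union> s ` {..<n})"
          using submodule_add_cancel[OF spn, of "c \<odot>\<^bsub>M\<^esub> s m" w] cU z w submodule_mem[OF sp \<open>w \<in> ?g (U \<union> s ` {..<m})\<close>] sM[of m]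
          by (auto simp: M.a_comm)
        then have "w \<in> U" using step.IH w by blast
        then show "z \<in> U" using cU w submoduleE(5)[OF U] by simp
      qed
    qed
  qed
  have "?g (U \<union> s ` {..<n}) \<inter> T n \<subseteq> U" for n using fin[of n] finite_tail[of n] by blast
  then show False
    by (intro lin_compact_no_infinite_sum[where T = T and s = s, OF lc U T sU])
qed


section \<open>Ideal multiples of a submodule and Nakayama's lemma\<close>

lemma smult_commute:
  "\<lbrakk>r \<in> carrier R; s \<in> carrier R; x \<in> carrier M\<rbrakk> \<Longrightarrow> r \<odot>\<^bsub>M\<^esub> (s \<odot>\<^bsub>M\<^esub> x) = s \<odot>\<^bsub>M\<^esub> (r \<odot>\<^bsub>M\<^esub> x)"
  by (metis smult_assoc1 R.m_comm)

definition ideal_smult :: "'r set \<Rightarrow> 'm set \<Rightarrow> 'm set" where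
  "ideal_smult I N = submodule_gen R M {c \<odot>\<^bsub>M\<^esub> x | c x. c \<in> I \<and> x \<in> N}"

lemma ideal_smult_submodule:
  assumes "ideal I R" "N \<subseteq> carrier M"
  shows "submodule (ideal_smult I N) R M"
  unfolding ideal_smult_def using assms(2) ideal.Icarr[OF assms(1)]
  by (intro submodule_gen_submodule) auto

lemma ideal_smult_mem: "c \<in> I \<Longrightarrow> x \<in> N \<Longrightarrow> c \<odot>\<^bsub>M\<^esub> x \<in> ideal_smult I N"
  unfolding ideal_smult_def by (rule subsetD[OF submodule_gen_incl]) blast

lemma ideal_smult_least:
  assumes "submodule K R M" "\<And>c x. \<lbrakk>c \<in> I; x \<in> N\<rbrakk> \<Longrightarrow> c \<odot>\<^bsub>M\<^esub> x \<in> K"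
  shows "ideal_smult I N \<subseteq> K"
  unfolding ideal_smult_def by (rule submodule_gen_least[OF assms(1)]) (use assms(2) in auto)

text \<open>The coefficient of the last generator can be kept inside I, because the sums with such
  coefficients form a submodule. Elimination in Nakayama's lemma depends on this control.\<close>

lemma ideal_smult_insert:
  assumes I: "ideal I R" and X: "X \<subseteq> carrier M" and y: "y \<in> carrier M"
  shows "ideal_smult I (submodule_gen R M (insert y X)) \<subseteq>
    {u \<oplus>\<^bsub>M\<^esub> c \<odot>\<^bsub>M\<^esub> y | u c. u \<in> ideal_smult I (submodule_gen R M X) \<and> c \<in> I}" (is "_ \<subseteq> ?S")
proof (rule ideal_smult_least)
  interpret I: ideal I R by (rule I)
  let ?N = "submodule_gen R M X"
  have N: "submodule ?N R M" using X by (rule submodule_gen_submodule)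
  have NM: "?N \<subseteq> carrier M" using submodule_mem[OF N] by blast
  have IN: "submodule (ideal_smult I ?N) R M" by (rule ideal_smult_submodule[OF I NM])
  show "submodule ?S R M"
  proof (rule submoduleI')
    show "?S \<subseteq> carrier M" using submodule_mem[OF IN] y I.Icarr by auto
    have "\<zero>\<^bsub>M\<^esub> = \<zero>\<^bsub>M\<^esub> \<oplus>\<^bsub>M\<^esub> \<zero> \<odot>\<^bsub>M\<^esub> y" using y by simp
    then show "\<zero>\<^bsub>M\<^esub> \<in> ?S" using submodule_zero[OF IN] I.zero_closed by blast
    fix a b r assume "a \<in> ?S" "b \<in> ?S" and r: "r \<in> carrier R"
    then obtain u c v d where a: "a = u \<oplus>\<^bsub>M\<^esub> c \<odot>\<^bsub>M\<^esub> y" "u \<in> ideal_smult I ?N" "c \<in> I"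
      and b: "b = v \<oplus>\<^bsub>M\<^esub> d \<odot>\<^bsub>M\<^esub> y" "v \<in> ideal_smult I ?N" "d \<in> I" by blast
    have "a \<oplus>\<^bsub>M\<^esub> r \<odot>\<^bsub>M\<^esub> b = (u \<oplus>\<^bsub>M\<^esub> r \<odot>\<^bsub>M\<^esub> v) \<oplus>\<^bsub>M\<^esub> (c \<oplus> r \<otimes> d) \<odot>\<^bsub>M\<^esub> y"
      using a b r y submodule_mem[OF IN] I.Icarr
      by (simp add: smult_l_distr smult_r_distr smult_assoc1 M.a_ac)
    moreover have "u \<oplus>\<^bsub>M\<^esub> r \<odot>\<^bsub>M\<^esub> v \<in> ideal_smult I ?N" using submodule_lin[OF IN] a b r by blast
    moreover have "c \<oplus> r \<otimes> d \<in> I" using a b r I.I_l_closed I.a_closed by blast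
    ultimately show "a \<oplus>\<^bsub>M\<^esub> r \<odot>\<^bsub>M\<^esub> b \<in> ?S" by blast
  qed
  fix c x assume c: "c \<in> I" and "x \<in> submodule_gen R M (insert y X)"
  then obtain n d where n: "n \<in> ?N" "d \<in> carrier R" "x = n \<oplus>\<^bsub>M\<^esub> d \<odot>\<^bsub>M\<^esub> y"
    using submodule_gen_insert[OF X y] by auto
  have "c \<odot>\<^bsub>M\<^esub> x = c \<odot>\<^bsub>M\<^esub> n \<oplus>\<^bsub>M\<^esub> (c \<otimes> d) \<odot>\<^bsub>M\<^esub> y"
    using n c y NM I.Icarr by (simp add: smult_r_distr smult_assoc1 subset_iff)
  then show "c \<odot>\<^bsub>M\<^esub> x \<in> ?S" using ideal_smult_mem[OF c n(1)] I.I_r_closed[OF c n(2)] by blast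
qed

text \<open>
  A form of Nakayama's lemma: \<open>e\<close> is a power of \<open>c\<close> modulo \<open>I\<close>. Eliminating one generator replaces
  \<open>c\<close> by \<open>c\<^sup>2\<close>.
\<close>

lemma nakayama_annihilator:
  assumes I: "ideal I R"
    and X: "finite X" "X \<subseteq> carrier M" and c: "c \<in> carrier R"
    and cX: "\<And>x. x \<in> X \<Longrightarrow> c \<odot>\<^bsub>M\<^esub> x \<in> ideal_smult I (submodule_gen R M X)"
  shows "\<exists>e\<in>carrier R. (\<forall>x\<in>X. e \<odot>\<^bsub>M\<^esub> x = \<zero>\<^bsub>M\<^esub>) \<and> (\<forall>p. primeideal p R \<and> I \<subseteq> p \<and> c \<notin> p \<longrightarrow> e \<notin> p)"
  using X c cX
proof (induction X arbitrary: c rule: finite_induct)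
  case empty
  then show ?case by (intro bexI[of _ c]) auto
next
  case (insert y X)
  interpret I: ideal I R by (rule I)
  let ?N = "submodule_gen R M X"
  have X: "X \<subseteq> carrier M" and y: "y \<in> carrier M" and c: "c \<in> carrier R" using insert.prems by auto
  have N: "submodule ?N R M" using X by (rule submodule_gen_submodule)
  have NM: "?N \<subseteq> carrier M" using submodule_mem[OF N] by blast
  have IN: "submodule (ideal_smult I ?N) R M" by (rule ideal_smult_submodule[OF I NM])
  have dec: "\<exists>u a. u \<in> ideal_smult I ?N \<and> a \<in> I \<and> c \<odot>\<^bsub>M\<^esub> x = u \<oplus>\<^bsub>M\<^esub> a \<odot>\<^bsub>M\<^esub> y" if "x \<in> insert y X" for x
    using subsetD[OF ideal_smult_insert[OF I X y] insert.prems(3)[OF that]] by blast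
  obtain u a where u: "u \<in> ideal_smult I ?N" "a \<in> I" "c \<odot>\<^bsub>M\<^esub> y = u \<oplus>\<^bsub>M\<^esub> a \<odot>\<^bsub>M\<^esub> y"
    using dec[of y] by blast
  have uM: "u \<in> carrier M" and aR: "a \<in> carrier R" using u submodule_mem[OF IN] I.Icarr by auto
  \<comment> \<open>Multiply c x = v + b y by c, replace c y by u + a y, and then b y by c x - v.
    The generator y disappears and every remaining term lies in the I-multiple of the smaller
    span.\<close>
  have "(c \<otimes> c) \<odot>\<^bsub>M\<^esub> x \<in> ideal_smult I ?N" if x: "x \<in> X" for x
  proof -
    obtain v b where v: "v \<in> ideal_smult I ?N" "b \<in> I" "c \<odot>\<^bsub>M\<^esub> x = v \<oplus>\<^bsub>M\<^esub> b \<odot>\<^bsub>M\<^esub> y"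
      using dec[of x] x by blast
    have vM: "v \<in> carrier M" and bR: "b \<in> carrier R" and xM: "x \<in> carrier M"
      using v submodule_mem[OF IN] I.Icarr X x by auto
    have "(c \<otimes> c) \<odot>\<^bsub>M\<^esub> x = c \<odot>\<^bsub>M\<^esub> v \<oplus>\<^bsub>M\<^esub> b \<odot>\<^bsub>M\<^esub> (c \<odot>\<^bsub>M\<^esub> y)"
      using c xM vM bR y v(3)
      by (simp add: smult_assoc1 smult_r_distr) (simp add: smult_assoc1[symmetric] R.m_comm)
    also have "\<dots> = c \<odot>\<^bsub>M\<^esub> v \<oplus>\<^bsub>M\<^esub> (b \<odot>\<^bsub>M\<^esub> u \<oplus>\<^bsub>M\<^esub> a \<odot>\<^bsub>M\<^esub> (b \<odot>\<^bsub>M\<^esub> y))"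
      unfolding u(3) using uM aR bR y
      by (simp add: smult_r_distr smult_assoc1[symmetric] R.m_comm)
    also have "b \<odot>\<^bsub>M\<^esub> y = c \<odot>\<^bsub>M\<^esub> x \<ominus>\<^bsub>M\<^esub> v"
      unfolding v(3) using vM bR y by (simp add: M.minus_eq M.a_comm[of v] M.a_assoc M.r_neg)
    finally have "(c \<otimes> c) \<odot>\<^bsub>M\<^esub> x =
      c \<odot>\<^bsub>M\<^esub> v \<oplus>\<^bsub>M\<^esub> (b \<odot>\<^bsub>M\<^esub> u \<oplus>\<^bsub>M\<^esub> ((a \<otimes> c) \<odot>\<^bsub>M\<^esub> x \<ominus>\<^bsub>M\<^esub> a \<odot>\<^bsub>M\<^esub> v))"
      using aR c xM vM by (simp add: M.minus_eq smult_r_distr smult_r_minus smult_assoc1)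
    moreover have "(a \<otimes> c) \<odot>\<^bsub>M\<^esub> x \<in> ideal_smult I ?N"
      using I.I_r_closed[OF u(2) c] x submodule_gen_incl[of X] by (intro ideal_smult_mem) auto
    ultimately show ?thesis
      using submoduleE(4,5)[OF IN] submodule_diff[OF IN] u v c aR bR by simp
  qed
  then obtain e where e: "e \<in> carrier R" "\<And>x. x \<in> X \<Longrightarrow> e \<odot>\<^bsub>M\<^esub> x = \<zero>\<^bsub>M\<^esub>"
    "\<And>p. \<lbrakk>primeideal p R; I \<subseteq> p; c \<otimes> c \<notin> p\<rbrakk> \<Longrightarrow> e \<notin> p"
    using insert.IH[OF X, of "c \<otimes> c"] c by blast
  have ann: "submodule {x \<in> carrier M. e \<odot>\<^bsub>M\<^esub> x = \<zero>\<^bsub>M\<^esub>} R M"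
  proof (rule submoduleI')
    fix x z r assume "x \<in> {x \<in> carrier M. e \<odot>\<^bsub>M\<^esub> x = \<zero>\<^bsub>M\<^esub>}" "z \<in> {x \<in> carrier M. e \<odot>\<^bsub>M\<^esub> x = \<zero>\<^bsub>M\<^esub>}" "r \<in> carrier R"
    moreover from this have "e \<odot>\<^bsub>M\<^esub> (r \<odot>\<^bsub>M\<^esub> z) = r \<odot>\<^bsub>M\<^esub> (e \<odot>\<^bsub>M\<^esub> z)"
      using e(1) smult_commute by blast
    ultimately show "x \<oplus>\<^bsub>M\<^esub> r \<odot>\<^bsub>M\<^esub> z \<in> {x \<in> carrier M. e \<odot>\<^bsub>M\<^esub> x = \<zero>\<^bsub>M\<^esub>}"
      using e(1) by (simp add: smult_r_distr)
  qed (use e in auto)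
  have "?N \<subseteq> {x \<in> carrier M. e \<odot>\<^bsub>M\<^esub> x = \<zero>\<^bsub>M\<^esub>}" by (rule submodule_gen_least[OF ann]) (use e X in auto)
  moreover have "ideal_smult I ?N \<subseteq> ?N"
    by (rule ideal_smult_least[OF N]) (use submoduleE(4)[OF N] I.Icarr in blast)
  ultimately have eu: "e \<odot>\<^bsub>M\<^esub> u = \<zero>\<^bsub>M\<^esub>" using u by blast
  \<comment> \<open>Since e u = 0, the product e(c - a) kills y. The factor c - a agrees with c
    modulo I and so avoids the same primes above I.\<close>
  have dy: "(c \<ominus> a) \<odot>\<^bsub>M\<^esub> y = u"
    using c aR y u(3) uM
    by (simp add: R.minus_eq smult_l_distr smult_l_minus M.a_assoc M.r_neg)
  show ?case
  proof (intro bexI[of _ "e \<otimes> (c \<ominus> a)"] conjI ballI allI impI)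
    fix x assume x: "x \<in> insert y X"
    show "(e \<otimes> (c \<ominus> a)) \<odot>\<^bsub>M\<^esub> x = \<zero>\<^bsub>M\<^esub>"
    proof (cases "x = y")
      case True
      then show ?thesis using dy eu e(1) c aR y by (simp add: smult_assoc1)
    next
      case False
      then have "x \<in> X" "x \<in> carrier M" using x X by auto
      then show ?thesis using e c aR by (simp add: R.m_comm[of e] smult_assoc1)
    qed
  next
    fix p assume p: "primeideal p R \<and> I \<subseteq> p \<and> c \<notin> p"
    interpret p: primeideal p R using p by simp
    have "c \<otimes> c \<notin> p" using p c p.I_prime by blast
    then have "e \<notin> p" using e(3) p by blast
    moreover have "c \<ominus> a \<notin> p"
    proof
      assume "c \<ominus> a \<in> p"
      moreover have "a \<in> p" using u p by blast
      moreover have "c = (c \<ominus> a) \<oplus> a" using c aR by (simp add: R.minus_eq R.a_assoc R.l_neg)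
      ultimately have "c \<in> p" using p.a_closed by metis
      then show False using p by blast
    qed
    ultimately show "e \<otimes> (c \<ominus> a) \<notin> p" using p.I_prime e(1) c aR by blast
  qed (use e c aR in auto)
qed

text \<open>The set is the preimage in M of K localised at p; for sums the two multipliers are
  multiplied.\<close>

lemma submodule_saturation:
  assumes p: "primeideal p R" and K: "submodule K R M"
  shows "submodule {z \<in> carrier M. \<exists>v\<in>carrier R - p. v \<odot>\<^bsub>M\<^esub> z \<in> K} R M"
proof (rule submoduleI')
  interpret p: primeideal p R by (rule p)
  have "\<one> \<odot>\<^bsub>M\<^esub> \<zero>\<^bsub>M\<^esub> \<in> K" using submodule_zero[OF K] by simp
  then show "\<zero>\<^bsub>M\<^esub> \<in> {z \<in> carrier M. \<exists>v\<in>carrier R - p. v \<odot>\<^bsub>M\<^esub> z \<in> K}" using p.one_notin by blast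
  fix x y r assume "x \<in> {z \<in> carrier M. \<exists>v\<in>carrier R - p. v \<odot>\<^bsub>M\<^esub> z \<in> K}"
    "y \<in> {z \<in> carrier M. \<exists>v\<in>carrier R - p. v \<odot>\<^bsub>M\<^esub> z \<in> K}" and r: "r \<in> carrier R"
  then obtain v w where v: "v \<in> carrier R - p" "v \<odot>\<^bsub>M\<^esub> x \<in> K" "x \<in> carrier M"
    and w: "w \<in> carrier R - p" "w \<odot>\<^bsub>M\<^esub> y \<in> K" "y \<in> carrier M" by auto
  have "(v \<otimes> w) \<odot>\<^bsub>M\<^esub> (x \<oplus>\<^bsub>M\<^esub> r \<odot>\<^bsub>M\<^esub> y) = w \<odot>\<^bsub>M\<^esub> (v \<odot>\<^bsub>M\<^esub> x) \<oplus>\<^bsub>M\<^esub> (v \<otimes> r) \<odot>\<^bsub>M\<^esub> (w \<odot>\<^bsub>M\<^esub> y)"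
    using v w r by (simp add: smult_r_distr smult_assoc1[symmetric] R.m_ac)
  also have "\<dots> \<in> K"
    using v(1) w(1) r submodule_lin[OF K submoduleE(4)[OF K _ v(2)] w(2)] by auto
  finally have "(v \<otimes> w) \<odot>\<^bsub>M\<^esub> (x \<oplus>\<^bsub>M\<^esub> r \<odot>\<^bsub>M\<^esub> y) \<in> K" .
  moreover have "v \<otimes> w \<in> carrier R - p" using v w p.I_prime by blast
  ultimately show "x \<oplus>\<^bsub>M\<^esub> r \<odot>\<^bsub>M\<^esub> y \<in> {z \<in> carrier M. \<exists>v\<in>carrier R - p. v \<odot>\<^bsub>M\<^esub> z \<in> K}"
    using v w r by auto
qed auto

lemma submodule_ideal_image:
  assumes I: "ideal I R" and x: "x \<in> carrier M"
  shows "submodule ((\<lambda>s. s \<odot>\<^bsub>M\<^esub> x) ` I) R M"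
proof (rule submoduleI')
  interpret I: ideal I R by (rule I)
  show "(\<lambda>s. s \<odot>\<^bsub>M\<^esub> x) ` I \<subseteq> carrier M" using x I.Icarr by auto
  show "\<zero>\<^bsub>M\<^esub> \<in> (\<lambda>s. s \<odot>\<^bsub>M\<^esub> x) ` I" using x I.zero_closed by (intro image_eqI[of _ _ \<zero>]) auto
  fix a b r assume "a \<in> (\<lambda>s. s \<odot>\<^bsub>M\<^esub> x) ` I" "b \<in> (\<lambda>s. s \<odot>\<^bsub>M\<^esub> x) ` I" and r: "r \<in> carrier R"
  then obtain s t where "s \<in> I" "t \<in> I" "a = s \<odot>\<^bsub>M\<^esub> x" "b = t \<odot>\<^bsub>M\<^esub> x" by auto
  then show "a \<oplus>\<^bsub>M\<^esub> r \<odot>\<^bsub>M\<^esub> b \<in> (\<lambda>s. s \<odot>\<^bsub>M\<^esub> x) ` I"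
    using x r I.Icarr I.I_l_closed I.a_closed
    by (intro image_eqI[of _ _ "s \<oplus> r \<otimes> t"]) (auto simp: smult_l_distr smult_assoc1)
qed

text \<open>If p contains the annihilator of x, then R/p is a quotient of Rx, hence an artinian
  domain, hence a field. The descending chain comes from the powers of an element c outside
  p.\<close>

lemma artinian_imp_torsion:
  assumes art: "artinian_module R M" and x: "x \<in> carrier M"
  shows "torsion_mod R M {\<zero>\<^bsub>M\<^esub>} x"
  unfolding torsion_mod_def
proof (intro allI impI)
  fix p assume p: "primeideal p R \<and> colon R M {\<zero>\<^bsub>M\<^esub>} x \<subseteq> p"
  interpret p: primeideal p R using p by simp
  have unit: "\<exists>r\<in>carrier R. \<one> \<ominus> r \<otimes> c \<in> p" if c: "c \<in> carrier R" "c \<notin> p" for c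
  proof -
    \<comment> \<open>Adding p to the ideal of each power of c imitates the chain of these powers in
      R/p without forming the quotient.\<close>
    define J where "J n = p <+>\<^bsub>R\<^esub> PIdl (c [^] n)" for n :: nat
    have J: "ideal (J n) R" for n unfolding J_def using c
      by (intro R.add_ideals p.is_ideal R.cgenideal_ideal) auto
    have "PIdl (c [^] Suc n) \<subseteq> PIdl (c [^] n)" for n :: nat
      using c ideal.I_r_closed[OF R.cgenideal_ideal R.cgenideal_self, of "c [^] n" c]
      by (intro R.cgenideal_minimal R.cgenideal_ideal) auto
    then have "J (Suc n) \<subseteq> J n" for n unfolding J_def set_add_def' by blast
    then have "(\<lambda>s. s \<odot>\<^bsub>M\<^esub> x) ` J (Suc n) \<subseteq> (\<lambda>s. s \<odot>\<^bsub>M\<^esub> x) ` J n" for n by (rule image_mono)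
    then obtain k where k: "\<forall>n\<ge>k. (\<lambda>s. s \<odot>\<^bsub>M\<^esub> x) ` J n = (\<lambda>s. s \<odot>\<^bsub>M\<^esub> x) ` J k"
      using art submodule_ideal_image[OF J x] unfolding artinian_module_def
      by (elim conjE allE[of _ "\<lambda>n. (\<lambda>s. s \<odot>\<^bsub>M\<^esub> x) ` J n"]) auto
    have "(\<lambda>s. s \<odot>\<^bsub>M\<^esub> x) ` J (Suc k) = (\<lambda>s. s \<odot>\<^bsub>M\<^esub> x) ` J k" by (rule k[rule_format]) simp
    moreover have "c [^] k \<in> J k"
    proof -
      have "c [^] k = \<zero> \<oplus> c [^] k" using c by simp
      then show ?thesis unfolding J_def set_add_def' using p.zero_closed R.cgenideal_self[of "c [^] k"] c by blast
    qed
    then have "c [^] k \<odot>\<^bsub>M\<^esub> x \<in> (\<lambda>s. s \<odot>\<^bsub>M\<^esub> x) ` J k" by (rule imageI)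
    ultimately have "c [^] k \<odot>\<^bsub>M\<^esub> x \<in> (\<lambda>s. s \<odot>\<^bsub>M\<^esub> x) ` J (Suc k)" by (rule ssubst)
    then obtain s where s: "s \<in> J (Suc k)" "c [^] k \<odot>\<^bsub>M\<^esub> x = s \<odot>\<^bsub>M\<^esub> x" by (rule imageE)
    then obtain q r where q: "q \<in> p" "r \<in> carrier R" "s = q \<oplus> r \<otimes> c [^] Suc k"
      unfolding J_def set_add_def' cgenideal_def by auto
    have qR: "q \<in> carrier R" using q(1) by (rule p.Icarr)
    then have sR: "s \<in> carrier R" using q c by simp
    have "(c [^] k \<ominus> s) \<odot>\<^bsub>M\<^esub> x = \<zero>\<^bsub>M\<^esub>"
      using s(2) sR c x by (simp add: R.minus_eq smult_l_distr smult_l_minus M.r_neg)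
    then have "c [^] k \<ominus> s \<in> p" using p sR c unfolding colon_def by auto
    then have "(c [^] k \<ominus> s) \<oplus> q \<in> p" using q p.a_closed by blast
    moreover have "(c [^] k \<ominus> s) \<oplus> q = c [^] k \<otimes> (\<one> \<ominus> r \<otimes> c)"
      unfolding q(3) using c qR q(2)
      by (simp add: R.minus_eq R.minus_add R.r_distr R.r_minus R.a_ac R.r_neg1 R.r_neg2 R.m_ac)
    ultimately have "c [^] k \<otimes> (\<one> \<ominus> r \<otimes> c) \<in> p" by simp
    moreover have "c [^] k \<notin> p" for k :: nat
    proof (induction k)
      case 0
      show ?case using p.one_notin by simp
    next
      case (Suc k)
      then show ?case using c p.I_prime[of "c [^] k" c] by auto
    qed
    ultimately show ?thesis using p.I_prime[of "c [^] k" "\<one> \<ominus> r \<otimes> c"] c q(2) by auto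
  qed
  show "maximalideal p R"
  proof (rule maximalidealI)
    fix L assume L: "ideal L R" "p \<subseteq> L" "L \<subseteq> carrier R"
    interpret L: ideal L R by (rule L(1))
    show "L = p \<or> L = carrier R"
    proof (cases "L = p")
      case False
      then obtain c where c: "c \<in> L" "c \<notin> p" using L(2) by blast
      then obtain r where r: "r \<in> carrier R" "\<one> \<ominus> r \<otimes> c \<in> p" using unit L(3) by blast
      have "\<one> = (\<one> \<ominus> r \<otimes> c) \<oplus> r \<otimes> c" using c r L(3) by (simp add: R.minus_eq R.a_assoc R.l_neg subset_iff)
      moreover have "r \<otimes> c \<in> L" "\<one> \<ominus> r \<otimes> c \<in> L" using r c L(2) L.I_l_closed by auto
      ultimately show ?thesis using L.a_closed L.one_imp_carrier by metis
    qed simp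
  qed (use p.is_ideal p.I_notcarr in auto)
qed

end

text \<open>The last condition says that R/(\<aa> + Ann N) is supported at maximal ideals. Only Ann
  N is recorded, not finite generation, so that N \<inter> H can serve for a submodule H.\<close>

definition coartinian_witness :: "('r, 'x) ring_scheme \<Rightarrow> 'r set \<Rightarrow> ('r, 'm) module \<Rightarrow> 'm set \<Rightarrow> bool" where
  "coartinian_witness R \<aa> M N \<longleftrightarrow> submodule N R M \<and> (\<forall>x\<in>carrier M. torsion_mod R M N x) \<and>
     (\<forall>p. primeideal p R \<and> \<aa> \<subseteq> p \<and> {r \<in> carrier R. \<forall>x\<in>N. r \<odot>\<^bsub>M\<^esub> x = \<zero>\<^bsub>M\<^esub>} \<subseteq> p \<longrightarrow> maximalideal p R)"

text \<open>
  For linearly compact modules this is equivalent to the finiteness conditions on all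
  \<open>Tor\<^sub>i(R/\<aa>, M)\<close>, and it is visibly inherited by submodules.
\<close>

definition quasi_coartinian :: "('r, 'x) ring_scheme \<Rightarrow> 'r set \<Rightarrow> ('r, 'm) module \<Rightarrow> bool" where
  "quasi_coartinian R \<aa> M \<longleftrightarrow> (\<exists>N. coartinian_witness R \<aa> M N)"

lemma coartinian_witnessD:
  assumes "coartinian_witness R \<aa> M N"
  shows "submodule N R M" and "x \<in> carrier M \<Longrightarrow> torsion_mod R M N x"
    and "\<lbrakk>primeideal p R; \<aa> \<subseteq> p; \<not> maximalideal p R\<rbrakk> \<Longrightarrow> \<exists>r\<in>carrier R - p. \<forall>x\<in>N. r \<odot>\<^bsub>M\<^esub> x = \<zero>\<^bsub>M\<^esub>"
  using assms unfolding coartinian_witness_def by (blast, blast, blast)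

context rmodule
begin

lemma diff_eq_zero_iff:
  assumes a: "a \<in> carrier M" and b: "b \<in> carrier M"
  shows "a \<ominus>\<^bsub>M\<^esub> b = \<zero>\<^bsub>M\<^esub> \<longleftrightarrow> a = b"
proof
  have "a = (a \<ominus>\<^bsub>M\<^esub> b) \<oplus>\<^bsub>M\<^esub> b" using a b by (simp add: M.minus_eq M.a_assoc M.l_neg)
  then show "a = b" if "a \<ominus>\<^bsub>M\<^esub> b = \<zero>\<^bsub>M\<^esub>" using that b by simp
qed (use a in \<open>simp add: M.minus_eq M.r_neg\<close>)

text \<open>Localised at a nonmaximal prime p above \<aa>, the two torsion conditions read N = M and
  M = \<aa>M, so N = \<aa>N there. Nakayama then supplies an annihilator of N outside p.\<close>

lemma lin_compact_quasi_coartinian: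
  assumes noeth: "noetherian_ring R" and lc: "lin_compact R M (carrier M)" and I: "ideal \<aa> R"
    and tors: "\<And>x. x \<in> carrier M \<Longrightarrow> torsion_mod R M (ideal_smult \<aa> (carrier M)) x"
  shows "quasi_coartinian R \<aa> M"
proof -
  obtain X where X: "finite X" "X \<subseteq> carrier M"
    and XT: "\<And>x. x \<in> carrier M \<Longrightarrow> torsion_mod R M (submodule_gen R M X) x"
    using lin_compact_minimax[OF noeth lc] by blast
  let ?N = "submodule_gen R M X"
  have N: "submodule ?N R M" using X(2) by (rule submodule_gen_submodule)
  have NM: "?N \<subseteq> carrier M" using submodule_mem[OF N] by blast
  have IN: "submodule (ideal_smult \<aa> ?N) R M" by (rule ideal_smult_submodule[OF I NM])
  have "maximalideal p R"
    if h: "primeideal p R" "\<aa> \<subseteq> p" "{r \<in> carrier R. \<forall>x\<in>?N. r \<odot>\<^bsub>M\<^esub> x = \<zero>\<^bsub>M\<^esub>} \<subseteq> p" for p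
  proof (rule ccontr)
    assume nm: "\<not> maximalideal p R"
    interpret p: primeideal p R by (rule h(1))
    let ?S = "{z \<in> carrier M. \<exists>v\<in>carrier R - p. v \<odot>\<^bsub>M\<^esub> z \<in> ideal_smult \<aa> ?N}"
    have S: "submodule ?S R M" by (rule submodule_saturation[OF h(1) IN])
    \<comment> \<open>\<aa>M and \<aa>N agree at p, because every x in M has a multiple v x in N
      with v outside p.\<close>
    have aS: "ideal_smult \<aa> (carrier M) \<subseteq> ?S"
    proof (rule ideal_smult_least[OF S])
      fix a x assume a: "a \<in> \<aa>" and x: "x \<in> carrier M"
      have aR: "a \<in> carrier R" using a ideal.Icarr[OF I] by blast
      obtain v where v: "v \<in> carrier R - p" "v \<odot>\<^bsub>M\<^esub> x \<in> ?N" using torsion_mod_witness[OF XT[OF x] h(1) nm] by blast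
      have "v \<odot>\<^bsub>M\<^esub> (a \<odot>\<^bsub>M\<^esub> x) = a \<odot>\<^bsub>M\<^esub> (v \<odot>\<^bsub>M\<^esub> x)" using v aR x by (intro smult_commute) auto
      also have "\<dots> \<in> ideal_smult \<aa> ?N" by (rule ideal_smult_mem[OF a v(2)])
      finally show "a \<odot>\<^bsub>M\<^esub> x \<in> ?S" using v(1) aR x by blast
    qed
    have single: "\<exists>w\<in>carrier R - p. w \<odot>\<^bsub>M\<^esub> x \<in> ideal_smult \<aa> ?N" if x: "x \<in> X" for x
    proof -
      have xM: "x \<in> carrier M" using x X by blast
      obtain u where u: "u \<in> carrier R - p" "u \<odot>\<^bsub>M\<^esub> x \<in> ideal_smult \<aa> (carrier M)"
        using torsion_mod_witness[OF tors[OF xM] h(1) nm] by blast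
      then obtain v where v: "v \<in> carrier R - p" "v \<odot>\<^bsub>M\<^esub> (u \<odot>\<^bsub>M\<^esub> x) \<in> ideal_smult \<aa> ?N" using aS by blast
      have "(v \<otimes> u) \<odot>\<^bsub>M\<^esub> x \<in> ideal_smult \<aa> ?N" using u v xM by (simp add: smult_assoc1)
      moreover have "v \<otimes> u \<in> carrier R - p" using u v p.I_prime by blast
      ultimately show ?thesis by blast
    qed
    \<comment> \<open>Finite generation of N is used here: the multipliers of the generators are
      multiplied into a single c outside p.\<close>
    have "\<exists>c\<in>carrier R - p. \<forall>x\<in>Y. c \<odot>\<^bsub>M\<^esub> x \<in> ideal_smult \<aa> ?N" if "finite Y" "Y \<subseteq> X" for Y
      using that
    proof (induction Y rule: finite_induct)
      case empty
      show ?case using p.one_notin by (intro bexI[of _ \<one>]) auto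
    next
      case (insert y Y)
      then obtain c where c: "c \<in> carrier R - p" "\<And>x. x \<in> Y \<Longrightarrow> c \<odot>\<^bsub>M\<^esub> x \<in> ideal_smult \<aa> ?N" by auto
      obtain w where w: "w \<in> carrier R - p" "w \<odot>\<^bsub>M\<^esub> y \<in> ideal_smult \<aa> ?N" using single insert.prems by blast
      have yM: "insert y Y \<subseteq> carrier M" using insert.prems X by blast
      show ?case
      proof (intro bexI ballI)
        show "c \<otimes> w \<in> carrier R - p" using c w p.I_prime by blast
        fix x assume x: "x \<in> insert y Y"
        then have xM: "x \<in> carrier M" using yM by blast
        show "(c \<otimes> w) \<odot>\<^bsub>M\<^esub> x \<in> ideal_smult \<aa> ?N"
        proof (cases "x = y")
          case True
          then show ?thesis using c w xM submoduleE(4)[OF IN, of c "w \<odot>\<^bsub>M\<^esub> y"] by (simp add: smult_assoc1)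
        next
          case False
          then have "c \<odot>\<^bsub>M\<^esub> x \<in> ideal_smult \<aa> ?N" using c x by blast
          then have "w \<odot>\<^bsub>M\<^esub> (c \<odot>\<^bsub>M\<^esub> x) \<in> ideal_smult \<aa> ?N" using submoduleE(4)[OF IN] w by blast
          then show ?thesis using c w xM by (simp add: smult_assoc1 smult_commute[of w c x])
        qed
      qed
    qed
    from this[OF X(1)] obtain c where c: "c \<in> carrier R" "c \<notin> p" "\<And>x. x \<in> X \<Longrightarrow> c \<odot>\<^bsub>M\<^esub> x \<in> ideal_smult \<aa> ?N" by blast
    obtain e where e: "e \<in> carrier R" "\<forall>x\<in>X. e \<odot>\<^bsub>M\<^esub> x = \<zero>\<^bsub>M\<^esub>" "e \<notin> p"
      using nakayama_annihilator[OF I X c(1,3)] c(2) h by blast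
    have "submodule {x \<in> carrier M. e \<odot>\<^bsub>M\<^esub> x = \<zero>\<^bsub>M\<^esub>} R M"
    proof (rule submoduleI')
      fix x z r assume "x \<in> {x \<in> carrier M. e \<odot>\<^bsub>M\<^esub> x = \<zero>\<^bsub>M\<^esub>}" "z \<in> {x \<in> carrier M. e \<odot>\<^bsub>M\<^esub> x = \<zero>\<^bsub>M\<^esub>}" "r \<in> carrier R"
      moreover from this have "e \<odot>\<^bsub>M\<^esub> (r \<odot>\<^bsub>M\<^esub> z) = r \<odot>\<^bsub>M\<^esub> (e \<odot>\<^bsub>M\<^esub> z)"
        using e(1) smult_commute by blast
      ultimately show "x \<oplus>\<^bsub>M\<^esub> r \<odot>\<^bsub>M\<^esub> z \<in> {x \<in> carrier M. e \<odot>\<^bsub>M\<^esub> x = \<zero>\<^bsub>M\<^esub>}"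
        using e(1) by (simp add: smult_r_distr)
    qed (use e in auto)
    then have "?N \<subseteq> {x \<in> carrier M. e \<odot>\<^bsub>M\<^esub> x = \<zero>\<^bsub>M\<^esub>}"
      by (rule submodule_gen_least) (use e X in auto)
    then have "e \<in> p" using h(3) e(1) by blast
    with e(3) show False by simp
  qed
  then show ?thesis unfolding quasi_coartinian_def coartinian_witness_def using N XT by (intro exI[of _ ?N]) simp
qed

section \<open>Inheritance by submodules and sums\<close>

lemma submodule_restrict_iff:
  assumes H: "submodule H R M"
  shows "submodule K R (M\<lparr>carrier := H\<rparr>) \<longleftrightarrow> submodule K R M \<and> K \<subseteq> H"
proof -
  interpret H: rmodule R "M\<lparr>carrier := H\<rparr>"
    by (rule rmoduleI[OF submodule.submodule_is_module[OF H module_M]])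
  show ?thesis
  proof
    assume K: "submodule K R (M\<lparr>carrier := H\<rparr>)"
    have "submodule K R M"
      by (rule submoduleI')
        (use H.submodule_mem[OF K] H.submodule_zero[OF K] H.submodule_lin[OF K] submodule_mem[OF H] in auto)
    then show "submodule K R M \<and> K \<subseteq> H" using H.submodule_mem[OF K] by auto
  next
    assume "submodule K R M \<and> K \<subseteq> H"
    then show "submodule K R (M\<lparr>carrier := H\<rparr>)"
      by (intro H.submoduleI') (auto simp: submodule_zero submodule_lin)
  qed
qed

lemma module_restrict: "submodule H R M \<Longrightarrow> Module.module R (M\<lparr>carrier := H\<rparr>)"
  using submodule.submodule_is_module module_M by blast

lemma incl_mod_hom: "submodule H R M \<Longrightarrow> (\<lambda>x. x) \<in> mod_hom R (M\<lparr>carrier := H\<rparr>) M"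
  by (rule mod_homI) (auto simp: submodule_mem)

lemma quasi_coartinian_submodule:
  assumes q: "quasi_coartinian R \<aa> M" and H: "submodule H R M"
  shows "quasi_coartinian R \<aa> (M\<lparr>carrier := H\<rparr>)"
proof -
  obtain N where wN: "coartinian_witness R \<aa> M N" using q unfolding quasi_coartinian_def by blast
  note N = coartinian_witnessD(1,2)[OF wN] and Np = coartinian_witnessD(3)[OF wN]
  show ?thesis unfolding quasi_coartinian_def coartinian_witness_def
  proof (intro exI[of _ "N \<inter> H"] conjI ballI allI impI)
    show "submodule (N \<inter> H) R (M\<lparr>carrier := H\<rparr>)"
      unfolding submodule_restrict_iff[OF H] using submodule_Int[OF N(1) H] by simp
    fix x assume "x \<in> carrier (M\<lparr>carrier := H\<rparr>)"
    then have x: "x \<in> H" by simp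
    \<comment> \<open>H/(N \<inter> H) embeds in M/N, so the annihilators of classes do not
      change.\<close>
    have "colon R (M\<lparr>carrier := H\<rparr>) (N \<inter> H) x = colon R M N x"
      unfolding colon_def using x submoduleE(4)[OF H] by auto
    then show "torsion_mod R (M\<lparr>carrier := H\<rparr>) (N \<inter> H) x"
      using N(2) submodule_mem[OF H x] unfolding torsion_mod_def by simp
  next
    fix p assume "primeideal p R \<and> \<aa> \<subseteq> p \<and>
      {r \<in> carrier R. \<forall>x\<in>N \<inter> H. r \<odot>\<^bsub>M\<lparr>carrier := H\<rparr>\<^esub> x = \<zero>\<^bsub>M\<lparr>carrier := H\<rparr>\<^esub>} \<subseteq> p"
    then have p: "primeideal p R" "\<aa> \<subseteq> p" and ann: "{r \<in> carrier R. \<forall>x\<in>N \<inter> H. r \<odot>\<^bsub>M\<^esub> x = \<zero>\<^bsub>M\<^esub>} \<subseteq> p" by auto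
    show "maximalideal p R"
    proof (rule ccontr)
      assume "\<not> maximalideal p R"
      then obtain r where "r \<in> carrier R - p" "\<forall>x\<in>N. r \<odot>\<^bsub>M\<^esub> x = \<zero>\<^bsub>M\<^esub>" using Np[OF p] by blast
      then show False using ann by blast
    qed
  qed
qed

lemma lin_compact_restrict:
  assumes lc: "lin_compact R M H" and H: "submodule H R M"
  shows "lin_compact R (M\<lparr>carrier := H\<rparr>) H"
proof -
  interpret H: rmodule R "M\<lparr>carrier := H\<rparr>" by (rule rmoduleI[OF module_restrict[OF H]])
  \<comment> \<open>Negation in the restricted record is defined relative to its own carrier and
    must be identified with that of M before affine subsets can be compared.\<close>
  have neg: "\<ominus>\<^bsub>M\<lparr>carrier := H\<rparr>\<^esub> x = \<ominus>\<^bsub>M\<^esub> x" if "x \<in> H" for x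
    using H.smult_l_minus[of \<one> x] smult_l_minus[of \<one> x] H.smult_one[of x] that submodule_mem[OF H that] by simp
  have "affine_subset R M C" if "affine_subset R (M\<lparr>carrier := H\<rparr>) C" for C
  proof -
    have "C \<subseteq> H" using that unfolding affine_subset_def by simp
    then have "y \<ominus>\<^bsub>M\<lparr>carrier := H\<rparr>\<^esub> z = y \<ominus>\<^bsub>M\<^esub> z" if "y \<in> C" "z \<in> C" for y z
      using that neg[of z] by (auto simp: H.minus_eq M.minus_eq)
    then show ?thesis using that submodule_mem[OF H] unfolding affine_subset_def by auto
  qed
  note aff = this
  show ?thesis unfolding lin_compact_def
  proof (intro allI impI)
    fix \<F> assume F: "(\<forall>C\<in>\<F>. affine_subset R (M\<lparr>carrier := H\<rparr>) C \<and> C \<subseteq> H) \<and>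
      (\<forall>\<G>\<subseteq>\<F>. finite \<G> \<longrightarrow> \<Inter>\<G> \<noteq> {})"
    show "\<Inter>\<F> \<noteq> {}"
      by (rule lin_compactD[OF lc]) (use F aff in blast)+
  qed
qed

end

text \<open>The sum of the images of the two witnesses is a witness: at a prime, the multipliers
  found for the two summands are combined into their product.\<close>

lemma quasi_coartinian_sum:
  assumes X: "Module.module R X" and Y: "Module.module R Y" and P: "Module.module R P"
    and i: "i \<in> mod_hom R X P" and j: "j \<in> mod_hom R Y P"
    and span: "carrier P \<subseteq> {i x \<oplus>\<^bsub>P\<^esub> j y | x y. x \<in> carrier X \<and> y \<in> carrier Y}"
    and qX: "quasi_coartinian R \<aa> X" and qY: "quasi_coartinian R \<aa> Y"
  shows "quasi_coartinian R \<aa> P"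
proof -
  interpret i: mod_map R X P i by (rule mod_mapI[OF X P i])
  interpret j: mod_map R Y P j by (rule mod_mapI[OF Y P j])
  obtain N1 where wN1: "coartinian_witness R \<aa> X N1" using qX unfolding quasi_coartinian_def by blast
  note N1 = coartinian_witnessD(1,2)[OF wN1] and N1p = coartinian_witnessD(3)[OF wN1]
  obtain N2 where wN2: "coartinian_witness R \<aa> Y N2" using qY unfolding quasi_coartinian_def by blast
  note N2 = coartinian_witnessD(1,2)[OF wN2] and N2p = coartinian_witnessD(3)[OF wN2]
  let ?N = "{h \<oplus>\<^bsub>P\<^esub> k | h k. h \<in> i ` N1 \<and> k \<in> j ` N2}"
  have N: "submodule ?N R P"
    by (rule i.N.submodule_sum[OF i.image_submodule[OF N1(1)] j.image_submodule[OF N2(1)]])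
  show ?thesis unfolding quasi_coartinian_def coartinian_witness_def
  proof (intro exI[of _ ?N] conjI ballI allI impI)
    fix z assume "z \<in> carrier P"
    then obtain x y where xy: "x \<in> carrier X" "y \<in> carrier Y" "z = i x \<oplus>\<^bsub>P\<^esub> j y" using span by blast
    show "torsion_mod R P ?N z" unfolding torsion_mod_def
    proof (intro allI impI, rule ccontr)
      fix p assume p: "primeideal p R \<and> colon R P ?N z \<subseteq> p" and nm: "\<not> maximalideal p R"
      interpret p: primeideal p R using p by simp
      obtain r where r: "r \<in> carrier R - p" "r \<odot>\<^bsub>X\<^esub> x \<in> N1"
        using torsion_mod_witness[OF N1(2)[OF xy(1)] conjunct1[OF p] nm] by blast
      obtain s where s: "s \<in> carrier R - p" "s \<odot>\<^bsub>Y\<^esub> y \<in> N2"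
        using torsion_mod_witness[OF N2(2)[OF xy(2)] conjunct1[OF p] nm] by blast
      have sr: "s \<odot>\<^bsub>X\<^esub> (r \<odot>\<^bsub>X\<^esub> x) \<in> N1" "r \<odot>\<^bsub>Y\<^esub> (s \<odot>\<^bsub>Y\<^esub> y) \<in> N2"
        using r s i.M.submoduleE(4)[OF N1(1)] j.M.submoduleE(4)[OF N2(1)] by auto
      have "(s \<otimes>\<^bsub>R\<^esub> r) \<odot>\<^bsub>P\<^esub> z = i (s \<odot>\<^bsub>X\<^esub> (r \<odot>\<^bsub>X\<^esub> x)) \<oplus>\<^bsub>P\<^esub> j (r \<odot>\<^bsub>Y\<^esub> (s \<odot>\<^bsub>Y\<^esub> y))"
        using r s xy i.closed[of x] j.closed[of y] i.N.smult_commute[of s r "j y"]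
        by (simp add: i.smult j.smult i.N.smult_r_distr i.N.smult_assoc1)
      then have "(s \<otimes>\<^bsub>R\<^esub> r) \<odot>\<^bsub>P\<^esub> z \<in> ?N" using sr by blast
      then have "s \<otimes>\<^bsub>R\<^esub> r \<in> p" using p r s unfolding colon_def by blast
      then show False using p.I_prime r s by blast
    qed
  next
    fix p assume p: "primeideal p R \<and> \<aa> \<subseteq> p \<and> {r \<in> carrier R. \<forall>x\<in>?N. r \<odot>\<^bsub>P\<^esub> x = \<zero>\<^bsub>P\<^esub>} \<subseteq> p"
    interpret p: primeideal p R using p by simp
    show "maximalideal p R"
    proof (rule ccontr)
      assume nm: "\<not> maximalideal p R"
      obtain r where r: "r \<in> carrier R" "r \<notin> p" "\<And>x. x \<in> N1 \<Longrightarrow> r \<odot>\<^bsub>X\<^esub> x = \<zero>\<^bsub>X\<^esub>"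
        using N1p[of p] p nm by blast
      obtain s where s: "s \<in> carrier R" "s \<notin> p" "\<And>x. x \<in> N2 \<Longrightarrow> s \<odot>\<^bsub>Y\<^esub> x = \<zero>\<^bsub>Y\<^esub>"
        using N2p[of p] p nm by blast
      have "(r \<otimes>\<^bsub>R\<^esub> s) \<odot>\<^bsub>P\<^esub> z = \<zero>\<^bsub>P\<^esub>" if "z \<in> ?N" for z
      proof -
        obtain x y where xy: "x \<in> N1" "y \<in> N2" "z = i x \<oplus>\<^bsub>P\<^esub> j y" using \<open>z \<in> ?N\<close> by blast
        have c: "x \<in> carrier X" "y \<in> carrier Y" using xy i.M.submodule_mem[OF N1(1)] j.M.submodule_mem[OF N2(1)] by auto
        have "(r \<otimes>\<^bsub>R\<^esub> s) \<odot>\<^bsub>P\<^esub> z = s \<odot>\<^bsub>P\<^esub> i (r \<odot>\<^bsub>X\<^esub> x) \<oplus>\<^bsub>P\<^esub> r \<odot>\<^bsub>P\<^esub> j (s \<odot>\<^bsub>Y\<^esub> y)"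
          using r(1) s(1) xy(3) c i.closed[of x] j.closed[of y] i.N.smult_commute[of s r "i x"]
          by (simp add: i.smult j.smult i.N.smult_r_distr i.N.smult_assoc1)
        then show ?thesis using r s xy by (simp add: i.zero j.zero)
      qed
      then have "r \<otimes>\<^bsub>R\<^esub> s \<in> p" using p r s by blast
      then show False using p.I_prime r s by blast
    qed
  qed (rule N)
qed


section \<open>Quotient modules\<close>

context rmodule
begin

context
  fixes N assumes N: "submodule N R M"
begin

lemma abelian_subgroup_N: "abelian_subgroup N M"
proof (rule abelian_subgroupI3)
  show "additive_subgroup N M"
    using submodule.axioms(1)[OF N] by (rule additive_subgroup.intro)
  show "abelian_group M" by (rule M.abelian_group_axioms)
qed

lemma quot_carrier: "carrier (quot_module M N) = (\<lambda>x. N +>\<^bsub>M\<^esub> x) ` carrier M"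
  unfolding quot_module_def by (auto simp: A_RCOSETS_def')

lemma quot_zero: "\<zero>\<^bsub>quot_module M N\<^esub> = N +>\<^bsub>M\<^esub> \<zero>\<^bsub>M\<^esub>"
  using submodule_mem[OF N] by (auto simp: quot_module_def a_r_coset_def')

lemma rcoset_eq_iff:
  assumes a: "a \<in> carrier M" and b: "b \<in> carrier M"
  shows "N +>\<^bsub>M\<^esub> a = N +>\<^bsub>M\<^esub> b \<longleftrightarrow> a \<ominus>\<^bsub>M\<^esub> b \<in> N"
proof
  assume eq: "N +>\<^bsub>M\<^esub> a = N +>\<^bsub>M\<^esub> b"
  have "a \<in> N +>\<^bsub>M\<^esub> a" using a submodule_zero[OF N] by (simp add: mem_rcoset_iff[OF N a] M.minus_eq M.r_neg)
  then show "a \<ominus>\<^bsub>M\<^esub> b \<in> N" unfolding eq mem_rcoset_iff[OF N b] by simp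
next
  assume h: "a \<ominus>\<^bsub>M\<^esub> b \<in> N"
  have ab: "b \<ominus>\<^bsub>M\<^esub> a \<in> N"
  proof -
    have "b \<ominus>\<^bsub>M\<^esub> a = \<ominus>\<^bsub>M\<^esub> (a \<ominus>\<^bsub>M\<^esub> b)" using a b by (simp add: M.minus_eq M.minus_add M.a_comm)
    then show ?thesis using submoduleE(3)[OF N h] by simp
  qed
  have "x \<ominus>\<^bsub>M\<^esub> d \<in> N" if x: "x \<in> carrier M" "c \<in> carrier M" "d \<in> carrier M" "x \<ominus>\<^bsub>M\<^esub> c \<in> N" "c \<ominus>\<^bsub>M\<^esub> d \<in> N" for x c d
  proof -
    have "x \<ominus>\<^bsub>M\<^esub> d = (x \<ominus>\<^bsub>M\<^esub> c) \<oplus>\<^bsub>M\<^esub> (c \<ominus>\<^bsub>M\<^esub> d)"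
      using x(1-3) by (simp add: M.minus_eq M.a_assoc M.r_neg1)
    then show ?thesis using submoduleE(5)[OF N x(4,5)] by simp
  qed
  then show "N +>\<^bsub>M\<^esub> a = N +>\<^bsub>M\<^esub> b" unfolding rcoset_eq_Collect[OF N a] rcoset_eq_Collect[OF N b]
    using a b h ab by blast
qed

lemma quot_add:
  "\<lbrakk>a \<in> carrier M; b \<in> carrier M\<rbrakk> \<Longrightarrow> (N +>\<^bsub>M\<^esub> a) \<oplus>\<^bsub>quot_module M N\<^esub> (N +>\<^bsub>M\<^esub> b) = N +>\<^bsub>M\<^esub> (a \<oplus>\<^bsub>M\<^esub> b)"
  unfolding quot_module_def using abelian_subgroup.a_rcos_sum[OF abelian_subgroup_N] by simp

lemma quot_smult:
  assumes r: "r \<in> carrier R" and a: "a \<in> carrier M"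
  shows "r \<odot>\<^bsub>quot_module M N\<^esub> (N +>\<^bsub>M\<^esub> a) = N +>\<^bsub>M\<^esub> (r \<odot>\<^bsub>M\<^esub> a)"
proof -
  \<comment> \<open>The scalar multiple of a coset is a union over its representatives; all members
    of this union coincide.\<close>
  have "N +>\<^bsub>M\<^esub> (r \<odot>\<^bsub>M\<^esub> x) = N +>\<^bsub>M\<^esub> (r \<odot>\<^bsub>M\<^esub> a)" if x: "x \<in> N +>\<^bsub>M\<^esub> a" for x
  proof -
    have xM: "x \<in> carrier M" and xa: "x \<ominus>\<^bsub>M\<^esub> a \<in> N" using x mem_rcoset_iff[OF N a] by auto
    have "r \<odot>\<^bsub>M\<^esub> x \<ominus>\<^bsub>M\<^esub> r \<odot>\<^bsub>M\<^esub> a = r \<odot>\<^bsub>M\<^esub> (x \<ominus>\<^bsub>M\<^esub> a)"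
      using r a xM by (simp add: M.minus_eq smult_r_distr smult_r_minus)
    then show ?thesis using submoduleE(4)[OF N r xa] rcoset_eq_iff r a xM by simp
  qed
  then have "(\<Union>x\<in>N +>\<^bsub>M\<^esub> a. N +>\<^bsub>M\<^esub> (r \<odot>\<^bsub>M\<^esub> x)) = (\<Union>x\<in>N +>\<^bsub>M\<^esub> a. N +>\<^bsub>M\<^esub> (r \<odot>\<^bsub>M\<^esub> a))"
    by (rule SUP_cong[OF refl])
  moreover have "a \<in> N +>\<^bsub>M\<^esub> a" using a submodule_zero[OF N] by (simp add: mem_rcoset_iff[OF N a] M.minus_eq M.r_neg)
  ultimately have "(\<Union>x\<in>N +>\<^bsub>M\<^esub> a. N +>\<^bsub>M\<^esub> (r \<odot>\<^bsub>M\<^esub> x)) = N +>\<^bsub>M\<^esub> (r \<odot>\<^bsub>M\<^esub> a)"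
    by (simp only: UN_constant) (auto)
  then show ?thesis unfolding quot_module_def by simp
qed

lemma quot_module_module: "Module.module R (quot_module M N)"
proof (rule moduleI)
  show "cring R" by (rule R.is_cring)
  show "abelian_group (quot_module M N)"
  proof (rule abelian_groupI)
    fix x assume "x \<in> carrier (quot_module M N)"
    then obtain a where a: "a \<in> carrier M" "x = N +>\<^bsub>M\<^esub> a" unfolding quot_carrier by blast
    show "\<zero>\<^bsub>quot_module M N\<^esub> \<oplus>\<^bsub>quot_module M N\<^esub> x = x" using a by (simp add: quot_zero quot_add)
    show "\<exists>y\<in>carrier (quot_module M N). y \<oplus>\<^bsub>quot_module M N\<^esub> x = \<zero>\<^bsub>quot_module M N\<^esub>"
      using a by (intro bexI[of _ "N +>\<^bsub>M\<^esub> (\<ominus>\<^bsub>M\<^esub> a)"]) (simp_all add: quot_zero quot_add quot_carrier M.l_neg)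
  qed (auto simp: quot_carrier quot_zero quot_add M.a_ac)
qed (auto simp: quot_carrier quot_add quot_smult smult_l_distr smult_r_distr smult_assoc1)

lemma quot_proj_hom: "(\<lambda>x. N +>\<^bsub>M\<^esub> x) \<in> mod_hom R M (quot_module M N)"
  by (rule mod_homI) (auto simp: quot_carrier quot_add quot_smult)

lemma quot_lift:
  fixes Q :: "('r, 'q) module"
  assumes Q: "Module.module R Q" and h: "h \<in> mod_hom R M Q" and ker: "\<And>x. x \<in> N \<Longrightarrow> h x = \<zero>\<^bsub>Q\<^esub>"
  shows "\<exists>g\<in>mod_hom R (quot_module M N) Q. \<forall>x\<in>carrier M. g (N +>\<^bsub>M\<^esub> x) = h x"
proof -
  interpret h: mod_map R M Q h by (rule mod_mapI[OF module_M Q h])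
  define g where "g X = h (SOME x. x \<in> X)" for X
  have g: "g (N +>\<^bsub>M\<^esub> x) = h x" if x: "x \<in> carrier M" for x
  proof -
    have "x \<in> N +>\<^bsub>M\<^esub> x" using x submodule_zero[OF N] by (simp add: mem_rcoset_iff[OF N x] M.minus_eq M.r_neg)
    then have "(SOME y. y \<in> N +>\<^bsub>M\<^esub> x) \<in> N +>\<^bsub>M\<^esub> x" by (rule someI)
    then have y: "(SOME y. y \<in> N +>\<^bsub>M\<^esub> x) \<in> carrier M" "(SOME y. y \<in> N +>\<^bsub>M\<^esub> x) \<ominus>\<^bsub>M\<^esub> x \<in> N"
      using mem_rcoset_iff[OF N x] by auto
    then show ?thesis using ker[OF y(2)] x y(1) unfolding g_def by (simp add: h.diff h.closed h.N.diff_eq_zero_iff)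
  qed
  have "g \<in> mod_hom R (quot_module M N) Q"
    by (rule mod_homI) (auto simp: quot_carrier quot_add quot_smult g h.closed h.add h.smult)
  then show ?thesis using g by blast
qed

end

end


section \<open>Injective modules and the cosupport\<close>

text \<open>Copies of the ideal and of the ring live in the test type.\<close>

lemma injective_module_ideal:
  fixes R :: "('r, 'x) ring_scheme" (structure) and E :: "('r, 'e) module"
  assumes R: "cring R" and inj: "injective_module R E" and I: "ideal I R"
    and f: "\<And>r. r \<in> I \<Longrightarrow> f r \<in> carrier E"
      "\<And>r s. \<lbrakk>r \<in> I; s \<in> I\<rbrakk> \<Longrightarrow> f (r \<oplus>\<^bsub>R\<^esub> s) = f r \<oplus>\<^bsub>E\<^esub> f s"
      "\<And>c r. \<lbrakk>c \<in> carrier R; r \<in> I\<rbrakk> \<Longrightarrow> f (c \<otimes>\<^bsub>R\<^esub> r) = c \<odot>\<^bsub>E\<^esub> f r"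
  shows "\<exists>e\<in>carrier E. \<forall>r\<in>I. f r = r \<odot>\<^bsub>E\<^esub> e"
proof -
  interpret cring R by (rule R)
  interpret I: ideal I R by (rule I)
  \<comment> \<open>The copy of an ideal J under \<open>Inl\<close>. For J = R the extended map is
    determined by its value at 1, which is the required e.\<close>
  define C :: "'r set \<Rightarrow> ('r, 'r + 'e) module" where
    "C J = \<lparr>carrier = Inl ` J, mult = undefined, one = undefined, zero = Inl \<zero>,
      add = (\<lambda>a b. Inl (projl a \<oplus> projl b)), smult = (\<lambda>c a. Inl (c \<otimes> projl a))\<rparr>" for J
  have C: "Module.module R (C J)" if "ideal J R" for J
  proof -
    interpret J: ideal J R by (rule that)
    show ?thesis
    proof (rule moduleI)
      show "abelian_group (C J)"
      proof (rule abelian_groupI)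
        fix x assume "x \<in> carrier (C J)"
        then obtain a where "a \<in> J" "x = Inl a" unfolding C_def by auto
        then show "\<exists>y\<in>carrier (C J). y \<oplus>\<^bsub>C J\<^esub> x = \<zero>\<^bsub>C J\<^esub>"
          using J.a_inv_closed J.Icarr unfolding C_def by (intro bexI[of _ "Inl (\<ominus> a)"]) (auto simp: l_neg)
      qed (auto simp: C_def J.Icarr a_ac)
    qed (auto simp: C_def J.Icarr J.I_l_closed l_distr r_distr m_assoc is_cring)
  qed
  have "ideal (carrier R) R" by (rule oneideal)
  have hom: "(\<lambda>x. x) \<in> mod_hom R (C I) (C (carrier R))"
    by (rule mod_homI) (auto simp: C_def I.Icarr)
  have fhom: "(\<lambda>x. f (projl x)) \<in> mod_hom R (C I) E"
    by (rule mod_homI) (auto simp: C_def f)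
  have "\<exists>g\<in>mod_hom R (C (carrier R)) E. \<forall>x\<in>carrier (C I). g x = f (projl x)"
    by (rule conjunct2[OF inj[unfolded injective_module_def], rule_format, OF hom fhom])
      (simp add: C I oneideal)
  then obtain g where g: "g \<in> mod_hom R (C (carrier R)) E" "\<forall>x\<in>carrier (C I). g x = f (projl x)"
    by blast
  show ?thesis
  proof (intro bexI ballI)
    show "g (Inl \<one>) \<in> carrier E" by (rule mod_homD(1)[OF g(1)]) (simp add: C_def)
    fix r assume r: "r \<in> I"
    then have "f r = g (Inl r)" using g(2) unfolding C_def by auto
    also have "Inl r = r \<odot>\<^bsub>C (carrier R)\<^esub> Inl \<one>" using r by (simp add: C_def I.Icarr)
    also have "g \<dots> = r \<odot>\<^bsub>E\<^esub> g (Inl \<one>)"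
      by (rule mod_homD(3)[OF g(1)]) (use r in \<open>simp_all add: C_def I.Icarr\<close>)
    finally show "f r = r \<odot>\<^bsub>E\<^esub> g (Inl \<one>)" .
  qed
qed

text \<open>A partial extension is represented by its graph in M \<times> E, so that extension is
  inclusion and unions of chains are immediate. The last condition is single-valuedness at 0, which
  by linearity is single-valuedness everywhere.\<close>

definition partial_ext ::
  "('r, 'x) ring_scheme \<Rightarrow> ('r, 'm) module \<Rightarrow> ('r, 'e) module \<Rightarrow> 'm set \<Rightarrow> ('m \<Rightarrow> 'e) \<Rightarrow> ('m \<times> 'e) set \<Rightarrow> bool" where
  "partial_ext R M E K g G \<longleftrightarrow> G \<subseteq> carrier M \<times> carrier E \<and> (\<forall>x\<in>K. (x, g x) \<in> G) \<and>
     (\<forall>x u y v. \<forall>r\<in>carrier R. (x, u) \<in> G \<longrightarrow> (y, v) \<in> G \<longrightarrow> (x \<oplus>\<^bsub>M\<^esub> r \<odot>\<^bsub>M\<^esub> y, u \<oplus>\<^bsub>E\<^esub> r \<odot>\<^bsub>E\<^esub> v) \<in> G) \<and>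
     (\<forall>v. (\<zero>\<^bsub>M\<^esub>, v) \<in> G \<longrightarrow> v = \<zero>\<^bsub>E\<^esub>)"

lemma partial_extD:
  assumes "partial_ext R M E K g G"
  shows "(x, u) \<in> G \<Longrightarrow> x \<in> carrier M" "(x, u) \<in> G \<Longrightarrow> u \<in> carrier E"
    and "x \<in> K \<Longrightarrow> (x, g x) \<in> G"
    and "\<lbrakk>r \<in> carrier R; (x, u) \<in> G; (y, v) \<in> G\<rbrakk> \<Longrightarrow> (x \<oplus>\<^bsub>M\<^esub> r \<odot>\<^bsub>M\<^esub> y, u \<oplus>\<^bsub>E\<^esub> r \<odot>\<^bsub>E\<^esub> v) \<in> G"
    and "(\<zero>\<^bsub>M\<^esub>, v) \<in> G \<Longrightarrow> v = \<zero>\<^bsub>E\<^esub>"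
  using assms unfolding partial_ext_def by blast+

text \<open>Injectivity is tested in one type only, whereas M is arbitrary. A maximal partial
  extension is total: at a missing x, the ideal of all r with r x in the domain carries a map into
  E, this map is multiplication by some e, and e is a consistent value at x.\<close>

lemma baer:
  fixes R :: "('r, 'x) ring_scheme" and E :: "('r, 'e) module" and M :: "('r, 'm) module"
  assumes M: "Module.module R M" and inj: "injective_module R E"
    and K: "submodule K R M" and g: "g \<in> mod_hom R (M\<lparr>carrier := K\<rparr>) E"
  shows "\<exists>h\<in>mod_hom R M E. \<forall>x\<in>K. h x = g x"
proof -
  interpret M: rmodule R M by (rule rmoduleI[OF M])
  have E: "Module.module R E" using inj unfolding injective_module_def by blast
  interpret E: rmodule R E by (rule rmoduleI[OF E])
  interpret g: mod_map R "M\<lparr>carrier := K\<rparr>" E g by (rule mod_mapI[OF M.module_restrict[OF K] E g])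
  let ?A = "{G. partial_ext R M E K g G}"
  have "\<exists>G\<in>?A. \<forall>G'\<in>?A. G \<subseteq> G' \<longrightarrow> G' = G"
  proof (rule subset_Zorn_nonempty)
    have "partial_ext R M E K g ((\<lambda>x. (x, g x)) ` K)" unfolding partial_ext_def
    proof (intro conjI allI ballI impI)
      show "(\<lambda>x. (x, g x)) ` K \<subseteq> carrier M \<times> carrier E"
        using M.submodule_mem[OF K] g.closed by auto
      fix x u y v r assume "r \<in> carrier R" "(x, u) \<in> (\<lambda>x. (x, g x)) ` K" "(y, v) \<in> (\<lambda>x. (x, g x)) ` K"
      then show "(x \<oplus>\<^bsub>M\<^esub> r \<odot>\<^bsub>M\<^esub> y, u \<oplus>\<^bsub>E\<^esub> r \<odot>\<^bsub>E\<^esub> v) \<in> (\<lambda>x. (x, g x)) ` K"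
        using g.add[of x "r \<odot>\<^bsub>M\<^esub> y"] g.smult[of r y] M.submodule_lin[OF K] M.submoduleE(4)[OF K] by auto
    qed (use g.zero in auto)
    then show "?A \<noteq> {}" by blast
    fix \<C> assume C: "\<C> \<noteq> {}" "subset.chain ?A \<C>"
    then have ext: "partial_ext R M E K g G" if "G \<in> \<C>" for G using that by (auto simp: subset_chain_def)
    have "partial_ext R M E K g (\<Union>\<C>)" unfolding partial_ext_def
    proof (intro conjI allI ballI impI)
      show "\<Union>\<C> \<subseteq> carrier M \<times> carrier E" using ext partial_extD(1,2) by fast
      show "(x, g x) \<in> \<Union>\<C>" if "x \<in> K" for x using C(1) partial_extD(3)[OF ext that] by blast
      show "v = \<zero>\<^bsub>E\<^esub>" if "(\<zero>\<^bsub>M\<^esub>, v) \<in> \<Union>\<C>" for v using that partial_extD(5)[OF ext] by blast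
      fix x u y v r assume r: "r \<in> carrier R" and "(x, u) \<in> \<Union>\<C>" "(y, v) \<in> \<Union>\<C>"
      then obtain G G' where "G \<in> \<C>" "G' \<in> \<C>" "(x, u) \<in> G" "(y, v) \<in> G'" by auto
      moreover have "G \<subseteq> G' \<or> G' \<subseteq> G" using C(2) calculation(1,2) by (auto simp: subset_chain_def)
      ultimately obtain G where "G \<in> \<C>" "(x, u) \<in> G" "(y, v) \<in> G" by blast
      then show "(x \<oplus>\<^bsub>M\<^esub> r \<odot>\<^bsub>M\<^esub> y, u \<oplus>\<^bsub>E\<^esub> r \<odot>\<^bsub>E\<^esub> v) \<in> \<Union>\<C>"
        using partial_extD(4)[OF ext r] by blast
    qed
    then show "\<Union>\<C> \<in> ?A" by simp
  qed
  then obtain G where G: "partial_ext R M E K g G" and max: "\<And>G'. \<lbrakk>partial_ext R M E K g G'; G \<subseteq> G'\<rbrakk> \<Longrightarrow> G' = G"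
    by auto
  note D = partial_extD[OF G]
  have zero: "(\<zero>\<^bsub>M\<^esub>, \<zero>\<^bsub>E\<^esub>) \<in> G" using D(3)[OF M.submodule_zero[OF K]] g.zero by simp
  have smult: "(r \<odot>\<^bsub>M\<^esub> x, r \<odot>\<^bsub>E\<^esub> u) \<in> G" if "r \<in> carrier R" "(x, u) \<in> G" for r x u
    using D(4)[OF that(1) zero that(2)] D(1,2)[OF that(2)] that(1) by simp
  have add: "(x \<oplus>\<^bsub>M\<^esub> y, u \<oplus>\<^bsub>E\<^esub> v) \<in> G" if "(x, u) \<in> G" "(y, v) \<in> G" for x u y v
    using D(4)[OF M.R.one_closed that] D(1,2)[OF that(2)] by simp
  have neg: "(\<ominus>\<^bsub>M\<^esub> x, \<ominus>\<^bsub>E\<^esub> u) \<in> G" if "(x, u) \<in> G" for x u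
    using smult[OF _ that, of "\<ominus>\<^bsub>R\<^esub> \<one>\<^bsub>R\<^esub>"] D(1,2)[OF that] by (simp add: M.smult_l_minus E.smult_l_minus)
  have uniq: "u = v" if "(x, u) \<in> G" "(x, v) \<in> G" for x u v
  proof -
    have "(x \<oplus>\<^bsub>M\<^esub> \<ominus>\<^bsub>M\<^esub> x, u \<oplus>\<^bsub>E\<^esub> \<ominus>\<^bsub>E\<^esub> v) \<in> G" using add[OF that(1) neg[OF that(2)]] .
    then have "u \<oplus>\<^bsub>E\<^esub> \<ominus>\<^bsub>E\<^esub> v = \<zero>\<^bsub>E\<^esub>" using D(5) D(1)[OF that(1)] by (simp add: M.M.r_neg)
    then show ?thesis using E.diff_eq_zero_iff[OF D(2)[OF that(1)] D(2)[OF that(2)]] by (simp add: E.M.minus_eq)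
  qed
  have total: "\<exists>u. (x, u) \<in> G" if x: "x \<in> carrier M" for x
  proof (rule ccontr)
    assume no: "\<nexists>u. (x, u) \<in> G"
    have dom: "submodule (fst ` G) R M"
    proof (rule M.submoduleI')
      fix y z r assume "y \<in> fst ` G" "z \<in> fst ` G" "r \<in> carrier R"
      then obtain u v where "(y, u) \<in> G" "(z, v) \<in> G" by auto
      then show "y \<oplus>\<^bsub>M\<^esub> r \<odot>\<^bsub>M\<^esub> z \<in> fst ` G" using D(4)[OF \<open>r \<in> carrier R\<close>] by force
    qed (use zero D(1) in \<open>force+\<close>)
    define I where "I = colon R M (fst ` G) x"
    have I: "ideal I R" unfolding I_def by (rule M.colon_ideal[OF dom x])
    define f where "f r = (THE u. (r \<odot>\<^bsub>M\<^esub> x, u) \<in> G)" for r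
    have f_eq: "f r = u" if "(r \<odot>\<^bsub>M\<^esub> x, u) \<in> G" for r u
      unfolding f_def using that uniq by blast
    have f: "(r \<odot>\<^bsub>M\<^esub> x, f r) \<in> G" "r \<in> carrier R" if r: "r \<in> I" for r
    proof -
      obtain u where "(r \<odot>\<^bsub>M\<^esub> x, u) \<in> G" using r unfolding I_def colon_def by force
      then show "(r \<odot>\<^bsub>M\<^esub> x, f r) \<in> G" using f_eq by simp
      show "r \<in> carrier R" using r unfolding I_def colon_def by simp
    qed
    have "\<exists>e\<in>carrier E. \<forall>r\<in>I. f r = r \<odot>\<^bsub>E\<^esub> e"
    proof (rule injective_module_ideal[OF M.R.is_cring inj I])
      show "f r \<in> carrier E" if "r \<in> I" for r using D(2)[OF f(1)[OF that]] .
      show "f (r \<oplus>\<^bsub>R\<^esub> s) = f r \<oplus>\<^bsub>E\<^esub> f s" if "r \<in> I" "s \<in> I" for r s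
        using add[OF f(1)[OF that(1)] f(1)[OF that(2)]] f(2)[OF that(1)] f(2)[OF that(2)] x
        by (intro f_eq) (simp add: M.smult_l_distr)
      show "f (c \<otimes>\<^bsub>R\<^esub> r) = c \<odot>\<^bsub>E\<^esub> f r" if "c \<in> carrier R" "r \<in> I" for c r
        using smult[OF that(1) f(1)[OF that(2)]] f(2)[OF that(2)] that(1) x
        by (intro f_eq) (simp add: M.smult_assoc1)
    qed
    then obtain e where e: "e \<in> carrier E" "\<And>r. r \<in> I \<Longrightarrow> f r = r \<odot>\<^bsub>E\<^esub> e" by blast
    define G' where "G' = {(y \<oplus>\<^bsub>M\<^esub> r \<odot>\<^bsub>M\<^esub> x, u \<oplus>\<^bsub>E\<^esub> r \<odot>\<^bsub>E\<^esub> e) | y u r. (y, u) \<in> G \<and> r \<in> carrier R}"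
    have GG': "G \<subseteq> G'"
    proof (rule subrelI)
      fix y u assume yu: "(y, u) \<in> G"
      then have "(y, u) = (y \<oplus>\<^bsub>M\<^esub> \<zero>\<^bsub>R\<^esub> \<odot>\<^bsub>M\<^esub> x, u \<oplus>\<^bsub>E\<^esub> \<zero>\<^bsub>R\<^esub> \<odot>\<^bsub>E\<^esub> e)"
        using D(1,2)[OF yu] x e by simp
      then show "(y, u) \<in> G'" unfolding G'_def using yu M.R.zero_closed by blast
    qed
    have "partial_ext R M E K g G'" unfolding partial_ext_def
    proof (intro conjI allI ballI impI)
      show "G' \<subseteq> carrier M \<times> carrier E" unfolding G'_def using D(1,2) x e by auto
      show "(y, g y) \<in> G'" if "y \<in> K" for y using D(3)[OF that] GG' by blast
    next
      \<comment> \<open>If 0 = y + r x, then r lies in I, and r e is the value already prescribed at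
        r x.\<close>
      fix v assume "(\<zero>\<^bsub>M\<^esub>, v) \<in> G'"
      then obtain y u r where yu: "(y, u) \<in> G" "r \<in> carrier R" "\<zero>\<^bsub>M\<^esub> = y \<oplus>\<^bsub>M\<^esub> r \<odot>\<^bsub>M\<^esub> x" "v = u \<oplus>\<^bsub>E\<^esub> r \<odot>\<^bsub>E\<^esub> e"
        unfolding G'_def by auto
      have "r \<odot>\<^bsub>M\<^esub> x = \<ominus>\<^bsub>M\<^esub> y"
        using yu(2,3) D(1)[OF yu(1)] x by (metis M.M.a_comm M.M.minus_equality M.smult_closed)
      then have "r \<in> I" unfolding I_def colon_def using neg[OF yu(1)] yu(2) by force
      then have "(r \<odot>\<^bsub>M\<^esub> x, r \<odot>\<^bsub>E\<^esub> e) \<in> G" using f(1) e(2) by metis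
      then have "(\<zero>\<^bsub>M\<^esub>, v) \<in> G" using add[OF yu(1)] yu(3,4) by metis
      then show "v = \<zero>\<^bsub>E\<^esub>" by (rule D(5))
    next
      fix y u z v r assume r: "r \<in> carrier R" and "(y, u) \<in> G'" "(z, v) \<in> G'"
      then obtain a b c a' b' c' where a: "(a, b) \<in> G" "c \<in> carrier R" "y = a \<oplus>\<^bsub>M\<^esub> c \<odot>\<^bsub>M\<^esub> x" "u = b \<oplus>\<^bsub>E\<^esub> c \<odot>\<^bsub>E\<^esub> e"
        and a': "(a', b') \<in> G" "c' \<in> carrier R" "z = a' \<oplus>\<^bsub>M\<^esub> c' \<odot>\<^bsub>M\<^esub> x" "v = b' \<oplus>\<^bsub>E\<^esub> c' \<odot>\<^bsub>E\<^esub> e"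
        unfolding G'_def by auto
      have "y \<oplus>\<^bsub>M\<^esub> r \<odot>\<^bsub>M\<^esub> z = (a \<oplus>\<^bsub>M\<^esub> r \<odot>\<^bsub>M\<^esub> a') \<oplus>\<^bsub>M\<^esub> (c \<oplus>\<^bsub>R\<^esub> r \<otimes>\<^bsub>R\<^esub> c') \<odot>\<^bsub>M\<^esub> x"
        using a a' r x D(1) by (simp add: M.smult_l_distr M.smult_r_distr M.smult_assoc1 M.M.a_ac)
      moreover have "u \<oplus>\<^bsub>E\<^esub> r \<odot>\<^bsub>E\<^esub> v = (b \<oplus>\<^bsub>E\<^esub> r \<odot>\<^bsub>E\<^esub> b') \<oplus>\<^bsub>E\<^esub> (c \<oplus>\<^bsub>R\<^esub> r \<otimes>\<^bsub>R\<^esub> c') \<odot>\<^bsub>E\<^esub> e"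
        using a a' r e(1) D(2) by (simp add: E.smult_l_distr E.smult_r_distr E.smult_assoc1 E.M.a_ac)
      ultimately show "(y \<oplus>\<^bsub>M\<^esub> r \<odot>\<^bsub>M\<^esub> z, u \<oplus>\<^bsub>E\<^esub> r \<odot>\<^bsub>E\<^esub> v) \<in> G'"
        unfolding G'_def using D(4)[OF r a(1) a'(1)] a(2) a'(2) r by blast
    qed
    then have "G' = G" using GG' by (rule max)
    moreover have "(x, e) \<in> G'"
    proof -
      have "(x, e) = (\<zero>\<^bsub>M\<^esub> \<oplus>\<^bsub>M\<^esub> \<one>\<^bsub>R\<^esub> \<odot>\<^bsub>M\<^esub> x, \<zero>\<^bsub>E\<^esub> \<oplus>\<^bsub>E\<^esub> \<one>\<^bsub>R\<^esub> \<odot>\<^bsub>E\<^esub> e)" using x e by simp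
      then show ?thesis unfolding G'_def using zero M.R.one_closed by blast
    qed
    ultimately show False using no by blast
  qed
  define h where "h x = (THE u. (x, u) \<in> G)" for x
  have h_eq: "h x = u" if "(x, u) \<in> G" for x u unfolding h_def using that uniq by blast
  have h: "(x, h x) \<in> G" if "x \<in> carrier M" for x using total[OF that] h_eq by auto
  have "h \<in> mod_hom R M E"
    using D(2)[OF h] h_eq[OF add[OF h h]] h_eq[OF smult[OF _ h]] by (intro mod_homI) auto
  moreover have "h x = g x" if "x \<in> K" for x using h_eq[OF D(3)[OF that]] .
  ultimately show ?thesis by blast
qed

section \<open>The cosupport through maps into injective hulls\<close>

definition cocyclic_map :: "('r, 'x) ring_scheme \<Rightarrow> ('r, 'm) module \<Rightarrow> ('r, 'r \<Rightarrow> nat) module \<Rightarrow> ('m \<Rightarrow> 'r \<Rightarrow> nat) \<Rightarrow> bool" where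
  "cocyclic_map R M E g \<longleftrightarrow> g \<in> mod_hom R M E \<and>
     (\<exists>\<mm> i. maximalideal \<mm> R \<and> injective_hull R (quot_module (regular_module R) \<mm>) E i)"

lemma cocyclic_map_injective: "cocyclic_map R M E g \<Longrightarrow> injective_module R E"
  unfolding cocyclic_map_def injective_hull_def by blast

text \<open>Cocyclic quotients of M correspond to maps from M into the hulls E(R/\<mm>), by dividing
  out the kernel, and the annihilator of the quotient is that of the image. Such maps can be
  extended and precomposed, which quotients do not allow.\<close>

lemma cosupp_iff:
  assumes M: "Module.module R M"
  shows "p \<in> cosupp R M \<longleftrightarrow> primeideal p R \<and>
    (\<exists>E g. cocyclic_map R M E g \<and> {r \<in> carrier R. \<forall>x\<in>carrier M. r \<odot>\<^bsub>E\<^esub> g x = \<zero>\<^bsub>E\<^esub>} \<subseteq> p)"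
proof -
  interpret M: rmodule R M by (rule rmoduleI[OF M])
  show ?thesis
  proof
    assume "p \<in> cosupp R M"
    then obtain N where p: "primeideal p R" and N: "submodule N R M"
      and coc: "cocyclic R (quot_module M N)" and ann: "annihilator R (quot_module M N) \<subseteq> p"
      unfolding cosupp_def by auto
    from coc obtain \<mm> and E :: "('a, 'a \<Rightarrow> nat) module" and i j
      where E: "maximalideal \<mm> R" "injective_hull R (quot_module (regular_module R) \<mm>) E i"
        and j: "j \<in> mod_hom R (quot_module M N) E" "inj_on j (carrier (quot_module M N))"
      unfolding cocyclic_def by auto
    have mE: "Module.module R E" using E(2) unfolding injective_hull_def injective_module_def by auto
    interpret j: mod_map R "quot_module M N" E j by (rule mod_mapI[OF M.quot_module_module[OF N] mE j(1)])
    let ?g = "\<lambda>x. j (N +>\<^bsub>M\<^esub> x)"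
    have "cocyclic_map R M E ?g" unfolding cocyclic_map_def
      using mod_hom_comp[OF M.quot_proj_hom[OF N] j(1)] E by blast
    moreover have "{r \<in> carrier R. \<forall>x\<in>carrier M. r \<odot>\<^bsub>E\<^esub> ?g x = \<zero>\<^bsub>E\<^esub>} \<subseteq> p"
    proof safe
      fix r assume r: "r \<in> carrier R" and z: "\<forall>x\<in>carrier M. r \<odot>\<^bsub>E\<^esub> ?g x = \<zero>\<^bsub>E\<^esub>"
      have "r \<odot>\<^bsub>quot_module M N\<^esub> X = \<zero>\<^bsub>quot_module M N\<^esub>" if X: "X \<in> carrier (quot_module M N)" for X
      proof -
        obtain x where x: "x \<in> carrier M" "X = N +>\<^bsub>M\<^esub> x" using X M.quot_carrier[OF N] by auto
        have "j (r \<odot>\<^bsub>quot_module M N\<^esub> X) = j \<zero>\<^bsub>quot_module M N\<^esub>"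
          using j.smult[OF r X] z x j.zero by simp
        then show ?thesis using inj_onD[OF j(2)] r X by (simp add: j.M.smult_closed)
      qed
      then have "r \<in> annihilator R (quot_module M N)" unfolding annihilator_def using r by simp
      then show "r \<in> p" using ann by blast
    qed
    ultimately show "primeideal p R \<and> (\<exists>E g. cocyclic_map R M E g \<and>
        {r \<in> carrier R. \<forall>x\<in>carrier M. r \<odot>\<^bsub>E\<^esub> g x = \<zero>\<^bsub>E\<^esub>} \<subseteq> p)" using p by blast
  next
    assume "primeideal p R \<and> (\<exists>E g. cocyclic_map R M E g \<and>
        {r \<in> carrier R. \<forall>x\<in>carrier M. r \<odot>\<^bsub>E\<^esub> g x = \<zero>\<^bsub>E\<^esub>} \<subseteq> p)"
    then obtain E g where p: "primeideal p R" and coc: "cocyclic_map R M E g"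
      and ann: "{r \<in> carrier R. \<forall>x\<in>carrier M. r \<odot>\<^bsub>E\<^esub> g x = \<zero>\<^bsub>E\<^esub>} \<subseteq> p" by blast
    have mE: "Module.module R E" using cocyclic_map_injective[OF coc] unfolding injective_module_def by auto
    have g: "g \<in> mod_hom R M E" using coc unfolding cocyclic_map_def by blast
    interpret g: mod_map R M E g by (rule mod_mapI[OF M mE g])
    let ?N = "mod_ker M E g"
    have N: "submodule ?N R M" by (rule g.ker_submodule)
    obtain j where j: "j \<in> mod_hom R (quot_module M ?N) E" "\<And>x. x \<in> carrier M \<Longrightarrow> j (?N +>\<^bsub>M\<^esub> x) = g x"
      using M.quot_lift[OF N mE g] unfolding mod_ker_def by auto
    have "inj_on j (carrier (quot_module M ?N))"
    proof (rule inj_onI)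
      fix X Y assume "X \<in> carrier (quot_module M ?N)" "Y \<in> carrier (quot_module M ?N)" and eq: "j X = j Y"
      then obtain x y where xy: "x \<in> carrier M" "y \<in> carrier M" "X = ?N +>\<^bsub>M\<^esub> x" "Y = ?N +>\<^bsub>M\<^esub> y"
        using M.quot_carrier[OF N] by auto
      have "g (x \<ominus>\<^bsub>M\<^esub> y) = \<zero>\<^bsub>E\<^esub>" using xy eq j(2) g.closed by (simp add: g.diff g.N.M.minus_eq g.N.M.r_neg)
      then have "x \<ominus>\<^bsub>M\<^esub> y \<in> ?N" using xy unfolding mod_ker_def by simp
      then show "X = Y" using M.rcoset_eq_iff[OF N] xy by simp
    qed
    then have "cocyclic R (quot_module M ?N)"
      using coc j(1) M.quot_module_module[OF N] unfolding cocyclic_def cocyclic_map_def by blast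
    moreover have "annihilator R (quot_module M ?N) \<subseteq> p"
    proof
      fix r assume "r \<in> annihilator R (quot_module M ?N)"
      then have r: "r \<in> carrier R" and z: "\<And>X. X \<in> carrier (quot_module M ?N) \<Longrightarrow> r \<odot>\<^bsub>quot_module M ?N\<^esub> X = \<zero>\<^bsub>quot_module M ?N\<^esub>"
        unfolding annihilator_def by auto
      have "r \<odot>\<^bsub>E\<^esub> g x = \<zero>\<^bsub>E\<^esub>" if x: "x \<in> carrier M" for x
      proof -
        have "?N +>\<^bsub>M\<^esub> (r \<odot>\<^bsub>M\<^esub> x) = ?N +>\<^bsub>M\<^esub> \<zero>\<^bsub>M\<^esub>"
          using z[of "?N +>\<^bsub>M\<^esub> x"] x r by (simp add: M.quot_carrier[OF N] M.quot_smult[OF N] M.quot_zero[OF N])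
        then have "g (r \<odot>\<^bsub>M\<^esub> x) = g \<zero>\<^bsub>M\<^esub>" using j(2)[of "r \<odot>\<^bsub>M\<^esub> x"] j(2)[of "\<zero>\<^bsub>M\<^esub>"] r x by simp
        then show ?thesis using g.smult[OF r x] g.zero by simp
      qed
      then show "r \<in> p" using ann r by blast
    qed
    ultimately show "p \<in> cosupp R M" unfolding cosupp_def using p N by blast
  qed
qed

text \<open>A map into the hull extends from K to M by injectivity. The image grows, so its
  annihilator shrinks and stays inside p.\<close>

lemma cosupp_submodule:
  assumes M: "Module.module R M" and K: "submodule K R M"
  shows "cosupp R (M\<lparr>carrier := K\<rparr>) \<subseteq> cosupp R M"
proof
  interpret M: rmodule R M by (rule rmoduleI[OF M])
  fix p assume "p \<in> cosupp R (M\<lparr>carrier := K\<rparr>)"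
  then obtain E g where p: "primeideal p R" and coc: "cocyclic_map R (M\<lparr>carrier := K\<rparr>) E g"
    and ann: "{r \<in> carrier R. \<forall>x\<in>K. r \<odot>\<^bsub>E\<^esub> g x = \<zero>\<^bsub>E\<^esub>} \<subseteq> p"
    unfolding cosupp_iff[OF M.module_restrict[OF K]] by auto
  have g: "g \<in> mod_hom R (M\<lparr>carrier := K\<rparr>) E" using coc unfolding cocyclic_map_def by blast
  obtain h where h: "h \<in> mod_hom R M E" "\<forall>x\<in>K. h x = g x"
    using baer[OF M cocyclic_map_injective[OF coc] K g] by blast
  have "cocyclic_map R M E h" using coc h unfolding cocyclic_map_def by blast
  moreover have "{r \<in> carrier R. \<forall>x\<in>carrier M. r \<odot>\<^bsub>E\<^esub> h x = \<zero>\<^bsub>E\<^esub>} \<subseteq> p"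
  proof
    fix r assume "r \<in> {r \<in> carrier R. \<forall>x\<in>carrier M. r \<odot>\<^bsub>E\<^esub> h x = \<zero>\<^bsub>E\<^esub>}"
    then have r: "r \<in> carrier R" "\<And>x. x \<in> carrier M \<Longrightarrow> r \<odot>\<^bsub>E\<^esub> h x = \<zero>\<^bsub>E\<^esub>" by auto
    have "r \<odot>\<^bsub>E\<^esub> g x = \<zero>\<^bsub>E\<^esub>" if "x \<in> K" for x
      using r(2)[OF M.submodule_mem[OF K that]] h(2) that by simp
    then show "r \<in> p" using ann r(1) by blast
  qed
  ultimately show "p \<in> cosupp R M" unfolding cosupp_iff[OF M] using p by blast
qed

text \<open>For a map g on P, an annihilator of g \<circ> i times an annihilator of g \<circ> j
  kills the image of g. If both had elements outside p, so would the annihilator of g. With both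
  maps equal to a surjection this covers quotients.\<close>

lemma cosupp_sum:
  assumes X: "Module.module R X" and Y: "Module.module R Y" and P: "Module.module R P"
    and i: "i \<in> mod_hom R X P" and j: "j \<in> mod_hom R Y P"
    and span: "carrier P \<subseteq> {i x \<oplus>\<^bsub>P\<^esub> j y | x y. x \<in> carrier X \<and> y \<in> carrier Y}"
  shows "cosupp R P \<subseteq> cosupp R X \<union> cosupp R Y"
proof
  fix p assume "p \<in> cosupp R P"
  then obtain E g where p: "primeideal p R" and coc: "cocyclic_map R P E g"
    and ann: "{r \<in> carrier R. \<forall>x\<in>carrier P. r \<odot>\<^bsub>E\<^esub> g x = \<zero>\<^bsub>E\<^esub>} \<subseteq> p"
    unfolding cosupp_iff[OF P] by auto
  have mE: "Module.module R E" using cocyclic_map_injective[OF coc] unfolding injective_module_def by auto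
  have g: "g \<in> mod_hom R P E" using coc unfolding cocyclic_map_def by blast
  interpret g: mod_map R P E g by (rule mod_mapI[OF P mE g])
  interpret p: primeideal p R by (rule p)
  have cX: "cocyclic_map R X E (\<lambda>x. g (i x))" and cY: "cocyclic_map R Y E (\<lambda>y. g (j y))"
    using coc mod_hom_comp[OF i g] mod_hom_comp[OF j g] unfolding cocyclic_map_def by auto
  show "p \<in> cosupp R X \<union> cosupp R Y"
  proof (rule ccontr)
    assume "p \<notin> cosupp R X \<union> cosupp R Y"
    then have "\<not> {r \<in> carrier R. \<forall>x\<in>carrier X. r \<odot>\<^bsub>E\<^esub> g (i x) = \<zero>\<^bsub>E\<^esub>} \<subseteq> p"
      "\<not> {r \<in> carrier R. \<forall>x\<in>carrier Y. r \<odot>\<^bsub>E\<^esub> g (j x) = \<zero>\<^bsub>E\<^esub>} \<subseteq> p"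
      unfolding Un_iff cosupp_iff[OF X] cosupp_iff[OF Y] using p cX cY by auto
    then obtain r s where r: "r \<in> carrier R" "r \<notin> p" "\<And>x. x \<in> carrier X \<Longrightarrow> r \<odot>\<^bsub>E\<^esub> g (i x) = \<zero>\<^bsub>E\<^esub>"
      and s: "s \<in> carrier R" "s \<notin> p" "\<And>x. x \<in> carrier Y \<Longrightarrow> s \<odot>\<^bsub>E\<^esub> g (j x) = \<zero>\<^bsub>E\<^esub>" by auto
    have "(s \<otimes>\<^bsub>R\<^esub> r) \<odot>\<^bsub>E\<^esub> g z = \<zero>\<^bsub>E\<^esub>" if z: "z \<in> carrier P" for z
    proof -
      obtain x y where xy: "x \<in> carrier X" "y \<in> carrier Y" "z = i x \<oplus>\<^bsub>P\<^esub> j y" using span z by blast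
      have c: "i x \<in> carrier P" "j y \<in> carrier P" using xy mod_homD(1)[OF i] mod_homD(1)[OF j] by auto
      have "(s \<otimes>\<^bsub>R\<^esub> r) \<odot>\<^bsub>E\<^esub> g z = s \<odot>\<^bsub>E\<^esub> (r \<odot>\<^bsub>E\<^esub> g (i x)) \<oplus>\<^bsub>E\<^esub> r \<odot>\<^bsub>E\<^esub> (s \<odot>\<^bsub>E\<^esub> g (j y))"
        using r(1) s(1) c g.closed g.N.smult_commute[of s r "g (j y)"] unfolding xy(3)
        by (simp add: g.add g.N.smult_r_distr g.N.smult_assoc1)
      then show ?thesis using r s xy by simp
    qed
    then have "s \<otimes>\<^bsub>R\<^esub> r \<in> p" using ann r s by blast
    then show False using p.I_prime r s by blast
  qed
qed

section \<open>Free modules and tensor products\<close>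

lemma (in cring) free_mod_mem_iff:
  "f \<in> carrier (free_mod R S) \<longleftrightarrow> (\<forall>s. f s \<in> carrier R) \<and> finite {s. f s \<noteq> \<zero>} \<and> (\<forall>s. s \<notin> S \<longrightarrow> f s = \<zero>)"
  by (simp add: free_mod_def)

lemma free_mod_simps:
  "f \<oplus>\<^bsub>free_mod R S\<^esub> g = (\<lambda>s. f s \<oplus>\<^bsub>R\<^esub> g s)" "r \<odot>\<^bsub>free_mod R S\<^esub> f = (\<lambda>s. r \<otimes>\<^bsub>R\<^esub> f s)"
  "\<zero>\<^bsub>free_mod R S\<^esub> = (\<lambda>s. \<zero>\<^bsub>R\<^esub>)"
  by (simp_all add: free_mod_def)

context cring
begin

lemma free_mod_module: "Module.module R (free_mod R S)"
proof (rule moduleI)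
  have add: "f \<oplus>\<^bsub>free_mod R S\<^esub> g \<in> carrier (free_mod R S)"
    if "f \<in> carrier (free_mod R S)" "g \<in> carrier (free_mod R S)" for f g
  proof -
    have "{s. f s \<oplus> g s \<noteq> \<zero>} \<subseteq> {s. f s \<noteq> \<zero>} \<union> {s. g s \<noteq> \<zero>}"
      using that by (auto simp: free_mod_mem_iff)
    then have "finite {s. f s \<oplus> g s \<noteq> \<zero>}"
      using that by (auto simp: free_mod_mem_iff intro: finite_subset)
    then show ?thesis using that by (simp add: free_mod_mem_iff free_mod_simps)
  qed
  show smult: "r \<odot>\<^bsub>free_mod R S\<^esub> f \<in> carrier (free_mod R S)"
    if "r \<in> carrier R" "f \<in> carrier (free_mod R S)" for r f
  proof -
    have "{s. r \<otimes> f s \<noteq> \<zero>} \<subseteq> {s. f s \<noteq> \<zero>}" using that by auto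
    then have "finite {s. r \<otimes> f s \<noteq> \<zero>}"
      using that by (auto simp: free_mod_mem_iff intro: finite_subset)
    then show ?thesis using that by (simp add: free_mod_mem_iff free_mod_simps)
  qed
  show "abelian_group (free_mod R S)"
  proof (rule abelian_groupI)
    show "f \<oplus>\<^bsub>free_mod R S\<^esub> g \<in> carrier (free_mod R S)"
      if "f \<in> carrier (free_mod R S)" "g \<in> carrier (free_mod R S)" for f g by (rule add[OF that])
    fix f assume f: "f \<in> carrier (free_mod R S)"
    show "\<exists>g\<in>carrier (free_mod R S). g \<oplus>\<^bsub>free_mod R S\<^esub> f = \<zero>\<^bsub>free_mod R S\<^esub>"
    proof
      show "(\<ominus> \<one>) \<odot>\<^bsub>free_mod R S\<^esub> f \<in> carrier (free_mod R S)" using f by (intro smult) auto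
      show "(\<ominus> \<one>) \<odot>\<^bsub>free_mod R S\<^esub> f \<oplus>\<^bsub>free_mod R S\<^esub> f = \<zero>\<^bsub>free_mod R S\<^esub>"
        using f by (simp add: free_mod_mem_iff free_mod_simps l_minus l_neg)
    qed
  qed (auto simp: free_mod_mem_iff free_mod_simps a_ac)
qed (auto simp: free_mod_mem_iff free_mod_simps l_distr r_distr m_assoc is_cring)

lemma free_gen_mem: "s \<in> S \<Longrightarrow> free_gen R s \<in> carrier (free_mod R S)"
  by (auto simp: free_mod_mem_iff free_gen_def)

text \<open>Induction on a finite set containing the support: clearing the value at one point splits
  off a multiple of the generator there.\<close>

lemma free_mod_induct:
  assumes H: "submodule H R (free_mod R S)" and gen: "\<And>s. s \<in> S \<Longrightarrow> free_gen R s \<in> H"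
    and f: "f \<in> carrier (free_mod R S)"
  shows "f \<in> H"
proof -
  interpret F: rmodule R "free_mod R S" by (rule rmoduleI[OF free_mod_module])
  have "\<forall>f\<in>carrier (free_mod R S). {s. f s \<noteq> \<zero>} \<subseteq> A \<longrightarrow> f \<in> H" if "finite A" for A
    using that
  proof (induction A rule: finite_induct)
    case empty
    show ?case
    proof (intro ballI impI)
      fix f assume "f \<in> carrier (free_mod R S)" "{s. f s \<noteq> \<zero>} \<subseteq> {}"
      then have "f = \<zero>\<^bsub>free_mod R S\<^esub>" by (auto simp: free_mod_simps)
      then show "f \<in> H" using F.submodule_zero[OF H] by simp
    qed
  next
    case (insert a A)
    show ?case
    proof (intro ballI impI)
      fix f assume f: "f \<in> carrier (free_mod R S)" and supp: "{s. f s \<noteq> \<zero>} \<subseteq> insert a A"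
      have fR: "f s \<in> carrier R" for s using f by (simp add: free_mod_mem_iff)
      show "f \<in> H"
      proof (cases "f a = \<zero>")
        case True
        then show ?thesis using insert.IH f supp by blast
      next
        case False
        then have aS: "a \<in> S" using f by (auto simp: free_mod_mem_iff)
        have "{s. (f(a := \<zero>)) s \<noteq> \<zero>} \<subseteq> {s. f s \<noteq> \<zero>}" by auto
        then have "f(a := \<zero>) \<in> carrier (free_mod R S)"
          using f by (auto simp: free_mod_mem_iff intro: finite_subset)
        moreover have "{s. (f(a := \<zero>)) s \<noteq> \<zero>} \<subseteq> A" using supp by auto
        ultimately have "f(a := \<zero>) \<in> H" using insert.IH by blast
        moreover have "f = f(a := \<zero>) \<oplus>\<^bsub>free_mod R S\<^esub> f a \<odot>\<^bsub>free_mod R S\<^esub> free_gen R a"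
          using fR by (auto simp: free_mod_simps free_gen_def fun_eq_iff)
        ultimately show ?thesis using F.submodule_lin[OF H _ gen[OF aS] fR[of a]] by metis
      qed
    qed
  qed
  then show ?thesis using f by (auto simp: free_mod_mem_iff)
qed

end

lemma mod_hom_equalizer:
  assumes M: "Module.module R M" and N: "Module.module R N"
    and f: "f \<in> mod_hom R M N" and g: "g \<in> mod_hom R M N"
  shows "submodule {x \<in> carrier M. f x = g x} R M"
proof -
  interpret f: mod_map R M N f by (rule mod_mapI[OF M N f])
  interpret g: mod_map R M N g by (rule mod_mapI[OF M N g])
  show ?thesis
    by (rule f.M.submoduleI') (auto simp: f.zero g.zero f.add g.add f.smult g.smult)
qed

lemma free_mod_hom_ext:
  assumes R: "cring R" and N: "Module.module R N"
    and f: "f \<in> mod_hom R (free_mod R S) N" and g: "g \<in> mod_hom R (free_mod R S) N"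
    and eq: "\<And>s. s \<in> S \<Longrightarrow> f (free_gen R s) = g (free_gen R s)" and x: "x \<in> carrier (free_mod R S)"
  shows "f x = g x"
proof -
  have "x \<in> {x \<in> carrier (free_mod R S). f x = g x}"
    by (rule cring.free_mod_induct[OF R mod_hom_equalizer[OF cring.free_mod_module[OF R] N f g] _ x])
      (simp add: cring.free_gen_mem[OF R] eq)
  then show ?thesis by simp
qed

lemma (in rmodule) free_lift:
  assumes g: "\<And>s. s \<in> S \<Longrightarrow> g s \<in> carrier M"
  shows "\<exists>h\<in>mod_hom R (free_mod R S) M. \<forall>s\<in>S. h (free_gen R s) = g s"
proof -
  define h where "h f = finsum M (\<lambda>s. f s \<odot>\<^bsub>M\<^esub> g s) {s \<in> S. f s \<noteq> \<zero>}" for f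
  have cl: "(\<lambda>s. f s \<odot>\<^bsub>M\<^esub> g s) \<in> A \<rightarrow> carrier M" if "f \<in> carrier (free_mod R S)" "A \<subseteq> S" for f A
    using that g by (auto simp: R.free_mod_mem_iff)
  have fin: "finite {s \<in> S. f s \<noteq> \<zero>}" if "f \<in> carrier (free_mod R S)" for f
    using that by (auto simp: R.free_mod_mem_iff)
  \<comment> \<open>The sum may run over any finite set between the support and S, which gives two
    functions a common index set.\<close>
  have h_eq: "h f = finsum M (\<lambda>s. f s \<odot>\<^bsub>M\<^esub> g s) A"
    if f: "f \<in> carrier (free_mod R S)" and A: "finite A" "A \<subseteq> S" "{s \<in> S. f s \<noteq> \<zero>} \<subseteq> A" for f A
    unfolding h_def
    by (rule M.add.finprod_mono_neutral_cong_left[OF A(1,3)]) (use A(2) g cl[OF f A(2)] in auto)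
  have "h \<in> mod_hom R (free_mod R S) M"
  proof (rule mod_homI)
    fix f assume f: "f \<in> carrier (free_mod R S)"
    show "h f \<in> carrier M" unfolding h_def by (rule M.finsum_closed[OF cl[OF f]]) auto
    {
      fix f' assume f': "f' \<in> carrier (free_mod R S)"
      let ?A = "{s \<in> S. f s \<noteq> \<zero>} \<union> {s \<in> S. f' s \<noteq> \<zero>}"
      have A: "finite ?A" "?A \<subseteq> S" using fin f f' by auto
      have ff': "f \<oplus>\<^bsub>free_mod R S\<^esub> f' \<in> carrier (free_mod R S)"
        using f f' Module.module.axioms(2)[OF R.free_mod_module] abelian_monoid.a_closed abelian_group.axioms(1) by metis
      have "h (f \<oplus>\<^bsub>free_mod R S\<^esub> f') = finsum M (\<lambda>s. (f \<oplus>\<^bsub>free_mod R S\<^esub> f') s \<odot>\<^bsub>M\<^esub> g s) ?A"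
        by (rule h_eq[OF ff' A]) (auto simp: free_mod_simps)
      also have "\<dots> = finsum M (\<lambda>s. f s \<odot>\<^bsub>M\<^esub> g s \<oplus>\<^bsub>M\<^esub> f' s \<odot>\<^bsub>M\<^esub> g s) ?A"
        by (rule M.finsum_cong') (use f f' g in \<open>auto simp: free_mod_simps R.free_mod_mem_iff smult_l_distr\<close>)
      also have "\<dots> = finsum M (\<lambda>s. f s \<odot>\<^bsub>M\<^esub> g s) ?A \<oplus>\<^bsub>M\<^esub> finsum M (\<lambda>s. f' s \<odot>\<^bsub>M\<^esub> g s) ?A"
        by (rule M.finsum_addf[OF cl[OF f A(2)] cl[OF f' A(2)]])
      also have "\<dots> = h f \<oplus>\<^bsub>M\<^esub> h f'"
        using h_eq[OF f A] h_eq[OF f' A] by auto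
      finally show "h (f \<oplus>\<^bsub>free_mod R S\<^esub> f') = h f \<oplus>\<^bsub>M\<^esub> h f'" .
    }
    fix r assume r: "r \<in> carrier R"
    let ?A = "{s \<in> S. f s \<noteq> \<zero>}"
    have rf: "r \<odot>\<^bsub>free_mod R S\<^esub> f \<in> carrier (free_mod R S)"
      using Module.module.smult_closed[OF R.free_mod_module r f] .
    have A: "finite ?A" "?A \<subseteq> S" using fin[OF f] by auto
    have "h (r \<odot>\<^bsub>free_mod R S\<^esub> f) = finsum M (\<lambda>s. (r \<odot>\<^bsub>free_mod R S\<^esub> f) s \<odot>\<^bsub>M\<^esub> g s) ?A"
      by (rule h_eq[OF rf A]) (use r in \<open>auto simp: free_mod_simps\<close>)
    also have "\<dots> = finsum M (\<lambda>s. r \<odot>\<^bsub>M\<^esub> (f s \<odot>\<^bsub>M\<^esub> g s)) ?A"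
      by (rule M.finsum_cong') (use f r g in \<open>auto simp: free_mod_simps R.free_mod_mem_iff smult_assoc1\<close>)
    also have "\<dots> = r \<odot>\<^bsub>M\<^esub> h f"
      unfolding h_def by (rule finsum_smult_ldistr[OF A(1) r cl[OF f A(2)], symmetric])
    finally show "h (r \<odot>\<^bsub>free_mod R S\<^esub> f) = r \<odot>\<^bsub>M\<^esub> h f" .
  qed
  moreover have "h (free_gen R s) = g s" if s: "s \<in> S" for s
  proof -
    have "h (free_gen R s) = finsum M (\<lambda>t. free_gen R s t \<odot>\<^bsub>M\<^esub> g t) {s}"
      by (rule h_eq[OF R.free_gen_mem[OF s]]) (use s in \<open>auto simp: free_gen_def\<close>)
    also have "\<dots> = g s" using g[OF s] by (simp add: free_gen_def)
    finally show ?thesis .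
  qed
  ultimately show ?thesis by blast
qed

section \<open>Tensor products and their universal property\<close>

locale tensor_product = P: rmodule R P + M: rmodule R M
  for R :: "('r, 'x) ring_scheme" (structure) and P :: "('r, 'p) module" and M :: "('r, 'm) module"
begin

abbreviation F where "F \<equiv> free_mod R (carrier P \<times> carrier M)"
abbreviation K where "K \<equiv> tensor_ker R P M"
abbreviation tens (infixl "\<boxtimes>" 75) where "x \<boxtimes> y \<equiv> elem_tensor R P M x y"

sublocale F: rmodule R F
  by (rule rmoduleI[OF P.R.free_mod_module])

lemma gen_mem: "x \<in> carrier P \<Longrightarrow> y \<in> carrier M \<Longrightarrow> free_gen R (x, y) \<in> carrier F"
  by (rule P.R.free_gen_mem) simp

lemma relations_subset: "tensor_relations R P M \<subseteq> carrier F"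
  unfolding tensor_relations_def Let_def by (auto simp: gen_mem)

lemma K: "submodule K R F"
  unfolding tensor_ker_def by (rule F.submodule_gen_submodule[OF relations_subset])

lemma rel_K: "r \<in> tensor_relations R P M \<Longrightarrow> r \<in> K"
  unfolding tensor_ker_def by (rule subsetD[OF F.submodule_gen_incl])

lemma tensor_module: "Module.module R (tensor R P M)"
  unfolding tensor_def by (rule F.quot_module_module[OF K])

sublocale T: rmodule R "tensor R P M"
  by (rule rmoduleI[OF tensor_module])

lemma tens_closed: "\<lbrakk>x \<in> carrier P; y \<in> carrier M\<rbrakk> \<Longrightarrow> x \<boxtimes> y \<in> carrier (tensor R P M)"
  unfolding tensor_def elem_tensor_def F.quot_carrier[OF K] using gen_mem by blast

lemma tens_add_left:
  assumes "x \<in> carrier P" "x' \<in> carrier P" "y \<in> carrier M"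
  shows "(x \<oplus>\<^bsub>P\<^esub> x') \<boxtimes> y = x \<boxtimes> y \<oplus>\<^bsub>tensor R P M\<^esub> x' \<boxtimes> y"
proof -
  have "free_gen R (x \<oplus>\<^bsub>P\<^esub> x', y) \<ominus>\<^bsub>F\<^esub> (free_gen R (x, y) \<oplus>\<^bsub>F\<^esub> free_gen R (x', y)) \<in> K"
    by (rule rel_K) (use assms in \<open>auto simp: tensor_relations_def Let_def\<close>)
  then show ?thesis unfolding tensor_def elem_tensor_def
    using assms by (simp add: F.quot_add[OF K] F.rcoset_eq_iff[OF K] gen_mem)
qed

lemma tens_add_right:
  assumes "x \<in> carrier P" "y \<in> carrier M" "y' \<in> carrier M"
  shows "x \<boxtimes> (y \<oplus>\<^bsub>M\<^esub> y') = x \<boxtimes> y \<oplus>\<^bsub>tensor R P M\<^esub> x \<boxtimes> y'"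
proof -
  have "free_gen R (x, y \<oplus>\<^bsub>M\<^esub> y') \<ominus>\<^bsub>F\<^esub> (free_gen R (x, y) \<oplus>\<^bsub>F\<^esub> free_gen R (x, y')) \<in> K"
    by (rule rel_K) (use assms in \<open>auto simp: tensor_relations_def Let_def\<close>)
  then show ?thesis unfolding tensor_def elem_tensor_def
    using assms by (simp add: F.quot_add[OF K] F.rcoset_eq_iff[OF K] gen_mem)
qed

lemma tens_smult_left:
  assumes "r \<in> carrier R" "x \<in> carrier P" "y \<in> carrier M"
  shows "(r \<odot>\<^bsub>P\<^esub> x) \<boxtimes> y = r \<odot>\<^bsub>tensor R P M\<^esub> (x \<boxtimes> y)"
proof -
  have "free_gen R (r \<odot>\<^bsub>P\<^esub> x, y) \<ominus>\<^bsub>F\<^esub> (r \<odot>\<^bsub>F\<^esub> free_gen R (x, y)) \<in> K"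
    by (rule rel_K) (use assms in \<open>auto simp: tensor_relations_def Let_def\<close>)
  then show ?thesis unfolding tensor_def elem_tensor_def
    using assms by (simp add: F.quot_smult[OF K] F.rcoset_eq_iff[OF K] gen_mem)
qed

lemma tens_smult_right:
  assumes "r \<in> carrier R" "x \<in> carrier P" "y \<in> carrier M"
  shows "x \<boxtimes> (r \<odot>\<^bsub>M\<^esub> y) = r \<odot>\<^bsub>tensor R P M\<^esub> (x \<boxtimes> y)"
proof -
  have "free_gen R (x, r \<odot>\<^bsub>M\<^esub> y) \<ominus>\<^bsub>F\<^esub> (r \<odot>\<^bsub>F\<^esub> free_gen R (x, y)) \<in> K"
    by (rule rel_K) (use assms in \<open>auto simp: tensor_relations_def Let_def\<close>)
  then show ?thesis unfolding tensor_def elem_tensor_def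
    using assms by (simp add: F.quot_smult[OF K] F.rcoset_eq_iff[OF K] gen_mem)
qed

text \<open>Pulled back to the free module on pairs, H is a submodule containing all
  generators.\<close>

lemma tensor_induct:
  assumes H: "submodule H R (tensor R P M)"
    and gen: "\<And>x y. \<lbrakk>x \<in> carrier P; y \<in> carrier M\<rbrakk> \<Longrightarrow> x \<boxtimes> y \<in> H"
    and z: "z \<in> carrier (tensor R P M)"
  shows "z \<in> H"
proof -
  interpret q: mod_map R F "tensor R P M" "\<lambda>f. K +>\<^bsub>F\<^esub> f"
    using F.quot_proj_hom[OF K] by (intro mod_mapI F.module_M tensor_module) (simp add: tensor_def)
  obtain f where f: "f \<in> carrier F" "z = K +>\<^bsub>F\<^esub> f"
    using z unfolding tensor_def F.quot_carrier[OF K] by blast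
  have "f \<in> {f \<in> carrier F. K +>\<^bsub>F\<^esub> f \<in> H}"
  proof (rule P.R.free_mod_induct[OF q.vimage_submodule[OF H] _ f(1)])
    fix s assume "s \<in> carrier P \<times> carrier M"
    then show "free_gen R s \<in> {f \<in> carrier F. K +>\<^bsub>F\<^esub> f \<in> H}"
      using gen gen_mem unfolding elem_tensor_def by auto
  qed
  then show ?thesis using f by simp
qed

lemma tensor_hom_ext:
  assumes Q: "Module.module R Q" and f: "f \<in> mod_hom R (tensor R P M) Q" and g: "g \<in> mod_hom R (tensor R P M) Q"
    and eq: "\<And>x y. \<lbrakk>x \<in> carrier P; y \<in> carrier M\<rbrakk> \<Longrightarrow> f (x \<boxtimes> y) = g (x \<boxtimes> y)"
    and z: "z \<in> carrier (tensor R P M)"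
  shows "f z = g z"
proof -
  have "z \<in> {z \<in> carrier (tensor R P M). f z = g z}"
    by (rule tensor_induct[OF mod_hom_equalizer[OF tensor_module Q f g] _ z]) (auto simp: tens_closed eq)
  then show ?thesis by simp
qed

text \<open>The four bilinearity conditions kill the four families of relations, so the linear
  extension to the free module on pairs factors through the quotient.\<close>

lemma tensor_lift:
  fixes Q :: "('r, 'q) module"
  assumes Q: "Module.module R Q"
    and cl: "\<And>x y. \<lbrakk>x \<in> carrier P; y \<in> carrier M\<rbrakk> \<Longrightarrow> b x y \<in> carrier Q"
    and add_l: "\<And>x x' y. \<lbrakk>x \<in> carrier P; x' \<in> carrier P; y \<in> carrier M\<rbrakk> \<Longrightarrow> b (x \<oplus>\<^bsub>P\<^esub> x') y = b x y \<oplus>\<^bsub>Q\<^esub> b x' y"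
    and add_r: "\<And>x y y'. \<lbrakk>x \<in> carrier P; y \<in> carrier M; y' \<in> carrier M\<rbrakk> \<Longrightarrow> b x (y \<oplus>\<^bsub>M\<^esub> y') = b x y \<oplus>\<^bsub>Q\<^esub> b x y'"
    and smult_l: "\<And>r x y. \<lbrakk>r \<in> carrier R; x \<in> carrier P; y \<in> carrier M\<rbrakk> \<Longrightarrow> b (r \<odot>\<^bsub>P\<^esub> x) y = r \<odot>\<^bsub>Q\<^esub> b x y"
    and smult_r: "\<And>r x y. \<lbrakk>r \<in> carrier R; x \<in> carrier P; y \<in> carrier M\<rbrakk> \<Longrightarrow> b x (r \<odot>\<^bsub>M\<^esub> y) = r \<odot>\<^bsub>Q\<^esub> b x y"
  shows "\<exists>h\<in>mod_hom R (tensor R P M) Q. \<forall>x\<in>carrier P. \<forall>y\<in>carrier M. h (x \<boxtimes> y) = b x y"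
proof -
  interpret Q: rmodule R Q by (rule rmoduleI[OF Q])
  have "\<exists>h\<in>mod_hom R F Q. \<forall>s\<in>carrier P \<times> carrier M. h (free_gen R s) = b (fst s) (snd s)"
    by (rule Q.free_lift) (auto simp: cl)
  then obtain h where h: "h \<in> mod_hom R F Q" "\<And>x y. \<lbrakk>x \<in> carrier P; y \<in> carrier M\<rbrakk> \<Longrightarrow> h (free_gen R (x, y)) = b x y"
    by auto
  interpret h: mod_map R F Q h by (rule mod_mapI[OF F.module_M Q h(1)])
  have self: "u \<ominus>\<^bsub>Q\<^esub> u = \<zero>\<^bsub>Q\<^esub>" if "u \<in> carrier Q" for u
    using that Q.diff_eq_zero_iff by blast
  have "tensor_relations R P M \<subseteq> mod_ker F Q h"
  proof
    fix u assume u: "u \<in> tensor_relations R P M"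
    then have uF: "u \<in> carrier F" using relations_subset by blast
    from u have "h u = \<zero>\<^bsub>Q\<^esub>"
      unfolding tensor_relations_def Let_def
      by (auto simp: h.diff h.add h.smult h(2) gen_mem add_l add_r smult_l smult_r cl self)
    then show "u \<in> mod_ker F Q h" unfolding mod_ker_def using uF by simp
  qed
  then have "K \<subseteq> mod_ker F Q h" unfolding tensor_ker_def by (rule F.submodule_gen_least[OF h.ker_submodule])
  then have "\<And>u. u \<in> K \<Longrightarrow> h u = \<zero>\<^bsub>Q\<^esub>" unfolding mod_ker_def by blast
  from F.quot_lift[OF K Q h(1) this] obtain g
    where "g \<in> mod_hom R (tensor R P M) Q" "\<And>x. x \<in> carrier F \<Longrightarrow> g (K +>\<^bsub>F\<^esub> x) = h x"
    unfolding tensor_def by auto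
  then show ?thesis using h(2) gen_mem unfolding elem_tensor_def by (intro bexI[of _ g]) auto
qed

end

text \<open>Justifies the choice made in \<open>tensor_map\<close>: sending (x, y) to f(x) \<otimes>
  y is bilinear, so a map with the chosen property exists.\<close>

lemma tensor_map_spec:
  assumes P: "Module.module R P" and Q: "Module.module R Q" and M: "Module.module R M" and f: "f \<in> mod_hom R P Q"
  shows "tensor_map R P Q M f \<in> mod_hom R (tensor R P M) (tensor R Q M)"
    and "\<lbrakk>x \<in> carrier P; y \<in> carrier M\<rbrakk> \<Longrightarrow>
      tensor_map R P Q M f (elem_tensor R P M x y) = elem_tensor R Q M (f x) y"
proof -
  interpret PM: tensor_product R P M by (simp add: tensor_product_def rmoduleI P M)
  interpret QM: tensor_product R Q M by (simp add: tensor_product_def rmoduleI Q M)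
  interpret f: mod_map R P Q f by (rule mod_mapI[OF P Q f])
  have "\<exists>h\<in>mod_hom R (tensor R P M) (tensor R Q M).
      \<forall>x\<in>carrier P. \<forall>y\<in>carrier M. h (elem_tensor R P M x y) = elem_tensor R Q M (f x) y"
    by (rule PM.tensor_lift[OF QM.tensor_module])
      (auto simp: f.closed f.add f.smult QM.tens_closed QM.tens_add_left QM.tens_add_right
        QM.tens_smult_left QM.tens_smult_right)
  then have ex: "\<exists>h. h \<in> mod_hom R (tensor R P M) (tensor R Q M) \<and>
      (\<forall>x\<in>carrier P. \<forall>y\<in>carrier M. h (elem_tensor R P M x y) = elem_tensor R Q M (f x) y)" by blast
  note * = someI_ex[OF ex, folded tensor_map_def]
  show "tensor_map R P Q M f \<in> mod_hom R (tensor R P M) (tensor R Q M)" using * by blast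
  show "tensor_map R P Q M f (elem_tensor R P M x y) = elem_tensor R Q M (f x) y"
    if "x \<in> carrier P" "y \<in> carrier M" using * that by blast
qed

lemma mod_hom_add:
  assumes N: "Module.module R N" and f: "f \<in> mod_hom R M N" and g: "g \<in> mod_hom R M N"
  shows "(\<lambda>x. f x \<oplus>\<^bsub>N\<^esub> g x) \<in> mod_hom R M N"
proof -
  interpret N: rmodule R N by (rule rmoduleI[OF N])
  show ?thesis
    by (rule mod_homI) (auto simp: mod_homD[OF f] mod_homD[OF g] N.M.a_ac N.smult_r_distr)
qed

lemma mod_hom_smult:
  assumes N: "Module.module R N" and f: "f \<in> mod_hom R M N" and r: "r \<in> carrier R"
  shows "(\<lambda>x. r \<odot>\<^bsub>N\<^esub> f x) \<in> mod_hom R M N"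
proof -
  interpret N: rmodule R N by (rule rmoduleI[OF N])
  show ?thesis
    by (rule mod_homI) (auto simp: mod_homD[OF f] N.smult_r_distr r N.smult_commute[of r])
qed

lemma mod_hom_ident: "(\<lambda>x. x) \<in> mod_hom R M M"
  by (rule mod_homI) auto

lemma mod_hom_zero: "Module.module R N \<Longrightarrow> (\<lambda>x. \<zero>\<^bsub>N\<^esub>) \<in> mod_hom R M N"
proof -
  assume N: "Module.module R N"
  interpret N: rmodule R N by (rule rmoduleI[OF N])
  show ?thesis by (rule mod_homI) auto
qed

text \<open>
  For a free module of finite rank, \<open>F \<otimes> M\<close> is a sum of finitely many copies of \<open>M\<close>.
\<close>

lemma tensor_free_lin_compact:
  assumes M: "Module.module R M" and S: "finite S" and lc: "lin_compact R M (carrier M)"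
  shows "lin_compact R (tensor R (free_mod R S) M) (carrier (tensor R (free_mod R S) M))"
proof -
  interpret M: rmodule R M by (rule rmoduleI[OF M])
  interpret T: tensor_product R "free_mod R S" M
    by (simp add: tensor_product_def rmoduleI M M.R.free_mod_module)
  let ?T = "tensor R (free_mod R S) M" and ?e = "free_gen R"
  \<comment> \<open>The basis elements are added one at a time, each contributing the image of M
    under tensoring with that basis element.\<close>
  have "\<exists>H. submodule H R ?T \<and> lin_compact R ?T H \<and> (\<forall>s\<in>A. \<forall>y\<in>carrier M. elem_tensor R (free_mod R S) M (?e s) y \<in> H)"
    if "finite A" "A \<subseteq> S" for A
    using that
  proof (induction A rule: finite_induct)
    case empty
    have "lin_compact R ?T {\<zero>\<^bsub>?T\<^esub>}"
    proof -
      have "(\<lambda>x. \<zero>\<^bsub>?T\<^esub>) \<in> mod_hom R M ?T" by (rule mod_hom_zero[OF T.tensor_module])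
      from lin_compact_image[OF M T.tensor_module this M.carrier_is_submodule lc]
      have "lin_compact R ?T ((\<lambda>x. \<zero>\<^bsub>?T\<^esub>) ` carrier M)" .
      moreover have "(\<lambda>x. \<zero>\<^bsub>?T\<^esub>) ` carrier M = {\<zero>\<^bsub>?T\<^esub>}" using M.M.zero_closed by blast
      ultimately show ?thesis by simp
    qed
    then show ?case using T.T.submodule_zero_set by auto
  next
    case (insert s A)
    then obtain H where H: "submodule H R ?T" "lin_compact R ?T H"
      and gen: "\<And>s y. \<lbrakk>s \<in> A; y \<in> carrier M\<rbrakk> \<Longrightarrow> elem_tensor R (free_mod R S) M (?e s) y \<in> H" by auto
    have es: "?e s \<in> carrier (free_mod R S)" using insert.prems by (intro M.R.free_gen_mem) auto
    let ?j = "elem_tensor R (free_mod R S) M (?e s)"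
    have j: "?j \<in> mod_hom R M ?T"
      by (rule mod_homI) (auto simp: es T.tens_closed T.tens_add_right T.tens_smult_right)
    interpret j: mod_map R M ?T ?j by (rule mod_mapI[OF M T.tensor_module j])
    let ?H = "{h \<oplus>\<^bsub>?T\<^esub> k | h k. h \<in> H \<and> k \<in> ?j ` carrier M}"
    have sub: "submodule ?H R ?T"
      by (rule T.T.submodule_sum[OF H(1) j.image_submodule[OF M.carrier_is_submodule]])
    have "lin_compact R ?T {x \<oplus>\<^bsub>?T\<^esub> ?j y | x y. x \<in> H \<and> y \<in> carrier M}"
      by (rule lin_compact_sum[OF T.tensor_module M T.tensor_module mod_hom_ident j H M.carrier_is_submodule lc])
    moreover have "?H = {x \<oplus>\<^bsub>?T\<^esub> ?j y | x y. x \<in> H \<and> y \<in> carrier M}" by blast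
    ultimately have "lin_compact R ?T ?H" by simp
    moreover have "elem_tensor R (free_mod R S) M (?e t) y \<in> ?H" if t: "t \<in> insert s A" and y: "y \<in> carrier M" for t y
    proof (cases "t = s")
      case True
      have "?j y = \<zero>\<^bsub>?T\<^esub> \<oplus>\<^bsub>?T\<^esub> ?j y" using j.closed[OF y] by simp
      then show ?thesis using True T.T.submodule_zero[OF H(1)] y by blast
    next
      case False
      then have h: "elem_tensor R (free_mod R S) M (?e t) y \<in> H" using gen t y by blast
      then have "elem_tensor R (free_mod R S) M (?e t) y =
          elem_tensor R (free_mod R S) M (?e t) y \<oplus>\<^bsub>?T\<^esub> ?j \<zero>\<^bsub>M\<^esub>"
        using T.T.submodule_mem[OF H(1) h] j.zero by simp
      then show ?thesis using h M.M.zero_closed by blast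
    qed
    ultimately show ?case using sub by blast
  qed
  from this[OF S subset_refl] obtain H where H: "submodule H R ?T" "lin_compact R ?T H"
    and gen: "\<And>s y. \<lbrakk>s \<in> S; y \<in> carrier M\<rbrakk> \<Longrightarrow> elem_tensor R (free_mod R S) M (?e s) y \<in> H" by blast
  have "carrier ?T \<subseteq> H"
  proof
    fix z assume z: "z \<in> carrier ?T"
    show "z \<in> H"
    proof (rule T.tensor_induct[OF H(1) _ z])
      fix f y assume f: "f \<in> carrier (free_mod R S)" and y: "y \<in> carrier M"
      let ?i = "\<lambda>f. elem_tensor R (free_mod R S) M f y"
      have i: "?i \<in> mod_hom R (free_mod R S) ?T"
        by (rule mod_homI) (auto simp: y T.tens_closed T.tens_add_left T.tens_smult_left)
      interpret i: mod_map R "free_mod R S" ?T ?i by (rule mod_mapI[OF M.R.free_mod_module T.tensor_module i])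
      have "f \<in> {f \<in> carrier (free_mod R S). ?i f \<in> H}"
        by (rule M.R.free_mod_induct[OF i.vimage_submodule[OF H(1)] _ f])
          (auto simp: M.R.free_gen_mem gen y)
      then show "?i f \<in> H" by simp
    qed
  qed
  then show ?thesis using H(2) lin_compact_mono by blast
qed

section \<open>Free resolutions\<close>

text \<open>Induction on the number of generators. H is generated by the part of it inside the span
  of X, finitely generated by induction, together with lifts of finitely many generators of the
  ideal of coefficients of x occurring in H.\<close>

lemma (in rmodule) noetherian_submodule_fg:
  assumes noeth: "noetherian_ring R" and X: "finite X" "X \<subseteq> carrier M"
    and H: "submodule H R M" "H \<subseteq> submodule_gen R M X"
  shows "\<exists>Y. finite Y \<and> Y \<subseteq> H \<and> H = submodule_gen R M Y"
  using X H
proof (induction X arbitrary: H rule: finite_induct)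
  case empty
  then have "H = submodule_gen R M {}" using submodule_zero by (auto simp: submodule_gen_empty)
  then show ?case by blast
next
  case (insert x X)
  let ?g = "submodule_gen R M"
  have X: "X \<subseteq> carrier M" and x: "x \<in> carrier M" using insert.prems by auto
  have H: "submodule H R M" and Hsub: "H \<subseteq> ?g (insert x X)" using insert.prems by auto
  have N: "submodule (?g X) R M" by (rule submodule_gen_submodule[OF X])
  obtain Y where Y: "finite Y" "Y \<subseteq> H \<inter> ?g X" "H \<inter> ?g X = ?g Y"
    using insert.IH[OF X submodule_Int[OF H N]] by blast
  \<comment> \<open>The coefficients of x that occur in K modulo the span of X. The finitely
    generated L below is chosen so that it realises all coefficients occurring in H.\<close>
  define J where "J K = colon R M {n \<oplus>\<^bsub>M\<^esub> k | n k. n \<in> ?g X \<and> k \<in> K} x" for K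
  have J: "ideal (J K) R" if "submodule K R M" for K
    unfolding J_def by (rule colon_ideal[OF submodule_sum[OF N that] x])
  obtain A where A: "A \<subseteq> carrier R" "finite A" "J H = Idl A"
    using noetherian_ring.finetely_gen[OF noeth J[OF H]] by blast
  have "\<exists>k\<in>H. \<exists>n\<in>?g X. a \<odot>\<^bsub>M\<^esub> x = n \<oplus>\<^bsub>M\<^esub> k" if "a \<in> A" for a
  proof -
    have "a \<in> J H" using that R.genideal_self[OF A(1)] A(3) by blast
    then show ?thesis unfolding J_def colon_def by blast
  qed
  then obtain \<kappa> where \<kappa>: "\<And>a. a \<in> A \<Longrightarrow> \<kappa> a \<in> H" "\<And>a. a \<in> A \<Longrightarrow> \<exists>n\<in>?g X. a \<odot>\<^bsub>M\<^esub> x = n \<oplus>\<^bsub>M\<^esub> \<kappa> a"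
    by metis
  have \<kappa>M: "\<kappa> ` A \<subseteq> carrier M" using \<kappa>(1) submodule_mem[OF H] by blast
  let ?L = "?g (\<kappa> ` A)"
  have L: "submodule ?L R M" by (rule submodule_gen_submodule[OF \<kappa>M])
  have LH: "?L \<subseteq> H" by (rule submodule_gen_least[OF H]) (use \<kappa>(1) in blast)
  have "J H \<subseteq> J ?L" unfolding A(3)
  proof (rule R.genideal_minimal[OF J[OF L]])
    show "A \<subseteq> J ?L"
    proof
      fix a assume a: "a \<in> A"
      have "\<kappa> a \<in> ?L" by (rule subsetD[OF submodule_gen_incl]) (use a in blast)
      then show "a \<in> J ?L" unfolding J_def colon_def using \<kappa>(2)[OF a] a A(1) by blast
    qed
  qed
  have YM: "Y \<subseteq> carrier M" using Y(2) submodule_mem[OF H] by blast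
  have sub: "submodule (?g (Y \<union> \<kappa> ` A)) R M"
    by (rule submodule_gen_submodule) (use YM \<kappa>M in blast)
  have "H \<subseteq> ?g (Y \<union> \<kappa> ` A)"
  proof
    fix z assume z: "z \<in> H"
    then obtain n r where n: "n \<in> ?g X" "r \<in> carrier R" "z = n \<oplus>\<^bsub>M\<^esub> r \<odot>\<^bsub>M\<^esub> x"
      using Hsub submodule_gen_insert[OF X x] by blast
    have nM: "n \<in> carrier M" using submodule_mem[OF N n(1)] .
    have "r \<odot>\<^bsub>M\<^esub> x = \<ominus>\<^bsub>M\<^esub> n \<oplus>\<^bsub>M\<^esub> z" unfolding n(3) using nM n(2) x by (simp add: M.r_neg1)
    then have "r \<in> J H" unfolding J_def colon_def using n(2) z submoduleE(3)[OF N n(1)] by blast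
    then have "r \<in> J ?L" using \<open>J H \<subseteq> J ?L\<close> by blast
    then obtain n' l where n': "n' \<in> ?g X" "l \<in> ?L" "r \<odot>\<^bsub>M\<^esub> x = n' \<oplus>\<^bsub>M\<^esub> l" unfolding J_def colon_def by blast
    have c: "n' \<in> carrier M" "l \<in> carrier M" using submodule_mem[OF N n'(1)] submodule_mem[OF L n'(2)] by auto
    \<comment> \<open>l has the same coefficient of x as z modulo the span of X, so the remainder
      lies both in H and in that span.\<close>
    have zl: "z = l \<oplus>\<^bsub>M\<^esub> (n \<oplus>\<^bsub>M\<^esub> n')" unfolding n(3) n'(3) using nM c by (simp add: M.a_ac)
    have "n \<oplus>\<^bsub>M\<^esub> n' \<in> H"
      using submodule_add_cancel[OF H, of l "n \<oplus>\<^bsub>M\<^esub> n'"] z zl n'(2) LH nM c by auto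
    then have "n \<oplus>\<^bsub>M\<^esub> n' \<in> ?g Y" using submoduleE(5)[OF N n(1) n'(1)] Y(3) by blast
    moreover have "?g Y \<subseteq> ?g (Y \<union> \<kappa> ` A)" "?L \<subseteq> ?g (Y \<union> \<kappa> ` A)"
      by (rule submodule_gen_mono, blast)+
    ultimately show "z \<in> ?g (Y \<union> \<kappa> ` A)" unfolding zl using n'(2) submoduleE(5)[OF sub] by blast
  qed
  moreover have "?g (Y \<union> \<kappa> ` A) \<subseteq> H" by (rule submodule_gen_least[OF H]) (use Y(2) \<kappa>(1) in blast)
  ultimately show ?case using Y \<kappa>(1) A(2) by (intro exI[of _ "Y \<union> \<kappa> ` A"]) auto
qed

text \<open>An infinite type has subsets of every finite size, so the basis can be found in any
  prescribed infinite type.\<close>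

lemma (in rmodule) free_cover:
  assumes b: "infinite (UNIV :: 'b set)" and Y: "finite Y" "Y \<subseteq> carrier M"
  shows "\<exists>(S :: 'b set) d. finite S \<and> d \<in> mod_hom R (free_mod R S) M \<and>
    d ` carrier (free_mod R S) = submodule_gen R M Y"
proof -
  obtain S :: "'b set" where S: "finite S" "card S = card Y"
    using infinite_arbitrarily_large[OF b] by blast
  then obtain g where g: "bij_betw g S Y" using finite_same_card_bij Y(1) by blast
  have gS: "g s \<in> Y" if "s \<in> S" for s using g that by (rule bij_betw_apply)
  obtain d where d: "d \<in> mod_hom R (free_mod R S) M" "\<And>s. s \<in> S \<Longrightarrow> d (free_gen R s) = g s"
    using free_lift[of S g] gS Y(2) by blast
  interpret d: mod_map R "free_mod R S" M d by (rule mod_mapI[OF R.free_mod_module module_M d(1)])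
  have gen: "submodule (submodule_gen R M Y) R M" by (rule submodule_gen_submodule[OF Y(2)])
  have "d ` carrier (free_mod R S) = submodule_gen R M Y"
  proof
    show "submodule_gen R M Y \<subseteq> d ` carrier (free_mod R S)"
    proof (rule submodule_gen_least[OF d.image_submodule[OF d.M.carrier_is_submodule]])
      show "Y \<subseteq> d ` carrier (free_mod R S)"
      proof
        fix y assume "y \<in> Y"
        then obtain s where "s \<in> S" "y = g s" using g unfolding bij_betw_def by blast
        then show "y \<in> d ` carrier (free_mod R S)" using d(2) R.free_gen_mem by (metis imageI)
      qed
    qed
    show "d ` carrier (free_mod R S) \<subseteq> submodule_gen R M Y"
    proof (rule image_subsetI)
      fix x assume x: "x \<in> carrier (free_mod R S)"
      have "x \<in> {x \<in> carrier (free_mod R S). d x \<in> submodule_gen R M Y}"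
        by (rule R.free_mod_induct[OF d.vimage_submodule[OF gen] _ x])
          (use gS d(2) submodule_gen_incl[of Y] in \<open>auto simp: R.free_gen_mem\<close>)
      then show "d x \<in> submodule_gen R M Y" by simp
    qed
  qed
  then show ?thesis using S(1) d(1) by blast
qed

text \<open>Over a noetherian ring the kernel is finitely generated, so the next module of a
  resolution again has a finite basis.\<close>

lemma free_kernel_cover:
  assumes R: "cring R" and noeth: "noetherian_ring R" and b: "infinite (UNIV :: 'b set)"
    and S: "finite (S :: 'c set)" and B: "Module.module R B" and h: "h \<in> mod_hom R (free_mod R S) B"
  shows "\<exists>(S' :: 'b set) d. finite S' \<and> d \<in> mod_hom R (free_mod R S') (free_mod R S) \<and>
    mod_ker (free_mod R S) B h = d ` carrier (free_mod R S')"
proof -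
  interpret R: cring R by (rule R)
  interpret h: mod_map R "free_mod R S" B h by (rule mod_mapI[OF R.free_mod_module B h])
  let ?X = "free_gen R ` S"
  have X: "finite ?X" "?X \<subseteq> carrier (free_mod R S)" using S R.free_gen_mem by auto
  have "carrier (free_mod R S) \<subseteq> submodule_gen R (free_mod R S) ?X"
  proof
    fix f assume "f \<in> carrier (free_mod R S)"
    then show "f \<in> submodule_gen R (free_mod R S) ?X"
      by (rule R.free_mod_induct[OF h.M.submodule_gen_submodule[OF X(2)], rotated])
        (rule subsetD[OF h.M.submodule_gen_incl], blast)
  qed
  then have "mod_ker (free_mod R S) B h \<subseteq> submodule_gen R (free_mod R S) ?X" unfolding mod_ker_def by blast
  then obtain Y where Y: "finite Y" "Y \<subseteq> mod_ker (free_mod R S) B h"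
      "mod_ker (free_mod R S) B h = submodule_gen R (free_mod R S) Y"
    using h.M.noetherian_submodule_fg[OF noeth X h.ker_submodule] by blast
  have "Y \<subseteq> carrier (free_mod R S)" using Y(2) unfolding mod_ker_def by blast
  then show ?thesis using h.M.free_cover[OF b Y(1)] Y(3) by metis
qed

lemma finite_free_resolution:
  fixes A :: "('r, 'a) module"
  assumes R: "cring R" and noeth: "noetherian_ring R" and b: "infinite (UNIV :: 'b set)"
    and A: "Module.module R A" and X: "finite X" "X \<subseteq> carrier A" "carrier A = submodule_gen R A X"
  shows "\<exists>(S :: nat \<Rightarrow> 'b set) d \<epsilon>. free_resolution R A S d \<epsilon> \<and> (\<forall>n. finite (S n))"
proof -
  interpret A: rmodule R A by (rule rmoduleI[OF A])
  obtain S0 :: "'b set" and \<epsilon> where S0: "finite S0" and \<epsilon>: "\<epsilon> \<in> mod_hom R (free_mod R S0) A"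
    "\<epsilon> ` carrier (free_mod R S0) = carrier A"
    using A.free_cover[OF b X(1,2)] X(3) by metis
  \<comment> \<open>A state is one differential with its target and source bases; \<open>Q\<close>
    makes the source basis the next target basis. The clause for n = 0 ties the first differential
    to the augmentation.\<close>
  define P where "P n z \<longleftrightarrow> (case z of (S, S', d) \<Rightarrow> finite S \<and> finite S' \<and>
      d \<in> mod_hom R (free_mod R S') (free_mod R S) \<and>
      (n = 0 \<longrightarrow> S = S0 \<and> mod_ker (free_mod R S0) A \<epsilon> = d ` carrier (free_mod R S')))"
    for n :: nat and z :: "'b set \<times> 'b set \<times> (('b \<Rightarrow> 'r) \<Rightarrow> 'b \<Rightarrow> 'r)"
  define Q where "Q z w \<longleftrightarrow> (case z of (S, S', d) \<Rightarrow> case w of (T, T', e) \<Rightarrow> T = S' \<and>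
      mod_ker (free_mod R S') (free_mod R S) d = e ` carrier (free_mod R T'))"
    for z w :: "'b set \<times> 'b set \<times> (('b \<Rightarrow> 'r) \<Rightarrow> 'b \<Rightarrow> 'r)"
  have "\<exists>f. \<forall>n. P n (f n) \<and> Q (f n) (f (Suc n))"
  proof (rule dependent_nat_choice)
    obtain S' :: "'b set" and d where "finite S'" "d \<in> mod_hom R (free_mod R S') (free_mod R S0)"
      "mod_ker (free_mod R S0) A \<epsilon> = d ` carrier (free_mod R S')"
      using free_kernel_cover[OF R noeth b S0 A \<epsilon>(1)] by blast
    then have "P 0 (S0, S', d)" unfolding P_def using S0 by simp
    then show "\<exists>z. P 0 z" by blast
    fix z n assume Pz: "P n z"
    obtain S S' d where z: "z = (S, S', d)" by (cases z) auto
    have d: "finite S'" "d \<in> mod_hom R (free_mod R S') (free_mod R S)" using Pz unfolding P_def z by auto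
    obtain T' :: "'b set" and e where T': "finite T'" "e \<in> mod_hom R (free_mod R T') (free_mod R S')"
      "mod_ker (free_mod R S') (free_mod R S) d = e ` carrier (free_mod R T')"
      using free_kernel_cover[OF R noeth b d(1) A.R.free_mod_module d(2)] by blast
    have "P (Suc n) (S', T', e)" unfolding P_def using T' d by simp
    moreover have "Q z (S', T', e)" unfolding Q_def z using T' by simp
    ultimately show "\<exists>w. P (Suc n) w \<and> Q z w" by blast
  qed
  then obtain f where f: "\<And>n. P n (f n)" "\<And>n. Q (f n) (f (Suc n))" by blast
  define S where "S n = fst (f n)" for n
  define d where "d n = snd (snd (f n))" for n
  have S_Suc: "fst (snd (f n)) = S (Suc n)" for n
    using f(2)[of n] unfolding Q_def S_def by (simp add: split_beta)
  have fin: "finite (S n)" and dn: "d n \<in> mod_hom R (free_mod R (S (Suc n))) (free_mod R (S n))" for n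
    using f(1)[of n] S_Suc[of n] unfolding P_def S_def d_def by (simp_all add: split_beta)
  have ex: "mod_ker (free_mod R (S (Suc n))) (free_mod R (S n)) (d n) = d (Suc n) ` carrier (free_mod R (S (Suc (Suc n))))" for n
    using f(2)[of n] S_Suc[of n] S_Suc[of "Suc n"] unfolding Q_def S_def d_def by (simp add: split_beta)
  have S_0: "S 0 = S0" and ex0: "mod_ker (free_mod R S0) A \<epsilon> = d 0 ` carrier (free_mod R (S (Suc 0)))"
    using f(1)[of 0] S_Suc[of 0] unfolding P_def S_def d_def by (simp_all add: split_beta)
  have "free_resolution R A S d \<epsilon>"
    unfolding free_resolution_def using \<epsilon> dn ex S_0 ex0 by simp
  then show ?thesis using fin by blast
qed

section \<open>Comparison of free resolutions\<close>

lemma free_projective: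
  assumes C: "Module.module R C" and B: "Module.module R B" and d: "d \<in> mod_hom R C B"
    and h: "h \<in> mod_hom R (free_mod R S) B"
    and im: "\<And>x. x \<in> carrier (free_mod R S) \<Longrightarrow> h x \<in> d ` carrier C"
  shows "\<exists>k\<in>mod_hom R (free_mod R S) C. \<forall>x\<in>carrier (free_mod R S). d (k x) = h x"
proof -
  interpret C: rmodule R C by (rule rmoduleI[OF C])
  have "\<forall>s\<in>S. \<exists>c\<in>carrier C. d c = h (free_gen R s)" using im C.R.free_gen_mem by (metis imageE)
  then obtain c where c: "\<And>s. s \<in> S \<Longrightarrow> c s \<in> carrier C" "\<And>s. s \<in> S \<Longrightarrow> d (c s) = h (free_gen R s)"
    by metis
  obtain k where k: "k \<in> mod_hom R (free_mod R S) C" "\<And>s. s \<in> S \<Longrightarrow> k (free_gen R s) = c s"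
    using C.free_lift[of S c] c(1) by blast
  have "d (k x) = h x" if x: "x \<in> carrier (free_mod R S)" for x
    by (rule free_mod_hom_ext[OF C.R.is_cring B mod_hom_comp[OF k(1) d] h _ x]) (simp add: k c)
  then show ?thesis using k(1) by blast
qed

locale free_res = A: rmodule R A for R :: "('r, 'x) ring_scheme" (structure) and A :: "('r, 'a) module" +
  fixes S :: "nat \<Rightarrow> 'b set" and d \<epsilon>
  assumes res: "free_resolution R A S d \<epsilon>"
begin

abbreviation F where "F n \<equiv> free_mod R (S n)"

sublocale F: rmodule R "F n" for n
  by (rule rmoduleI[OF A.R.free_mod_module])

lemma eps: "\<epsilon> \<in> mod_hom R (F 0) A" and dif: "d n \<in> mod_hom R (F (Suc n)) (F n)"
  using res unfolding free_resolution_def by auto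

sublocale eps: mod_map R "F 0" A \<epsilon>
  by (rule mod_mapI[OF F.module_M A.module_M eps])

sublocale d: mod_map R "F (Suc n)" "F n" "d n" for n
  by (rule mod_mapI[OF F.module_M F.module_M dif])

lemma eps_surj: "\<epsilon> ` carrier (F 0) = carrier A"
  using res unfolding free_resolution_def by auto

lemma eps_d: "x \<in> carrier (F (Suc 0)) \<Longrightarrow> \<epsilon> (d 0 x) = \<zero>\<^bsub>A\<^esub>"
  using res unfolding free_resolution_def mod_ker_def by auto

lemma d_d: "x \<in> carrier (F (Suc (Suc n))) \<Longrightarrow> d n (d (Suc n) x) = \<zero>\<^bsub>F n\<^esub>"
  using res unfolding free_resolution_def mod_ker_def by blast

lemma exact_0: "\<lbrakk>x \<in> carrier (F 0); \<epsilon> x = \<zero>\<^bsub>A\<^esub>\<rbrakk> \<Longrightarrow> x \<in> d 0 ` carrier (F (Suc 0))"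
  using res unfolding free_resolution_def mod_ker_def by auto

lemma exact_Suc: "\<lbrakk>x \<in> carrier (F (Suc n)); d n x = \<zero>\<^bsub>F n\<^esub>\<rbrakk> \<Longrightarrow> x \<in> d (Suc n) ` carrier (F (Suc (Suc n)))"
  using res unfolding free_resolution_def mod_ker_def by blast

end

locale res_pair = F: free_res R A S d \<epsilon> + G: free_res R A S' d' \<epsilon>'
  for R :: "('r, 'x) ring_scheme" (structure) and A :: "('r, 'a) module"
    and S :: "nat \<Rightarrow> 'b set" and d \<epsilon> and S' :: "nat \<Rightarrow> 'c set" and d' \<epsilon>'
begin

text \<open>The comparison theorem. The last clause of the invariant \<open>P\<close>, that k
  carries the image of d into the image of d', is what makes the next lift possible.\<close>

lemma chain_map:
  "\<exists>\<phi>. (\<forall>n. \<phi> n \<in> mod_hom R (F.F n) (G.F n)) \<and> (\<forall>x\<in>carrier (F.F 0). \<epsilon>' (\<phi> 0 x) = \<epsilon> x) \<and>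
    (\<forall>n. \<forall>x\<in>carrier (F.F (Suc n)). d' n (\<phi> (Suc n) x) = \<phi> n (d n x))"
proof -
  define P where "P n k \<longleftrightarrow> k \<in> mod_hom R (F.F n) (G.F n) \<and>
    (n = 0 \<longrightarrow> (\<forall>x\<in>carrier (F.F 0). \<epsilon>' (k x) = \<epsilon> x)) \<and>
    (\<forall>x\<in>carrier (F.F (Suc n)). k (d n x) \<in> d' n ` carrier (G.F (Suc n)))" for n k
  have "\<exists>\<phi>. \<forall>n. P n (\<phi> n) \<and> (\<forall>x\<in>carrier (F.F (Suc n)). d' n (\<phi> (Suc n) x) = \<phi> n (d n x))"
  proof (rule dependent_nat_choice)
    have "\<exists>k\<in>mod_hom R (F.F 0) (G.F 0). \<forall>x\<in>carrier (F.F 0). \<epsilon>' (k x) = \<epsilon> x"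
      by (rule free_projective[OF G.F.module_M F.A.module_M G.eps F.eps]) (simp add: G.eps_surj F.eps.closed)
    then obtain k where k: "k \<in> mod_hom R (F.F 0) (G.F 0)" "\<And>x. x \<in> carrier (F.F 0) \<Longrightarrow> \<epsilon>' (k x) = \<epsilon> x" by blast
    have "k (d 0 x) \<in> d' 0 ` carrier (G.F (Suc 0))" if x: "x \<in> carrier (F.F (Suc 0))" for x
      using F.d.closed[OF x] F.eps_d[OF x] k(2) by (intro G.exact_0 mod_homD(1)[OF k(1)]) auto
    then show "\<exists>k. P 0 k" unfolding P_def using k by blast
    fix k n assume Pk: "P n k"
    have k: "k \<in> mod_hom R (F.F n) (G.F n)" using Pk unfolding P_def by blast
    interpret k: mod_map R "F.F n" "G.F n" k by (rule mod_mapI[OF F.F.module_M G.F.module_M k])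
    have "\<exists>k'\<in>mod_hom R (F.F (Suc n)) (G.F (Suc n)). \<forall>x\<in>carrier (F.F (Suc n)). d' n (k' x) = k (d n x)"
      by (rule free_projective[OF G.F.module_M G.F.module_M G.dif mod_hom_comp[OF F.dif k]])
        (use Pk in \<open>simp add: P_def\<close>)
    then obtain k' where k': "k' \<in> mod_hom R (F.F (Suc n)) (G.F (Suc n))"
      "\<And>x. x \<in> carrier (F.F (Suc n)) \<Longrightarrow> d' n (k' x) = k (d n x)" by blast
    have "k' (d (Suc n) x) \<in> d' (Suc n) ` carrier (G.F (Suc (Suc n)))" if x: "x \<in> carrier (F.F (Suc (Suc n)))" for x
    proof (rule G.exact_Suc)
      show "k' (d (Suc n) x) \<in> carrier (G.F (Suc n))" using mod_homD(1)[OF k'(1)] F.d.closed[OF x] by blast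
      show "d' n (k' (d (Suc n) x)) = \<zero>\<^bsub>G.F n\<^esub>" using k'(2)[OF F.d.closed[OF x]] F.d_d[OF x] k.zero by simp
    qed
    then have "P (Suc n) k'" unfolding P_def using k'(1) by simp
    then show "\<exists>k'. P (Suc n) k' \<and> (\<forall>x\<in>carrier (F.F (Suc n)). d' n (k' x) = k (d n x))" using k'(2) by blast
  qed
  then obtain \<phi> where \<phi>: "\<And>n. P n (\<phi> n)"
    "\<And>n. \<forall>x\<in>carrier (F.F (Suc n)). d' n (\<phi> (Suc n) x) = \<phi> n (d n x)" by blast
  then show ?thesis unfolding P_def by (intro exI[of _ \<phi>] conjI allI) auto
qed

text \<open>A chain map over the zero map of A is null-homotopic. The next component of the homotopy
  lifts \<theta> - s d through d'; this difference is a cycle by the last clause of the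
  invariant.\<close>

lemma homotopy:
  assumes \<theta>: "\<And>n. \<theta> n \<in> mod_hom R (F.F n) (G.F n)"
    and \<theta>0: "\<And>x. x \<in> carrier (F.F 0) \<Longrightarrow> \<epsilon>' (\<theta> 0 x) = \<zero>\<^bsub>A\<^esub>"
    and \<theta>d: "\<And>n x. x \<in> carrier (F.F (Suc n)) \<Longrightarrow> d' n (\<theta> (Suc n) x) = \<theta> n (d n x)"
  shows "\<exists>s. (\<forall>n. s n \<in> mod_hom R (F.F n) (G.F (Suc n))) \<and>
    (\<forall>x\<in>carrier (F.F 0). \<theta> 0 x = d' 0 (s 0 x)) \<and>
    (\<forall>n. \<forall>x\<in>carrier (F.F (Suc n)). \<theta> (Suc n) x = d' (Suc n) (s (Suc n) x) \<oplus>\<^bsub>G.F (Suc n)\<^esub> s n (d n x))"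
proof -
  define P where "P n s \<longleftrightarrow> s \<in> mod_hom R (F.F n) (G.F (Suc n)) \<and>
    (n = 0 \<longrightarrow> (\<forall>x\<in>carrier (F.F 0). \<theta> 0 x = d' 0 (s x))) \<and>
    (\<forall>x\<in>carrier (F.F (Suc n)). d' n (s (d n x)) = \<theta> n (d n x))" for n s
  have \<theta>M: "mod_map R (F.F n) (G.F n) (\<theta> n)" for n
    by (rule mod_mapI[OF F.F.module_M G.F.module_M \<theta>])
  have "\<exists>s. \<forall>n. P n (s n) \<and>
    (\<forall>x\<in>carrier (F.F (Suc n)). \<theta> (Suc n) x = d' (Suc n) (s (Suc n) x) \<oplus>\<^bsub>G.F (Suc n)\<^esub> s n (d n x))"
  proof (rule dependent_nat_choice)
    have "\<exists>s\<in>mod_hom R (F.F 0) (G.F (Suc 0)). \<forall>x\<in>carrier (F.F 0). d' 0 (s x) = \<theta> 0 x"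
      by (rule free_projective[OF G.F.module_M G.F.module_M G.dif \<theta>])
        (intro G.exact_0 mod_homD(1)[OF \<theta>] \<theta>0)
    then obtain s where s: "s \<in> mod_hom R (F.F 0) (G.F (Suc 0))" "\<And>x. x \<in> carrier (F.F 0) \<Longrightarrow> d' 0 (s x) = \<theta> 0 x" by blast
    then have "P 0 s" unfolding P_def using F.d.closed by auto
    then show "\<exists>s. P 0 s" by blast
    fix s n assume Ps: "P n s"
    have s: "s \<in> mod_hom R (F.F n) (G.F (Suc n))" and sd: "\<And>x. x \<in> carrier (F.F (Suc n)) \<Longrightarrow> d' n (s (d n x)) = \<theta> n (d n x)"
      using Ps unfolding P_def by blast+
    interpret s: mod_map R "F.F n" "G.F (Suc n)" s by (rule mod_mapI[OF F.F.module_M G.F.module_M s])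
    interpret \<theta>': mod_map R "F.F (Suc n)" "G.F (Suc n)" "\<theta> (Suc n)" by (rule \<theta>M)
    \<comment> \<open>The difference is written with the scalar -1, so that its linearity follows
      from closure of linear maps under sums and multiples.\<close>
    let ?h = "\<lambda>x. \<theta> (Suc n) x \<oplus>\<^bsub>G.F (Suc n)\<^esub> (\<ominus> \<one>) \<odot>\<^bsub>G.F (Suc n)\<^esub> s (d n x)"
    have h_eq: "?h x = \<theta> (Suc n) x \<ominus>\<^bsub>G.F (Suc n)\<^esub> s (d n x)" if "x \<in> carrier (F.F (Suc n))" for x
      using s.closed[OF F.d.closed[OF that]] by (simp add: G.F.smult_l_minus G.F.minus_eq)
    have h: "?h \<in> mod_hom R (F.F (Suc n)) (G.F (Suc n))"
      by (intro mod_hom_add mod_hom_smult G.F.module_M \<theta> mod_hom_comp[OF F.dif s]) simp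
    have "\<exists>s'\<in>mod_hom R (F.F (Suc n)) (G.F (Suc (Suc n))). \<forall>x\<in>carrier (F.F (Suc n)). d' (Suc n) (s' x) = ?h x"
    proof (rule free_projective[OF G.F.module_M G.F.module_M G.dif h])
      fix x assume x: "x \<in> carrier (F.F (Suc n))"
      have c: "\<theta> (Suc n) x \<in> carrier (G.F (Suc n))" "s (d n x) \<in> carrier (G.F (Suc n))"
        using \<theta>'.closed[OF x] s.closed[OF F.d.closed[OF x]] by auto
      have "d' n (\<theta> (Suc n) x \<ominus>\<^bsub>G.F (Suc n)\<^esub> s (d n x)) = \<zero>\<^bsub>G.F n\<^esub>"
        using c G.F.diff_eq_zero_iff[of "\<theta> n (d n x)" n "\<theta> n (d n x)"] mod_homD(1)[OF \<theta> F.d.closed[OF x]]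
        by (simp add: G.d.diff \<theta>d[OF x] sd[OF x])
      then show "?h x \<in> d' (Suc n) ` carrier (G.F (Suc (Suc n)))"
        unfolding h_eq[OF x] using c by (intro G.exact_Suc) auto
    qed
    then obtain s' where s': "s' \<in> mod_hom R (F.F (Suc n)) (G.F (Suc (Suc n)))"
      and s'h: "\<And>x. x \<in> carrier (F.F (Suc n)) \<Longrightarrow> d' (Suc n) (s' x) = ?h x" by blast
    have eq: "\<theta> (Suc n) x = d' (Suc n) (s' x) \<oplus>\<^bsub>G.F (Suc n)\<^esub> s (d n x)" if x: "x \<in> carrier (F.F (Suc n))" for x
      unfolding s'h[OF x] h_eq[OF x] using \<theta>'.closed[OF x] s.closed[OF F.d.closed[OF x]]
      by (simp add: G.F.minus_eq G.F.M.a_assoc G.F.M.l_neg)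
    have "d' (Suc n) (s' (d (Suc n) x)) = \<theta> (Suc n) (d (Suc n) x)" if x: "x \<in> carrier (F.F (Suc (Suc n)))" for x
    proof -
      note dx = F.d.closed[OF x]
      have "\<theta> (Suc n) (d (Suc n) x) = d' (Suc n) (s' (d (Suc n) x)) \<oplus>\<^bsub>G.F (Suc n)\<^esub> \<zero>\<^bsub>G.F (Suc n)\<^esub>"
        unfolding eq[OF dx] F.d_d[OF x] s.zero ..
      then show ?thesis using G.d.closed[OF mod_homD(1)[OF s' dx]] by simp
    qed
    then have "P (Suc n) s'" unfolding P_def using s' by simp
    then show "\<exists>s'. P (Suc n) s' \<and> (\<forall>x\<in>carrier (F.F (Suc n)). \<theta> (Suc n) x = d' (Suc n) (s' x) \<oplus>\<^bsub>G.F (Suc n)\<^esub> s (d n x))"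
      using eq by blast
  qed
  then obtain s where s: "\<And>n. P n (s n)" "\<And>n. \<forall>x\<in>carrier (F.F (Suc n)). \<theta> (Suc n) x = d' (Suc n) (s (Suc n) x) \<oplus>\<^bsub>G.F (Suc n)\<^esub> s n (d n x)"
    by blast
  then show ?thesis unfolding P_def by (intro exI[of _ s] conjI allI) auto
qed

end

section \<open>Torsion products\<close>

text \<open>\<open>Tor\<close> is tied to one chosen resolution. These definitions spell out the
  same homology for an arbitrary resolution, so that different resolutions can be compared.\<close>

definition res_cycles ::
  "('r, 'x) ring_scheme \<Rightarrow> ('r, 'm) module \<Rightarrow> (nat \<Rightarrow> 'b set) \<Rightarrow> (nat \<Rightarrow> ('b \<Rightarrow> 'r) \<Rightarrow> 'b \<Rightarrow> 'r) \<Rightarrow> nat \<Rightarrow>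
    (('b \<Rightarrow> 'r) \<times> 'm \<Rightarrow> 'r) set set" where
  "res_cycles R M S d i = (case i of 0 \<Rightarrow> carrier (tensor R (free_mod R (S 0)) M)
     | Suc n \<Rightarrow> mod_ker (tensor R (free_mod R (S (Suc n))) M) (tensor R (free_mod R (S n)) M)
         (tensor_map R (free_mod R (S (Suc n))) (free_mod R (S n)) M (d n)))"

definition res_boundaries ::
  "('r, 'x) ring_scheme \<Rightarrow> ('r, 'm) module \<Rightarrow> (nat \<Rightarrow> 'b set) \<Rightarrow> (nat \<Rightarrow> ('b \<Rightarrow> 'r) \<Rightarrow> 'b \<Rightarrow> 'r) \<Rightarrow> nat \<Rightarrow>
    (('b \<Rightarrow> 'r) \<times> 'm \<Rightarrow> 'r) set set" where
  "res_boundaries R M S d i = tensor_map R (free_mod R (S (Suc i))) (free_mod R (S i)) M (d i) `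
     carrier (tensor R (free_mod R (S (Suc i))) M)"

definition res_homology ::
  "('r, 'x) ring_scheme \<Rightarrow> ('r, 'm) module \<Rightarrow> (nat \<Rightarrow> 'b set) \<Rightarrow> (nat \<Rightarrow> ('b \<Rightarrow> 'r) \<Rightarrow> 'b \<Rightarrow> 'r) \<Rightarrow> nat \<Rightarrow>
    ('r, (('b \<Rightarrow> 'r) \<times> 'm \<Rightarrow> 'r) set set) module" where
  "res_homology R M S d i = quot_module ((tensor R (free_mod R (S i)) M)\<lparr>carrier := res_cycles R M S d i\<rparr>)
     (res_boundaries R M S d i)"

lemma Tor_eq_res_homology:
  "chosen_resolution R A = (S, d) \<Longrightarrow> Tor R i A M = res_homology R M S d i"
  by (simp add: Tor_def res_homology_def res_cycles_def res_boundaries_def Let_def)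

locale res_tensor = free_res R A S d \<epsilon> + M: rmodule R M
  for R :: "('r, 'x) ring_scheme" (structure) and A :: "('r, 'a) module"
    and S :: "nat \<Rightarrow> 'b set" and d \<epsilon> and M :: "('r, 'm) module"
begin

abbreviation T where "T n \<equiv> tensor R (F n) M"
abbreviation D where "D n \<equiv> tensor_map R (F (Suc n)) (F n) M (d n)"
abbreviation Z where "Z \<equiv> res_cycles R M S d"
abbreviation B where "B \<equiv> res_boundaries R M S d"

sublocale tp: tensor_product R "F n" M for n
  by (simp add: tensor_product_def rmoduleI F.module_M M.module_M)

sublocale D: mod_map R "T (Suc n)" "T n" "D n" for n
  by (intro mod_mapI tp.tensor_module tensor_map_spec(1) F.module_M M.module_M dif)

lemma D_tens: "\<lbrakk>x \<in> carrier (F (Suc n)); y \<in> carrier M\<rbrakk> \<Longrightarrow>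
    D n (elem_tensor R (F (Suc n)) M x y) = elem_tensor R (F n) M (d n x) y"
  by (intro tensor_map_spec(2) F.module_M M.module_M dif)

lemma tens_zero_left: "y \<in> carrier M \<Longrightarrow> elem_tensor R (F n) M \<zero>\<^bsub>F n\<^esub> y = \<zero>\<^bsub>T n\<^esub>"
  using tp.tens_smult_left[of \<zero> "\<zero>\<^bsub>F n\<^esub>" n y] tp.tens_closed[of "\<zero>\<^bsub>F n\<^esub>" n y] by simp

lemma tens_zero_right: "x \<in> carrier (F n) \<Longrightarrow> elem_tensor R (F n) M x \<zero>\<^bsub>M\<^esub> = \<zero>\<^bsub>T n\<^esub>"
  using tp.tens_smult_right[of \<zero> x n "\<zero>\<^bsub>M\<^esub>"] tp.tens_closed[of x n "\<zero>\<^bsub>M\<^esub>"] by simp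

lemma D_D:
  assumes z: "z \<in> carrier (T (Suc (Suc n)))"
  shows "D n (D (Suc n) z) = \<zero>\<^bsub>T n\<^esub>"
  by (rule tp.tensor_hom_ext[OF tp.tensor_module mod_hom_comp[OF D.h D.h] mod_hom_zero[OF tp.tensor_module] _ z])
    (simp add: D_tens d.closed d_d tens_zero_left)

lemma Z_submodule: "submodule (Z i) R (T i)"
  unfolding res_cycles_def using tp.T.carrier_is_submodule D.ker_submodule by (cases i) auto

lemma B_submodule: "submodule (B i) R (T i)"
  unfolding res_boundaries_def by (rule D.image_submodule[OF tp.T.carrier_is_submodule])

lemma B_Z: "B i \<subseteq> Z i"
proof (cases i)
  case 0
  then show ?thesis unfolding res_cycles_def res_boundaries_def using D.closed by auto
next
  case (Suc n)
  then show ?thesis unfolding res_cycles_def res_boundaries_def mod_ker_def using D.closed D_D by auto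
qed

lemma Z_Suc: "z \<in> Z (Suc n) \<longleftrightarrow> z \<in> carrier (T (Suc n)) \<and> D n z = \<zero>\<^bsub>T n\<^esub>"
  unfolding res_cycles_def mod_ker_def by simp

lemma Z_module: "Module.module R ((T i)\<lparr>carrier := Z i\<rparr>)"
  by (rule tp.T.module_restrict[OF Z_submodule])

lemma Z_rmodule: "rmodule R ((T i)\<lparr>carrier := Z i\<rparr>)"
  by (rule rmoduleI[OF Z_module])

lemma B_submodule_Z: "submodule (B i) R ((T i)\<lparr>carrier := Z i\<rparr>)"
  unfolding tp.T.submodule_restrict_iff[OF Z_submodule] using B_submodule B_Z by simp

lemma homology_module: "Module.module R (res_homology R M S d i)"
  unfolding res_homology_def by (rule rmodule.quot_module_module[OF Z_rmodule B_submodule_Z])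

text \<open>Annihilators in the homology, a quotient of a restricted record, become colon ideals in
  the tensor product, so torsion can be tested on cycles.\<close>

lemma colon_homology:
  assumes z: "z \<in> Z i"
  shows "colon R (res_homology R M S d i) {\<zero>\<^bsub>res_homology R M S d i\<^esub>} (B i +>\<^bsub>(T i)\<lparr>carrier := Z i\<rparr>\<^esub> z) =
    colon R (T i) (B i) z"
proof -
  let ?Z = "(T i)\<lparr>carrier := Z i\<rparr>"
  interpret Zi: rmodule R ?Z by (rule rmoduleI[OF Z_module])
  have "r \<odot>\<^bsub>res_homology R M S d i\<^esub> (B i +>\<^bsub>?Z\<^esub> z) = \<zero>\<^bsub>res_homology R M S d i\<^esub> \<longleftrightarrow> r \<odot>\<^bsub>T i\<^esub> z \<in> B i"
    if r: "r \<in> carrier R" for r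
  proof -
    let ?x = "r \<odot>\<^bsub>?Z\<^esub> z"
    have x: "?x \<in> carrier ?Z" using r z by (intro Zi.smult_closed) auto
    have "r \<odot>\<^bsub>res_homology R M S d i\<^esub> (B i +>\<^bsub>?Z\<^esub> z) = B i +>\<^bsub>?Z\<^esub> ?x"
      unfolding res_homology_def by (rule Zi.quot_smult[OF B_submodule_Z r]) (use z in simp)
    moreover have "\<zero>\<^bsub>res_homology R M S d i\<^esub> = B i +>\<^bsub>?Z\<^esub> \<zero>\<^bsub>?Z\<^esub>"
      unfolding res_homology_def by (rule Zi.quot_zero[OF B_submodule_Z])
    moreover have "B i +>\<^bsub>?Z\<^esub> ?x = B i +>\<^bsub>?Z\<^esub> \<zero>\<^bsub>?Z\<^esub> \<longleftrightarrow> ?x \<ominus>\<^bsub>?Z\<^esub> \<zero>\<^bsub>?Z\<^esub> \<in> B i"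
      by (rule Zi.rcoset_eq_iff[OF B_submodule_Z x Zi.M.zero_closed])
    moreover have "(?x \<ominus>\<^bsub>?Z\<^esub> \<zero>\<^bsub>?Z\<^esub>) \<oplus>\<^bsub>?Z\<^esub> \<zero>\<^bsub>?Z\<^esub> = ?x"
      unfolding Zi.M.minus_eq
      by (simp only: Zi.M.a_assoc[OF x Zi.M.a_inv_closed Zi.M.zero_closed] Zi.M.l_neg[OF Zi.M.zero_closed]
          Zi.M.zero_closed Zi.M.r_zero[OF x])
    then have "?x \<ominus>\<^bsub>?Z\<^esub> \<zero>\<^bsub>?Z\<^esub> = ?x"
      using Zi.M.r_zero[OF Zi.M.minus_closed[OF x Zi.M.zero_closed]] by (simp only:)
    ultimately show ?thesis by simp
  qed
  then show ?thesis unfolding colon_def by auto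
qed

lemma homology_carrier:
  "carrier (res_homology R M S d i) = (\<lambda>z. B i +>\<^bsub>(T i)\<lparr>carrier := Z i\<rparr>\<^esub> z) ` Z i"
  unfolding res_homology_def using rmodule.quot_carrier[OF Z_rmodule B_submodule_Z, of i] by simp

text \<open>The homotopy \<theta> = d s + s d survives tensoring with M; on cycles the term s d
  vanishes and only a boundary remains.\<close>

lemma homotopic_boundary:
  assumes s: "\<And>n. s n \<in> mod_hom R (F n) (F (Suc n))"
    and s0: "\<And>x. x \<in> carrier (F 0) \<Longrightarrow> \<theta> 0 x = d 0 (s 0 x)"
    and sS: "\<And>n x. x \<in> carrier (F (Suc n)) \<Longrightarrow> \<theta> (Suc n) x = d (Suc n) (s (Suc n) x) \<oplus>\<^bsub>F (Suc n)\<^esub> s n (d n x)"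
    and \<Theta>: "\<And>n. \<Theta> n \<in> mod_hom R (T n) (T n)"
    and \<Theta>t: "\<And>n x y. \<lbrakk>x \<in> carrier (F n); y \<in> carrier M\<rbrakk> \<Longrightarrow>
      \<Theta> n (elem_tensor R (F n) M x y) = elem_tensor R (F n) M (\<theta> n x) y"
    and z: "z \<in> Z i"
  shows "\<Theta> i z \<in> B i"
proof -
  define \<sigma> where "\<sigma> n = tensor_map R (F n) (F (Suc n)) M (s n)" for n
  have \<sigma>: "\<sigma> n \<in> mod_hom R (T n) (T (Suc n))" for n
    unfolding \<sigma>_def by (intro tensor_map_spec(1) F.module_M M.module_M s)
  have \<sigma>t: "\<sigma> n (elem_tensor R (F n) M x y) = elem_tensor R (F (Suc n)) M (s n x) y"
    if "x \<in> carrier (F n)" "y \<in> carrier M" for n x y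
    unfolding \<sigma>_def using that by (intro tensor_map_spec(2) F.module_M M.module_M s)
  note sc = mod_homD(1)[OF s]
  have zT: "z \<in> carrier (T i)" using tp.T.submodule_mem[OF Z_submodule z] .
  show ?thesis
  proof (cases i)
    case 0
    have "\<Theta> 0 z = D 0 (\<sigma> 0 z)"
      by (rule tp.tensor_hom_ext[OF tp.tensor_module \<Theta> mod_hom_comp[OF \<sigma> D.h]])
        (use zT 0 in \<open>simp_all add: \<Theta>t \<sigma>t D_tens sc s0\<close>)
    then show ?thesis unfolding 0 res_boundaries_def using mod_homD(1)[OF \<sigma>] zT 0 by auto
  next
    case (Suc n)
    have "\<Theta> (Suc n) z = D (Suc n) (\<sigma> (Suc n) z) \<oplus>\<^bsub>T (Suc n)\<^esub> \<sigma> n (D n z)"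
      by (rule tp.tensor_hom_ext[OF tp.tensor_module \<Theta>
            mod_hom_add[OF tp.tensor_module mod_hom_comp[OF \<sigma> D.h] mod_hom_comp[OF D.h \<sigma>]]])
        (use zT Suc in \<open>simp_all add: \<Theta>t \<sigma>t D_tens sc sS d.closed tp.tens_add_left\<close>)
    moreover have "\<sigma> n (D n z) = \<zero>\<^bsub>T (Suc n)\<^esub>"
    proof -
      interpret \<sigma>: mod_map R "T n" "T (Suc n)" "\<sigma> n" by (intro mod_mapI tp.tensor_module \<sigma>)
      show ?thesis using z unfolding Suc Z_Suc by (simp add: \<sigma>.zero)
    qed
    moreover have "\<sigma> (Suc n) z \<in> carrier (T (Suc (Suc n)))" using mod_homD(1)[OF \<sigma>] zT Suc by auto
    ultimately have "\<Theta> (Suc n) z = D (Suc n) (\<sigma> (Suc n) z)" by (simp add: D.closed)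
    then show ?thesis unfolding Suc res_boundaries_def
      using \<open>\<sigma> (Suc n) z \<in> carrier (T (Suc (Suc n)))\<close> by auto
  qed
qed

text \<open>Multiplication by a on the resolution lies over multiplication by a on A, which is zero,
  and is therefore null-homotopic.\<close>

lemma annihilator_homology:
  assumes a: "a \<in> carrier R" and ann: "\<And>x. x \<in> carrier A \<Longrightarrow> a \<odot>\<^bsub>A\<^esub> x = \<zero>\<^bsub>A\<^esub>" and z: "z \<in> Z i"
  shows "a \<odot>\<^bsub>T i\<^esub> z \<in> B i"
proof -
  interpret res_pair R A S d \<epsilon> S d \<epsilon> by unfold_locales
  have "\<exists>s. (\<forall>n. s n \<in> mod_hom R (F n) (F (Suc n))) \<and>
    (\<forall>x\<in>carrier (F 0). a \<odot>\<^bsub>F 0\<^esub> x = d 0 (s 0 x)) \<and>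
    (\<forall>n. \<forall>x\<in>carrier (F (Suc n)). a \<odot>\<^bsub>F (Suc n)\<^esub> x = d (Suc n) (s (Suc n) x) \<oplus>\<^bsub>F (Suc n)\<^esub> s n (d n x))"
  proof (rule homotopy)
    show "(\<lambda>x. a \<odot>\<^bsub>F n\<^esub> x) \<in> mod_hom R (F n) (F n)" for n
      by (rule mod_hom_smult[OF F.module_M mod_hom_ident a])
    show "\<epsilon> (a \<odot>\<^bsub>F 0\<^esub> x) = \<zero>\<^bsub>A\<^esub>" if "x \<in> carrier (F 0)" for x
      using that by (simp add: eps.smult a ann eps.closed)
    show "d n (a \<odot>\<^bsub>F (Suc n)\<^esub> x) = a \<odot>\<^bsub>F n\<^esub> d n x" if "x \<in> carrier (F (Suc n))" for n x
      using that by (simp add: d.smult a)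
  qed
  then obtain s where s: "\<And>n. s n \<in> mod_hom R (F n) (F (Suc n))"
    "\<And>x. x \<in> carrier (F 0) \<Longrightarrow> a \<odot>\<^bsub>F 0\<^esub> x = d 0 (s 0 x)"
    "\<And>n x. x \<in> carrier (F (Suc n)) \<Longrightarrow> a \<odot>\<^bsub>F (Suc n)\<^esub> x = d (Suc n) (s (Suc n) x) \<oplus>\<^bsub>F (Suc n)\<^esub> s n (d n x)"
    by blast
  show ?thesis
    by (rule homotopic_boundary[where \<theta> = "\<lambda>n x. a \<odot>\<^bsub>F n\<^esub> x" and \<Theta> = "\<lambda>n x. a \<odot>\<^bsub>T n\<^esub> x", OF s _ _ z])
      (simp_all add: mod_hom_smult[OF tp.tensor_module mod_hom_ident a] tp.tens_smult_left a)
qed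

text \<open>
  Elements of \<open>\<aa>\<close> kill the homology, and after multiplication by an element outside \<open>p\<close> a cycle comes
  from \<open>F \<otimes> N\<close>, which is killed by the annihilator of \<open>N\<close>.
\<close>

lemma homology_torsion:
  assumes q: "quasi_coartinian R \<aa> M" and \<aa>: "\<aa> \<subseteq> carrier R"
    and ann: "\<And>a x. \<lbrakk>a \<in> \<aa>; x \<in> carrier A\<rbrakk> \<Longrightarrow> a \<odot>\<^bsub>A\<^esub> x = \<zero>\<^bsub>A\<^esub>" and z: "z \<in> Z i"
  shows "torsion_mod R (T i) (B i) z"
  unfolding torsion_mod_def
proof (intro allI impI, rule ccontr)
  fix p assume p: "primeideal p R \<and> colon R (T i) (B i) z \<subseteq> p" and nm: "\<not> maximalideal p R"
  interpret p: primeideal p R using p by simp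
  have zT: "z \<in> carrier (T i)" using tp.T.submodule_mem[OF Z_submodule z] .
  obtain N where w: "coartinian_witness R \<aa> M N" using q unfolding quasi_coartinian_def by blast
  let ?ann = "{b \<in> carrier R. \<forall>y\<in>N. b \<odot>\<^bsub>M\<^esub> y = \<zero>\<^bsub>M\<^esub>}"
  \<comment> \<open>After multiplication by r such an element behaves like one coming from F
    \<otimes> N. The set is a submodule containing the pure tensors, hence everything, and F
    \<otimes> N itself need not be formed.\<close>
  let ?H = "{z \<in> carrier (T i). \<exists>r\<in>carrier R - p. \<forall>b\<in>?ann. b \<odot>\<^bsub>T i\<^esub> (r \<odot>\<^bsub>T i\<^esub> z) = \<zero>\<^bsub>T i\<^esub>}"
  have "submodule ?H R (T i)"
  proof (rule tp.T.submoduleI')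
    show "?H \<subseteq> carrier (T i)" by blast
    have "\<forall>b\<in>?ann. b \<odot>\<^bsub>T i\<^esub> (\<one> \<odot>\<^bsub>T i\<^esub> \<zero>\<^bsub>T i\<^esub>) = \<zero>\<^bsub>T i\<^esub>" by simp
    then show "\<zero>\<^bsub>T i\<^esub> \<in> ?H" using p.one_notin by blast
    fix x y c assume "x \<in> ?H" "y \<in> ?H" and c: "c \<in> carrier R"
    then obtain r s where r: "r \<in> carrier R - p" "x \<in> carrier (T i)" "\<And>b. b \<in> ?ann \<Longrightarrow> b \<odot>\<^bsub>T i\<^esub> (r \<odot>\<^bsub>T i\<^esub> x) = \<zero>\<^bsub>T i\<^esub>"
      and s: "s \<in> carrier R - p" "y \<in> carrier (T i)" "\<And>b. b \<in> ?ann \<Longrightarrow> b \<odot>\<^bsub>T i\<^esub> (s \<odot>\<^bsub>T i\<^esub> y) = \<zero>\<^bsub>T i\<^esub>" by blast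
    have "b \<odot>\<^bsub>T i\<^esub> ((r \<otimes> s) \<odot>\<^bsub>T i\<^esub> (x \<oplus>\<^bsub>T i\<^esub> c \<odot>\<^bsub>T i\<^esub> y)) = \<zero>\<^bsub>T i\<^esub>" if b: "b \<in> ?ann" for b
    proof -
      have "b \<odot>\<^bsub>T i\<^esub> ((r \<otimes> s) \<odot>\<^bsub>T i\<^esub> (x \<oplus>\<^bsub>T i\<^esub> c \<odot>\<^bsub>T i\<^esub> y)) =
          s \<odot>\<^bsub>T i\<^esub> (b \<odot>\<^bsub>T i\<^esub> (r \<odot>\<^bsub>T i\<^esub> x)) \<oplus>\<^bsub>T i\<^esub> (r \<otimes> c) \<odot>\<^bsub>T i\<^esub> (b \<odot>\<^bsub>T i\<^esub> (s \<odot>\<^bsub>T i\<^esub> y))"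
        using b c r(1,2) s(1,2)
        by (simp add: tp.T.smult_r_distr tp.T.smult_assoc1[symmetric] A.R.m_ac)
      then show ?thesis using r(1) s(1) c by (simp add: r(3)[OF b] s(3)[OF b])
    qed
    moreover have "r \<otimes> s \<in> carrier R - p" using r(1) s(1) p.I_prime by blast
    moreover have "x \<oplus>\<^bsub>T i\<^esub> c \<odot>\<^bsub>T i\<^esub> y \<in> carrier (T i)" using r s c by simp
    ultimately show "x \<oplus>\<^bsub>T i\<^esub> c \<odot>\<^bsub>T i\<^esub> y \<in> ?H" by blast
  qed
  then have "z \<in> ?H"
  proof (rule tp.tensor_induct[OF _ _ zT])
    fix x y assume x: "x \<in> carrier (F i)" and y: "y \<in> carrier M"
    obtain r where r: "r \<in> carrier R - p" "r \<odot>\<^bsub>M\<^esub> y \<in> N"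
      using torsion_mod_witness[OF coartinian_witnessD(2)[OF w y] conjunct1[OF p] nm] by blast
    have "b \<odot>\<^bsub>T i\<^esub> (r \<odot>\<^bsub>T i\<^esub> elem_tensor R (F i) M x y) = \<zero>\<^bsub>T i\<^esub>" if b: "b \<in> ?ann" for b
    proof -
      have "b \<odot>\<^bsub>T i\<^esub> (r \<odot>\<^bsub>T i\<^esub> elem_tensor R (F i) M x y) = elem_tensor R (F i) M x (b \<odot>\<^bsub>M\<^esub> (r \<odot>\<^bsub>M\<^esub> y))"
        using b r(1) x y by (simp add: tp.tens_smult_right)
      also have "b \<odot>\<^bsub>M\<^esub> (r \<odot>\<^bsub>M\<^esub> y) = \<zero>\<^bsub>M\<^esub>" using b r(2) by blast
      finally show ?thesis using x by (simp add: tens_zero_right)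
    qed
    then show "elem_tensor R (F i) M x y \<in> ?H" using r(1) tp.tens_closed[OF x y] by blast
  qed
  then obtain r where r: "r \<in> carrier R - p" "\<And>b. b \<in> ?ann \<Longrightarrow> b \<odot>\<^bsub>T i\<^esub> (r \<odot>\<^bsub>T i\<^esub> z) = \<zero>\<^bsub>T i\<^esub>" by blast
  \<comment> \<open>Either some a in \<aa> outside p kills the class of z, or the witness supplies
    an annihilator b of N outside p, and then b r kills it.\<close>
  show False
  proof (cases "\<aa> \<subseteq> p")
    case False
    then obtain a where a: "a \<in> \<aa>" "a \<notin> p" by blast
    then have "a \<in> colon R (T i) (B i) z"
      unfolding colon_def using annihilator_homology[OF _ ann z, of a] \<aa> by blast
    then show False using p a by blast
  next
    case True
    obtain b where b: "b \<in> carrier R - p" "\<forall>y\<in>N. b \<odot>\<^bsub>M\<^esub> y = \<zero>\<^bsub>M\<^esub>"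
      using coartinian_witnessD(3)[OF w conjunct1[OF p] True nm] by blast
    then have "(b \<otimes> r) \<odot>\<^bsub>T i\<^esub> z = \<zero>\<^bsub>T i\<^esub>" using r(2)[of b] r(1) zT by (simp add: tp.T.smult_assoc1)
    then have "b \<otimes> r \<in> colon R (T i) (B i) z"
      unfolding colon_def using b r(1) tp.T.submodule_zero[OF B_submodule] by simp
    then show False using p p.I_prime b r(1) by blast
  qed
qed

text \<open>The given resolution may have infinite bases. Chain maps \<phi> to the finite resolution
  and \<psi> back compose to a map homotopic to the identity, so the class of z is that of
  \<Psi>(\<Phi>(z)). Thus the homology is a linear image of the cycles of the finite complex, which
  are linearly compact.\<close>

lemma homology_lin_compact:
  assumes G: "free_res R A S' d' \<epsilon>'" and fin: "\<And>n. finite (S' n)" and lc: "lin_compact R M (carrier M)"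
  shows "lin_compact R (res_homology R M S d i) (carrier (res_homology R M S d i))"
proof -
  interpret G: free_res R A S' d' \<epsilon>' by (rule G)
  interpret G: res_tensor R A S' d' \<epsilon>' M by unfold_locales
  interpret FG: res_pair R A S d \<epsilon> S' d' \<epsilon>' by unfold_locales
  interpret GF: res_pair R A S' d' \<epsilon>' S d \<epsilon> by unfold_locales
  interpret FF: res_pair R A S d \<epsilon> S d \<epsilon> by unfold_locales
  obtain \<phi> where \<phi>: "\<And>n. \<phi> n \<in> mod_hom R (F n) (G.F n)" "\<And>x. x \<in> carrier (F 0) \<Longrightarrow> \<epsilon>' (\<phi> 0 x) = \<epsilon> x"
    "\<And>n x. x \<in> carrier (F (Suc n)) \<Longrightarrow> d' n (\<phi> (Suc n) x) = \<phi> n (d n x)"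
    using FG.chain_map by blast
  obtain \<psi> where \<psi>: "\<And>n. \<psi> n \<in> mod_hom R (G.F n) (F n)" "\<And>x. x \<in> carrier (G.F 0) \<Longrightarrow> \<epsilon> (\<psi> 0 x) = \<epsilon>' x"
    "\<And>n x. x \<in> carrier (G.F (Suc n)) \<Longrightarrow> d n (\<psi> (Suc n) x) = \<psi> n (d' n x)"
    using GF.chain_map by blast
  note \<phi>c = mod_homD(1)[OF \<phi>(1)] and \<psi>c = mod_homD(1)[OF \<psi>(1)]
  \<comment> \<open>The difference of \<psi>\<phi> and the identity lies over zero on A. This one
    homotopy suffices for surjectivity onto the homology.\<close>
  define \<theta> where "\<theta> n x = \<psi> n (\<phi> n x) \<oplus>\<^bsub>F n\<^esub> (\<ominus> \<one>) \<odot>\<^bsub>F n\<^esub> x" for n x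
  have "\<exists>s. (\<forall>n. s n \<in> mod_hom R (F n) (F (Suc n))) \<and>
    (\<forall>x\<in>carrier (F 0). \<theta> 0 x = d 0 (s 0 x)) \<and>
    (\<forall>n. \<forall>x\<in>carrier (F (Suc n)). \<theta> (Suc n) x = d (Suc n) (s (Suc n) x) \<oplus>\<^bsub>F (Suc n)\<^esub> s n (d n x))"
  proof (rule FF.homotopy)
    show "\<theta> n \<in> mod_hom R (F n) (F n)" for n
      unfolding \<theta>_def by (intro mod_hom_add mod_hom_smult F.module_M mod_hom_comp[OF \<phi>(1) \<psi>(1)] mod_hom_ident) simp
    show "\<epsilon> (\<theta> 0 x) = \<zero>\<^bsub>A\<^esub>" if x: "x \<in> carrier (F 0)" for x
      unfolding \<theta>_def using x eps.closed[OF x]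
      by (simp add: eps.add eps.smult \<phi>c \<psi>c \<psi>(2) \<phi>(2) A.smult_l_minus A.M.r_neg)
    show "d n (\<theta> (Suc n) x) = \<theta> n (d n x)" if x: "x \<in> carrier (F (Suc n))" for n x
      unfolding \<theta>_def using x d.closed[OF x]
      by (simp add: d.add d.smult \<phi>c \<psi>c \<psi>(3) \<phi>(3))
  qed
  then obtain s where s: "\<And>n. s n \<in> mod_hom R (F n) (F (Suc n))"
    "\<And>x. x \<in> carrier (F 0) \<Longrightarrow> \<theta> 0 x = d 0 (s 0 x)"
    "\<And>n x. x \<in> carrier (F (Suc n)) \<Longrightarrow> \<theta> (Suc n) x = d (Suc n) (s (Suc n) x) \<oplus>\<^bsub>F (Suc n)\<^esub> s n (d n x)"
    by blast
  define \<Phi> where "\<Phi> n = tensor_map R (F n) (G.F n) M (\<phi> n)" for n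
  define \<Psi> where "\<Psi> n = tensor_map R (G.F n) (F n) M (\<psi> n)" for n
  have \<Phi>: "\<Phi> n \<in> mod_hom R (T n) (G.T n)" and \<Psi>: "\<Psi> n \<in> mod_hom R (G.T n) (T n)" for n
    unfolding \<Phi>_def \<Psi>_def by (intro tensor_map_spec(1) F.module_M G.F.module_M M.module_M \<phi> \<psi>)+
  have \<Phi>t: "\<Phi> n (elem_tensor R (F n) M x y) = elem_tensor R (G.F n) M (\<phi> n x) y"
    if "x \<in> carrier (F n)" "y \<in> carrier M" for n x y
    unfolding \<Phi>_def using that by (intro tensor_map_spec(2) F.module_M G.F.module_M M.module_M \<phi>)
  have \<Psi>t: "\<Psi> n (elem_tensor R (G.F n) M x y) = elem_tensor R (F n) M (\<psi> n x) y"
    if "x \<in> carrier (G.F n)" "y \<in> carrier M" for n x y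
    unfolding \<Psi>_def using that by (intro tensor_map_spec(2) F.module_M G.F.module_M M.module_M \<psi>)
  interpret \<Phi>: mod_map R "T n" "G.T n" "\<Phi> n" for n by (intro mod_mapI tp.tensor_module G.tp.tensor_module \<Phi>)
  interpret \<Psi>: mod_map R "G.T n" "T n" "\<Psi> n" for n by (intro mod_mapI tp.tensor_module G.tp.tensor_module \<Psi>)
  have D\<Phi>: "G.D n (\<Phi> (Suc n) z) = \<Phi> n (D n z)" if z: "z \<in> carrier (T (Suc n))" for n z
    by (rule tp.tensor_hom_ext[OF G.tp.tensor_module mod_hom_comp[OF \<Phi> G.D.h] mod_hom_comp[OF D.h \<Phi>] _ z])
      (simp add: \<Phi>t D_tens G.D_tens \<phi>c d.closed \<phi>(3))
  have D\<Psi>: "D n (\<Psi> (Suc n) z) = \<Psi> n (G.D n z)" if z: "z \<in> carrier (G.T (Suc n))" for n z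
    by (rule G.tp.tensor_hom_ext[OF tp.tensor_module mod_hom_comp[OF \<Psi> D.h] mod_hom_comp[OF G.D.h \<Psi>] _ z])
      (simp add: \<Psi>t D_tens G.D_tens \<psi>c G.d.closed \<psi>(3))
  have Z\<Phi>: "\<Phi> i z \<in> G.Z i" if z: "z \<in> Z i" for z
  proof (cases i)
    case 0
    then show ?thesis using z \<Phi>.closed unfolding res_cycles_def by simp
  next
    case (Suc n)
    then show ?thesis using z \<Phi>.closed D\<Phi> \<Phi>.zero by (simp add: Z_Suc G.Z_Suc)
  qed
  have Z\<Psi>: "\<Psi> i z \<in> Z i" if z: "z \<in> G.Z i" for z
  proof (cases i)
    case 0
    then show ?thesis using z \<Psi>.closed unfolding res_cycles_def by simp
  next
    case (Suc n)
    then show ?thesis using z \<Psi>.closed D\<Psi> \<Psi>.zero by (simp add: Z_Suc G.Z_Suc)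
  qed
  have homotopic: "\<Psi> i (\<Phi> i z) \<oplus>\<^bsub>T i\<^esub> (\<ominus> \<one>) \<odot>\<^bsub>T i\<^esub> z \<in> B i" if z: "z \<in> Z i" for z
  proof (rule homotopic_boundary[where \<theta> = \<theta> and \<Theta> = "\<lambda>n z. \<Psi> n (\<Phi> n z) \<oplus>\<^bsub>T n\<^esub> (\<ominus> \<one>) \<odot>\<^bsub>T n\<^esub> z", OF s _ _ z])
    show "(\<lambda>z. \<Psi> n (\<Phi> n z) \<oplus>\<^bsub>T n\<^esub> (\<ominus> \<one>) \<odot>\<^bsub>T n\<^esub> z) \<in> mod_hom R (T n) (T n)" for n
      by (intro mod_hom_add mod_hom_smult tp.tensor_module mod_hom_comp[OF \<Phi> \<Psi>] mod_hom_ident) simp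
    show "\<Psi> n (\<Phi> n (elem_tensor R (F n) M x y)) \<oplus>\<^bsub>T n\<^esub> (\<ominus> \<one>) \<odot>\<^bsub>T n\<^esub> elem_tensor R (F n) M x y =
        elem_tensor R (F n) M (\<theta> n x) y" if "x \<in> carrier (F n)" "y \<in> carrier M" for n x y
    proof -
      have neg: "\<ominus> \<one> \<in> carrier R" by simp
      show ?thesis unfolding \<theta>_def
        using that by (simp add: \<Phi>t \<Psi>t \<phi>c \<psi>c tp.tens_add_left tp.tens_smult_left[OF neg])
    qed
  qed
  let ?ZG = "(G.T i)\<lparr>carrier := G.Z i\<rparr>" and ?ZF = "(T i)\<lparr>carrier := Z i\<rparr>" and ?H = "res_homology R M S d i"
  interpret Zi: rmodule R ?ZF by (rule Z_rmodule)
  interpret ZGi: rmodule R ?ZG by (rule G.Z_rmodule)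
  have "lin_compact R (G.T i) (carrier (G.T i))"
    by (rule tensor_free_lin_compact[OF M.module_M fin lc])
  then have "lin_compact R (G.T i) (G.Z i)"
    by (rule lin_compact_mono) (use G.tp.T.submodule_mem[OF G.Z_submodule] in blast)
  then have lcZ: "lin_compact R ?ZG (G.Z i)" by (rule G.tp.T.lin_compact_restrict[OF _ G.Z_submodule])
  have res: "\<Psi> i \<in> mod_hom R ?ZG ?ZF"
    by (rule mod_homI) (use Z\<Psi> G.tp.T.submodule_mem[OF G.Z_submodule] in \<open>simp_all add: \<Psi>.add \<Psi>.smult\<close>)
  have "(\<lambda>z. B i +>\<^bsub>?ZF\<^esub> \<Psi> i z) \<in> mod_hom R ?ZG ?H"
    using mod_hom_comp[OF res Zi.quot_proj_hom[OF B_submodule_Z]] unfolding res_homology_def .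
  from lin_compact_image[OF G.Z_module homology_module this]
  have "lin_compact R ?H ((\<lambda>z. B i +>\<^bsub>?ZF\<^esub> \<Psi> i z) ` G.Z i)"
    using lcZ ZGi.carrier_is_submodule by simp
  moreover have "carrier ?H \<subseteq> (\<lambda>z. B i +>\<^bsub>?ZF\<^esub> \<Psi> i z) ` G.Z i"
  proof
    fix X assume "X \<in> carrier ?H"
    then obtain z where z: "z \<in> Z i" "X = B i +>\<^bsub>?ZF\<^esub> z" unfolding homology_carrier by blast
    let ?w = "\<Psi> i (\<Phi> i z)"
    have w: "?w \<in> Z i" using Z\<Psi>[OF Z\<Phi>[OF z(1)]] .
    have "(\<ominus> \<one>) \<odot>\<^bsub>?ZF\<^esub> z = \<ominus>\<^bsub>?ZF\<^esub> z"
      using Zi.smult_l_minus[of \<one> z] Zi.smult_one[of z] z(1) by simp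
    then have "?w \<ominus>\<^bsub>?ZF\<^esub> z \<in> B i" using homotopic[OF z(1)] by (simp add: Zi.M.minus_eq)
    then have "B i +>\<^bsub>?ZF\<^esub> ?w = X"
      unfolding z(2) using Zi.rcoset_eq_iff[OF B_submodule_Z, of ?w z] w z(1) by simp
    then show "X \<in> (\<lambda>z. B i +>\<^bsub>?ZF\<^esub> \<Psi> i z) ` G.Z i" using Z\<Phi>[OF z(1)] by blast
  qed
  ultimately show ?thesis using lin_compact_mono by blast
qed

end

section \<open>Torsion products with the residue ring\<close>

context cring
begin

lemma regular_module_module: "Module.module R (regular_module R)"
proof (rule moduleI)
  show "abelian_group (regular_module R)"
  proof (rule abelian_groupI)
    fix x assume "x \<in> carrier (regular_module R)"
    then show "\<exists>y\<in>carrier (regular_module R). y \<oplus>\<^bsub>regular_module R\<^esub> x = \<zero>\<^bsub>regular_module R\<^esub>"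
      by (intro bexI[of _ "\<ominus> x"]) (simp_all add: regular_module_def l_neg)
  qed (auto simp: regular_module_def a_ac)
qed (auto simp: regular_module_def l_distr r_distr m_assoc is_cring)

lemma ideal_submodule_regular:
  assumes "ideal I R" shows "submodule I R (regular_module R)"
proof -
  interpret I: ideal I R by (rule assms)
  interpret P: rmodule R "regular_module R" by (rule rmoduleI[OF regular_module_module])
  show ?thesis
    by (rule P.submoduleI') (auto simp: regular_module_def I.Icarr I.I_l_closed I.a_closed)
qed

end

locale ideal_quotient = cring R for R :: "('r, 'x) ring_scheme" (structure) +
  fixes \<aa> assumes \<aa>: "ideal \<aa> R"
begin

abbreviation A where "A \<equiv> quot_module (regular_module R) \<aa>"
abbreviation cls where "cls x \<equiv> \<aa> +>\<^bsub>regular_module R\<^esub> x"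

sublocale P: rmodule R "regular_module R"
  by (rule rmoduleI[OF regular_module_module])

sublocale \<aa>: ideal \<aa> R by (rule \<aa>)

lemma sub: "submodule \<aa> R (regular_module R)"
  by (rule ideal_submodule_regular[OF \<aa>])

lemma A_module: "Module.module R A"
  by (rule P.quot_module_module[OF sub])

sublocale A: rmodule R A by (rule rmoduleI[OF A_module])

lemma regular_simps [simp]:
  "carrier (regular_module R) = carrier R" "add (regular_module R) = add R"
  "zero (regular_module R) = \<zero>" "smult (regular_module R) = mult R"
  by (simp_all add: regular_module_def)

lemma cls_zero: "x \<in> \<aa> \<Longrightarrow> cls x = \<zero>\<^bsub>A\<^esub>"
proof -
  assume x: "x \<in> \<aa>"
  then have "x \<in> carrier R" by (rule \<aa>.Icarr)
  moreover have "x \<ominus>\<^bsub>regular_module R\<^esub> \<zero> \<in> \<aa>"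
    using P.submodule_diff[OF sub x \<aa>.zero_closed] .
  ultimately show ?thesis using P.rcoset_eq_iff[OF sub, of x \<zero>] P.quot_zero[OF sub] by simp
qed

lemma cls_eqD: "\<lbrakk>x \<in> carrier R; cls x = \<zero>\<^bsub>A\<^esub>\<rbrakk> \<Longrightarrow> x \<in> \<aa>"
  using P.mem_rcoset_iff[OF sub, of x x] P.diff_eq_zero_iff[of x x] \<aa>.zero_closed
  by (simp add: quot_module_def)

lemma annihilates: "\<lbrakk>a \<in> \<aa>; X \<in> carrier A\<rbrakk> \<Longrightarrow> a \<odot>\<^bsub>A\<^esub> X = \<zero>\<^bsub>A\<^esub>"
  using P.quot_smult[OF sub] cls_zero \<aa>.I_r_closed \<aa>.Icarr by (auto simp: P.quot_carrier[OF sub])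

lemma generated: "carrier A = submodule_gen R A {cls \<one>}" and one_mem: "cls \<one> \<in> carrier A"
proof -
  show one: "cls \<one> \<in> carrier A" by (simp add: P.quot_carrier[OF sub])
  have g: "submodule (submodule_gen R A {cls \<one>}) R A" by (rule A.submodule_gen_submodule) (use one in simp)
  show "carrier A = submodule_gen R A {cls \<one>}"
  proof
    show "submodule_gen R A {cls \<one>} \<subseteq> carrier A" using A.submodule_mem[OF g] by blast
    show "carrier A \<subseteq> submodule_gen R A {cls \<one>}"
    proof
      fix X assume "X \<in> carrier A"
      then obtain r where r: "r \<in> carrier R" "X = cls r" by (auto simp: P.quot_carrier[OF sub])
      then have "X = r \<odot>\<^bsub>A\<^esub> cls \<one>" using P.quot_smult[OF sub, of r \<one>] by simp
      moreover have "cls \<one> \<in> submodule_gen R A {cls \<one>}" by (rule subsetD[OF A.submodule_gen_incl]) simp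
      ultimately show "X \<in> submodule_gen R A {cls \<one>}" using A.submoduleE(4)[OF g r(1)] by simp
    qed
  qed
qed

lemma finite_resolution:
  assumes "noetherian_ring R"
  shows "\<exists>(S :: nat \<Rightarrow> ('r set \<times> 'r) list set) d \<epsilon>. free_resolution R A S d \<epsilon> \<and> (\<forall>n. finite (S n))"
  by (rule finite_free_resolution[OF is_cring assms infinite_UNIV_listI A_module _ _ generated])
    (use one_mem in auto)

text \<open>Existence of some resolution with bases in the list type turns the choice into an actual
  resolution; finiteness of the chosen bases is not implied.\<close>

lemma chosen_resolution_spec:
  assumes "noetherian_ring R"
  shows "\<exists>S d \<epsilon>. chosen_resolution R A = (S, d) \<and> free_resolution R A S d \<epsilon>"
proof -
  have "\<exists>z. case z of (S :: nat \<Rightarrow> ('r set \<times> 'r) list set, d) \<Rightarrow> \<exists>\<epsilon>. free_resolution R A S d \<epsilon>"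
    using finite_resolution[OF assms] by auto
  from someI_ex[OF this] show ?thesis
    unfolding chosen_resolution_def[symmetric] by (auto split: prod.splits)
qed

text \<open>The homology is torsion by the witness and linearly compact by comparison of
  resolutions; together these give the descending chain condition.\<close>

lemma Tor_artinian:
  assumes noeth: "noetherian_ring R" and M: "Module.module R M"
    and lc: "lin_compact R M (carrier M)" and q: "quasi_coartinian R \<aa> M"
  shows "artinian_module R (Tor R i A M)"
proof -
  obtain S d \<epsilon> where ch: "chosen_resolution R A = (S, d)" and res: "free_resolution R A S d \<epsilon>"
    using chosen_resolution_spec[OF noeth] by blast
  obtain S' :: "nat \<Rightarrow> ('r set \<times> 'r) list set" and d' \<epsilon>' where
    res': "free_resolution R A S' d' \<epsilon>'" and fin: "\<And>n. finite (S' n)"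
    using finite_resolution[OF noeth] by blast
  interpret res_tensor R A S d \<epsilon> M
    by (intro res_tensor.intro free_res.intro free_res_axioms.intro rmoduleI A_module M res)
  have G: "free_res R A S' d' \<epsilon>'"
    by (intro free_res.intro free_res_axioms.intro rmoduleI A_module res')
  let ?H = "res_homology R M S d i"
  interpret H: rmodule R ?H by (rule rmoduleI[OF homology_module])
  have "torsion_mod R ?H {\<zero>\<^bsub>?H\<^esub>} X" if "X \<in> carrier ?H" for X
  proof -
    obtain z where z: "z \<in> Z i" "X = B i +>\<^bsub>(T i)\<lparr>carrier := Z i\<rparr>\<^esub> z"
      using \<open>X \<in> carrier ?H\<close> unfolding homology_carrier by blast
    have "torsion_mod R (T i) (B i) z"
      by (rule homology_torsion[OF q \<aa>.a_subset annihilates z(1)])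
    then show ?thesis unfolding torsion_mod_def z(2) colon_homology[OF z(1)] .
  qed
  then have "\<exists>k. \<forall>n\<ge>k. N n = N k" if "\<And>n. submodule (N n) R ?H" "\<And>n. N (Suc n) \<subseteq> N n" for N :: "nat \<Rightarrow> _"
    using H.lin_compact_torsion_dcc[OF noeth homology_lin_compact[OF G fin lc]] that by blast
  then have "artinian_module R ?H" unfolding artinian_module_def using homology_module by blast
  then show ?thesis unfolding Tor_eq_res_homology[OF ch] .
qed

text \<open>The map \<open>F\<^sub>0 \<otimes> M \<rightarrow> M / \<aa>M\<close> comes from a lift \<open>F\<^sub>0 \<rightarrow> R\<close> of the augmentation \<open>F\<^sub>0 \<rightarrow> R/\<aa>\<close>.\<close>

lemma Tor_0_artinian_imp_torsion:
  assumes noeth: "noetherian_ring R" and M: "Module.module R M"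
    and art: "artinian_module R (Tor R 0 A M)" and x: "x \<in> carrier M"
  shows "torsion_mod R M (rmodule.ideal_smult R M \<aa> (carrier M)) x"
proof -
  obtain S d \<epsilon> where ch: "chosen_resolution R A = (S, d)" and res: "free_resolution R A S d \<epsilon>"
    using chosen_resolution_spec[OF noeth] by blast
  interpret res_tensor R A S d \<epsilon> M
    by (intro res_tensor.intro free_res.intro free_res_axioms.intro rmoduleI A_module M res)
  let ?H = "res_homology R M S d 0" and ?N = "M.ideal_smult \<aa> (carrier M)" and ?Z = "(T 0)\<lparr>carrier := Z 0\<rparr>"
  have N: "submodule ?N R M" by (rule M.ideal_smult_submodule[OF \<aa>]) simp
  let ?Q = "quot_module M ?N"
  have Q: "Module.module R ?Q" by (rule M.quot_module_module[OF N])
  have "\<exists>l\<in>mod_hom R (F 0) (regular_module R). \<forall>x\<in>carrier (F 0). cls (l x) = \<epsilon> x"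
    by (rule free_projective[OF regular_module_module A_module P.quot_proj_hom[OF sub] eps])
      (use P.quot_carrier[OF sub] eps.closed in auto)
  then obtain l where l: "l \<in> mod_hom R (F 0) (regular_module R)" "\<And>x. x \<in> carrier (F 0) \<Longrightarrow> cls (l x) = \<epsilon> x"
    by blast
  have lR: "l f \<in> carrier R" if "f \<in> carrier (F 0)" for f using mod_homD(1)[OF l(1) that] by simp
  have "\<exists>h\<in>mod_hom R (T 0) ?Q. \<forall>f\<in>carrier (F 0). \<forall>y\<in>carrier M.
      h (elem_tensor R (F 0) M f y) = ?N +>\<^bsub>M\<^esub> (l f \<odot>\<^bsub>M\<^esub> y)"
    by (rule tp.tensor_lift[OF Q])
      (use lR in \<open>simp_all add: M.quot_carrier[OF N] M.quot_add[OF N] M.quot_smult[OF N] mod_homD(2,3)[OF l(1)]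
        M.smult_l_distr M.smult_r_distr M.smult_assoc1 M.smult_commute\<close>)
  then obtain h where h: "h \<in> mod_hom R (T 0) ?Q"
    "\<And>f y. \<lbrakk>f \<in> carrier (F 0); y \<in> carrier M\<rbrakk> \<Longrightarrow> h (elem_tensor R (F 0) M f y) = ?N +>\<^bsub>M\<^esub> (l f \<odot>\<^bsub>M\<^esub> y)"
    by blast
  interpret h: mod_map R "T 0" ?Q h by (intro mod_mapI tp.tensor_module Q h)
  have N_zero: "?N +>\<^bsub>M\<^esub> y = \<zero>\<^bsub>?Q\<^esub> \<longleftrightarrow> y \<in> ?N" if y: "y \<in> carrier M" for y
  proof -
    have "\<ominus>\<^bsub>M\<^esub> \<zero>\<^bsub>M\<^esub> = \<zero>\<^bsub>M\<^esub>" by (rule M.M.minus_equality) simp_all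
    then have "y \<ominus>\<^bsub>M\<^esub> \<zero>\<^bsub>M\<^esub> = y" using y by (simp add: M.minus_eq)
    then show ?thesis unfolding M.quot_zero[OF N] using M.rcoset_eq_iff[OF N y M.M.zero_closed] by simp
  qed
  \<comment> \<open>Since \<epsilon> vanishes on boundaries, l (d f) lies in \<aa>, so boundaries go
    to zero in M/\<aa>M.\<close>
  have hB: "h w = \<zero>\<^bsub>?Q\<^esub>" if w: "w \<in> B 0" for w
  proof -
    obtain v where v: "v \<in> carrier (T (Suc 0))" "w = D 0 v" using w unfolding res_boundaries_def by auto
    have "h (D 0 v) = \<zero>\<^bsub>?Q\<^esub>"
    proof (rule tp.tensor_hom_ext[OF Q mod_hom_comp[OF D.h h(1)] mod_hom_zero[OF Q] _ v(1)])
      fix f y assume f: "f \<in> carrier (F (Suc 0))" and y: "y \<in> carrier M"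
      have "cls (l (d 0 f)) = \<zero>\<^bsub>A\<^esub>" using l(2)[OF d.closed[OF f]] eps_d[OF f] by simp
      then have "l (d 0 f) \<in> \<aa>" by (rule cls_eqD[OF lR[OF d.closed[OF f]]])
      then have "l (d 0 f) \<odot>\<^bsub>M\<^esub> y \<in> ?N" using y by (rule M.ideal_smult_mem)
      then show "h (D 0 (elem_tensor R (F (Suc 0)) M f y)) = \<zero>\<^bsub>?Q\<^esub>"
        using f y lR[OF d.closed[OF f]] by (simp add: D_tens h(2) d.closed N_zero)
    qed
    then show ?thesis using v(2) by simp
  qed
  \<comment> \<open>e lies over the class of 1, so l e is 1 modulo \<aa> and e \<otimes> x maps to
    the class of x. Annihilators can only grow along this map, which transfers torsion to x.\<close>
  obtain e where e: "e \<in> carrier (F 0)" "\<epsilon> e = cls \<one>" using one_mem eps_surj by (metis imageE)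
  have le: "\<one> \<ominus> l e \<in> \<aa>"
  proof -
    have "cls \<one> = cls (l e)" using l(2)[OF e(1)] e(2) by simp
    then have "\<one> \<ominus>\<^bsub>regular_module R\<^esub> l e \<in> \<aa>" using P.rcoset_eq_iff[OF sub, of \<one> "l e"] lR[OF e(1)] by simp
    moreover have "\<one> \<ominus>\<^bsub>regular_module R\<^esub> l e = \<one> \<ominus> l e"
      using P.smult_l_minus[of \<one> "l e"] lR[OF e(1)] by (simp add: P.M.minus_eq minus_eq l_minus)
    ultimately show ?thesis by simp
  qed
  let ?z = "elem_tensor R (F 0) M e x"
  have zT: "?z \<in> carrier (T 0)" by (rule tp.tens_closed[OF e(1) x])
  have z: "?z \<in> Z 0" using zT unfolding res_cycles_def by simp
  have "torsion_mod R ?H {\<zero>\<^bsub>?H\<^esub>} (B 0 +>\<^bsub>?Z\<^esub> ?z)"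
    by (rule rmodule.artinian_imp_torsion[OF rmoduleI[OF homology_module]])
      (use art z in \<open>auto simp: Tor_eq_res_homology[OF ch] homology_carrier\<close>)
  then have tz: "torsion_mod R (T 0) (B 0) ?z" unfolding torsion_mod_def colon_homology[OF z] .
  have "colon R (T 0) (B 0) ?z \<subseteq> colon R M ?N x"
  proof
    fix r assume "r \<in> colon R (T 0) (B 0) ?z"
    then have r: "r \<in> carrier R" "r \<odot>\<^bsub>T 0\<^esub> ?z \<in> B 0" unfolding colon_def by auto
    have rl: "r \<odot>\<^bsub>M\<^esub> (l e \<odot>\<^bsub>M\<^esub> x) \<in> carrier M" using r(1) lR[OF e(1)] x by simp
    have "?N +>\<^bsub>M\<^esub> (r \<odot>\<^bsub>M\<^esub> (l e \<odot>\<^bsub>M\<^esub> x)) = \<zero>\<^bsub>?Q\<^esub>"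
      using hB[OF r(2)] h.smult[OF r(1) zT] h(2)[OF e(1) x] M.quot_smult[OF N r(1), of "l e \<odot>\<^bsub>M\<^esub> x"] lR[OF e(1)] x
      by simp
    then have a: "r \<odot>\<^bsub>M\<^esub> (l e \<odot>\<^bsub>M\<^esub> x) \<in> ?N" using N_zero[OF rl] by simp
    have b: "r \<odot>\<^bsub>M\<^esub> ((\<one> \<ominus> l e) \<odot>\<^bsub>M\<^esub> x) \<in> ?N"
      by (rule M.submoduleE(4)[OF N r(1) M.ideal_smult_mem[OF le x]])
    have "r \<odot>\<^bsub>M\<^esub> ((\<one> \<ominus> l e) \<odot>\<^bsub>M\<^esub> x) \<oplus>\<^bsub>M\<^esub> r \<odot>\<^bsub>M\<^esub> (l e \<odot>\<^bsub>M\<^esub> x) = r \<odot>\<^bsub>M\<^esub> (((\<one> \<ominus> l e) \<oplus> l e) \<odot>\<^bsub>M\<^esub> x)"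
      using r(1) lR[OF e(1)] x by (simp add: M.smult_l_distr M.smult_r_distr)
    also have "(\<one> \<ominus> l e) \<oplus> l e = \<one>" using lR[OF e(1)] by (simp add: minus_eq a_assoc l_neg)
    finally have "r \<odot>\<^bsub>M\<^esub> ((\<one> \<ominus> l e) \<odot>\<^bsub>M\<^esub> x) \<oplus>\<^bsub>M\<^esub> r \<odot>\<^bsub>M\<^esub> (l e \<odot>\<^bsub>M\<^esub> x) = r \<odot>\<^bsub>M\<^esub> x" using x by simp
    then have "r \<odot>\<^bsub>M\<^esub> x \<in> ?N" using M.submoduleE(5)[OF N b a] by simp
    then show "r \<in> colon R M ?N x" unfolding colon_def using r(1) by simp
  qed
  then show ?thesis using tz unfolding torsion_mod_def by blast
qed

end

section \<open>Semi-discrete linearly compact modules\<close>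

text \<open>If every submodule is closed, the closed cosets are exactly the nonempty affine sets,
  and the topology drops out. Conversely the discrete topology is a suitable one.\<close>

lemma sdlc_iff_lin_compact:
  assumes M: "Module.module R M"
  shows "(\<exists>T. linearly_compact R M T \<and> semi_discrete R M T) \<longleftrightarrow> lin_compact R M (carrier M)"
proof
  interpret M: rmodule R M by (rule rmoduleI[OF M])
  assume "\<exists>T. linearly_compact R M T \<and> semi_discrete R M T"
  then obtain T where lc: "linearly_compact R M T" and sd: "semi_discrete R M T" by blast
  show "lin_compact R M (carrier M)" unfolding lin_compact_def
  proof (intro allI impI)
    fix \<F> assume h: "(\<forall>C\<in>\<F>. affine_subset R M C \<and> C \<subseteq> carrier M) \<and> (\<forall>\<G>\<subseteq>\<F>. finite \<G> \<longrightarrow> \<Inter>\<G> \<noteq> {})"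
    have "closed_coset R M T C" if C: "C \<in> \<F>" for C
    proof -
      \<comment> \<open>The finite intersection property of a single set rules out the empty affine
        set.\<close>
      have "\<Inter>{C} \<noteq> {}" using h C by blast
      then obtain a where a: "a \<in> C" by auto
      have aff: "affine_subset R M C" using h C by simp
      obtain N where N: "submodule N R M" "C = N +>\<^bsub>M\<^esub> a" using M.affine_imp_coset[OF aff a] by blast
      moreover have "closedin T N" using sd N(1) unfolding semi_discrete_def by simp
      moreover have "a \<in> carrier M" using a aff unfolding affine_subset_def by auto
      ultimately show ?thesis unfolding closed_coset_def by (intro exI[of _ N] exI[of _ a]) simp
    qed
    moreover have "(\<forall>C\<in>\<F>. closed_coset R M T C) \<and> (\<forall>\<G>\<subseteq>\<F>. finite \<G> \<longrightarrow> \<Inter>\<G> \<noteq> {}) \<longrightarrow> \<Inter>\<F> \<noteq> {}"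
      using lc unfolding linearly_compact_def by simp
    ultimately show "\<Inter>\<F> \<noteq> {}" using h by simp
  qed
next
  interpret M: rmodule R M by (rule rmoduleI[OF M])
  assume lc: "lin_compact R M (carrier M)"
  let ?T = "discrete_topology (carrier M)"
  have top: "topological_module R M ?T" unfolding topological_module_def
    by (auto simp: M prod_topology_discrete_topology[symmetric])
  have z: "zero_nbhd M ?T {\<zero>\<^bsub>M\<^esub>}" 
    unfolding zero_nbhd_def by (intro conjI exI[of _ "{\<zero>\<^bsub>M\<^esub>}"]) simp_all
  have z0: "\<zero>\<^bsub>M\<^esub> \<in> U" if "zero_nbhd M ?T U" for U using that unfolding zero_nbhd_def by blast
  have "\<exists>N. submodule N R M \<and> zero_nbhd M ?T N \<and> N \<subseteq> U" if "zero_nbhd M ?T U" for U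
    using M.submodule_zero_set z z0[OF that] by (intro exI[of _ "{\<zero>\<^bsub>M\<^esub>}"]) simp
  then have lt: "linearly_topologized R M ?T" unfolding linearly_topologized_def using top by simp
  have hd: "hausdorff_module M ?T" unfolding hausdorff_module_def
  proof (rule equalityI)
    show "\<Inter>{U. zero_nbhd M ?T U} \<subseteq> {\<zero>\<^bsub>M\<^esub>}" by (rule Inter_lower) (use z in simp)
    show "{\<zero>\<^bsub>M\<^esub>} \<subseteq> \<Inter>{U. zero_nbhd M ?T U}" using z0 by simp
  qed
  have "\<Inter>\<F> \<noteq> {}" if h: "\<forall>C\<in>\<F>. closed_coset R M ?T C" "\<forall>\<G>\<subseteq>\<F>. finite \<G> \<longrightarrow> \<Inter>\<G> \<noteq> {}" for \<F>
  proof (rule lin_compactD[OF lc])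
    fix C assume "C \<in> \<F>"
    then obtain N x where "submodule N R M" "x \<in> carrier M" "C = N +>\<^bsub>M\<^esub> x"
      using h(1) unfolding closed_coset_def by blast
    then show "affine_subset R M C" using M.affine_coset M.rcoset_eq_Collect by simp
    then show "C \<subseteq> carrier M" unfolding affine_subset_def by simp
  qed (use h(2) in blast)
  then have "linearly_compact R M ?T" unfolding linearly_compact_def using lt hd by simp
  moreover have "semi_discrete R M ?T" unfolding semi_discrete_def
    using M.submodule_mem by auto
  ultimately show "\<exists>T. linearly_compact R M T \<and> semi_discrete R M T" by blast
qed

text \<open>The circle closes here, passing from all degrees of \<open>Tor\<close> through degree 0
  and a witness back to all degrees. The right-hand side mentions neither \<open>Tor\<close> nor a
  topology.\<close>

lemma sdlc_coartinian_iff: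
  assumes R: "cring R" and noeth: "noetherian_ring R" and \<aa>: "ideal \<aa> R"
  shows "M \<in> sdlc_coartinian_modules R \<aa> \<longleftrightarrow> Module.module R M \<and> lin_compact R M (carrier M) \<and>
    cosupp R M \<subseteq> prime_variety R \<aa> \<and> quasi_coartinian R \<aa> M"
proof -
  interpret ideal_quotient R \<aa> by (simp add: ideal_quotient_def ideal_quotient_axioms_def R \<aa>)
  have "(\<forall>i. artinian_module R (Tor R i A M)) \<longleftrightarrow> quasi_coartinian R \<aa> M"
    if M: "Module.module R M" and lc: "lin_compact R M (carrier M)"
    using Tor_artinian[OF noeth M lc] Tor_0_artinian_imp_torsion[OF noeth M]
      rmodule.lin_compact_quasi_coartinian[OF rmoduleI[OF M] noeth lc \<aa>] by blast
  then show ?thesis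
    unfolding sdlc_coartinian_modules_def coartinian_def using sdlc_iff_lin_compact by blast
qed

section \<open>Full subcategories of the category of modules\<close>

text \<open>Brings modules of cosets or of pairs back into the element type of the category, with
  the operations computed through the inverse of the injection.\<close>

lemma module_transport:
  fixes N :: "('r, 'n) module" and j :: "'n \<Rightarrow> 'm"
  assumes N: "Module.module R N" and j: "inj_on j (carrier N)"
  shows "\<exists>Q :: ('r, 'm) module. Module.module R Q \<and> j \<in> mod_hom R N Q \<and> j ` carrier N = carrier Q"
proof -
  interpret N: rmodule R N by (rule rmoduleI[OF N])
  let ?k = "the_inv_into (carrier N) j"
  define Q :: "('r, 'm) module" where "Q = \<lparr>carrier = j ` carrier N, mult = undefined, one = undefined,
    zero = j \<zero>\<^bsub>N\<^esub>, add = (\<lambda>x y. j (?k x \<oplus>\<^bsub>N\<^esub> ?k y)), smult = (\<lambda>r x. j (r \<odot>\<^bsub>N\<^esub> ?k x))\<rparr>"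
  have k: "?k (j x) = x" if "x \<in> carrier N" for x using that j by (rule the_inv_into_f_f[rotated])
  have "Module.module R Q"
  proof (rule moduleI)
    show "cring R" by (rule N.R.is_cring)
    show "abelian_group Q"
    proof (rule abelian_groupI)
      fix x assume "x \<in> carrier Q"
      then obtain a where a: "a \<in> carrier N" "x = j a" unfolding Q_def by auto
      then show "\<exists>y\<in>carrier Q. y \<oplus>\<^bsub>Q\<^esub> x = \<zero>\<^bsub>Q\<^esub>"
        by (intro bexI[of _ "j (\<ominus>\<^bsub>N\<^esub> a)"]) (simp_all add: Q_def k N.M.l_neg)
    qed (auto simp: Q_def k N.M.a_ac)
  qed (auto simp: Q_def k N.smult_l_distr N.smult_r_distr N.smult_assoc1)
  moreover have "j \<in> mod_hom R N Q" by (rule mod_homI) (simp_all add: Q_def k)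
  moreover have "j ` carrier N = carrier Q" by (simp add: Q_def)
  ultimately show ?thesis by blast
qed

text \<open>Cosets have the wrong type for an object of the category. Choosing a representative of
  each coset is injective, so the quotient can be transported into the type of M.\<close>

lemma (in rmodule) quotient_representative:
  assumes H: "submodule H R M"
  shows "\<exists>(Q :: ('r, 'm) module) q. Module.module R Q \<and> q \<in> mod_hom R M Q \<and>
    q ` carrier M = carrier Q \<and> mod_ker M Q q = H"
proof -
  let ?N = "quot_module M H" and ?j = "\<lambda>X. SOME x. x \<in> X"
  have N: "Module.module R ?N" by (rule quot_module_module[OF H])
  have rep: "H +>\<^bsub>M\<^esub> ?j (H +>\<^bsub>M\<^esub> x) = H +>\<^bsub>M\<^esub> x" if x: "x \<in> carrier M" for x
  proof -
    have "x \<in> H +>\<^bsub>M\<^esub> x" using x submodule_zero[OF H] by (simp add: mem_rcoset_iff[OF H x] M.minus_eq M.r_neg)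
    then have "?j (H +>\<^bsub>M\<^esub> x) \<in> H +>\<^bsub>M\<^esub> x" by (rule someI)
    then show ?thesis using rcoset_eq_iff[OF H _ x] mem_rcoset_iff[OF H x] by blast
  qed
  have inj: "inj_on ?j (carrier ?N)"
  proof (rule inj_onI)
    fix X Y assume "X \<in> carrier ?N" "Y \<in> carrier ?N" and eq: "?j X = ?j Y"
    then obtain x y where xy: "x \<in> carrier M" "X = H +>\<^bsub>M\<^esub> x" "y \<in> carrier M" "Y = H +>\<^bsub>M\<^esub> y"
      unfolding quot_carrier[OF H] by blast
    have "X = H +>\<^bsub>M\<^esub> ?j X" unfolding xy(2) by (rule rep[OF xy(1), symmetric])
    also have "\<dots> = Y" unfolding eq xy(4) by (rule rep[OF xy(3)])
    finally show "X = Y" .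
  qed
  obtain Q :: "('r, 'm) module" where Q: "Module.module R Q" "?j \<in> mod_hom R ?N Q" "?j ` carrier ?N = carrier Q"
    using module_transport[OF N inj] by blast
  interpret j: mod_map R ?N Q ?j by (rule mod_mapI[OF N Q(1,2)])
  let ?q = "\<lambda>x. ?j (H +>\<^bsub>M\<^esub> x)"
  have "?q \<in> mod_hom R M Q" by (rule mod_hom_comp[OF quot_proj_hom[OF H] Q(2)])
  moreover have "?q ` carrier M = carrier Q" unfolding Q(3)[symmetric] quot_carrier[OF H] by (simp add: image_image)
  moreover have "mod_ker M Q ?q = H"
  proof -
    have "?q x = \<zero>\<^bsub>Q\<^esub> \<longleftrightarrow> x \<in> H" if x: "x \<in> carrier M" for x
    proof -
      have neg0: "\<ominus>\<^bsub>M\<^esub> \<zero>\<^bsub>M\<^esub> = \<zero>\<^bsub>M\<^esub>" by (rule M.minus_equality) simp_all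
      have "?q x = \<zero>\<^bsub>Q\<^esub> \<longleftrightarrow> ?j (H +>\<^bsub>M\<^esub> x) = ?j \<zero>\<^bsub>?N\<^esub>" using j.zero by simp
      also have "\<dots> \<longleftrightarrow> H +>\<^bsub>M\<^esub> x = \<zero>\<^bsub>?N\<^esub>"
        by (rule inj_on_eq_iff[OF inj]) (use x quot_carrier[OF H] in auto)
      also have "\<dots> \<longleftrightarrow> x \<in> H"
        unfolding quot_zero[OF H] rcoset_eq_iff[OF H x M.zero_closed] using x by (simp add: M.minus_eq neg0)
      finally show ?thesis .
    qed
    then show ?thesis unfolding mod_ker_def using submodule_mem[OF H] by blast
  qed
  ultimately show ?thesis using Q(1) by blast
qed

section \<open>Direct sums inside the universe\<close>

definition biproduct ::
  "('r, 'x) ring_scheme \<Rightarrow> ('r, 'm) module \<Rightarrow> ('r, 'm) module \<Rightarrow> ('r, 'm) module \<Rightarrow>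
    ('m \<Rightarrow> 'm) \<Rightarrow> ('m \<Rightarrow> 'm) \<Rightarrow> ('m \<Rightarrow> 'm) \<Rightarrow> ('m \<Rightarrow> 'm) \<Rightarrow> bool" where
  "biproduct R X Y P p q i j \<longleftrightarrow> Module.module R P \<and> p \<in> mod_hom R P X \<and> q \<in> mod_hom R P Y \<and>
     i \<in> mod_hom R X P \<and> j \<in> mod_hom R Y P \<and>
     (\<forall>x\<in>carrier X. p (i x) = x \<and> q (i x) = \<zero>\<^bsub>Y\<^esub>) \<and> (\<forall>y\<in>carrier Y. p (j y) = \<zero>\<^bsub>X\<^esub> \<and> q (j y) = y) \<and>
     (\<forall>z\<in>carrier P. z = i (p z) \<oplus>\<^bsub>P\<^esub> j (q z))"

text \<open>An infinite type is in bijection with its square, so pairs can be coded by single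
  elements.\<close>

lemma ex_biproduct:
  fixes X Y :: "('r, 'm) module"
  assumes X: "Module.module R X" and Y: "Module.module R Y" and inf: "infinite (UNIV :: 'm set)"
  shows "\<exists>P p q i j. biproduct R X Y P p q i j"
proof -
  interpret X: rmodule R X by (rule rmoduleI[OF X])
  interpret Y: rmodule R Y by (rule rmoduleI[OF Y])
  have "\<exists>c :: 'm \<times> 'm \<Rightarrow> 'm. bij_betw c (UNIV \<times> UNIV) UNIV"
    using card_of_Times_same_infinite[OF inf] unfolding card_of_ordIso[symmetric] .
  then obtain c :: "'m \<times> 'm \<Rightarrow> 'm" where c: "bij_betw c (UNIV \<times> UNIV) UNIV" by blast
  then have inj: "inj c" unfolding bij_betw_def by simp
  define N :: "('r, 'm \<times> 'm) module" where "N = \<lparr>carrier = carrier X \<times> carrier Y, mult = undefined, one = undefined,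
    zero = (\<zero>\<^bsub>X\<^esub>, \<zero>\<^bsub>Y\<^esub>), add = (\<lambda>u v. (fst u \<oplus>\<^bsub>X\<^esub> fst v, snd u \<oplus>\<^bsub>Y\<^esub> snd v)),
    smult = (\<lambda>r u. (r \<odot>\<^bsub>X\<^esub> fst u, r \<odot>\<^bsub>Y\<^esub> snd u))\<rparr>"
  have N: "Module.module R N"
  proof (rule moduleI)
    show "cring R" by (rule X.R.is_cring)
    show "abelian_group N"
    proof (rule abelian_groupI)
      fix u assume "u \<in> carrier N"
      then show "\<exists>v\<in>carrier N. v \<oplus>\<^bsub>N\<^esub> u = \<zero>\<^bsub>N\<^esub>"
        by (intro bexI[of _ "(\<ominus>\<^bsub>X\<^esub> fst u, \<ominus>\<^bsub>Y\<^esub> snd u)"]) (auto simp: N_def X.M.l_neg Y.M.l_neg)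
    qed (auto simp: N_def X.M.a_ac Y.M.a_ac)
  qed (auto simp: N_def X.smult_l_distr Y.smult_l_distr X.smult_r_distr Y.smult_r_distr X.smult_assoc1 Y.smult_assoc1)
  obtain P :: "('r, 'm) module" where P: "Module.module R P" "c \<in> mod_hom R N P" "c ` carrier N = carrier P"
    using module_transport[OF N inj_on_subset[OF inj subset_UNIV]] by blast
  define ci where "ci = inv_into UNIV c"
  have ci: "ci (c u) = u" for u unfolding ci_def using inj by simp
  have cN: "ci z \<in> carrier N" "c (ci z) = z" if "z \<in> carrier P" for z
    using that ci unfolding P(3)[symmetric] by auto
  have invhom: "ci \<in> mod_hom R P N"
  proof (rule mod_homI)
    show "ci z \<in> carrier N" if "z \<in> carrier P" for z by (rule cN(1)[OF that])
    show "ci (z \<oplus>\<^bsub>P\<^esub> w) = ci z \<oplus>\<^bsub>N\<^esub> ci w" if "z \<in> carrier P" "w \<in> carrier P" for z w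
      using mod_homD(2)[OF P(2) cN(1)[OF that(1)] cN(1)[OF that(2)]] cN(2)[OF that(1)] cN(2)[OF that(2)] ci by metis
    show "ci (r \<odot>\<^bsub>P\<^esub> z) = r \<odot>\<^bsub>N\<^esub> ci z" if "r \<in> carrier R" "z \<in> carrier P" for r z
      using mod_homD(3)[OF P(2) that(1) cN(1)[OF that(2)]] cN(2)[OF that(2)] ci by metis
  qed
  have "biproduct R X Y P (\<lambda>z. fst (ci z)) (\<lambda>z. snd (ci z)) (\<lambda>x. c (x, \<zero>\<^bsub>Y\<^esub>)) (\<lambda>y. c (\<zero>\<^bsub>X\<^esub>, y))"
    unfolding biproduct_def
  proof (intro conjI ballI)
    show "(\<lambda>z. fst (ci z)) \<in> mod_hom R P X" "(\<lambda>z. snd (ci z)) \<in> mod_hom R P Y"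
      by (rule mod_hom_comp[OF invhom], rule mod_homI, auto simp: N_def)+
    show "(\<lambda>x. c (x, \<zero>\<^bsub>Y\<^esub>)) \<in> mod_hom R X P" "(\<lambda>y. c (\<zero>\<^bsub>X\<^esub>, y)) \<in> mod_hom R Y P"
      by (rule mod_hom_comp[OF _ P(2)], rule mod_homI, auto simp: N_def)+
    fix z assume z: "z \<in> carrier P"
    obtain x y where xy: "ci z = (x, y)" "x \<in> carrier X" "y \<in> carrier Y" using cN(1)[OF z] unfolding N_def by auto
    have "c (x, \<zero>\<^bsub>Y\<^esub>) \<oplus>\<^bsub>P\<^esub> c (\<zero>\<^bsub>X\<^esub>, y) = c ((x, \<zero>\<^bsub>Y\<^esub>) \<oplus>\<^bsub>N\<^esub> (\<zero>\<^bsub>X\<^esub>, y))"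
      by (rule mod_homD(2)[OF P(2), symmetric]) (use xy in \<open>simp_all add: N_def\<close>)
    also have "\<dots> = z" using xy cN(2)[OF z] by (simp add: N_def)
    finally show "z = c (fst (ci z), \<zero>\<^bsub>Y\<^esub>) \<oplus>\<^bsub>P\<^esub> c (\<zero>\<^bsub>X\<^esub>, snd (ci z))" using xy(1) by simp
  qed (simp_all add: P(1) ci)
  then show ?thesis by blast
qed

text \<open>\<open>sum_in\<close> yields two constructions at once: a quotient is an image of X used
  twice, and a biproduct is spanned by its two injections. The locale is applied both to the given
  class and to the class of all modules.\<close>

locale module_class = cring R for R :: "('r, 'x) ring_scheme" (structure) +
  fixes \<A> :: "('r, 'm) module set"
  assumes infinite_universe: "infinite (UNIV :: 'm set)"
    and mod: "M \<in> \<A> \<Longrightarrow> Module.module R M"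
    and zero_in: "\<lbrakk>Module.module R Z; carrier Z = {\<zero>\<^bsub>Z\<^esub>}\<rbrakk> \<Longrightarrow> Z \<in> \<A>"
    and sub_in: "\<lbrakk>M \<in> \<A>; submodule H R M\<rbrakk> \<Longrightarrow> M\<lparr>carrier := H\<rparr> \<in> \<A>"
    and sum_in: "\<lbrakk>X \<in> \<A>; Y \<in> \<A>; Module.module R P; i \<in> mod_hom R X P; j \<in> mod_hom R Y P;
      carrier P \<subseteq> {i x \<oplus>\<^bsub>P\<^esub> j y | x y. x \<in> carrier X \<and> y \<in> carrier Y}\<rbrakk> \<Longrightarrow> P \<in> \<A>"
begin

abbreviation D where "D \<equiv> full_subcat (module_cat R) \<A>"

lemma D_simps [simp]:
  "Obj D = \<A>" "Hom D M N = mod_hom R M N \<inter> extensional (carrier M)"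
  "Comp D M N L g f = compose (carrier M) g f" "Ident D M = (\<lambda>x\<in>carrier M. x)"
  by (simp_all add: full_subcat_def module_cat_def)

lemma rmod: "M \<in> \<A> \<Longrightarrow> rmodule R M"
  by (rule rmoduleI[OF mod])

lemma map: "\<lbrakk>X \<in> \<A>; Y \<in> \<A>; f \<in> mod_hom R X Y\<rbrakk> \<Longrightarrow> mod_map R X Y f"
  by (rule mod_mapI[OF mod mod])

lemma hom_restrict: "f \<in> mod_hom R X Y \<Longrightarrow> X \<in> \<A> \<Longrightarrow> restrict f (carrier X) \<in> mod_hom R X Y \<inter> extensional (carrier X)"
proof -
  assume f: "f \<in> mod_hom R X Y" and X: "X \<in> \<A>"
  interpret X: rmodule R X by (rule rmod[OF X])
  show ?thesis using mod_homD[OF f] by (auto intro!: mod_homI)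
qed

lemma hom_compose:
  assumes "X \<in> \<A>" "f \<in> mod_hom R X Y" "g \<in> mod_hom R Y Z"
  shows "compose (carrier X) g f \<in> mod_hom R X Z \<inter> extensional (carrier X)"
  using hom_restrict[OF mod_hom_comp[OF assms(2,3)] assms(1)] by (simp add: compose_def)

lemma image_in:
  assumes X: "X \<in> \<A>" and P: "Module.module R P" and i: "i \<in> mod_hom R X P" and surj: "i ` carrier X = carrier P"
  shows "P \<in> \<A>"
proof (rule sum_in[OF X X P i i])
  interpret i: mod_map R X P i by (rule mod_mapI[OF mod[OF X] P i])
  show "carrier P \<subseteq> {i x \<oplus>\<^bsub>P\<^esub> i y | x y. x \<in> carrier X \<and> y \<in> carrier X}"
  proof
    fix z assume z: "z \<in> carrier P"
    then obtain x where x: "x \<in> carrier X" "z = i x" unfolding surj[symmetric] by blast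
    then have "z = i x \<oplus>\<^bsub>P\<^esub> i \<zero>\<^bsub>X\<^esub>" using z by (simp add: i.zero)
    then show "z \<in> {i x \<oplus>\<^bsub>P\<^esub> i y | x y. x \<in> carrier X \<and> y \<in> carrier X}" using x(1) i.M.M.zero_closed by blast
  qed
qed

lemma category_D: "is_category D"
  unfolding is_category_def
proof (intro conjI ballI)
  fix X assume X: "X \<in> Obj D"
  then show "Ident D X \<in> Hom D X X" using hom_restrict[OF mod_hom_ident] by simp
next
  fix X Y Z f g assume "X \<in> Obj D" "Y \<in> Obj D" "Z \<in> Obj D" "f \<in> Hom D X Y" "g \<in> Hom D Y Z"
  then show "Comp D X Y Z g f \<in> Hom D X Z" using hom_compose[of X f Y g Z] by simp
next
  fix X Y f assume "X \<in> Obj D" "Y \<in> Obj D" "f \<in> Hom D X Y"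
  then have f: "f \<in> mod_hom R X Y" "f \<in> extensional (carrier X)" by auto
  show "Comp D X X Y f (Ident D X) = f"
    using f(2) by (auto simp: compose_def extensional_def fun_eq_iff)
  show "Comp D X Y Y (Ident D Y) f = f"
    using f(2) mod_homD(1)[OF f(1)] by (auto simp: compose_def extensional_def fun_eq_iff)
next
  fix W X Y Z f g h assume "W \<in> Obj D" "X \<in> Obj D" "Y \<in> Obj D" "Z \<in> Obj D" "f \<in> Hom D W X" "g \<in> Hom D X Y" "h \<in> Hom D Y Z"
  then have "f \<in> mod_hom R W X" by simp
  then show "Comp D W Y Z h (Comp D W X Y g f) = Comp D W X Z (Comp D X Y Z h g) f"
    using mod_homD(1)[of f R W X] by (auto simp: compose_def fun_eq_iff)
qed

definition Z0 :: "('r, 'm) module" where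
  "Z0 = \<lparr>carrier = {undefined}, mult = undefined, one = undefined, zero = undefined,
     add = (\<lambda>_ _. undefined), smult = (\<lambda>_ _. undefined)\<rparr>"

lemma Z0_carrier: "carrier Z0 = {\<zero>\<^bsub>Z0\<^esub>}"
  by (simp add: Z0_def)

lemma Z0_in: "Z0 \<in> \<A>"
proof (rule zero_in[OF _ Z0_carrier])
  show "Module.module R Z0"
  proof (rule moduleI)
    show "abelian_group Z0" by (rule abelian_groupI) (auto simp: Z0_def)
  qed (auto simp: Z0_def is_cring)
qed

lemma zero_hom: "\<lbrakk>X \<in> \<A>; Y \<in> \<A>\<rbrakk> \<Longrightarrow> (\<lambda>x\<in>carrier X. \<zero>\<^bsub>Y\<^esub>) \<in> mod_hom R X Y \<inter> extensional (carrier X)"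
  by (rule hom_restrict[OF mod_hom_zero[OF mod]])

lemma Z0_zero_object: "zero_object D Z0"
  unfolding zero_object_def
proof (intro conjI ballI)
  show "Z0 \<in> Obj D" using Z0_in by simp
  fix X assume "X \<in> Obj D"
  then have X: "X \<in> \<A>" by simp
  show "\<exists>!f. f \<in> Hom D X Z0"
  proof (rule ex1I)
    show "(\<lambda>x\<in>carrier X. \<zero>\<^bsub>Z0\<^esub>) \<in> Hom D X Z0" using zero_hom[OF X Z0_in] by simp
    fix f assume "f \<in> Hom D X Z0"
    then have f: "f \<in> mod_hom R X Z0" "f \<in> extensional (carrier X)" by auto
    show "f = (\<lambda>x\<in>carrier X. \<zero>\<^bsub>Z0\<^esub>)"
      by (rule extensionalityI[OF f(2)]) (use mod_homD(1)[OF f(1)] Z0_carrier in auto)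
  qed
  show "\<exists>!f. f \<in> Hom D Z0 X"
  proof (rule ex1I)
    show "(\<lambda>x\<in>carrier Z0. \<zero>\<^bsub>X\<^esub>) \<in> Hom D Z0 X" using zero_hom[OF Z0_in X] by simp
    fix f assume "f \<in> Hom D Z0 X"
    then have f: "f \<in> mod_hom R Z0 X" "f \<in> extensional (carrier Z0)" by auto
    interpret f: mod_map R Z0 X f by (rule map[OF Z0_in X f(1)])
    show "f = (\<lambda>x\<in>carrier Z0. \<zero>\<^bsub>X\<^esub>)"
      by (rule extensionalityI[OF f(2)]) (use f.zero Z0_carrier in auto)
  qed
qed

text \<open>On a zero object the identity and the zero endomorphism must coincide.\<close>

lemma zero_object_carrier:
  assumes "zero_object D Z" shows "Z \<in> \<A>" "carrier Z = {\<zero>\<^bsub>Z\<^esub>}"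
proof -
  show Z: "Z \<in> \<A>" using assms unfolding zero_object_def by simp
  interpret Z: rmodule R Z by (rule rmod[OF Z])
  have "\<exists>!f. f \<in> Hom D Z Z" using assms unfolding zero_object_def by blast
  moreover have "(\<lambda>x\<in>carrier Z. x) \<in> Hom D Z Z" using hom_restrict[OF mod_hom_ident Z] by simp
  moreover have "(\<lambda>x\<in>carrier Z. \<zero>\<^bsub>Z\<^esub>) \<in> Hom D Z Z" using zero_hom[OF Z Z] by simp
  ultimately have "(\<lambda>x\<in>carrier Z. x) = (\<lambda>x\<in>carrier Z. \<zero>\<^bsub>Z\<^esub>)" by blast
  then have "x = \<zero>\<^bsub>Z\<^esub>" if "x \<in> carrier Z" for x using that by (metis restrict_apply')
  then show "carrier Z = {\<zero>\<^bsub>Z\<^esub>}" using Z.M.zero_closed by blast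
qed

text \<open>A map through a zero object passes through a one-element module and so vanishes; for the
  converse, \<open>Z0\<close> provides the factorisation.\<close>

lemma zero_morphism_iff:
  assumes X: "X \<in> \<A>" and Y: "Y \<in> \<A>"
  shows "zero_morphism D X Y f \<longleftrightarrow> f = (\<lambda>x\<in>carrier X. \<zero>\<^bsub>Y\<^esub>)"
proof
  assume "zero_morphism D X Y f"
  then obtain Z u v where Z: "zero_object D Z" and u: "u \<in> mod_hom R X Z" and v: "v \<in> mod_hom R Z Y"
    and f: "f = compose (carrier X) v u" unfolding zero_morphism_def by auto
  interpret v: mod_map R Z Y v by (rule map[OF zero_object_carrier(1)[OF Z] Y v])
  have "v (u x) = \<zero>\<^bsub>Y\<^esub>" if "x \<in> carrier X" for x
    using mod_homD(1)[OF u that] zero_object_carrier(2)[OF Z] v.zero by auto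
  then show "f = (\<lambda>x\<in>carrier X. \<zero>\<^bsub>Y\<^esub>)" unfolding f compose_def by (auto simp: fun_eq_iff)
next
  assume f: "f = (\<lambda>x\<in>carrier X. \<zero>\<^bsub>Y\<^esub>)"
  have "f = Comp D X Z0 Y (\<lambda>x\<in>carrier Z0. \<zero>\<^bsub>Y\<^esub>) (\<lambda>x\<in>carrier X. \<zero>\<^bsub>Z0\<^esub>)"
    unfolding f by (auto simp: compose_def fun_eq_iff Z0_carrier)
  then show "zero_morphism D X Y f"
    unfolding zero_morphism_def using Z0_zero_object zero_hom[OF X Z0_in] zero_hom[OF Z0_in Y] by force
qed

lemma zero_comp_iff:
  assumes "X \<in> \<A>" "Y \<in> \<A>"
  shows "zero_morphism D X Y (compose (carrier X) g f) \<longleftrightarrow> (\<forall>x\<in>carrier X. g (f x) = \<zero>\<^bsub>Y\<^esub>)"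
  unfolding zero_morphism_iff[OF assms] by (auto simp: compose_def fun_eq_iff restrict_def)

lemma kernel_in:
  assumes X: "X \<in> \<A>" and Y: "Y \<in> \<A>" and f: "f \<in> mod_hom R X Y"
  shows "X\<lparr>carrier := mod_ker X Y f\<rparr> \<in> \<A>"
    and "(\<lambda>x\<in>mod_ker X Y f. x) \<in> mod_hom R (X\<lparr>carrier := mod_ker X Y f\<rparr>) X \<inter> extensional (mod_ker X Y f)"
proof -
  interpret f: mod_map R X Y f by (rule map[OF X Y f])
  show K: "X\<lparr>carrier := mod_ker X Y f\<rparr> \<in> \<A>" by (rule sub_in[OF X f.ker_submodule])
  show "(\<lambda>x\<in>mod_ker X Y f. x) \<in> mod_hom R (X\<lparr>carrier := mod_ker X Y f\<rparr>) X \<inter> extensional (mod_ker X Y f)"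
    using hom_restrict[OF f.M.incl_mod_hom[OF f.ker_submodule] K] by simp
qed

lemma is_kernelI:
  assumes X: "X \<in> \<A>" and Y: "Y \<in> \<A>" and f: "f \<in> mod_hom R X Y"
    and K: "K \<in> \<A>" and k: "k \<in> mod_hom R K X" "k \<in> extensional (carrier K)"
    and inj: "inj_on k (carrier K)" and im: "k ` carrier K = mod_ker X Y f"
  shows "is_kernel D X Y f K k"
  unfolding is_kernel_def
proof (intro conjI ballI impI)
  show "K \<in> Obj D" "k \<in> Hom D K X" using K k by auto
  show "zero_morphism D K Y (Comp D K X Y f k)"
    unfolding D_simps zero_comp_iff[OF K Y] using im unfolding mod_ker_def by blast
  fix W g assume "W \<in> Obj D" "g \<in> Hom D W X" and z: "zero_morphism D W Y (Comp D W X Y f g)"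
  then have W: "W \<in> \<A>" and g: "g \<in> mod_hom R W X" "g \<in> extensional (carrier W)" by auto
  interpret k: mod_map R K X k by (rule map[OF K X k(1)])
  have gk: "g w \<in> k ` carrier K" if "w \<in> carrier W" for w
    using z that mod_homD(1)[OF g(1) that] unfolding im mod_ker_def D_simps zero_comp_iff[OF W Y] by blast
  let ?u = "\<lambda>w. the_inv_into (carrier K) k (g w)"
  have u: "?u w \<in> carrier K" "k (?u w) = g w" if "w \<in> carrier W" for w
    using the_inv_into_into[OF inj gk[OF that] subset_refl] f_the_inv_into_f[OF inj gk[OF that]] by auto
  have uniq: "a = ?u w" if "a \<in> carrier K" "k a = g w" "w \<in> carrier W" for a w
    using the_inv_into_f_eq[OF inj that(2,1)] by simp
  interpret W: rmodule R W by (rule rmod[OF W])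
  have uhom: "?u \<in> mod_hom R W K"
  proof (rule mod_homI)
    show "?u (x \<oplus>\<^bsub>W\<^esub> y) = ?u x \<oplus>\<^bsub>K\<^esub> ?u y" if "x \<in> carrier W" "y \<in> carrier W" for x y
      by (rule uniq[symmetric]) (use that u in \<open>simp_all add: k.add mod_homD(2)[OF g(1)]\<close>)
    show "?u (r \<odot>\<^bsub>W\<^esub> x) = r \<odot>\<^bsub>K\<^esub> ?u x" if "r \<in> carrier R" "x \<in> carrier W" for r x
      by (rule uniq[symmetric]) (use that u in \<open>simp_all add: k.smult mod_homD(3)[OF g(1)]\<close>)
  qed (rule u(1))
  show "\<exists>!u. u \<in> Hom D W K \<and> Comp D W K X k u = g"
  proof (rule ex1I)
    show "restrict ?u (carrier W) \<in> Hom D W K \<and> Comp D W K X k (restrict ?u (carrier W)) = g"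
      using hom_restrict[OF uhom W] u(2) g(2) by (auto simp: compose_def fun_eq_iff extensional_def)
    fix v assume v: "v \<in> Hom D W K \<and> Comp D W K X k v = g"
    then have v': "v \<in> mod_hom R W K" "v \<in> extensional (carrier W)" "compose (carrier W) k v = g" by auto
    show "v = restrict ?u (carrier W)"
    proof (rule extensionalityI[OF v'(2)])
      fix w assume w: "w \<in> carrier W"
      have "k (v w) = g w" using v'(3) w by (auto simp: compose_def)
      then show "v w = restrict ?u (carrier W) w" using uniq[OF mod_homD(1)[OF v'(1) w] _ w] w by simp
    qed simp
  qed
qed

text \<open>The universal property lifts the inclusion of the concrete kernel to a map u with k u =
  id, and its uniqueness part gives u k = id. Apart from membership in \<A> the right-hand side does
  not depend on the class, which is why kernels remain kernels among all modules.\<close>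

lemma is_kernel_iff:
  assumes X: "X \<in> \<A>" and Y: "Y \<in> \<A>" and f: "f \<in> mod_hom R X Y"
  shows "is_kernel D X Y f K k \<longleftrightarrow> K \<in> \<A> \<and> k \<in> mod_hom R K X \<and> k \<in> extensional (carrier K) \<and>
    inj_on k (carrier K) \<and> k ` carrier K = mod_ker X Y f"
proof
  assume ker: "is_kernel D X Y f K k"
  then have K: "K \<in> \<A>" and k: "k \<in> mod_hom R K X" "k \<in> extensional (carrier K)"
    and fk: "\<And>x. x \<in> carrier K \<Longrightarrow> f (k x) = \<zero>\<^bsub>Y\<^esub>"
    unfolding is_kernel_def using zero_comp_iff[of K Y f k] Y by auto
  have univ: "\<exists>!u. u \<in> mod_hom R W K \<inter> extensional (carrier W) \<and> compose (carrier W) k u = g"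
    if "W \<in> \<A>" "g \<in> mod_hom R W X" "g \<in> extensional (carrier W)" "\<And>w. w \<in> carrier W \<Longrightarrow> f (g w) = \<zero>\<^bsub>Y\<^esub>" for W g
    using ker that zero_comp_iff[OF that(1) Y, of f g] unfolding is_kernel_def by simp
  interpret k: mod_map R K X k by (rule map[OF K X k(1)])
  let ?K = "X\<lparr>carrier := mod_ker X Y f\<rparr>" and ?k = "\<lambda>x\<in>mod_ker X Y f. x"
  note K0 = kernel_in[OF X Y f]
  have "\<exists>!u. u \<in> mod_hom R ?K K \<inter> extensional (carrier ?K) \<and> compose (carrier ?K) k u = ?k"
    by (rule univ) (use K0 in \<open>auto simp: mod_ker_def\<close>)
  then obtain u where u: "u \<in> mod_hom R ?K K" "compose (carrier ?K) k u = ?k" by blast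
  have ku: "k (u x) = x" if "x \<in> mod_ker X Y f" for x
    using fun_cong[OF u(2), of x] that by (simp add: compose_def)
  have uK: "u x \<in> carrier K" if "x \<in> mod_ker X Y f" for x using mod_homD(1)[OF u(1)] that by simp
  have kker: "k x \<in> mod_ker X Y f" if "x \<in> carrier K" for x
    unfolding mod_ker_def using fk[OF that] k.closed[OF that] by simp
  have im: "k ` carrier K = mod_ker X Y f"
    using kker ku uK by force
  have inj: "inj_on k (carrier K)"
  proof (rule inj_on_inverseI)
    have "(\<lambda>x. x) \<in> mod_hom R K K" by (rule mod_hom_ident)
    then have id: "(\<lambda>x\<in>carrier K. x) \<in> mod_hom R K K \<inter> extensional (carrier K)" by (rule hom_restrict[OF _ K])
    have "k \<in> mod_hom R K ?K" by (rule mod_homI) (simp_all add: kker k.add k.smult)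
    then have uk: "compose (carrier K) u k \<in> mod_hom R K K \<inter> extensional (carrier K)"
      by (rule hom_compose[OF K _ u(1)])
    \<comment> \<open>u k and the identity both factor k through itself, so uniqueness identifies
      them.\<close>
    have "compose (carrier K) k (compose (carrier K) u k) = k"
      using k(2) ku kker by (auto simp: compose_def fun_eq_iff extensional_def)
    moreover have "compose (carrier K) k (\<lambda>x\<in>carrier K. x) = k"
      using k(2) by (auto simp: compose_def fun_eq_iff extensional_def)
    ultimately have "compose (carrier K) u k = (\<lambda>x\<in>carrier K. x)"
      using univ[OF K k fk] id uk by blast
    then show "u (k x) = x" if "x \<in> carrier K" for x
      using that by (metis compose_eq restrict_apply')
  qed
  show "K \<in> \<A> \<and> k \<in> mod_hom R K X \<and> k \<in> extensional (carrier K) \<and> inj_on k (carrier K) \<and> k ` carrier K = mod_ker X Y f"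
    using K k inj im by blast
qed (use is_kernelI[OF X Y f] in blast)

lemma is_cokernelI:
  assumes X: "X \<in> \<A>" and Y: "Y \<in> \<A>" and f: "f \<in> mod_hom R X Y"
    and Q: "Q \<in> \<A>" and q: "q \<in> mod_hom R Y Q" "q \<in> extensional (carrier Y)"
    and surj: "q ` carrier Y = carrier Q" and ker: "mod_ker Y Q q = f ` carrier X"
  shows "is_cokernel D X Y f Q q"
  unfolding is_cokernel_def
proof (intro conjI ballI impI)
  show "Q \<in> Obj D" "q \<in> Hom D Y Q" using Q q by auto
  show "zero_morphism D X Q (Comp D X Y Q q f)"
    unfolding D_simps zero_comp_iff[OF X Q] using ker unfolding mod_ker_def by blast
  fix W g assume "W \<in> Obj D" "g \<in> Hom D Y W" and z: "zero_morphism D X W (Comp D X Y W g f)"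
  then have W: "W \<in> \<A>" and g: "g \<in> mod_hom R Y W" "g \<in> extensional (carrier Y)" by auto
  interpret g: mod_map R Y W g by (rule map[OF Y W g(1)])
  interpret q: mod_map R Y Q q by (rule map[OF Y Q q(1)])
  have gf: "g y = \<zero>\<^bsub>W\<^esub>" if "y \<in> mod_ker Y Q q" for y
    using z that unfolding ker D_simps zero_comp_iff[OF X W] by blast
  \<comment> \<open>g kills the image of f, which is the kernel of q, so it is constant on the
    fibres of q.\<close>
  have wd: "g y = g y'" if y: "y \<in> carrier Y" "y' \<in> carrier Y" "q y = q y'" for y y'
  proof -
    have "y \<ominus>\<^bsub>Y\<^esub> y' \<in> mod_ker Y Q q"
      unfolding mod_ker_def using y q.closed q.N.diff_eq_zero_iff by (simp add: q.diff)
    then have "g y \<ominus>\<^bsub>W\<^esub> g y' = \<zero>\<^bsub>W\<^esub>" using gf y g.diff by metis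
    then show ?thesis using g.N.diff_eq_zero_iff g.closed y by blast
  qed
  let ?u = "\<lambda>z. g (inv_into (carrier Y) q z)"
  have u: "?u (q y) = g y" if "y \<in> carrier Y" for y
    by (rule wd) (use that in \<open>auto intro: inv_into_into f_inv_into_f\<close>)
  have rep: "\<exists>y\<in>carrier Y. z = q y" if "z \<in> carrier Q" for z using that unfolding surj[symmetric] by blast
  have uhom: "?u \<in> mod_hom R Q W"
  proof (rule mod_homI)
    show "?u z \<in> carrier W" if "z \<in> carrier Q" for z using rep[OF that] u g.closed by force
    show "?u (z \<oplus>\<^bsub>Q\<^esub> w) = ?u z \<oplus>\<^bsub>W\<^esub> ?u w" if zw: "z \<in> carrier Q" "w \<in> carrier Q" for z w
    proof -
      obtain y y' where y: "y \<in> carrier Y" "y' \<in> carrier Y" "z = q y" "w = q y'" using rep zw by blast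
      have "z \<oplus>\<^bsub>Q\<^esub> w = q (y \<oplus>\<^bsub>Y\<^esub> y')" using y by (simp add: q.add)
      then show ?thesis using u y g.add by simp
    qed
    show "?u (r \<odot>\<^bsub>Q\<^esub> z) = r \<odot>\<^bsub>W\<^esub> ?u z" if rz: "r \<in> carrier R" "z \<in> carrier Q" for r z
    proof -
      obtain y where y: "y \<in> carrier Y" "z = q y" using rep rz by blast
      have "r \<odot>\<^bsub>Q\<^esub> z = q (r \<odot>\<^bsub>Y\<^esub> y)" using y rz by (simp add: q.smult)
      then show ?thesis using u y rz g.smult by simp
    qed
  qed
  show "\<exists>!u. u \<in> Hom D Q W \<and> Comp D Y Q W u q = g"
  proof (rule ex1I)
    show "restrict ?u (carrier Q) \<in> Hom D Q W \<and> Comp D Y Q W (restrict ?u (carrier Q)) q = g"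
      using hom_restrict[OF uhom Q] u g(2) q.closed by (auto simp: compose_def fun_eq_iff extensional_def)
    fix v assume "v \<in> Hom D Q W \<and> Comp D Y Q W v q = g"
    then have v: "v \<in> mod_hom R Q W" "v \<in> extensional (carrier Q)" "compose (carrier Y) v q = g" by auto
    show "v = restrict ?u (carrier Q)"
    proof (rule extensionalityI[OF v(2)])
      fix z assume z: "z \<in> carrier Q"
      then obtain y where y: "y \<in> carrier Y" "z = q y" using rep by blast
      have "v (q y) = g y" using v(3) y(1) by (auto simp: compose_def)
      then show "v z = restrict ?u (carrier Q) z" using u[OF y(1)] y z by simp
    qed simp
  qed
qed

lemma ex_quotient:
  assumes Y: "Y \<in> \<A>" and H: "submodule H R Y"
  shows "\<exists>Q q. Q \<in> \<A> \<and> q \<in> mod_hom R Y Q \<and> q \<in> extensional (carrier Y) \<and> q ` carrier Y = carrier Q \<and> mod_ker Y Q q = H"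
proof -
  obtain Q :: "('r, 'm) module" and q where Q: "Module.module R Q" "q \<in> mod_hom R Y Q" "q ` carrier Y = carrier Q" "mod_ker Y Q q = H"
    using rmodule.quotient_representative[OF rmod[OF Y] H] by blast
  have "Q \<in> \<A>" by (rule image_in[OF Y Q(1-3)])
  moreover have "mod_ker Y Q (restrict q (carrier Y)) = H" using Q(4) unfolding mod_ker_def by auto
  ultimately show ?thesis using hom_restrict[OF Q(2) Y] Q(3)
    by (intro exI[of _ Q] exI[of _ "restrict q (carrier Y)"]) auto
qed

text \<open>The given cokernel q and the concrete quotient q0 factor through each other by u and v.
  The factorisation of q0 determines the kernel of q, and uniqueness makes v u the identity, which
  gives surjectivity.\<close>

lemma is_cokernel_iff:
  assumes X: "X \<in> \<A>" and Y: "Y \<in> \<A>" and f: "f \<in> mod_hom R X Y"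
  shows "is_cokernel D X Y f Q q \<longleftrightarrow> Q \<in> \<A> \<and> q \<in> mod_hom R Y Q \<and> q \<in> extensional (carrier Y) \<and>
    q ` carrier Y = carrier Q \<and> mod_ker Y Q q = f ` carrier X"
proof
  assume cok: "is_cokernel D X Y f Q q"
  interpret f: mod_map R X Y f by (rule map[OF X Y f])
  have Q: "Q \<in> \<A>" and q: "q \<in> mod_hom R Y Q" "q \<in> extensional (carrier Y)"
    using cok unfolding is_cokernel_def by auto
  have qf: "\<And>x. x \<in> carrier X \<Longrightarrow> q (f x) = \<zero>\<^bsub>Q\<^esub>"
    using cok zero_comp_iff[OF X Q, of q f] unfolding is_cokernel_def by auto
  have univ: "\<exists>!u. u \<in> mod_hom R Q W \<inter> extensional (carrier Q) \<and> compose (carrier Y) u q = g"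
    if "W \<in> \<A>" "g \<in> mod_hom R Y W" "g \<in> extensional (carrier Y)" "\<And>x. x \<in> carrier X \<Longrightarrow> g (f x) = \<zero>\<^bsub>W\<^esub>" for W g
    using cok that zero_comp_iff[OF X that(1), of g f] unfolding is_cokernel_def by simp
  obtain Q0 q0 where Q0: "Q0 \<in> \<A>" and q0: "q0 \<in> mod_hom R Y Q0" "q0 \<in> extensional (carrier Y)"
    "q0 ` carrier Y = carrier Q0" "mod_ker Y Q0 q0 = f ` carrier X"
    using ex_quotient[OF Y f.image_submodule[OF f.M.carrier_is_submodule]] by blast
  have cok0: "is_cokernel D X Y f Q0 q0" by (rule is_cokernelI[OF X Y f Q0 q0])
  have q0f: "q0 (f x) = \<zero>\<^bsub>Q0\<^esub>" if "x \<in> carrier X" for x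
    using q0(4) that unfolding mod_ker_def by blast
  obtain u where u: "u \<in> mod_hom R Q Q0" "u \<in> extensional (carrier Q)" "compose (carrier Y) u q = q0"
    using univ[OF Q0 q0(1,2) q0f] by blast
  have "\<exists>!v. v \<in> Hom D Q0 Q \<and> Comp D Y Q0 Q v q0 = q"
    using cok0 Q q zero_comp_iff[OF X Q, of q f] qf unfolding is_cokernel_def by simp
  then obtain v where v: "v \<in> mod_hom R Q0 Q" "compose (carrier Y) v q0 = q" by auto
  have uq: "u (q y) = q0 y" and vq0: "v (q0 y) = q y" if "y \<in> carrier Y" for y
    using fun_cong[OF u(3), of y] fun_cong[OF v(2), of y] that by (simp_all add: compose_def)
  interpret q: mod_map R Y Q q by (rule map[OF Y Q q(1)])
  interpret u: mod_map R Q Q0 u by (rule map[OF Q Q0 u(1)])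
  have "mod_ker Y Q q = f ` carrier X"
  proof
    show "f ` carrier X \<subseteq> mod_ker Y Q q" unfolding mod_ker_def using qf f.closed by auto
    show "mod_ker Y Q q \<subseteq> f ` carrier X"
      unfolding q0(4)[symmetric] mod_ker_def using uq u.zero by (auto, metis)
  qed
  moreover have "q ` carrier Y = carrier Q"
  proof
    show "q ` carrier Y \<subseteq> carrier Q" using q.closed by blast
    show "carrier Q \<subseteq> q ` carrier Y"
    proof
      fix z assume z: "z \<in> carrier Q"
      have "compose (carrier Q) v u \<in> mod_hom R Q Q \<inter> extensional (carrier Q)" by (rule hom_compose[OF Q u(1) v(1)])
      moreover have "compose (carrier Y) (compose (carrier Q) v u) q = q"
        using q(2) q.closed uq vq0 by (auto simp: compose_def fun_eq_iff extensional_def)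
      moreover have "(\<lambda>x\<in>carrier Q. x) \<in> mod_hom R Q Q \<inter> extensional (carrier Q)" by (rule hom_restrict[OF mod_hom_ident Q])
      moreover have "compose (carrier Y) (\<lambda>x\<in>carrier Q. x) q = q"
        using q(2) q.closed by (auto simp: compose_def fun_eq_iff extensional_def)
      ultimately have "compose (carrier Q) v u = (\<lambda>x\<in>carrier Q. x)" using univ[OF Q q qf] by blast
      then have "v (u z) = z" using z by (metis compose_eq restrict_apply')
      moreover obtain y where "y \<in> carrier Y" "u z = q0 y" using u.closed[OF z] q0(3) by (metis imageE)
      ultimately have "z = q y" using vq0 by simp
      then show "z \<in> q ` carrier Y" using \<open>y \<in> carrier Y\<close> by blast
    qed
  qed
  ultimately show "Q \<in> \<A> \<and> q \<in> mod_hom R Y Q \<and> q \<in> extensional (carrier Y) \<and>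
      q ` carrier Y = carrier Q \<and> mod_ker Y Q q = f ` carrier X"
    using Q q by blast
qed (use is_cokernelI[OF X Y f] in blast)

lemma ex_kernel:
  assumes X: "X \<in> \<A>" and Y: "Y \<in> \<A>" and f: "f \<in> mod_hom R X Y"
  shows "is_kernel D X Y f (X\<lparr>carrier := mod_ker X Y f\<rparr>) (\<lambda>x\<in>mod_ker X Y f. x)"
  using kernel_in[OF X Y f] by (intro is_kernelI[OF X Y f]) (auto simp: inj_on_def)

text \<open>One biproduct serves both purposes; the decomposition z = i (p z) + j (q z) forces
  uniqueness of the mediating maps.\<close>

lemma ex_product_coproduct:
  assumes X: "X \<in> \<A>" and Y: "Y \<in> \<A>"
  shows "\<exists>P p q. is_product D X Y P p q" and "\<exists>S i j. is_coproduct D X Y S i j"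
proof -
  obtain P p q i j where "biproduct R X Y P p q i j" using ex_biproduct[OF mod[OF X] mod[OF Y] infinite_universe] by blast
  then have mP: "Module.module R P" and p: "p \<in> mod_hom R P X" and q: "q \<in> mod_hom R P Y"
    and i: "i \<in> mod_hom R X P" and j: "j \<in> mod_hom R Y P"
    and pi: "\<And>x. x \<in> carrier X \<Longrightarrow> p (i x) = x" "\<And>x. x \<in> carrier X \<Longrightarrow> q (i x) = \<zero>\<^bsub>Y\<^esub>"
    and pj: "\<And>y. y \<in> carrier Y \<Longrightarrow> p (j y) = \<zero>\<^bsub>X\<^esub>" "\<And>y. y \<in> carrier Y \<Longrightarrow> q (j y) = y"
    and dec: "\<And>z. z \<in> carrier P \<Longrightarrow> z = i (p z) \<oplus>\<^bsub>P\<^esub> j (q z)"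
    unfolding biproduct_def by blast+
  have P: "P \<in> \<A>"
  proof (rule sum_in[OF X Y mP i j])
    show "carrier P \<subseteq> {i x \<oplus>\<^bsub>P\<^esub> j y | x y. x \<in> carrier X \<and> y \<in> carrier Y}"
      using dec mod_homD(1)[OF p] mod_homD(1)[OF q] by blast
  qed
  interpret p: mod_map R P X p by (rule map[OF P X p])
  interpret q: mod_map R P Y q by (rule map[OF P Y q])
  interpret i: mod_map R X P i by (rule map[OF X P i])
  interpret j: mod_map R Y P j by (rule map[OF Y P j])
  have "is_product D X Y P (restrict p (carrier P)) (restrict q (carrier P))"
    unfolding is_product_def
  proof (intro conjI ballI)
    show "P \<in> Obj D" "restrict p (carrier P) \<in> Hom D P X" "restrict q (carrier P) \<in> Hom D P Y"
      using P hom_restrict[OF p P] hom_restrict[OF q P] by auto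
    fix W f g assume "W \<in> Obj D" "f \<in> Hom D W X" "g \<in> Hom D W Y"
    then have W: "W \<in> \<A>" and f: "f \<in> mod_hom R W X" "f \<in> extensional (carrier W)"
      and g: "g \<in> mod_hom R W Y" "g \<in> extensional (carrier W)" by auto
    note fc = mod_homD(1)[OF f(1)] and gc = mod_homD(1)[OF g(1)]
    let ?u = "\<lambda>w. i (f w) \<oplus>\<^bsub>P\<^esub> j (g w)"
    have uhom: "?u \<in> mod_hom R W P" by (rule mod_hom_add[OF mP mod_hom_comp[OF f(1) i] mod_hom_comp[OF g(1) j]])
    show "\<exists>!u. u \<in> Hom D W P \<and> Comp D W P X (restrict p (carrier P)) u = f \<and> Comp D W P Y (restrict q (carrier P)) u = g"
    proof (rule ex1I)
      show "restrict ?u (carrier W) \<in> Hom D W P \<and>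
          Comp D W P X (restrict p (carrier P)) (restrict ?u (carrier W)) = f \<and>
          Comp D W P Y (restrict q (carrier P)) (restrict ?u (carrier W)) = g"
        using hom_restrict[OF uhom W] f(2) g(2)
        by (auto simp: compose_def fun_eq_iff extensional_def i.closed j.closed fc gc p.add q.add pi pj)
      fix v assume "v \<in> Hom D W P \<and> Comp D W P X (restrict p (carrier P)) v = f \<and> Comp D W P Y (restrict q (carrier P)) v = g"
      then have v: "v \<in> mod_hom R W P" "v \<in> extensional (carrier W)"
        "compose (carrier W) (restrict p (carrier P)) v = f" "compose (carrier W) (restrict q (carrier P)) v = g" by auto
      show "v = restrict ?u (carrier W)"
      proof (rule extensionalityI[OF v(2)])
        fix w assume w: "w \<in> carrier W"
        have vw: "v w \<in> carrier P" by (rule mod_homD(1)[OF v(1) w])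
        have "p (v w) = f w" "q (v w) = g w" using fun_cong[OF v(3), of w] fun_cong[OF v(4), of w] w vw by (simp_all add: compose_def)
        then show "v w = restrict ?u (carrier W) w" using dec[OF vw] w by simp
      qed simp
    qed
  qed
  then show "\<exists>P p q. is_product D X Y P p q" by blast
  have "is_coproduct D X Y P (restrict i (carrier X)) (restrict j (carrier Y))"
    unfolding is_coproduct_def
  proof (intro conjI ballI)
    show "P \<in> Obj D" "restrict i (carrier X) \<in> Hom D X P" "restrict j (carrier Y) \<in> Hom D Y P"
      using P hom_restrict[OF i X] hom_restrict[OF j Y] by auto
    fix W f g assume "W \<in> Obj D" "f \<in> Hom D X W" "g \<in> Hom D Y W"
    then have W: "W \<in> \<A>" and f: "f \<in> mod_hom R X W" "f \<in> extensional (carrier X)"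
      and g: "g \<in> mod_hom R Y W" "g \<in> extensional (carrier Y)" by auto
    interpret f: mod_map R X W f by (rule map[OF X W f(1)])
    interpret g: mod_map R Y W g by (rule map[OF Y W g(1)])
    let ?u = "\<lambda>z. f (p z) \<oplus>\<^bsub>W\<^esub> g (q z)"
    have uhom: "?u \<in> mod_hom R P W" by (rule mod_hom_add[OF mod[OF W] mod_hom_comp[OF p f(1)] mod_hom_comp[OF q g(1)]])
    show "\<exists>!u. u \<in> Hom D P W \<and> Comp D X P W u (restrict i (carrier X)) = f \<and> Comp D Y P W u (restrict j (carrier Y)) = g"
    proof (rule ex1I)
      show "restrict ?u (carrier P) \<in> Hom D P W \<and>
          Comp D X P W (restrict ?u (carrier P)) (restrict i (carrier X)) = f \<and>
          Comp D Y P W (restrict ?u (carrier P)) (restrict j (carrier Y)) = g"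
        using hom_restrict[OF uhom P] f(2) g(2)
        by (auto simp: compose_def fun_eq_iff extensional_def i.closed j.closed pi pj f.zero g.zero f.closed g.closed)
      fix v assume "v \<in> Hom D P W \<and> Comp D X P W v (restrict i (carrier X)) = f \<and> Comp D Y P W v (restrict j (carrier Y)) = g"
      then have v: "v \<in> mod_hom R P W" "v \<in> extensional (carrier P)"
        "compose (carrier X) v (restrict i (carrier X)) = f" "compose (carrier Y) v (restrict j (carrier Y)) = g" by auto
      show "v = restrict ?u (carrier P)"
      proof (rule extensionalityI[OF v(2)])
        fix z assume z: "z \<in> carrier P"
        have c: "p z \<in> carrier X" "q z \<in> carrier Y" using p.closed[OF z] q.closed[OF z] by auto
        have "v (i (p z)) = f (p z)" "v (j (q z)) = g (q z)"
          using fun_cong[OF v(3), of "p z"] fun_cong[OF v(4), of "q z"] c by (simp_all add: compose_def)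
        moreover have "v z = v (i (p z)) \<oplus>\<^bsub>W\<^esub> v (j (q z))"
          using mod_homD(2)[OF v(1) i.closed[OF c(1)] j.closed[OF c(2)]] dec[OF z] by simp
        ultimately show "v z = restrict ?u (carrier P) z" using z by simp
      qed simp
    qed
  qed
  then show "\<exists>S i j. is_coproduct D X Y S i j" by blast
qed

text \<open>Composed with f, the kernel inclusion and the zero map agree, so f is injective. It is
  then the kernel of the projection onto the quotient by its image.\<close>

lemma mono_is_kernel:
  assumes X: "X \<in> \<A>" and Y: "Y \<in> \<A>" and mono: "is_mono D X Y f"
  shows "\<exists>Z\<in>Obj D. \<exists>g\<in>Hom D Y Z. is_kernel D Y Z g X f"
proof -
  have f: "f \<in> mod_hom R X Y" "f \<in> extensional (carrier X)" using mono unfolding is_mono_def by auto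
  interpret f: mod_map R X Y f by (rule map[OF X Y f(1)])
  let ?K = "X\<lparr>carrier := mod_ker X Y f\<rparr>" and ?k = "\<lambda>x\<in>mod_ker X Y f. x"
  note K = kernel_in[OF X Y f(1)]
  have cancel: "u = v" if "u \<in> Hom D ?K X" "v \<in> Hom D ?K X" "Comp D ?K X Y f u = Comp D ?K X Y f v" for u v
    using mono K(1) that unfolding is_mono_def D_simps by blast
  have "?k = (\<lambda>x\<in>carrier ?K. \<zero>\<^bsub>X\<^esub>)"
  proof (rule cancel)
    show "?k \<in> Hom D ?K X" using K(2) by simp
    show "(\<lambda>x\<in>carrier ?K. \<zero>\<^bsub>X\<^esub>) \<in> Hom D ?K X" unfolding D_simps by (rule zero_hom[OF K(1) X])
    show "Comp D ?K X Y f ?k = Comp D ?K X Y f (\<lambda>x\<in>carrier ?K. \<zero>\<^bsub>X\<^esub>)"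
      by (auto simp: compose_def fun_eq_iff f.zero mod_ker_def)
  qed
  have k0: "x = \<zero>\<^bsub>X\<^esub>" if "x \<in> mod_ker X Y f" for x
    using fun_cong[OF \<open>?k = (\<lambda>x\<in>carrier ?K. \<zero>\<^bsub>X\<^esub>)\<close>, of x] that by simp
  have inj: "inj_on f (carrier X)"
  proof (rule inj_onI)
    fix x y assume xy: "x \<in> carrier X" "y \<in> carrier X" "f x = f y"
    then have "f (x \<ominus>\<^bsub>X\<^esub> y) = \<zero>\<^bsub>Y\<^esub>" using f.N.diff_eq_zero_iff f.closed by (simp add: f.diff)
    then have "x \<ominus>\<^bsub>X\<^esub> y = \<zero>\<^bsub>X\<^esub>" using xy by (intro k0) (simp add: mod_ker_def)
    then show "x = y" using f.M.diff_eq_zero_iff xy by blast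
  qed
  obtain Q q where Q: "Q \<in> \<A>" and q: "q \<in> mod_hom R Y Q" "q \<in> extensional (carrier Y)" "mod_ker Y Q q = f ` carrier X"
    using ex_quotient[OF Y f.image_submodule[OF f.M.carrier_is_submodule]] by blast
  have "is_kernel D Y Q q X f" by (rule is_kernelI[OF Y Q q(1) X f inj q(3)[symmetric]])
  then show ?thesis using Q q by auto
qed

text \<open>The projection onto the quotient by the image of f and the zero map agree after f, so
  the quotient vanishes and f is surjective. It is then the cokernel of its kernel
  inclusion.\<close>

lemma epi_is_cokernel:
  assumes X: "X \<in> \<A>" and Y: "Y \<in> \<A>" and epi: "is_epi D X Y f"
  shows "\<exists>W\<in>Obj D. \<exists>g\<in>Hom D W X. is_cokernel D W X g Y f"
proof -
  have f: "f \<in> mod_hom R X Y" "f \<in> extensional (carrier X)" using epi unfolding is_epi_def by auto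
  interpret f: mod_map R X Y f by (rule map[OF X Y f(1)])
  obtain Q q where Q: "Q \<in> \<A>" and q: "q \<in> mod_hom R Y Q" "q \<in> extensional (carrier Y)" "mod_ker Y Q q = f ` carrier X"
    using ex_quotient[OF Y f.image_submodule[OF f.M.carrier_is_submodule]] by blast
  have cancel: "u = v" if "u \<in> Hom D Y Q" "v \<in> Hom D Y Q" "Comp D X Y Q u f = Comp D X Y Q v f" for u v
    using epi Q that unfolding is_epi_def D_simps by blast
  have "q = (\<lambda>y\<in>carrier Y. \<zero>\<^bsub>Q\<^esub>)"
  proof (rule cancel)
    show "q \<in> Hom D Y Q" using q by simp
    show "(\<lambda>y\<in>carrier Y. \<zero>\<^bsub>Q\<^esub>) \<in> Hom D Y Q" unfolding D_simps by (rule zero_hom[OF Y Q])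
    have "q (f x) = \<zero>\<^bsub>Q\<^esub>" if "x \<in> carrier X" for x
      using q(3) that unfolding mod_ker_def by blast
    then show "Comp D X Y Q q f = Comp D X Y Q (\<lambda>y\<in>carrier Y. \<zero>\<^bsub>Q\<^esub>) f"
      by (auto simp: compose_def fun_eq_iff f.closed)
  qed
  then have "mod_ker Y Q q = carrier Y" unfolding mod_ker_def by auto
  then have surj: "f ` carrier X = carrier Y" using q(3) by simp
  let ?K = "X\<lparr>carrier := mod_ker X Y f\<rparr>" and ?k = "\<lambda>x\<in>mod_ker X Y f. x"
  note K = kernel_in[OF X Y f(1)]
  have "is_cokernel D ?K X ?k Y f"
    by (rule is_cokernelI[OF K(1) X _ Y f surj]) (use K(2) in auto)
  then show ?thesis using K by (intro bexI[of _ ?K] bexI[of _ ?k]) auto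
qed

theorem abelian_D: "abelian_category D"
  unfolding abelian_category_def
proof (intro conjI ballI allI impI)
  show "is_category D" by (rule category_D)
  show "\<exists>Z. zero_object D Z" using Z0_zero_object by blast
  fix X Y assume "X \<in> Obj D" "Y \<in> Obj D"
  then have XY: "X \<in> \<A>" "Y \<in> \<A>" by auto
  show "\<exists>P p q. is_product D X Y P p q" "\<exists>S i j. is_coproduct D X Y S i j"
    by (rule ex_product_coproduct[OF XY])+
  {
    fix f assume "f \<in> Hom D X Y"
    then have f: "f \<in> mod_hom R X Y" by simp
    interpret f: mod_map R X Y f by (rule map[OF XY f])
    show "\<exists>K k. is_kernel D X Y f K k" using ex_kernel[OF XY f] by blast
    obtain Q q where "Q \<in> \<A>" "q \<in> mod_hom R Y Q" "q \<in> extensional (carrier Y)" "q ` carrier Y = carrier Q" "mod_ker Y Q q = f ` carrier X"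
      using ex_quotient[OF XY(2) f.image_submodule[OF f.M.carrier_is_submodule]] by blast
    then show "\<exists>Q q. is_cokernel D X Y f Q q" using is_cokernelI[OF XY f] by blast
  }
  fix f
  show "is_mono D X Y f \<Longrightarrow> \<exists>Z\<in>Obj D. \<exists>g\<in>Hom D Y Z. is_kernel D Y Z g X f" by (rule mono_is_kernel[OF XY])
  show "is_epi D X Y f \<Longrightarrow> \<exists>W\<in>Obj D. \<exists>g\<in>Hom D W X. is_cokernel D W X g Y f" by (rule epi_is_cokernel[OF XY])
qed

text \<open>All modules form a class of the same kind, so the concrete descriptions of kernels and
  cokernels hold in both categories and agree.\<close>

theorem abelian_subcategory_D: "abelian_subcategory D (module_cat R)"
proof -
  interpret C: module_class R "{M :: ('r, 'm) module. Module.module R M}"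
  proof (intro module_class.intro module_class_axioms.intro is_cring infinite_universe)
    show "M\<lparr>carrier := H\<rparr> \<in> {M. Module.module R M}"
      if "M \<in> {M. Module.module R M}" "submodule H R M" for M :: "('r, 'm) module" and H
      using rmodule.module_restrict[OF rmoduleI that(2)] that(1) by simp
  qed simp_all
  have CD: "module_cat R = C.D" by (simp add: full_subcat_def module_cat_def)
  have AC: "M \<in> {M. Module.module R M}" if "M \<in> \<A>" for M using mod[OF that] by simp
  then have AC_sub: "\<A> \<subseteq> {M. Module.module R M}" by (rule subsetI)
  have "subcategory D C.D" unfolding subcategory_def D_simps C.D_simps
    using category_D C.category_D AC_sub by simp
  moreover have "is_kernel C.D X Y f K k" if "X \<in> \<A>" "Y \<in> \<A>" "f \<in> mod_hom R X Y" "is_kernel D X Y f K k" for X Y f K k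
    using that(4) AC[of K] unfolding is_kernel_iff[OF that(1-3)] C.is_kernel_iff[OF AC[OF that(1)] AC[OF that(2)] that(3)]
    by (elim conjE) (intro conjI)
  moreover have "is_cokernel C.D X Y f Q q" if "X \<in> \<A>" "Y \<in> \<A>" "f \<in> mod_hom R X Y" "is_cokernel D X Y f Q q" for X Y f Q q
    using that(4) AC[of Q] unfolding is_cokernel_iff[OF that(1-3)] C.is_cokernel_iff[OF AC[OF that(1)] AC[OF that(2)] that(3)]
    by (elim conjE) (intro conjI)
  ultimately have "abelian_subcategory D C.D" unfolding abelian_subcategory_def using abelian_D by simp
  then show ?thesis using CD by simp
qed

end

section \<open>Closure properties of the semi-discrete linearly compact coartinian modules\<close>

lemma zero_module_sdlc_coartinian:
  assumes R: "cring R" and noeth: "noetherian_ring R" and \<aa>: "ideal \<aa> R"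
    and Z: "Module.module R Z" "carrier Z = {\<zero>\<^bsub>Z\<^esub>}"
  shows "Z \<in> sdlc_coartinian_modules R \<aa>"
  unfolding sdlc_coartinian_iff[OF R noeth \<aa>]
proof (intro conjI)
  interpret Z: rmodule R Z by (rule rmoduleI[OF Z(1)])
  have not: "\<not> carrier R \<subseteq> p" if "primeideal p R" for p
    using primeideal.one_notin[OF that] Z.R.one_closed by blast
  show "lin_compact R Z (carrier Z)" unfolding lin_compact_def Z(2)
  proof (intro allI impI)
    fix \<F> assume h: "(\<forall>C\<in>\<F>. affine_subset R Z C \<and> C \<subseteq> {\<zero>\<^bsub>Z\<^esub>}) \<and> (\<forall>\<G>\<subseteq>\<F>. finite \<G> \<longrightarrow> \<Inter>\<G> \<noteq> {})"
    have "\<zero>\<^bsub>Z\<^esub> \<in> C" if C: "C \<in> \<F>" for C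
    proof -
      have "\<Inter>{C} \<noteq> {}" using h C by blast
      then show ?thesis using h C by auto
    qed
    then show "\<Inter>\<F> \<noteq> {}" by blast
  qed
  show "cosupp R Z \<subseteq> prime_variety R \<aa>"
  proof
    fix p assume "p \<in> cosupp R Z"
    then obtain E g where p: "primeideal p R" and coc: "cocyclic_map R Z E g"
      and ann: "{r \<in> carrier R. \<forall>x\<in>carrier Z. r \<odot>\<^bsub>E\<^esub> g x = \<zero>\<^bsub>E\<^esub>} \<subseteq> p"
      unfolding cosupp_iff[OF Z(1)] by blast
    have E: "Module.module R E" using cocyclic_map_injective[OF coc] unfolding injective_module_def by auto
    have g: "g \<in> mod_hom R Z E" using coc unfolding cocyclic_map_def by blast
    interpret g: mod_map R Z E g by (rule mod_mapI[OF Z(1) E g])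
    \<comment> \<open>Every scalar annihilates the image of the zero module, and no prime contains
      all scalars; so the cosupport is empty.\<close>
    have "carrier R \<subseteq> p" using ann Z(2) by (auto simp: g.zero)
    then show "p \<in> prime_variety R \<aa>" using not[OF p] by blast
  qed
  show "quasi_coartinian R \<aa> Z" unfolding quasi_coartinian_def coartinian_witness_def
  proof (intro exI[of _ "carrier Z"] conjI ballI allI impI)
    show "torsion_mod R Z (carrier Z) x" if "x \<in> carrier Z" for x
      by (rule Z.torsion_mod_zero[OF Z.carrier_is_submodule that])
    fix p assume p: "primeideal p R \<and> \<aa> \<subseteq> p \<and> {r \<in> carrier R. \<forall>x\<in>carrier Z. r \<odot>\<^bsub>Z\<^esub> x = \<zero>\<^bsub>Z\<^esub>} \<subseteq> p"
    have "carrier R \<subseteq> p" using p Z(2) by auto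
    then show "maximalideal p R" using not p by blast
  qed (rule Z.carrier_is_submodule)
qed (rule Z(1))

theorem corollary3p11:
  fixes R :: "('r, 'x) ring_scheme" and \<aa> :: "'r set"
  assumes "cring R" and "noetherian_ring R" and "\<one>\<^bsub>R\<^esub> \<noteq> \<zero>\<^bsub>R\<^esub>"
    and "ideal \<aa> R"
    and "krull_dim (R Quot \<aa>) \<le> 1"
    and "infinite (UNIV :: 'm set)"
  shows "abelian_subcategory (coa_cat R \<aa> :: (('r, 'm) module, 'm \<Rightarrow> 'm) cat) (module_cat R)"
proof -
  note iff = sdlc_coartinian_iff[OF assms(1,2,4)]
  \<comment> \<open>In the form without \<open>Tor\<close>, each closure condition splits into the
    separate facts on linear compactness, cosupport and witnesses.\<close>
  interpret module_class R "sdlc_coartinian_modules R \<aa> :: ('r, 'm) module set"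
  proof (intro module_class.intro module_class_axioms.intro assms(1,6))
    show "Module.module R M" if "M \<in> sdlc_coartinian_modules R \<aa>" for M :: "('r, 'm) module"
      using that unfolding iff by blast
    show "Z \<in> sdlc_coartinian_modules R \<aa>" if "Module.module R Z" "carrier Z = {\<zero>\<^bsub>Z\<^esub>}" for Z :: "('r, 'm) module"
      by (rule zero_module_sdlc_coartinian[OF assms(1,2,4) that])
    show "M\<lparr>carrier := H\<rparr> \<in> sdlc_coartinian_modules R \<aa>"
      if "M \<in> sdlc_coartinian_modules R \<aa>" and H: "submodule H R M" for M :: "('r, 'm) module" and H
    proof -
      have M: "Module.module R M" "lin_compact R M (carrier M)" "cosupp R M \<subseteq> prime_variety R \<aa>" "quasi_coartinian R \<aa> M"
        using that(1) unfolding iff by auto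
      interpret M: rmodule R M by (rule rmoduleI[OF M(1)])
      have "lin_compact R M H" using lin_compact_mono[OF M(2)] M.submodule_mem[OF H] by blast
      then show ?thesis unfolding iff
        using M.module_restrict[OF H] M.lin_compact_restrict[OF _ H] cosupp_submodule[OF M(1) H] M(3)
          M.quasi_coartinian_submodule[OF M(4) H] by simp
    qed
    show "P \<in> sdlc_coartinian_modules R \<aa>"
      if "X \<in> sdlc_coartinian_modules R \<aa>" "Y \<in> sdlc_coartinian_modules R \<aa>" and P: "Module.module R P"
        and i: "i \<in> mod_hom R X P" and j: "j \<in> mod_hom R Y P"
        and span: "carrier P \<subseteq> {i x \<oplus>\<^bsub>P\<^esub> j y | x y. x \<in> carrier X \<and> y \<in> carrier Y}"
      for X Y P :: "('r, 'm) module" and i j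
    proof -
      have X: "Module.module R X" "lin_compact R X (carrier X)" "cosupp R X \<subseteq> prime_variety R \<aa>" "quasi_coartinian R \<aa> X"
        and Y: "Module.module R Y" "lin_compact R Y (carrier Y)" "cosupp R Y \<subseteq> prime_variety R \<aa>" "quasi_coartinian R \<aa> Y"
        using that(1,2) unfolding iff by auto
      have "lin_compact R P {i x \<oplus>\<^bsub>P\<^esub> j y | x y. x \<in> carrier X \<and> y \<in> carrier Y}"
        by (rule lin_compact_sum[OF X(1) Y(1) P i j Module.module.carrier_is_submodule[OF X(1)] X(2)
              Module.module.carrier_is_submodule[OF Y(1)] Y(2)])
      then have "lin_compact R P (carrier P)" by (rule lin_compact_mono[OF _ span])
      moreover have "cosupp R P \<subseteq> prime_variety R \<aa>"
        using cosupp_sum[OF X(1) Y(1) P i j span] X(3) Y(3) by blast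
      ultimately show ?thesis unfolding iff
        using P quasi_coartinian_sum[OF X(1) Y(1) P i j span X(4) Y(4)] by simp
    qed
  qed
  show ?thesis unfolding coa_cat_def by (rule abelian_subcategory_D)
qed

end
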